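(* Assume $\mathbb E|X_{11}|^k<\infty$ for all $k\ge2$. Let $T$ be a finite set and, for each $t\in T$, let $k_t\ge1$ be an integer and $B_t=(B_{t,0},B_{t,1},\dots)\in M_n(\mathbb C)^{\mathbb N}$ with $B_{t,0}=u_tv_t^*$ for some vectors $u_t,v_t\in\mathbb C^n$, such that for every $t\in T$ and every $j\ge0$, $\sup_n\|B_{t,j}\|<\infty$ (operator norm). Then the Lévy–Prokhorov distance between the laws of $(Z_{k_t}(B_t))_{t\in T}$ and $(\tilde W_{k_t}(B_t))_{t\in T}$ tends to $0$ as $n\to\infty$. Moreover, if for all $t\in T$, $\|u_t\|_\infty\to0$ and $\|v_t\|_\infty\to0$ as $n\to\infty$, then the Lévy–Prokhorov distance between the laws of $(Z_{k_t}(B_t))_{t\in T}$ and $(W_{k_t}(B_t))_{t\in T}$ tends to $0$.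
   Context: $(X_{ij})_{i,j\ge1}$ are i.i.d. complex random variables (law independent of $n$) with $\mathbb EX_{11}=0$, $\mathbb E|X_{11}|^2=1$, $\mathbb EX_{11}^2=\rho\in[0,1]$, and $X=(X_{ij})_{1\le i,j\le n}$. For $B=(B_0,B_1,\dots)\in M_n(\mathbb C)^{\mathbb N}$ with $B_0=uv^*$ ($u,v\in\mathbb C^n$) and integer $k\ge1$, $$Z_k(B)=n^{-(k-1)/2}\operatorname{Tr}(B_0XB_1X\cdots B_{k-1}X)=n^{-(k-1)/2}\langle v,XB_1X\cdots B_{k-1}Xu\rangle.$$ For $B,B'$ define $\Sigma_k(B,B')=n^{-k+1}\prod_{t=0}^{k-1}\operatorname{Tr}(B_tB_t'^* )$ and $\Sigma'_k(B,B')=\rho^kn^{-k+1}\prod_{t=0}^{k-1}\operatorname{Tr}(B_tB_t'^\intercal)$. $W=(W_k(B))$, indexed by $k\ge1$ and $B$, is the centered complex Gaussian process with $\mathbb E[W_k(B)\overline{W_l(B')}]=\mathbb E[W_k(B)W_l(B')]=0$ for $k\ne l$ and $\mathbb E[W_k(B)\overline{W_k(B')}]=\Sigma_k(B,B')$, $\mathbb E[W_k(B)W_k(B')]=\Sigma'_k(B,B')$, taken independent of $X$. The process $\tilde W$ is defined by $\tilde W_1(B)=Z_1(B)=\langle v,Xu\rangle$ and $\tilde W_k(B)=W_k(B)$ for $k\ge2$. $\|\cdot\|_\infty$ is the max norm of a vector. *)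

theory Defs
  imports "HOL-Probability.Probability"
begin

text \<open>n x n complex matrices are functions nat => nat => complex, only entries with
  indices < n matter; vectors in C^n are functions nat => complex.\<close>

type_synonym cmat = "nat \<Rightarrow> nat \<Rightarrow> complex"
type_synonym cvec = "nat \<Rightarrow> complex"

definition l2norm :: "nat \<Rightarrow> cvec \<Rightarrow> real" where
  "l2norm n x = sqrt (\<Sum>i<n. (cmod (x i))^2)"

definition supnorm :: "nat \<Rightarrow> cvec \<Rightarrow> real" where
  "supnorm n x = Max (insert 0 ((\<lambda>i. cmod (x i)) ` {..<n}))"

definition mvmul :: "nat \<Rightarrow> cmat \<Rightarrow> cvec \<Rightarrow> cvec" where
  "mvmul n A x = (\<lambda>i. \<Sum>l<n. A i l * x l)"

definition opnorm :: "nat \<Rightarrow> cmat \<Rightarrow> real" where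
  "opnorm n A = Sup {l2norm n (mvmul n A x) | x. l2norm n x \<le> 1}"

definition mmul :: "nat \<Rightarrow> cmat \<Rightarrow> cmat \<Rightarrow> cmat" where
  "mmul n A C = (\<lambda>i j. \<Sum>l<n. A i l * C l j)"

definition idm :: cmat where
  "idm = (\<lambda>i j. if i = j then 1 else 0)"

definition trace :: "nat \<Rightarrow> cmat \<Rightarrow> complex" where
  "trace n A = (\<Sum>i<n. A i i)"

definition matX :: "(nat \<times> nat \<Rightarrow> complex) \<Rightarrow> cmat" where
  "matX x = (\<lambda>i j. x (i, j))"

fun chain :: "nat \<Rightarrow> (nat \<Rightarrow> cmat) \<Rightarrow> (nat \<times> nat \<Rightarrow> complex) \<Rightarrow> nat \<Rightarrow> cmat" where
  "chain n Bs x 0 = idm"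
| "chain n Bs x (Suc k) = mmul n (mmul n (chain n Bs x k) (Bs k)) (matX x)"

definition Zk :: "nat \<Rightarrow> nat \<Rightarrow> (nat \<Rightarrow> cmat) \<Rightarrow> (nat \<times> nat \<Rightarrow> complex) \<Rightarrow> complex" where
  "Zk n k Bs x = complex_of_real (real n powr (- (real k - 1) / 2)) * trace n (chain n Bs x k)"

definition Xlaw :: "complex measure \<Rightarrow> nat \<Rightarrow> (nat \<times> nat \<Rightarrow> complex) measure" where
  "Xlaw \<mu> n = PiM ({..<n} \<times> {..<n}) (\<lambda>_. \<mu>)"

definition Sig :: "nat \<Rightarrow> nat \<Rightarrow> (nat \<Rightarrow> cmat) \<Rightarrow> (nat \<Rightarrow> cmat) \<Rightarrow> complex" where
  "Sig n k Bs Bs' = complex_of_real (real n powr (1 - real k)) *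
     (\<Prod>j<k. \<Sum>i<n. \<Sum>l<n. Bs j i l * cnj (Bs' j i l))"

definition Sig' :: "real \<Rightarrow> nat \<Rightarrow> nat \<Rightarrow> (nat \<Rightarrow> cmat) \<Rightarrow> (nat \<Rightarrow> cmat) \<Rightarrow> complex" where
  "Sig' \<rho> n k Bs Bs' = complex_of_real (\<rho> ^ k * real n powr (1 - real k)) *
     (\<Prod>j<k. \<Sum>i<n. \<Sum>l<n. Bs j i l * Bs' j i l)"

text \<open>M is the law of a centered complex Gaussian vector Z indexed by 't with
  E[Z_s conj Z_t] = C s t and E[Z_s Z_t] = P s t, characterised by its
  characteristic function: for every a, Re(sum conj(a_t) Z_t) is centered
  real normal with variance (Re(sum conj a_s a_t C s t) + Re(sum conj a_s conj a_t P s t))/2.\<close>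
definition cgauss_law :: "('t::finite \<Rightarrow> 't \<Rightarrow> complex) \<Rightarrow> ('t \<Rightarrow> 't \<Rightarrow> complex)
    \<Rightarrow> (complex^'t) measure \<Rightarrow> bool" where
  "cgauss_law C P M \<longleftrightarrow> prob_space M \<and> sets M = sets borel \<and>
     (\<forall>a::complex^'t.
        (\<integral>z. exp (\<i> * complex_of_real (Re (\<Sum>t\<in>UNIV. cnj (a$t) * z$t))) \<partial>M)
        = exp (- complex_of_real
             ((Re (\<Sum>s\<in>UNIV. \<Sum>t\<in>UNIV. cnj (a$s) * a$t * C s t)
              + Re (\<Sum>s\<in>UNIV. \<Sum>t\<in>UNIV. cnj (a$s) * cnj (a$t) * P s t)) / 4)))"

definition LP :: "'a::metric_space measure \<Rightarrow> 'a measure \<Rightarrow> real" where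
  "LP P Q = Inf {e. e > 0 \<and> (\<forall>A\<in>sets borel.
       measure P A \<le> measure Q {x. \<exists>y\<in>A. dist x y < e} + e \<and>
       measure Q A \<le> measure P {x. \<exists>y\<in>A. dist x y < e} + e)}"

end

theory Submission
  imports Defs "HOL-Real_Asymp.Real_Asymp"
begin

text \<open>
  Characteristic functions are compared, and a Gaussian smoothing inequality turns their convergence,
  together with tightness of the limiting laws, into convergence of the Levy-Prokhorov distance.
  Write each trace as a matrix word \<^emph>\<open>v* X B X ... X u\<close>. For words of length at least two, Stein's identity,
  obtained from a second-order Taylor expansion in one entry of \<open>X\<close> at a time, expresses the derivative of the characteristic
  function through inner products of sub-words; these concentrate by the Efron-Stein inequality, and their means
  follow the recursion that produces the product of normalised traces in the covariance. Solving the resulting linear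
  differential equation in the scale parameter decouples the long words from the words of length one.
  Words of length one are linear forms in independent entries and satisfy Lindeberg's condition as soon as
  the coefficient vectors are uniformly small. All estimates are weighted by a random variable
  dominating the operator norm of \<open>X / sqrt n\<close> and the entries, whose moments grow at most
  like \<open>n powr (1/16)\<close>; this follows by counting closed walks in the trace of a high power of \<open>X X*\<close>.
\<close>

text \<open>The entries are not Gaussian, so integration by parts leaves a third-order error, and it
  is this error that singles out the words of length one. Once the first factor \<open>X\<close> is
  split off, a word is the sum over \<open>i\<close> and \<open>j\<close> of
  \<open>vv i * x (i, j) * yy j x\<close>, and up to weights the worst error is the sum of
  \<open>LL^3 * |yy| * RR^2\<close>. The profiles \<open>LL\<close> and \<open>RR\<close> have
  bounded l2 norms but need not be small, so only smallness of \<open>|yy j|\<close> uniformly in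
  \<open>j\<close> can help. If \<open>yy\<close> still contains a factor \<open>X\<close>, its
  fourth moments are of order \<open>n^-2\<close>, their sum over \<open>j\<close> is of order
  \<open>1/n\<close>, and this sum controls the maximum. For a word of length one \<open>yy\<close>
  is a fixed vector that may sit on a single coordinate. With the level \<open>n^(-1/8)\<close> for
  \<open>|yy j|\<close> and weight moments of order \<open>n^(1/16)\<close> all errors vanish. The
  bounds are pathwise in a random weight and do not refer to a good event, because such an event
  would not be stable under setting an entry to 0, the operation on which both the integration by
  parts and the variance bounds rest.\<close>

abbreviation (input) cor :: "real => complex" where "cor \<equiv> complex_of_real"

type_synonym arr = "nat \<times> nat \<Rightarrow> complex"

section \<open>Operator bounds and matrix words\<close>

lemma l2norm_eq_L2_set: "l2norm n x = L2_set (\<lambda>i. cmod (x i)) {..<n}" by (simp add: l2norm_def L2_set_def)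

lemma l2norm_nonneg [simp]: "0 <= l2norm n x" by (simp add: l2norm_def sum_nonneg)

lemma l2norm_cnj [simp]: "l2norm n (\<lambda>i. cnj (x i)) = l2norm n x" by (simp add: l2norm_def)

lemma cmod_sum_mult_le_l2norm: "cmod (\<Sum>i<n. a i * b i) <= l2norm n a * l2norm n b"
proof -
 have "cmod (\<Sum>i<n. a i * b i) <= (\<Sum>i<n. \<bar>cmod (a i)\<bar> * \<bar>cmod (b i)\<bar>)"
  by (rule order_trans[OF norm_sum]) (simp add: norm_mult)
 also have "... <= l2norm n a * l2norm n b"
  unfolding l2norm_eq_L2_set by (rule L2_set_mult_ineq)
 finally show ?thesis .
qed

lemma l2norm_square: "(l2norm n x)^2 = (\<Sum>i<n. (cmod (x i))^2)" by (simp add: l2norm_def sum_nonneg)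

lemma sum_self_cnj: "(\<Sum>i<n. cnj (x i) * x i) = cor ((l2norm n x)^2)"
 unfolding l2norm_square of_real_sum by (intro sum.cong refl) (metis complex_norm_square of_real_power mult.commute)

text \<open>An upper bound on the operator norm, phrased through the bilinear form: transposes and
  entrywise conjugates inherit it at once, and double sums \<open>a i * A i j * b j\<close> are
  estimated without reference to a supremum.\<close>

definition form_bound :: "nat => cmat => real => bool" where
 "form_bound n A c \<longleftrightarrow> 0 <= c \<and>
   (\<forall>a b. cmod (\<Sum>i<n. \<Sum>j<n. a i * A i j * b j) <= c * l2norm n a * l2norm n b)"

lemma form_boundI_vec:
 assumes "0 <= c" "\<And>b. l2norm n (mvmul n A b) <= c * l2norm n b"
 shows "form_bound n A c"
 unfolding form_bound_def
proof (intro conjI allI)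
 fix a b
 have "(\<Sum>i<n. \<Sum>j<n. a i * A i j * b j) = (\<Sum>i<n. a i * mvmul n A b i)" by (simp add: mvmul_def sum_distrib_left mult.assoc)
 then have "cmod (\<Sum>i<n. \<Sum>j<n. a i * A i j * b j) <= l2norm n a * l2norm n (mvmul n A b)" by (simp add: cmod_sum_mult_le_l2norm)
 also have "... <= l2norm n a * (c * l2norm n b)" by (intro mult_left_mono assms) simp
 finally show "cmod (\<Sum>i<n. \<Sum>j<n. a i * A i j * b j) <= c * l2norm n a * l2norm n b" by (simp add: mult_ac)
qed (use assms in simp)

text \<open>The form is tested against the conjugate of the image, which yields the square of its
  norm; one factor is then cancelled.\<close>

lemma form_bound_vec:
 assumes "form_bound n A c"
 shows "l2norm n (mvmul n A b) <= c * l2norm n b"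
proof -
 let ?w = "mvmul n A b"
 have "cor ((l2norm n ?w)^2) = (\<Sum>i<n. cnj (?w i) * ?w i)" by (rule sum_self_cnj[symmetric])
 also have "... = (\<Sum>i<n. \<Sum>j<n. cnj (?w i) * A i j * b j)" by (simp add: mvmul_def sum_distrib_left mult.assoc)
 finally have "(l2norm n ?w)^2 = cmod (\<Sum>i<n. \<Sum>j<n. cnj (?w i) * A i j * b j)" by (metis norm_of_real abs_of_nonneg zero_le_power2)
 also have "... <= c * l2norm n (\<lambda>i. cnj (?w i)) * l2norm n b"
  using assms[unfolded form_bound_def, THEN conjunct2, THEN spec, of "\<lambda>i. cnj (?w i)", THEN spec, of b] .
 finally have *: "l2norm n ?w * l2norm n ?w <= l2norm n ?w * (c * l2norm n b)" by (simp add: power2_eq_square mult_ac)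
 show ?thesis
 proof (cases "l2norm n ?w = 0")
  case True then show ?thesis using assms by (simp add: form_bound_def)
 next
  case False
  then have "0 < l2norm n ?w" using l2norm_nonneg[of n ?w] by linarith
  with * show ?thesis by simp
 qed
qed

lemma form_bound_mono: "form_bound n A c ==> c <= d ==> form_bound n A d"
 unfolding form_bound_def by (meson l2norm_nonneg mult_right_mono order_trans)

lemma form_bound_cnj:
 assumes "form_bound n A c" shows "form_bound n (\<lambda>i j. cnj (A i j)) c"
 unfolding form_bound_def
proof (intro conjI allI)
 fix a b
 have "(\<Sum>i<n. \<Sum>j<n. a i * cnj (A i j) * b j) = cnj (\<Sum>i<n. \<Sum>j<n. cnj (a i) * A i j * cnj (b j))" by simp
 then have "cmod (\<Sum>i<n. \<Sum>j<n. a i * cnj (A i j) * b j)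
   = cmod (\<Sum>i<n. \<Sum>j<n. cnj (a i) * A i j * cnj (b j))" by (metis complex_mod_cnj)
 also have "... <= c * l2norm n (\<lambda>i. cnj (a i)) * l2norm n (\<lambda>i. cnj (b i))"
  using assms[unfolded form_bound_def, THEN conjunct2, THEN spec, of "\<lambda>i. cnj (a i)", THEN spec, of "\<lambda>i. cnj (b i)"] .
 finally show "cmod (\<Sum>i<n. \<Sum>j<n. a i * cnj (A i j) * b j) <= c * l2norm n a * l2norm n b" by simp
qed (use assms form_bound_def in simp)

lemma form_bound_transpose:
 assumes "form_bound n A c" shows "form_bound n (\<lambda>i j. A j i) c"
 unfolding form_bound_def
proof (intro conjI allI)
 fix a b
 have "(\<Sum>i<n. \<Sum>j<n. a i * A j i * b j) = (\<Sum>i<n. \<Sum>j<n. b i * A i j * a j)" by (subst sum.swap) (simp add: mult_ac)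
 also have "cmod ... <= c * l2norm n b * l2norm n a"
  using assms unfolding form_bound_def by blast
 finally show "cmod (\<Sum>i<n. \<Sum>j<n. a i * A j i * b j) <= c * l2norm n a * l2norm n b" by (simp add: mult_ac)
qed (use assms form_bound_def in simp)

lemma mvmul_mmul: "mvmul n (mmul n A C) b = mvmul n A (mvmul n C b)"
proof
 fix i
 have "(\<Sum>l<n. (\<Sum>k<n. A i k * C k l) * b l) = (\<Sum>l<n. \<Sum>k<n. A i k * C k l * b l)" by (simp add: sum_distrib_right)
 also have "... = (\<Sum>k<n. \<Sum>l<n. A i k * C k l * b l)" by (rule sum.swap)
 finally show "mvmul n (mmul n A C) b i = mvmul n A (mvmul n C b) i" by (simp add: mvmul_def mmul_def sum_distrib_left mult.assoc)
qed

lemma form_bound_mmul: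
 assumes "form_bound n A c" "form_bound n C d"
 shows "form_bound n (mmul n A C) (c * d)"
proof (rule form_boundI_vec)
 have c: "0 <= c" and d: "0 <= d" using assms by (auto simp: form_bound_def)
 then show "0 <= c * d" by simp
 fix b
 have "l2norm n (mvmul n (mmul n A C) b) <= c * l2norm n (mvmul n C b)"
  unfolding mvmul_mmul by (rule form_bound_vec[OF assms(1)])
 also have "... <= c * (d * l2norm n b)" by (intro mult_left_mono form_bound_vec[OF assms(2)] c)
 finally show "l2norm n (mvmul n (mmul n A C) b) <= c * d * l2norm n b" by (simp add: mult_ac)
qed

lemma mmul_assoc: "mmul n (mmul n A B) C = mmul n A (mmul n B C)"
proof (intro ext)
 fix i j
 have "(\<Sum>l<n. (\<Sum>k<n. A i k * B k l) * C l j) = (\<Sum>l<n. \<Sum>k<n. A i k * B k l * C l j)" by (simp add: sum_distrib_right)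
 also have "... = (\<Sum>k<n. \<Sum>l<n. A i k * B k l * C l j)" by (rule sum.swap)
 finally show "mmul n (mmul n A B) C i j = mmul n A (mmul n B C) i j" by (simp add: mmul_def sum_distrib_left mult.assoc)
qed

lemma form_bound_col:
 assumes "form_bound n A c" "j < n"
 shows "l2norm n (\<lambda>i. A i j) <= c"
proof -
 let ?b = "\<lambda>l. if l = j then 1 else 0 :: complex"
 have "mvmul n A ?b = (\<lambda>i. A i j)"
  using assms(2) by (auto simp: mvmul_def if_distrib sum.delta cong: if_cong)
 moreover have "l2norm n ?b = 1"
  using assms(2) by (simp add: l2norm_def if_distrib[of cmod] if_distrib[of "\<lambda>x. x^2"] sum.delta cong: if_cong)
 ultimately show ?thesis using form_bound_vec[OF assms(1), of ?b] by simp
qed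

lemma form_bound_row:
 assumes "form_bound n A c" "i < n"
 shows "l2norm n (\<lambda>j. A i j) <= c"
 using form_bound_col[OF form_bound_transpose[OF assms(1)] assms(2)] .

lemma cmod_le_l2norm: "i < n ==> cmod (x i) <= l2norm n x"
 unfolding l2norm_eq_L2_set by (rule member_le_L2_set) auto

lemma form_bound_entry:
 assumes "form_bound n A c" "i < n" "j < n"
 shows "cmod (A i j) <= c"
 using cmod_le_l2norm[OF assms(2), of "\<lambda>i. A i j"] form_bound_col[OF assms(1,3)] by simp

lemma form_bound_diff:
 assumes "form_bound n A c" "form_bound n C d"
 shows "form_bound n (\<lambda>i j. A i j - C i j) (c + d)"
 unfolding form_bound_def
proof (intro conjI allI)
 show "0 <= c + d" using assms by (simp add: form_bound_def)
 fix a b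
 have "(\<Sum>i<n. \<Sum>j<n. a i * (A i j - C i j) * b j)
  = (\<Sum>i<n. \<Sum>j<n. a i * A i j * b j) - (\<Sum>i<n. \<Sum>j<n. a i * C i j * b j)" by (simp add: algebra_simps sum_subtractf)
 then have "cmod (\<Sum>i<n. \<Sum>j<n. a i * (A i j - C i j) * b j)
  <= cmod (\<Sum>i<n. \<Sum>j<n. a i * A i j * b j) + cmod (\<Sum>i<n. \<Sum>j<n. a i * C i j * b j)" by (simp add: norm_triangle_ineq4)
 also have "... <= c * l2norm n a * l2norm n b + d * l2norm n a * l2norm n b"
  using assms by (intro add_mono) (auto simp: form_bound_def)
 finally show "cmod (\<Sum>i<n. \<Sum>j<n. a i * (A i j - C i j) * b j) <= (c + d) * l2norm n a * l2norm n b" by (simp add: algebra_simps)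
qed

lemma form_bound_single:
 "form_bound n (\<lambda>a b. if a = i \<and> b = j then h else 0) (cmod h)"
proof (rule form_boundI_vec)
 fix b
 have *: "mvmul n (\<lambda>a b. if a = i \<and> b = j then h else 0) b
  = (\<lambda>a. if a = i then (if j < n then h * b j else 0) else 0)"
  by (auto simp: mvmul_def fun_eq_iff if_distrib[of "\<lambda>z. z * _"] sum.delta cong: if_cong)
 have "l2norm n (\<lambda>a. if a = i then (if j < n then h * b j else 0) else 0)
   <= (if j < n then cmod (h * b j) else 0)" by (simp add: l2norm_def if_distrib[of cmod] if_distrib[of "\<lambda>x. x^2"] sum.delta norm_mult
    power_mult_distrib real_sqrt_mult cong: if_cong)
 also have "... <= cmod h * l2norm n b" by (auto simp: norm_mult intro!: mult_left_mono cmod_le_l2norm)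
 finally show "l2norm n (mvmul n (\<lambda>a b. if a = i \<and> b = j then h else 0) b) <= cmod h * l2norm n b" by (simp add: *)
qed simp

definition scaledX :: "nat => arr => cmat" where
 "scaledX n x = (\<lambda>i j. x (i, j) / cor (sqrt (real n)))"

text \<open>The product \<open>C p * X * C (p+1) * ... * X * C (p+m)\<close> with \<open>X\<close>
  divided by \<open>sqrt n\<close>. The start index \<open>p\<close> makes prefixes and suffixes of
  a word again words over the same letters, which is what the difference formula and the recursions
  produce.\<close>

primrec wd :: "nat => (nat => cmat) => nat => nat => arr => cmat" where
 "wd n C p 0 x = C p"
| "wd n C p (Suc m) x = mmul n (mmul n (wd n C p m x) (scaledX n x)) (C (Suc (p + m)))"

lemma wd_Suc_left:
 "wd n C p (Suc m) x = mmul n (mmul n (C p) (scaledX n x)) (wd n C (Suc p) m x)"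
proof (induction m)
 case (Suc m)
 have "wd n C p (Suc (Suc m)) x
   = mmul n (mmul n (mmul n (mmul n (C p) (scaledX n x)) (wd n C (Suc p) m x)) (scaledX n x)) (C (Suc (p + Suc m)))"
  using Suc by simp
 then show ?case by (simp add: mmul_assoc)
qed simp

lemma wd_cong:
 assumes "\<And>q. p <= q ==> q <= p + m ==> C q = C' q"
 shows "wd n C p m x = wd n C' p m x"
 using assms by (induction m) auto

lemma scaledX_update:
 "scaledX n (x((i, j) := 0)) = (\<lambda>a b. scaledX n x a b -
   (if a = i \<and> b = j then x (i, j) / cor (sqrt (real n)) else 0))" by (auto simp: scaledX_def fun_eq_iff)

text \<open>Telescoping: \<open>r\<close> counts the factors in front of the last one in which the
  entry \<open>(i, j)\<close> is chosen. Hence prefixes are taken at \<open>x\<close> and suffixes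
  at the matrix without the entry. In this mixed form the identity is exact, without higher-order
  terms.\<close>

lemma wd_perturb:
 assumes "i < n" "j < n"
 shows "wd n C p m x a b - wd n C p m (x((i, j) := 0)) a b
  = (\<Sum>r<m. wd n C p r x a i * (x (i, j) / cor (sqrt (real n)))
    * wd n C (Suc (p + r)) (m - Suc r) (x((i, j) := 0)) j b)"
proof (induction m arbitrary: b)
 case (Suc m)
 let ?x' = "x((i, j) := 0)" and ?h = "x (i, j) / cor (sqrt (real n))"
 let ?V = "mmul n (scaledX n ?x') (C (Suc (p + m)))"
 have 1: "wd n C p (Suc m) x a b
   = (\<Sum>l<n. wd n C p m x a l * ?V l b) + wd n C p m x a i * ?h * C (Suc (p + m)) j b"
 proof -
  have inner: "(\<Sum>l'<n. (if l = i \<and> l' = j then ?h else 0) * C (Suc (p + m)) l' b)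
    = (if l = i then ?h * C (Suc (p + m)) j b else 0)" for l
   using assms by (simp add: if_distrib[of "\<lambda>z. z * _"] sum.delta cong: if_cong)
  have "mmul n (scaledX n x) (C (Suc (p + m))) l b = ?V l b
     + (if l = i then ?h * C (Suc (p + m)) j b else 0)" for l
   unfolding scaledX_update mmul_def left_diff_distrib sum_subtractf inner by simp
  then have "wd n C p (Suc m) x a b
    = (\<Sum>l<n. wd n C p m x a l * (?V l b + (if l = i then ?h * C (Suc (p + m)) j b else 0)))" by (simp add: mmul_assoc) (simp add: mmul_def)
  also have "... = (\<Sum>l<n. wd n C p m x a l * ?V l b)
    + (\<Sum>l<n. if l = i then wd n C p m x a l * (?h * C (Suc (p + m)) j b) else 0)"
   by (simp add: distrib_left sum.distrib if_distrib[of "\<lambda>z. _ * z"] cong: if_cong)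
  finally show ?thesis using assms by (simp add: sum.delta mult.assoc)
 qed
 have 2: "wd n C p (Suc m) ?x' a b = (\<Sum>l<n. wd n C p m ?x' a l * ?V l b)" by (simp add: mmul_assoc) (simp add: mmul_def)
 have 3: "(\<Sum>l<n. wd n C (Suc (p + r)) (m - Suc r) ?x' j l * ?V l b)
   = wd n C (Suc (p + r)) (Suc m - Suc r) ?x' j b" if "r < m" for r
 proof -
  have "Suc m - Suc r = Suc (m - Suc r)" "Suc (Suc (p + r) + (m - Suc r)) = Suc (p + m)"
   using that by auto
  then show ?thesis by (simp only: wd.simps mmul_assoc) (simp add: mmul_def)
 qed
 have "wd n C p (Suc m) x a b - wd n C p (Suc m) ?x' a b
   = (\<Sum>l<n. (wd n C p m x a l - wd n C p m ?x' a l) * ?V l b)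
    + wd n C p m x a i * ?h * C (Suc (p + m)) j b"
  unfolding 1 2 by (simp add: left_diff_distrib sum_subtractf)
 also have "(\<Sum>l<n. (wd n C p m x a l - wd n C p m ?x' a l) * ?V l b)
   = (\<Sum>r<m. wd n C p r x a i * ?h * (\<Sum>l<n. wd n C (Suc (p + r)) (m - Suc r) ?x' j l * ?V l b))"
  unfolding Suc sum_distrib_right by (subst sum.swap) (simp add: sum_distrib_left mult.assoc)
 also have "... = (\<Sum>r<m. wd n C p r x a i * ?h * wd n C (Suc (p + r)) (Suc m - Suc r) ?x' j b)"
  by (intro sum.cong refl) (simp add: 3 del: wd.simps)
 finally show ?case unfolding sum.lessThan_Suc diff_self_eq_0 wd.simps(1) .
qed simp

lemma form_bound_wd:
 assumes "1 <= X" "\<And>p. form_bound n (C p) X" "form_bound n (scaledX n x) Y" "1 <= Y"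
 shows "form_bound n (wd n C p m x) (X * (X * Y) ^ m)"
proof (induction m)
 case (Suc m)
 have "form_bound n (wd n C p (Suc m) x) (X * (X * Y) ^ m * Y * X)"
  unfolding wd.simps by (intro form_bound_mmul Suc assms)
 then show ?case by (simp add: mult_ac)
qed (use assms in simp)

text \<open>Profile, in the row index \<open>j\<close>, of all suffixes of a word down to its bare
  last letter. Passing to a suffix only shrinks it, so one profile serves a whole telescoping
  sum.\<close>

definition env :: "nat => (nat => cmat) => nat => nat => arr => nat => nat => real" where
 "env n C p m x j b = (\<Sum>r\<le>m. cmod (wd n C (p + r) (m - r) x j b))"

lemma env_nonneg [simp]: "0 <= env n C p m x j b" by (simp add: env_def sum_nonneg)

lemma wd_le_env: "cmod (wd n C p m x j b) <= env n C p m x j b"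
 unfolding env_def by (rule member_le_sum[of 0 _ "\<lambda>r. cmod (wd n C (p + r) (m - r) x j b)", simplified]) auto

lemma env_suffix_le:
 assumes "r < m"
 shows "env n C (Suc (p + r)) (m - Suc r) x j b <= env n C p m x j b"
proof -
 have "env n C (Suc (p + r)) (m - Suc r) x j b
   = (\<Sum>s\<in>(\<lambda>s. s + Suc r) ` {..m - Suc r}. cmod (wd n C (p + s) (m - s) x j b))"
  unfolding env_def by (subst sum.reindex) (auto intro!: sum.cong inj_onI simp: add_ac)
 also have "... <= env n C p m x j b"
  unfolding env_def using assms by (intro sum_mono2) auto
 finally show ?thesis .
qed

text \<open>Controls all words at \<^term>\<open>x\<close>, and at \<^term>\<open>x\<close> with one entry removed, by quantities at \<^term>\<open>x\<close>;
 the last clause keeps the row index of the removed entry, so that sums over all entries stay summable.\<close>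

definition controlled :: "nat => real => nat => arr => real => bool" where
 "controlled n K M x T \<longleftrightarrow> 2 <= T \<and> real M + 1 <= T \<and> K <= T \<and> (\<forall>i<n. \<forall>j<n. cmod (x (i, j)) <= T) \<and>
   (\<forall>C p m. (\<forall>q. form_bound n (C q) K) \<longrightarrow> m <= M \<longrightarrow>
    form_bound n (wd n C p m x) T \<and>
    (\<forall>i<n. \<forall>j<n. form_bound n (wd n C p m (x((i, j) := 0))) T \<and>
      (\<forall>b<n. cmod (wd n C p m (x((i, j) := 0)) j b) <= T * env n C p m x j b)))"

text \<open>Strong induction on the number of factors: by the difference formula the word without
  the entry is the word at \<open>x\<close> minus terms with shorter suffixes without the entry, and
  the prefixes enter only through the bounded numbers at position \<open>(j, i)\<close>. The row
  \<open>j\<close> is preserved because it is the second index of the removed entry, and therefore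
  the row in which those suffixes start.\<close>

lemma wd_update_le_env:
 assumes X: "2 <= X" "real M + 1 <= X" and C: "\<And>q. form_bound n (C q) X"
  and sX: "form_bound n (scaledX n x) X" and x: "cmod (x (i, j)) <= X"
  and ij: "i < n" "j < n" "m <= M" and b: "b < n"
 shows "cmod (wd n C p m (x((i, j) := 0)) j b) <= X ^ (4 * m) * env n C p m x j b"
 using ij(3)
proof (induction m arbitrary: p rule: less_induct)
 case (less m)
 let ?x' = "x((i, j) := 0)" and ?h = "x (i, j) / cor (sqrt (real n))"
 have n1: "1 <= sqrt (real n)" using ij by simp
 have X1: "1 <= X" using X by simp
 have h: "cmod ?h <= X"
 proof -
  have "cmod ?h = cmod (x (i, j)) / sqrt (real n)" by (simp add: norm_divide)
  also have "... <= cmod (x (i, j)) / 1" using n1 by (intro divide_left_mono) auto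
  finally show ?thesis using x by simp
 qed
 have summand: "cmod (wd n C p r x j i * ?h * wd n C (Suc (p + r)) (m - Suc r) ?x' j b)
   <= X ^ (4 * m - 2) * env n C p m x j b" if r: "r < m" for r
 proof -
  have "form_bound n (wd n C p r x) (X * (X * X) ^ r)" by (rule form_bound_wd) (use X1 C sX in auto)
  then have a1: "cmod (wd n C p r x j i) <= X * (X * X) ^ r"
   using form_bound_entry ij by blast
  have a2: "cmod (wd n C (Suc (p + r)) (m - Suc r) ?x' j b)
   <= X ^ (4 * (m - Suc r)) * env n C p m x j b"
  proof -
   have "cmod (wd n C (Suc (p + r)) (m - Suc r) ?x' j b)
    <= X ^ (4 * (m - Suc r)) * env n C (Suc (p + r)) (m - Suc r) x j b" by (rule less.IH) (use less.prems r in auto)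
   also have "... <= X ^ (4 * (m - Suc r)) * env n C p m x j b"
    using X1 by (intro mult_left_mono env_suffix_le r) auto
   finally show ?thesis .
  qed
  have "cmod (wd n C p r x j i * ?h * wd n C (Suc (p + r)) (m - Suc r) ?x' j b)
   <= (X * (X * X) ^ r) * X * (X ^ (4 * (m - Suc r)) * env n C p m x j b)"
   unfolding norm_mult using X1 by (intro mult_mono a1 a2 h) (auto intro!: mult_nonneg_nonneg)
  also have "... = X ^ (2 + 2 * r + 4 * (m - Suc r)) * env n C p m x j b"
  proof -
   have "(X * X) ^ r = X ^ (2 * r)" by (simp add: power_mult power2_eq_square)
   then show ?thesis by (simp add: power_add power2_eq_square)
  qed
  \<comment> \<open>The exponent on the left is \<open>4 * m - 2 - 2 * r\<close>. The slack below
    \<open>4 * m\<close> pays for the sum of \<open>m\<close> such terms and the word itself, since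
    \<open>m + 1 <= X\<close>.\<close>
  also have "... <= X ^ (4 * m - 2) * env n C p m x j b"
   using X1 r by (intro mult_right_mono power_increasing) auto
  finally show ?thesis .
 qed
 have "wd n C p m ?x' j b = wd n C p m x j b -
   (\<Sum>r<m. wd n C p r x j i * ?h * wd n C (Suc (p + r)) (m - Suc r) ?x' j b)"
  using wd_perturb[OF ij(1,2), of C p m x j b] by (simp add: algebra_simps)
 then have "cmod (wd n C p m ?x' j b) <= cmod (wd n C p m x j b) +
   cmod (\<Sum>r<m. wd n C p r x j i * ?h * wd n C (Suc (p + r)) (m - Suc r) ?x' j b)" by (simp only: norm_triangle_ineq4)
 also have "... <= env n C p m x j b + (\<Sum>r<m. X ^ (4 * m - 2) * env n C p m x j b)"
  by (intro add_mono wd_le_env order_trans[OF norm_sum] sum_mono summand) auto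
 also have "... = (1 + real m * X ^ (4 * m - 2)) * env n C p m x j b" by (simp add: algebra_simps)
 also have "1 + real m * X ^ (4 * m - 2) <= X ^ (4 * m)"
 proof (cases "m = 0")
  case False
  have "1 + real m * X ^ (4 * m - 2) <= X ^ (4 * m - 2) + real m * X ^ (4 * m - 2)"
   using X1 by (simp add: one_le_power)
  also have "... = (1 + real m) * X ^ (4 * m - 2)" by (simp add: algebra_simps)
  also have "... <= X * X ^ (4 * m - 2)"
   using X less.prems by (intro mult_right_mono) auto
  also have "... = X ^ (Suc (4 * m - 2))" by simp
  also have "... <= X ^ (4 * m)" using X1 False by (intro power_increasing) auto
  finally show ?thesis .
 qed simp
 then have "(1 + real m * X ^ (4 * m - 2)) * env n C p m x j b <= X ^ (4 * m) * env n C p m x j b" by (intro mult_right_mono) auto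
 finally show ?case .
qed

text \<open>Words at \<open>x\<close> cost \<open>2 * m + 1\<close> powers of \<open>X\<close>.
  Removing an entry at most squares the bound on the scaled matrix, which gives
  \<open>3 * m + 1\<close>. The row-preserving estimate costs \<open>4 * m\<close>. The common
  exponent dominates all three.\<close>

lemma controlledI:
 assumes X: "2 <= X" "real M + 1 <= X" "K <= X"
  and sX: "form_bound n (scaledX n x) X" and x: "\<And>i j. i < n ==> j < n ==> cmod (x (i, j)) <= X"
 shows "controlled n K M x (X ^ (4 * M + 1))"
 unfolding controlled_def
proof (intro conjI allI impI)
 have X1: "1 <= X" using X by simp
 have XX: "X <= X ^ (4 * M + 1)" using power_increasing[of 1 "4 * M + 1" X] X1 by simp
 show "2 <= X ^ (4 * M + 1)" "real M + 1 <= X ^ (4 * M + 1)" "K <= X ^ (4 * M + 1)"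
  using XX X by linarith+
 show "cmod (x (i, j)) <= X ^ (4 * M + 1)" if "i < n" "j < n" for i j
  using XX x[OF that] by linarith
 fix C :: "nat => cmat" and p m assume CK: "\<forall>q. form_bound n (C q) K" and m: "m <= M"
 have C: "form_bound n (C q) X" for q using CK X by (meson form_bound_mono)
 have "form_bound n (wd n C p m x) (X * (X * X) ^ m)" by (rule form_bound_wd) (use X1 C sX in auto)
 moreover have "X * (X * X) ^ m <= X ^ (4 * M + 1)"
 proof -
  have "X * (X * X) ^ m = X ^ (2 * m + 1)" by (simp add: power_mult power2_eq_square)
  then show ?thesis using X1 m by (simp only:) (rule power_increasing, auto)
 qed
 ultimately show "form_bound n (wd n C p m x) (X ^ (4 * M + 1))" by (rule form_bound_mono)
 fix i j assume ij: "i < n" "j < n"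
 show "form_bound n (wd n C p m (x((i, j) := 0))) (X ^ (4 * M + 1))"
 proof -
  let ?h = "x (i, j) / cor (sqrt (real n))"
  have n1: "1 <= sqrt (real n)" using ij by simp
  have "cmod ?h = cmod (x (i, j)) / sqrt (real n)" by (simp add: norm_divide)
  also have "... <= cmod (x (i, j)) / 1" using n1 by (intro divide_left_mono) auto
  finally have h: "cmod ?h <= X" using x[OF ij] by simp
  have "form_bound n (scaledX n (x((i, j) := 0))) (X + cmod ?h)"
   unfolding scaledX_update by (intro form_bound_diff sX form_bound_single)
  then have "form_bound n (scaledX n (x((i, j) := 0))) (X * X)" by (rule form_bound_mono) (use h X mult_right_mono[of 2 X X] in linarith)
  then have "form_bound n (wd n C p m (x((i, j) := 0))) (X * (X * (X * X)) ^ m)"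
   by (intro form_bound_wd) (use X1 C in \<open>auto intro: mult_ge1_I\<close>)
  moreover have "X * (X * (X * X)) ^ m <= X ^ (4 * M + 1)"
  proof -
   have "X * (X * (X * X)) ^ m = X ^ (3 * m + 1)" by (simp add: power_mult power3_eq_cube mult.assoc)
   then show ?thesis using X1 m by (simp only:) (rule power_increasing, auto)
  qed
  ultimately show ?thesis by (rule form_bound_mono)
 qed
 fix b assume b: "b < n"
 have "cmod (wd n C p m (x((i, j) := 0)) j b) <= X ^ (4 * m) * env n C p m x j b" by (rule wd_update_le_env[OF X(1,2) C sX x[OF ij] ij m b])
 also have "... <= X ^ (4 * M + 1) * env n C p m x j b"
  using X1 m by (intro mult_right_mono power_increasing) auto
 finally show "cmod (wd n C p m (x((i, j) := 0)) j b) <= X ^ (4 * M + 1) * env n C p m x j b" .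
qed

section \<open>Polynomially bounded functions of independent entries\<close>

definition polyweight :: "'e set => ('e => complex) => real" where
 "polyweight S x = (\<Prod>e\<in>S. 1 + cmod (x e))"

text \<open>A class closed under all operations used below and integrable under every product law
  with finite moments, so that integrability is never argued case by case. Degree and constant may
  depend on \<open>S\<close>, hence on \<open>n\<close>: nothing quantitative is drawn from
  them.\<close>

definition polybdd :: "'e set => (('e => complex) => 'b::{real_normed_vector, second_countable_topology}) => bool" where
 "polybdd S f \<longleftrightarrow> f \<in> borel_measurable (PiM S (\<lambda>_. borel)) \<and>
   (\<exists>C N. 0 <= C \<and> (\<forall>x. norm (f x) <= C * polyweight S x ^ N))"

lemma polyweight_ge1: "1 <= polyweight S x"
 unfolding polyweight_def by (rule prod_ge_1) simp

lemma polyweight_coord: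
 assumes "finite S" "e \<in> S" shows "cmod (x e) <= polyweight S x"
proof -
 have "polyweight S x = (1 + cmod (x e)) * polyweight (S - {e}) x"
  unfolding polyweight_def using assms by (simp add: prod.remove)
 moreover have "(1 + cmod (x e)) * 1 <= (1 + cmod (x e)) * polyweight (S - {e}) x"
  using polyweight_ge1[of "S - {e}" x] by (intro mult_left_mono) auto
 ultimately show ?thesis by simp
qed

lemma polyweight_update_le:
 assumes "finite S" "e \<in> S" shows "polyweight S (x(e := 0)) <= polyweight S x"
 unfolding polyweight_def by (intro prod_mono) auto

lemma polyweight_insert:
 assumes "finite S" "e \<notin> S"
 shows "polyweight (insert e S) (x(e := y)) = (1 + cmod y) * polyweight S x"
proof -
 have "(\<Prod>a\<in>S. 1 + cmod ((x(e := y)) a)) = (\<Prod>a\<in>S. 1 + cmod (x a))"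
  using assms by (intro prod.cong) auto
 then show ?thesis using assms by (simp add: polyweight_def)
qed

lemma polybddI:
 assumes "f \<in> borel_measurable (PiM S (\<lambda>_. borel))" "\<And>x. norm (f x) <= C * polyweight S x ^ N"
 shows "polybdd S f"
proof -
 have "norm (f x) <= max C 0 * polyweight S x ^ N" for x by (rule order_trans[OF assms(2) mult_right_mono]) (use polyweight_ge1[of S x] in auto)
 then show ?thesis unfolding polybdd_def using assms(1) by (metis max.cobounded2)
qed

lemma polybdd_measurable: "polybdd S f ==> f \<in> borel_measurable (PiM S (\<lambda>_. borel))" by (simp add: polybdd_def)

lemma polybddE:
 assumes "polybdd S f"
 obtains C N where "0 <= C" "\<And>x. norm (f x) <= C * polyweight S x ^ N"
 using assms unfolding polybdd_def by blast

lemma polybdd_const: "polybdd S (\<lambda>_. c)" by (rule polybddI[where C = "norm c" and N = 0]) auto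

lemma polybdd_coord:
 assumes "finite S" "e \<in> S" shows "polybdd S (\<lambda>x. x e)" by (rule polybddI[where C = 1 and N = 1])
   (use assms polyweight_coord in \<open>auto intro: measurable_component_singleton\<close>)

lemma polybdd_bounded:
 assumes "f \<in> borel_measurable (PiM S (\<lambda>_. borel))" "\<And>x. norm (f x) <= C"
 shows "polybdd S f" by (rule polybddI[where C = C and N = 0]) (use assms in auto)

lemma polybdd_dominated:
 assumes "f \<in> borel_measurable (PiM S (\<lambda>_. borel))" "polybdd S g" "\<And>x. norm (f x) <= norm (g x)"
 shows "polybdd S f"
 using assms unfolding polybdd_def by (meson order_trans)

lemma polybdd_add:
 assumes "polybdd S f" "polybdd S g" shows "polybdd S (\<lambda>x. f x + g x)"
proof -
 obtain C N where f: "0 <= C" "\<And>x. norm (f x) <= C * polyweight S x ^ N" by (rule polybddE[OF assms(1)]) (rule that)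
 obtain D M where g: "0 <= D" "\<And>x. norm (g x) <= D * polyweight S x ^ M" by (rule polybddE[OF assms(2)]) (rule that)
 show ?thesis
 proof (rule polybddI[where C = "C + D" and N = "max N M"])
  show "(\<lambda>x. f x + g x) \<in> borel_measurable (PiM S (\<lambda>_. borel))"
   using assms by (intro borel_measurable_add polybdd_measurable)
  fix x
  have "norm (f x + g x) <= C * polyweight S x ^ N + D * polyweight S x ^ M"
   using f(2)[of x] g(2)[of x] norm_triangle_ineq[of "f x" "g x"] by linarith
  also have "... <= C * polyweight S x ^ max N M + D * polyweight S x ^ max N M"
   by (intro add_mono mult_left_mono power_increasing polyweight_ge1 f g) auto
  finally show "norm (f x + g x) <= (C + D) * polyweight S x ^ max N M" by (simp add: algebra_simps)
 qed
qed

lemma polybdd_mult: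
 fixes f g :: "_ => 'b::{real_normed_algebra, second_countable_topology}"
 assumes "polybdd S f" "polybdd S g" shows "polybdd S (\<lambda>x. f x * g x)"
proof -
 obtain C N where f: "0 <= C" "\<And>x. norm (f x) <= C * polyweight S x ^ N" by (rule polybddE[OF assms(1)]) (rule that)
 obtain D M where g: "0 <= D" "\<And>x. norm (g x) <= D * polyweight S x ^ M" by (rule polybddE[OF assms(2)]) (rule that)
 show ?thesis
 proof (rule polybddI[where C = "C * D" and N = "N + M"])
  show "(\<lambda>x. f x * g x) \<in> borel_measurable (PiM S (\<lambda>_. borel))"
   using assms by (intro borel_measurable_times polybdd_measurable)
  fix x
  have P: "0 <= polyweight S x" using polyweight_ge1[of S x] by linarith
  have "norm (f x * g x) <= norm (f x) * norm (g x)" by (rule norm_mult_ineq)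
  also have "... <= (C * polyweight S x ^ N) * (D * polyweight S x ^ M)"
   using P f(1) by (intro mult_mono f g) auto
  finally show "norm (f x * g x) <= C * D * polyweight S x ^ (N + M)" by (simp add: power_add mult_ac)
 qed
qed

lemma polybdd_comp:
 assumes "polybdd S f" "h \<in> borel_measurable borel" "\<And>z. norm (h z) <= norm z"
 shows "polybdd S (\<lambda>x. h (f x))"
proof -
 obtain C N where f: "0 <= C" "\<And>x. norm (f x) <= C * polyweight S x ^ N" by (rule polybddE[OF assms(1)]) (rule that)
 show ?thesis by (rule polybddI[where C = C and N = N])
    (use assms f measurable_compose[OF polybdd_measurable[OF assms(1)] assms(2)] order_trans in \<open>auto, blast\<close>)
qed

lemma polybdd_cnj: "polybdd S f ==> polybdd S (\<lambda>x. cnj (f x))"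
 by (rule polybdd_comp) (auto intro: borel_measurable_continuous_onI continuous_intros)

lemma polybdd_norm: "polybdd S f ==> polybdd S (\<lambda>x. norm (f x))" by (rule polybdd_comp) auto

lemma polybdd_Re: "polybdd S f ==> polybdd S (\<lambda>x. Re (f x))" by (rule polybdd_comp) (auto simp: abs_Re_le_cmod)

lemma polybdd_of_real: "polybdd S f ==> polybdd S (\<lambda>x. cor (f x))" by (rule polybdd_comp) auto

lemma polybdd_uminus: "polybdd S f ==> polybdd S (\<lambda>x. - f x)" by (rule polybdd_comp) auto

lemma polybdd_diff: "polybdd S f ==> polybdd S g ==> polybdd S (\<lambda>x. f x - g x)"
 using polybdd_add[OF _ polybdd_uminus, of S f g] by simp

lemma polybdd_sum:
 assumes "\<And>i. i \<in> I ==> polybdd S (f i)" shows "polybdd S (\<lambda>x. \<Sum>i\<in>I. f i x)"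
proof (cases "finite I")
 case True
 then show ?thesis using assms by (induction I rule: finite_induct) (auto intro: polybdd_const polybdd_add)
qed (simp add: polybdd_const)

lemma polybdd_power:
 fixes f :: "_ => 'b::{real_normed_algebra_1, second_countable_topology}"
 assumes "polybdd S f" shows "polybdd S (\<lambda>x. f x ^ k)" by (induction k) (auto intro: polybdd_const polybdd_mult assms)

lemma polybdd_divide:
 fixes f :: "_ => 'b::{real_normed_field, second_countable_topology}"
 assumes "polybdd S f" shows "polybdd S (\<lambda>x. f x / c)"
 using polybdd_mult[OF assms polybdd_const[of S "inverse c"]] by (simp add: divide_inverse)

lemma measurable_update_zero:
 assumes "e \<in> S"
 shows "(\<lambda>x. x(e := 0::complex)) \<in> measurable (PiM S (\<lambda>_. borel)) (PiM S (\<lambda>_. borel))"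
proof (rule measurable_PiM_single')
 show "(\<lambda>x. x(e := 0::complex)) \<in> space (PiM S (\<lambda>_. borel)) \<rightarrow> (\<Pi>\<^sub>E i\<in>S. space borel)"
  using assms by (auto simp: space_PiM PiE_def extensional_def)
 fix i assume i: "i \<in> S"
 show "(\<lambda>x. (x(e := 0::complex)) i) \<in> borel_measurable (PiM S (\<lambda>_. borel))"
  by (cases "i = e") (use i in \<open>auto intro: measurable_component_singleton\<close>)
qed

lemma polybdd_update:
 assumes "finite S" "e \<in> S" "polybdd S f" shows "polybdd S (\<lambda>x. f (x(e := 0)))"
proof -
 obtain C N where f: "0 <= C" "\<And>x. norm (f x) <= C * polyweight S x ^ N" by (rule polybddE[OF assms(3)]) (rule that)
 show ?thesis
 proof (rule polybddI[where C = C and N = N])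
  show "(\<lambda>x. f (x(e := 0))) \<in> borel_measurable (PiM S (\<lambda>_. borel))"
   by (rule measurable_compose[OF measurable_update_zero[OF assms(2)] polybdd_measurable[OF assms(3)]])
  fix x
  have "norm (f (x(e := 0))) <= C * polyweight S (x(e := 0)) ^ N" by (rule f)
  also have "... <= C * polyweight S x ^ N"
   using polyweight_ge1[of S "x(e := 0)"] by (intro mult_left_mono power_mono polyweight_update_le assms f) auto
  finally show "norm (f (x(e := 0))) <= C * polyweight S x ^ N" .
 qed
qed

lemmas polybdd_intros = polybdd_const polybdd_coord polybdd_add polybdd_diff polybdd_uminus polybdd_mult
 polybdd_cnj polybdd_norm polybdd_Re polybdd_of_real polybdd_sum polybdd_power polybdd_divide
 polybdd_update

text \<open>If \<open>f\<close> is not integrable, its integral is 0 by convention, while the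
  integral of \<open>g\<close> is still nonnegative. This spares an integrability proof at each
  use.\<close>

lemma integral_norm_bound_integral':
 fixes f :: "_ => 'b::{banach, second_countable_topology}"
 assumes "integrable M g" "AE x in M. norm (f x) <= g x"
 shows "norm (integral\<^sup>L M f) <= integral\<^sup>L M g"
proof (cases "integrable M f")
 case True
 have "norm (integral\<^sup>L M f) <= (\<integral>x. norm (f x) \<partial>M)" by (rule integral_norm_bound)
 also have "... <= integral\<^sup>L M g" using assms True by (intro integral_mono_AE) auto
 finally show ?thesis .
next
 case False
 have "0 <= integral\<^sup>L M g" by (rule integral_nonneg_AE, rule eventually_mono[OF assms(2)]) (meson norm_ge_zero order_trans)
 then show ?thesis using False by (simp add: not_integrable_integral_eq)
qed

text \<open>With \<open>c\<close> left free, this gives both Jensen's inequality for the square and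
  the minimality of the distance to the mean.\<close>

lemma (in prob_space) variance_decomposition:
 fixes g :: "'a => complex"
 assumes "integrable M g" "integrable M (\<lambda>y. (cmod (g y))^2)"
 shows "integrable M (\<lambda>y. (cmod (g y - c))^2)"
  and "(\<integral>y. (cmod (g y - c))^2 \<partial>M)
   = (\<integral>y. (cmod (g y))^2 \<partial>M) - (cmod (integral\<^sup>L M g))^2 + (cmod (integral\<^sup>L M g - c))^2"
proof -
 have e: "(cmod (z - c))^2 = (cmod z)^2 - 2 * Re (cnj c * z) + (cmod c)^2" for z :: complex
  unfolding cmod_power2 by (simp add: power2_eq_square algebra_simps)
 have i: "integrable M (\<lambda>y. Re (cnj c * g y))" using assms by (intro integrable_Re) auto
 show "integrable M (\<lambda>y. (cmod (g y - c))^2)" unfolding e using assms i by auto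
 have "(\<integral>y. (cmod (g y - c))^2 \<partial>M)
   = (\<integral>y. (cmod (g y))^2 \<partial>M) - 2 * (\<integral>y. Re (cnj c * g y) \<partial>M) + (cmod c)^2"
  unfolding e using assms i by (simp add: prob_space)
 also have "(\<integral>y. Re (cnj c * g y) \<partial>M) = Re (cnj c * integral\<^sup>L M g)"
  using assms by (subst integral_Re) auto
 finally show "(\<integral>y. (cmod (g y - c))^2 \<partial>M)
   = (\<integral>y. (cmod (g y))^2 \<partial>M) - (cmod (integral\<^sup>L M g))^2 + (cmod (integral\<^sup>L M g - c))^2"
  unfolding e by simp
qed

lemma (in prob_space) cmod_integral_square_le:
 fixes g :: "'a => complex"
 assumes "integrable M g" "integrable M (\<lambda>y. (cmod (g y))^2)"
 shows "(cmod (integral\<^sup>L M g))^2 <= (\<integral>y. (cmod (g y))^2 \<partial>M)"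
proof -
 have "0 <= (\<integral>y. (cmod (g y - integral\<^sup>L M g))^2 \<partial>M)" by simp
 then show ?thesis unfolding variance_decomposition(2)[OF assms] by simp
qed

locale all_moments = prob_space \<mu> for \<mu> :: "complex measure" +
 assumes sets_mu: "sets \<mu> = sets borel"
  and moment: "\<And>m. integrable \<mu> (\<lambda>z. cmod z ^ m)"
begin

lemma space_mu [simp]: "space \<mu> = UNIV"
 using sets_eq_imp_space_eq[OF sets_mu] by simp

lemma prob_UNIV [simp]: "prob UNIV = 1"
 using prob_space by simp

abbreviation Pr :: "'e set => ('e => complex) measure" where
 "Pr S \<equiv> PiM S (\<lambda>_. \<mu>)"

lemma sets_Pr: "sets (Pr S) = sets (PiM S (\<lambda>_. borel))" by (intro sets_PiM_cong) (auto simp: sets_mu)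

lemma measurable_Pr [simp]: "measurable (Pr S) N = measurable (PiM S (\<lambda>_. borel)) N" by (intro measurable_cong_sets sets_Pr refl)

lemma psf: "product_sigma_finite (\<lambda>_::'e. \<mu>)" by (simp add: product_sigma_finite_def sigma_finite_measure_axioms)

lemma prob_space_Pr: "prob_space (Pr S)" by (rule prob_space_PiM) (rule prob_space_axioms)

lemma integrable_one_plus_power: "integrable \<mu> (\<lambda>z. (1 + cmod z) ^ N)"
 unfolding binomial_ring by (intro Bochner_Integration.integrable_sum) (simp add: moment)

lemma integrable_polyweight:
 assumes "finite S" shows "integrable (Pr S) (\<lambda>x. polyweight S x ^ N)"
proof -
 interpret product_sigma_finite "\<lambda>_::'a. \<mu>" by (rule psf)
 show ?thesis
  unfolding polyweight_def prod_power_distrib by (rule product_integrable_prod[OF assms]) (rule integrable_one_plus_power)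
qed

lemma integrable_polybdd:
 fixes f :: "_ => 'b::{banach, second_countable_topology}"
 assumes "finite S" "polybdd S f" shows "integrable (Pr S) f"
proof -
 obtain C N where f: "0 <= C" "\<And>x. norm (f x) <= C * polyweight S x ^ N" by (rule polybddE[OF assms(2)]) (rule that)
 show ?thesis
 proof (rule Bochner_Integration.integrable_bound)
  show "integrable (Pr S) (\<lambda>x. C * polyweight S x ^ N)" by (intro integrable_mult_right integrable_polyweight assms)
  show "f \<in> borel_measurable (Pr S)" using polybdd_measurable[OF assms(2)] by simp
  show "AE x in Pr S. norm (f x) <= norm (C * polyweight S x ^ N)"
   using f(2) by (intro AE_I2) (metis abs_ge_self order_trans real_norm_def)
 qed
qed

lemma integral_insert:
 fixes f :: "_ => 'b::{banach, second_countable_topology}"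
 assumes "finite S" "e \<notin> S" "polybdd (insert e S) f"
 shows "integral\<^sup>L (Pr (insert e S)) f = (\<integral>x. (\<integral>y. f (x(e := y)) \<partial>\<mu>) \<partial>Pr S)"
proof -
 interpret product_sigma_finite "\<lambda>_::'a. \<mu>" by (rule psf)
 show ?thesis by (rule product_integral_insert[OF assms(1,2)]) (use assms in \<open>auto intro: integrable_polybdd\<close>)
qed

lemma measurable_section:
 assumes "f \<in> borel_measurable (PiM (insert e S) (\<lambda>_. borel))"
 shows "(\<lambda>(x, y). f (x(e := y))) \<in> borel_measurable (Pr S \<Otimes>\<^sub>M \<mu>)"
proof -
 have "(\<lambda>(x, y). x(e := y)) \<in> measurable (Pr S \<Otimes>\<^sub>M \<mu>) (Pr (insert e S))" by (rule measurable_add_dim)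
 from measurable_compose[OF this, of f borel] assms
 show ?thesis by (simp add: case_prod_unfold)
qed

lemma integrable_section:
 fixes f :: "_ => 'b::{banach, second_countable_topology}"
 assumes "finite S" "e \<notin> S" "polybdd (insert e S) f" "x \<in> space (Pr S)"
 shows "integrable \<mu> (\<lambda>y. f (x(e := y)))"
proof -
 obtain C N where f: "0 <= C" "\<And>x. norm (f x) <= C * polyweight (insert e S) x ^ N" by (rule polybddE[OF assms(3)]) (rule that)
 show ?thesis
 proof (rule Bochner_Integration.integrable_bound)
  show "integrable \<mu> (\<lambda>y. C * polyweight S x ^ N * (1 + cmod y) ^ N)" by (intro integrable_mult_right integrable_one_plus_power)
  show "(\<lambda>y. f (x(e := y))) \<in> borel_measurable \<mu>"
   using measurable_Pair2[OF measurable_section[OF polybdd_measurable[OF assms(3)]] assms(4)] by simp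
  show "AE y in \<mu>. norm (f (x(e := y))) <= norm (C * polyweight S x ^ N * (1 + cmod y) ^ N)"
  proof (intro AE_I2)
   fix y
   have "norm (f (x(e := y))) <= C * polyweight S x ^ N * (1 + cmod y) ^ N"
    using f(2)[of "x(e := y)"] polyweight_insert[OF assms(1,2), of x y] by (simp add: power_mult_distrib mult_ac)
   then show "norm (f (x(e := y))) <= norm (C * polyweight S x ^ N * (1 + cmod y) ^ N)" by (metis abs_ge_self order_trans real_norm_def)
  qed
 qed
qed

lemma polybdd_integral_section:
 fixes f :: "_ => 'b::{banach, second_countable_topology}"
 assumes "finite S" "e \<notin> S" "polybdd (insert e S) f"
 shows "polybdd S (\<lambda>x. \<integral>y. f (x(e := y)) \<partial>\<mu>)"
proof -
 obtain C N where f: "0 <= C" "\<And>x. norm (f x) <= C * polyweight (insert e S) x ^ N" by (rule polybddE[OF assms(3)]) (rule that)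
 show ?thesis
 proof (rule polybddI[where C = "C * (\<integral>y. (1 + cmod y) ^ N \<partial>\<mu>)" and N = N])
  show "(\<lambda>x. \<integral>y. f (x(e := y)) \<partial>\<mu>) \<in> borel_measurable (PiM S (\<lambda>_. borel))"
   using borel_measurable_lebesgue_integral[OF measurable_section[OF polybdd_measurable[OF assms(3)]]] by simp
  fix x
  have "norm (\<integral>y. f (x(e := y)) \<partial>\<mu>) <= (\<integral>y. C * polyweight S x ^ N * (1 + cmod y) ^ N \<partial>\<mu>)"
  proof (rule integral_norm_bound_integral')
   show "AE y in \<mu>. norm (f (x(e := y))) <= C * polyweight S x ^ N * (1 + cmod y) ^ N"
    using f(2)[of "x(e := _)"] polyweight_insert[OF assms(1,2), of x] by (auto simp add: power_mult_distrib mult_ac intro!: AE_I2)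
  qed (intro integrable_mult_right integrable_one_plus_power)
  then show "norm (\<integral>y. f (x(e := y)) \<partial>\<mu>) <= C * (\<integral>y. (1 + cmod y) ^ N \<partial>\<mu>) * polyweight S x ^ N"
   by (simp add: mult_ac)
 qed
qed

text \<open>\<open>x(e := 0)\<close> does not see the coordinate \<open>e\<close>, so Fubini for
  that coordinate factors the expectation. This is the form in which independence of the entries
  enters the integration by parts.\<close>

lemma integral_update_decouple:
 fixes g :: "_ => complex"
 assumes "finite S" "e \<in> S" "polybdd S g" "polybdd S (\<lambda>x. f (x e))"
 shows "(\<integral>x. f (x e) * g (x(e := 0)) \<partial>Pr S) = (\<integral>z. f z \<partial>\<mu>) * (\<integral>x. g (x(e := 0)) \<partial>Pr S)"
proof -
 define S' where "S' = S - {e}"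
 have S: "S = insert e S'" "finite S'" "e \<notin> S'" using assms by (auto simp: S'_def)
 have g: "polybdd (insert e S') (\<lambda>x. g (x(e := 0)))"
  using polybdd_update[OF assms(1-3)] S by simp
 have f: "polybdd (insert e S') (\<lambda>x. f (x e))" using assms(4) S by simp
 have "(\<integral>x. g (x(e := 0)) \<partial>Pr S) = (\<integral>x. (\<integral>y. g (x(e := 0)) \<partial>\<mu>) \<partial>Pr S')"
  unfolding S(1) using integral_insert[OF S(2,3) g] by simp
 then have 1: "(\<integral>x. g (x(e := 0)) \<partial>Pr S) = (\<integral>x. g (x(e := 0)) \<partial>Pr S')" by (simp add: prob_space)
 have "(\<integral>x. f (x e) * g (x(e := 0)) \<partial>Pr S) = (\<integral>x. (\<integral>y. f y * g (x(e := 0)) \<partial>\<mu>) \<partial>Pr S')"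
  unfolding S(1) using integral_insert[OF S(2,3) polybdd_mult[OF f g]] by simp
 also have "... = (\<integral>x. (\<integral>y. f y \<partial>\<mu>) * g (x(e := 0)) \<partial>Pr S')" by simp
 finally show ?thesis by (simp add: 1)
qed

text \<open>Resampling a coordinate is replaced by setting it to 0: in one coordinate the variance
  is at most the mean square distance to any value that does not depend on it. The proof is by
  induction on the coordinates, with \<open>h\<close> the average over the new one.\<close>

lemma Efron_Stein:
 fixes f :: "('e => complex) => complex"
 assumes "finite S" "polybdd S f"
 shows "(\<integral>x. (cmod (f x - integral\<^sup>L (Pr S) f))^2 \<partial>Pr S)
  <= (\<Sum>e\<in>S. \<integral>x. (cmod (f x - f (x(e := 0))))^2 \<partial>Pr S)"
 using assms
proof (induction S arbitrary: f rule: finite_induct)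
 case empty
 have "integral\<^sup>L (Pr ({}::'e set)) f = f (\<lambda>_. undefined)" by (simp add: PiM_empty lebesgue_integral_count_space_finite)
 then show ?case by (simp add: PiM_empty lebesgue_integral_count_space_finite)
next
 case (insert e S)
 note fin = insert.hyps(1,2) and pf = insert.prems
 define h where "h = (\<lambda>x. \<integral>y. f (x(e := y)) \<partial>\<mu>)"
 define m where "m = integral\<^sup>L (Pr (insert e S)) f"
 have fi: "finite (insert e S)" using fin by simp
 have ph: "polybdd S h" unfolding h_def by (rule polybdd_integral_section[OF fin pf])
 have mh: "m = integral\<^sup>L (Pr S) h" unfolding m_def h_def by (rule integral_insert[OF fin pf])
 have p1: "polybdd (insert e S) (\<lambda>x. (cmod (f x - m))^2)" by (intro polybdd_intros pf)
 have p0: "polybdd (insert e S) (\<lambda>x. (cmod (f x))^2)" by (intro polybdd_intros pf)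
 have p2: "polybdd (insert e S) (\<lambda>x. (cmod (f x - f (x(e' := 0))))^2)" if "e' \<in> insert e S" for e'
  using that by (intro polybdd_intros pf fi)
 have i1: "integrable \<mu> (\<lambda>y. f (x(e := y)))" "integrable \<mu> (\<lambda>y. (cmod (f (x(e := y))))^2)"
  if "x \<in> space (Pr S)" for x by (rule integrable_section[OF fin pf that], rule integrable_section[OF fin p0 that])
 \<comment> \<open>The conditional variance in the coordinate \<open>e\<close> is at most the mean
   square distance to the constant \<open>f (x(e := 0))\<close>; the remaining term is the deviation
   of the conditional mean \<open>h\<close>.\<close>
 have step1: "(\<integral>y. (cmod (f (x(e := y)) - m))^2 \<partial>\<mu>)
   <= (\<integral>y. (cmod (f (x(e := y)) - f (x(e := 0))))^2 \<partial>\<mu>) + (cmod (h x - m))^2"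
  if x: "x \<in> space (Pr S)" for x
 proof -
  have "(\<integral>y. (cmod (f (x(e := y)) - f (x(e := 0))))^2 \<partial>\<mu>)
    \<ge> (\<integral>y. (cmod (f (x(e := y))))^2 \<partial>\<mu>) - (cmod (h x))^2"
   unfolding variance_decomposition(2)[OF i1[OF x]] h_def by simp
  then show ?thesis unfolding variance_decomposition(2)[OF i1[OF x], of m] h_def by simp
 qed
 have "(\<integral>x. (cmod (f x - m))^2 \<partial>Pr (insert e S)) = (\<integral>x. (\<integral>y. (cmod (f (x(e := y)) - m))^2 \<partial>\<mu>) \<partial>Pr S)"
  by (rule integral_insert[OF fin p1])
 also have "... <= (\<integral>x. (\<integral>y. (cmod (f (x(e := y)) - f (x(e := 0))))^2 \<partial>\<mu>) + (cmod (h x - m))^2 \<partial>Pr S)"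
 proof (rule integral_mono_AE)
  show "integrable (Pr S) (\<lambda>x. \<integral>y. (cmod (f (x(e := y)) - m))^2 \<partial>\<mu>)"
   by (rule integrable_polybdd[OF fin(1) polybdd_integral_section[OF fin p1]])
  have "polybdd S (\<lambda>x. \<integral>y. (cmod (f (x(e := y)) - f (x(e := 0))))^2 \<partial>\<mu>)"
   using polybdd_integral_section[OF fin p2[of e]] by simp
  then show "integrable (Pr S) (\<lambda>x. (\<integral>y. (cmod (f (x(e := y)) - f (x(e := 0))))^2 \<partial>\<mu>) + (cmod (h x - m))^2)"
   by (intro integrable_polybdd fin polybdd_add) (auto intro!: polybdd_intros ph)
 qed (use step1 in auto)
 also have "... = (\<integral>x. (cmod (f x - f (x(e := 0))))^2 \<partial>Pr (insert e S)) + (\<integral>x. (cmod (h x - m))^2 \<partial>Pr S)"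
 proof -
  have "polybdd S (\<lambda>x. \<integral>y. (cmod (f (x(e := y)) - f (x(e := 0))))^2 \<partial>\<mu>)"
   using polybdd_integral_section[OF fin p2[of e]] by simp
  moreover have "polybdd S (\<lambda>x. (cmod (h x - m))^2)" by (intro polybdd_intros ph)
  ultimately show ?thesis
   using integral_insert[OF fin p2[of e]] by (simp add: Bochner_Integration.integral_add integrable_polybdd fin)
 qed
 also have "(\<integral>x. (cmod (h x - m))^2 \<partial>Pr S) <= (\<Sum>e'\<in>S. \<integral>x. (cmod (h x - h (x(e' := 0))))^2 \<partial>Pr S)"
  unfolding mh by (rule insert.IH[OF ph])
 \<comment> \<open>Averaging over \<open>e\<close> commutes with setting \<open>e'\<close> to 0, so
   by Jensen's inequality the increments of \<open>h\<close> are at most those of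
   \<open>f\<close>.\<close>
 also have "... <= (\<Sum>e'\<in>S. \<integral>x. (cmod (f x - f (x(e' := 0))))^2 \<partial>Pr (insert e S))"
 proof (rule sum_mono)
  fix e' assume e': "e' \<in> S"
  then have ne: "e' \<noteq> e" using fin by auto
  have pd: "polybdd (insert e S) (\<lambda>x. f x - f (x(e' := 0)))"
   using e' by (intro polybdd_intros pf fi) auto
  have "(\<integral>x. (cmod (h x - h (x(e' := 0))))^2 \<partial>Pr S)
   <= (\<integral>x. (\<integral>y. (cmod (f (x(e := y)) - f ((x(e := y))(e' := 0))))^2 \<partial>\<mu>) \<partial>Pr S)"
  proof (rule integral_mono_AE)
   show "integrable (Pr S) (\<lambda>x. (cmod (h x - h (x(e' := 0))))^2)" by (intro integrable_polybdd fin polybdd_intros ph e')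
   show "integrable (Pr S) (\<lambda>x. \<integral>y. (cmod (f (x(e := y)) - f ((x(e := y))(e' := 0))))^2 \<partial>\<mu>)"
    by (intro integrable_polybdd[OF fin(1)] polybdd_integral_section[OF fin]) (rule p2, simp add: e')
   have "(cmod (h x - h (x(e' := 0))))^2
     <= (\<integral>y. (cmod (f (x(e := y)) - f ((x(e := y))(e' := 0))))^2 \<partial>\<mu>)"
    if x: "x \<in> space (Pr S)" for x
   proof -
    have x': "x(e' := 0) \<in> space (Pr S)"
     using x e' by (auto simp: space_PiM PiE_def extensional_def)
    have sw: "(x(e := y))(e' := 0) = (x(e' := 0))(e := y)" for y using ne by auto
    have "h x - h (x(e' := 0)) = (\<integral>y. f (x(e := y)) - f ((x(e := y))(e' := 0)) \<partial>\<mu>)"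
     unfolding h_def sw using i1(1)[OF x] i1(1)[OF x'] by simp
    then show ?thesis
     using cmod_integral_square_le[OF integrable_section[OF fin pd x] integrable_section[OF fin p2[of e'] x]] e' by simp
   qed
   then show "AE x in Pr S. (cmod (h x - h (x(e' := 0))))^2
     <= (\<integral>y. (cmod (f (x(e := y)) - f ((x(e := y))(e' := 0))))^2 \<partial>\<mu>)" by auto
  qed
  also have "... = (\<integral>x. (cmod (f x - f (x(e' := 0))))^2 \<partial>Pr (insert e S))"
   by (rule integral_insert[OF fin p2, symmetric]) (simp add: e')
  finally show "(\<integral>x. (cmod (h x - h (x(e' := 0))))^2 \<partial>Pr S)
    <= (\<integral>x. (cmod (f x - f (x(e' := 0))))^2 \<partial>Pr (insert e S))" .
 qed
 finally show ?case unfolding sum.insert[OF fin] m_def by - (assumption | linarith)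
qed

lemma norm_integral_le:
 fixes f :: "_ => 'b::{banach, second_countable_topology}"
 assumes "finite S" "polybdd S g" "\<And>x. norm (f x) <= g x"
 shows "norm (integral\<^sup>L (Pr S) f) <= integral\<^sup>L (Pr S) g" by (rule integral_norm_bound_integral') (use assms integrable_polybdd in auto)

lemma integral_mono_polybdd:
 fixes f g :: "_ => real"
 assumes "finite S" "polybdd S f" "polybdd S g" "\<And>x. f x <= g x"
 shows "integral\<^sup>L (Pr S) f <= integral\<^sup>L (Pr S) g" by (intro integral_mono integrable_polybdd assms)

lemma integral_power_mono:
 fixes T :: "_ => real"
 assumes "finite S" "polybdd S T" "\<And>x. 1 <= T x" "a <= b"
 shows "(\<integral>x. T x ^ a \<partial>Pr S) <= (\<integral>x. T x ^ b \<partial>Pr S)"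
 by (intro integral_mono_polybdd polybdd_intros power_increasing assms)

lemma square_integral_le:
 fixes f :: "_ => real"
 assumes "finite S" "polybdd S f"
 shows "(integral\<^sup>L (Pr S) f)^2 <= (\<integral>x. (f x)^2 \<partial>Pr S)"
proof -
 interpret P: prob_space "Pr S" by (rule prob_space_Pr)
 have "0 <= P.variance f" by simp
 then show ?thesis
  using P.variance_eq[of f] integrable_polybdd[OF assms]
   integrable_polybdd[OF assms(1) polybdd_power[OF assms(2), of 2]] by simp
qed

end

locale iid_entries = all_moments +
 fixes \<rho> :: real
 assumes mean0: "(\<integral>z. z \<partial>\<mu>) = 0"
  and var1: "(\<integral>z. (cmod z)^2 \<partial>\<mu>) = 1"
  and rho: "(\<integral>z. z^2 \<partial>\<mu>) = cor \<rho>" "0 <= \<rho>" "\<rho> <= 1"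
begin

lemma integral_coord_times_update:
 assumes "finite S" "e \<in> S" "polybdd S g"
 shows "(\<integral>x. x e * g (x(e := 0)) \<partial>Pr S) = 0"
 using integral_update_decouple[OF assms, of "\<lambda>z. z"] polybdd_coord[OF assms(1,2)] mean0 by simp

text \<open>Second-order Taylor expansion in one entry plays the role of Gaussian integration by parts.\<close>

lemma integration_by_parts:
 fixes F G H :: "('e => complex) => complex" and q1 q2 T :: "('e => complex) => real"
 assumes S: "finite S" "e \<in> S"
  and p: "polybdd S F" "polybdd S G" "polybdd S H" "polybdd S q1" "polybdd S q2" "polybdd S T"
  and q1: "\<And>x. cmod (F x - F (x(e := 0)) - x e * G x - cnj (x e) * H x) <= q1 x"
  and q2: "\<And>x. cmod (G x - G (x(e := 0))) <= q2 x" "\<And>x. cmod (H x - H (x(e := 0))) <= q2 x"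
  and T: "\<And>x. cmod (x e) <= T x" "\<And>x. 1 <= T x"
 shows "cmod ((\<integral>x. x e * F x \<partial>Pr S) - \<rho> * (\<integral>x. G x \<partial>Pr S) - (\<integral>x. H x \<partial>Pr S))
  <= (\<integral>x. T x * q1 x + 4 * (T x)^2 * q2 x \<partial>Pr S)"
proof -
 note pc = polybdd_coord[OF S]
 note pu = polybdd_update[OF S]
 note int = integrable_polybdd[OF S(1)]
 \<comment> \<open>\<open>?A\<close> is the Taylor remainder, \<open>?B\<close> and
   \<open>?C\<close> stem from replacing the square and the squared modulus of the entry by their
   means \<open>\<rho>\<close> and 1. At the matrix without the entry these replacements are exact
   in expectation (\<open>z1\<close>, \<open>z2\<close>, \<open>z3\<close>), so only the increments
   of \<open>G\<close> and \<open>H\<close> remain.\<close>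
 let ?A = "\<lambda>x. x e * (F x - F (x(e := 0)) - x e * G x - cnj (x e) * H x)"
 let ?B = "\<lambda>x. ((x e)^2 - cor \<rho>) * (G x - G (x(e := 0)))"
 let ?C = "\<lambda>x. cor ((cmod (x e))^2 - 1) * (H x - H (x(e := 0)))"
 have z1: "(\<integral>x. x e * F (x(e := 0)) \<partial>Pr S) = 0" by (rule integral_coord_times_update[OF S p(1)])
 have z2: "(\<integral>x. ((x e)^2 - \<rho>) * G (x(e := 0)) \<partial>Pr S) = 0"
 proof -
  have "integrable \<mu> (\<lambda>z. z^2)" by (rule Bochner_Integration.integrable_bound[OF moment[of 2]])
     (auto simp: norm_power measurable_cong_sets[OF sets_mu refl])
  then have "(\<integral>z. z^2 - cor \<rho> \<partial>\<mu>) = 0" using rho by (simp add: prob_space)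
  then show ?thesis
   using integral_update_decouple[OF S p(2), of "\<lambda>z. z^2 - \<rho>"] by (simp add: polybdd_intros S)
 qed
 have z3: "(\<integral>x. cor ((cmod (x e))^2 - 1) * H (x(e := 0)) \<partial>Pr S) = 0"
 proof -
  have "(\<integral>z. cor ((cmod z)^2 - 1) \<partial>\<mu>) = cor (\<integral>z. (cmod z)^2 - 1 \<partial>\<mu>)" by (rule integral_complex_of_real)
  also have "... = 0" using var1 moment[of 2] by (simp add: prob_space)
  finally show ?thesis
   using integral_update_decouple[OF S p(3), of "\<lambda>z. cor ((cmod z)^2 - 1)"]
    polybdd_of_real[OF polybdd_diff[OF polybdd_power[OF polybdd_norm[OF pc]] polybdd_const], of 2 1] by simp
 qed
 have "(\<integral>x. x e * F x \<partial>Pr S) - \<rho> * (\<integral>x. G x \<partial>Pr S) - (\<integral>x. H x \<partial>Pr S)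
   = (\<integral>x. x e * F x \<partial>Pr S) - (\<integral>x. \<rho> * G x \<partial>Pr S) - (\<integral>x. H x \<partial>Pr S) - (\<integral>x. x e * F (x(e := 0)) \<partial>Pr S)
   - (\<integral>x. ((x e)^2 - \<rho>) * G (x(e := 0)) \<partial>Pr S)
   - (\<integral>x. cor ((cmod (x e))^2 - 1) * H (x(e := 0)) \<partial>Pr S)"
  unfolding z1 z2 z3 by simp
 also have "... = (\<integral>x. x e * F x - \<rho> * G x - H x - x e * F (x(e := 0))
   - ((x e)^2 - \<rho>) * G (x(e := 0)) - cor ((cmod (x e))^2 - 1) * H (x(e := 0)) \<partial>Pr S)"
  by (subst Bochner_Integration.integral_diff, (intro int polybdd_intros S p pc pu)+)+ (rule refl)
 also have "... = (\<integral>x. ?A x + ?B x + ?C x \<partial>Pr S)"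
 proof (intro Bochner_Integration.integral_cong refl)
  fix x
  have "cor ((cmod (x e))^2) = x e * cnj (x e)" by (rule complex_norm_square)
  then show "x e * F x - \<rho> * G x - H x - x e * F (x(e := 0))
   - ((x e)^2 - \<rho>) * G (x(e := 0)) - cor ((cmod (x e))^2 - 1) * H (x(e := 0)) = ?A x + ?B x + ?C x" by (simp add: algebra_simps power2_eq_square)
 qed
 finally have eq: "(\<integral>x. x e * F x \<partial>Pr S) - \<rho> * (\<integral>x. G x \<partial>Pr S) - (\<integral>x. H x \<partial>Pr S)
   = (\<integral>x. ?A x + ?B x + ?C x \<partial>Pr S)" .
 show ?thesis unfolding eq
 proof (rule norm_integral_le[OF S(1)])
  show "polybdd S (\<lambda>x. T x * q1 x + 4 * (T x)^2 * q2 x)" by (intro polybdd_intros p)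
  fix x
  have T2: "1 <= (T x)^2" using T(2)[of x] by (simp add: one_le_power)
  have "0 <= q1 x" using q1[of x] norm_ge_zero order_trans by blast
  have a: "cmod (?A x) <= T x * q1 x"
   unfolding norm_mult using T(1)[of x] q1[of x] T(2)[of x] by (intro mult_mono) auto
  have xe: "(cmod (x e))^2 <= (T x)^2" using T(1)[of x] by (intro power_mono) auto
  have "cmod ((x e)^2 - \<rho>) <= 2 * (T x)^2"
   using norm_triangle_ineq4[of "(x e)^2" "cor \<rho>"] xe T2 rho by (simp add: norm_power)
  then have b: "cmod (?B x) <= 2 * (T x)^2 * q2 x"
   unfolding norm_mult using q2 by (intro mult_mono) auto
  have "cmod (cor ((cmod (x e))^2) - 1) <= 2 * (T x)^2"
   using norm_triangle_ineq4[of "cor ((cmod (x e))^2)" 1] xe T2 by (simp add: norm_power)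
  then have c: "cmod (?C x) <= 2 * (T x)^2 * q2 x"
   unfolding norm_mult using q2 by (intro mult_mono) auto
  show "cmod (?A x + ?B x + ?C x) <= T x * q1 x + 4 * (T x)^2 * q2 x"
   using a b c norm_triangle_ineq[of "?A x + ?B x" "?C x"] norm_triangle_ineq[of "?A x" "?B x"] by linarith
 qed
qed

end

section \<open>Moments of matrix words\<close>

lemma sum_pair_cong:
 assumes "\<And>i j. i < n ==> j < n ==> f i j = g i j"
 shows "(\<Sum>(i, j)\<in>{..<n::nat} \<times> {..<n}. f i j) = (\<Sum>(i, j)\<in>{..<n} \<times> {..<n}. g i j)"
 using assms by (intro sum.cong) auto

lemma sum_pair_mono:
 fixes f g :: "nat => nat => real"
 assumes "\<And>i j. i < n ==> j < n ==> f i j <= g i j"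
 shows "(\<Sum>(i, j)\<in>{..<n::nat} \<times> {..<n}. f i j) <= (\<Sum>(i, j)\<in>{..<n} \<times> {..<n}. g i j)"
 using assms by (intro sum_mono) auto

lemma norm_sum_pair_le:
 fixes f :: "nat => nat => 'a::real_normed_vector"
 assumes "\<And>i j. i < n ==> j < n ==> norm (f i j) <= g i j"
 shows "norm (\<Sum>(i, j)\<in>{..<n::nat} \<times> {..<n}. f i j) <= (\<Sum>(i, j)\<in>{..<n} \<times> {..<n}. g i j)"
 using assms by (intro sum_norm_le) auto

lemma L2_set_sum_le:
 assumes "\<And>r i. r \<in> R ==> 0 <= f r i"
 shows "L2_set (\<lambda>i. \<Sum>r\<in>R. f r i) A <= (\<Sum>r\<in>R. L2_set (f r) A)"
proof (cases "finite R")
 case True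
 then show ?thesis using assms
 proof (induction R rule: finite_induct)
  case (insert r R)
  have "L2_set (\<lambda>i. f r i + (\<Sum>r\<in>R. f r i)) A <= L2_set (f r) A + L2_set (\<lambda>i. \<Sum>r\<in>R. f r i) A"
   by (rule L2_set_triangle_ineq)
  also have "L2_set (\<lambda>i. \<Sum>r\<in>R. f r i) A <= (\<Sum>r\<in>R. L2_set (f r) A)"
   using insert by auto
  finally show ?case using insert by simp
 qed (simp add: L2_set_def)
qed (simp add: L2_set_def)

lemma sum_mult_le_L2_set:
 assumes "\<And>i. i \<in> A ==> 0 <= f i" "\<And>i. i \<in> A ==> 0 <= g i" "L2_set f A <= a" "L2_set g A <= b"
 shows "(\<Sum>i\<in>A. f i * g i) <= a * b"
proof -
 have "(\<Sum>i\<in>A. f i * g i) = (\<Sum>i\<in>A. \<bar>f i\<bar> * \<bar>g i\<bar>)"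
  using assms by (intro sum.cong) auto
 also have "... <= L2_set f A * L2_set g A" by (rule L2_set_mult_ineq)
 also have "... <= a * b" by (intro mult_mono assms L2_set_nonneg order_trans[OF L2_set_nonneg assms(3)])
 finally show ?thesis .
qed

lemma sum_le_sqrt_L2_set:
 assumes "\<And>i. i < n ==> 0 <= f i" "L2_set f {..<n} <= a"
 shows "(\<Sum>i<n. f i) <= sqrt (real n) * a"
proof -
 have "(\<Sum>i<n. 1 * f i) <= sqrt (real n) * a" by (rule sum_mult_le_L2_set) (use assms in \<open>auto simp: L2_set_def\<close>)
 then show ?thesis by simp
qed

lemma sum_squares_le_L2_set:
 assumes "L2_set f A <= a" shows "(\<Sum>i\<in>A. (f i)^2) <= a^2"
proof -
 have "(\<Sum>i\<in>A. (f i)^2) = (L2_set f A)^2" by (simp add: L2_set_def sum_nonneg)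
 also have "... <= a^2" using assms by (intro power_mono L2_set_nonneg)
 finally show ?thesis .
qed

lemma le_L2_set: "finite A ==> i \<in> A ==> L2_set f A <= a ==> f i <= a"
 using member_le_L2_set[of A i f] by linarith

text \<open>The counterpart of \<open>env\<close> for the column index \<open>i\<close>: profile of
  the proper prefixes. The full word is left out because the removed entry belongs to one of its
  factors.\<close>

definition pre :: "nat => (nat => cmat) => nat => nat => arr => nat => nat => real" where
 "pre n C p m x a i = (\<Sum>r<m. cmod (wd n C p r x a i))"

lemma pre_nonneg [simp]: "0 <= pre n C p m x a i" by (simp add: pre_def sum_nonneg)

lemma controlled_ge: "controlled n K M x T ==> 2 <= T" "controlled n K M x T ==> real M + 1 <= T"
 "controlled n K M x T ==> K <= T" by (simp_all add: controlled_def)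

lemma controlled_coord: "controlled n K M x T ==> i < n ==> j < n ==> cmod (x (i, j)) <= T" by (simp add: controlled_def)

lemma controlled_form_bound:
 "controlled n K M x T ==> (\<And>q. form_bound n (C q) K) ==> m <= M ==> form_bound n (wd n C p m x) T" by (simp add: controlled_def)

lemma controlled_form_bound_update:
 "controlled n K M x T ==> (\<And>q. form_bound n (C q) K) ==> m <= M ==> i < n ==> j < n
  ==> form_bound n (wd n C p m (x((i, j) := 0))) T" by (simp only: controlled_def) blast

lemma controlled_env:
 "controlled n K M x T ==> (\<And>q. form_bound n (C q) K) ==> m <= M ==> i < n ==> j < n ==> b < n
  ==> cmod (wd n C p m (x((i, j) := 0)) j b) <= T * env n C p m x j b" by (simp only: controlled_def) blast

lemma env_L2:
 assumes c: "controlled n K M x T" "\<And>q. form_bound n (C q) K" and m: "m <= M" and b: "b < n"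
 shows "L2_set (\<lambda>j. env n C p m x j b) {..<n} <= T^2"
proof -
 have "L2_set (\<lambda>j. env n C p m x j b) {..<n} <= (\<Sum>r\<le>m. L2_set (\<lambda>j. cmod (wd n C (p + r) (m - r) x j b)) {..<n})"
  unfolding env_def by (rule L2_set_sum_le) simp
 also have "... <= (\<Sum>r\<le>m. T)"
  unfolding l2norm_eq_L2_set[symmetric]
  using m by (intro sum_mono form_bound_col[OF controlled_form_bound[OF c]] b) auto
 also have "... = (real m + 1) * T" by simp
 also have "... <= T * T" using controlled_ge[OF c(1)] m by (intro mult_right_mono) auto
 finally show ?thesis by (simp add: power2_eq_square)
qed

lemma pre_L2:
 assumes c: "controlled n K M x T" "\<And>q. form_bound n (C q) K" and m: "m <= M" and a: "a < n"
 shows "L2_set (\<lambda>i. pre n C p m x a i) {..<n} <= T^2"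
proof -
 have "L2_set (\<lambda>i. pre n C p m x a i) {..<n} <= (\<Sum>r<m. L2_set (\<lambda>i. cmod (wd n C p r x a i)) {..<n})"
  unfolding pre_def by (rule L2_set_sum_le) simp
 also have "... <= (\<Sum>r<m. T)"
  unfolding l2norm_eq_L2_set[symmetric]
  using m by (intro sum_mono form_bound_row[OF controlled_form_bound[OF c]] a) auto
 also have "... = real m * T" by simp
 also have "... <= T * T" using controlled_ge[OF c(1)] m by (intro mult_right_mono) auto
 finally show ?thesis by (simp add: power2_eq_square)
qed

text \<open>The bound separates into a function of \<open>i\<close> and a function of
  \<open>j\<close>, each with l2 norm at most a power of \<open>T\<close>. Square sums over all
  \<open>n^2\<close> entries therefore lose nothing, and the factor \<open>1 / sqrt n\<close>
  survives.\<close>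

lemma wd_diff_le:
 assumes c: "controlled n K M x T" "\<And>q. form_bound n (C q) K" and m: "m <= M"
  and ij: "i < n" "j < n" and b: "b < n"
 shows "cmod (wd n C p m x a b - wd n C p m (x((i, j) := 0)) a b)
  <= T^2 / sqrt (real n) * (pre n C p m x a i * env n C p m x j b)"
proof -
 have T: "2 <= T" "cmod (x (i, j)) <= T" using controlled_ge[OF c(1)] controlled_coord[OF c(1) ij] by auto
 have n0: "0 < sqrt (real n)" using ij by simp
 have summand: "cmod (wd n C p r x a i * (x (i, j) / cor (sqrt (real n)))
    * wd n C (Suc (p + r)) (m - Suc r) (x((i, j) := 0)) j b)
   <= cmod (wd n C p r x a i) * (T / sqrt (real n)) * (T * env n C p m x j b)" if r: "r < m" for r
 proof -
  have "cmod (wd n C (Suc (p + r)) (m - Suc r) (x((i, j) := 0)) j b)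
    <= T * env n C (Suc (p + r)) (m - Suc r) x j b" by (rule controlled_env[OF c]) (use m r ij b in auto)
  also have "... <= T * env n C p m x j b"
   using T by (intro mult_left_mono env_suffix_le r) auto
  finally have 1: "cmod (wd n C (Suc (p + r)) (m - Suc r) (x((i, j) := 0)) j b) <= T * env n C p m x j b" .
  have 2: "cmod (x (i, j) / cor (sqrt (real n))) <= T / sqrt (real n)"
   using T n0 by (simp add: norm_divide divide_right_mono)
  show ?thesis
   unfolding norm_mult using T n0 by (intro mult_mono 1 2 order_refl) (auto intro!: mult_nonneg_nonneg)
 qed
 have "cmod (wd n C p m x a b - wd n C p m (x((i, j) := 0)) a b)
   <= (\<Sum>r<m. cmod (wd n C p r x a i) * (T / sqrt (real n)) * (T * env n C p m x j b))"
  unfolding wd_perturb[OF ij] by (intro order_trans[OF norm_sum] sum_mono summand) auto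
 also have "... = T^2 / sqrt (real n) * (pre n C p m x a i * env n C p m x j b)"
  by (simp add: pre_def power2_eq_square sum_distrib_left sum_distrib_right mult_ac)
 finally show ?thesis .
qed

lemma sum_square_product:
 fixes f g :: "nat => real"
 shows "(\<Sum>(i, j)\<in>{..<n} \<times> {..<n}. (c * (f i * g j))^2) = c^2 * ((\<Sum>i<n. (f i)^2) * (\<Sum>j<n. (g j)^2))"
 unfolding sum_product sum.cartesian_product[symmetric] by (simp add: power_mult_distrib sum_distrib_left)

lemma wd_diff_square_sum_le:
 assumes c: "controlled n K M x T" "\<And>q. form_bound n (C q) K" and m: "m <= M" and ab: "a < n" "b < n"
 shows "(\<Sum>e\<in>{..<n} \<times> {..<n}. (cmod (wd n C p m x a b - wd n C p m (x(e := 0)) a b))^2) <= T^12 / real n"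
proof -
 have n0: "0 < real n" using ab by simp
 have T: "2 <= T" using c controlled_ge by blast
 have "(\<Sum>e\<in>{..<n} \<times> {..<n}. (cmod (wd n C p m x a b - wd n C p m (x(e := 0)) a b))^2)
  = (\<Sum>(i, j)\<in>{..<n} \<times> {..<n}. (cmod (wd n C p m x a b - wd n C p m (x((i, j) := 0)) a b))^2)"
  by (simp only: case_prod_unfold prod.collapse)
 also have "...
  <= (\<Sum>(i, j)\<in>{..<n} \<times> {..<n}. (T^2 / sqrt (real n) * (pre n C p m x a i * env n C p m x j b))^2)"
  by (intro sum_pair_mono power_mono wd_diff_le[OF c m] ab) auto
 also have "... = (T^2 / sqrt (real n))^2 * ((\<Sum>i<n. (pre n C p m x a i)^2) * (\<Sum>j<n. (env n C p m x j b)^2))" by (rule sum_square_product)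
 also have "... <= (T^2 / sqrt (real n))^2 * ((T^2)^2 * (T^2)^2)"
  by (intro mult_left_mono mult_mono sum_squares_le_L2_set pre_L2[OF c m] env_L2[OF c m] ab sum_nonneg) auto
 also have "... = T^12 / real n"
  using n0 by (simp add: power_divide flip: power_mult power_add)
 finally show ?thesis .
qed

lemma polybdd_wd:
 "polybdd ({..<n} \<times> {..<n}) (\<lambda>x. wd n C p m x a b)"
proof (induction m arbitrary: a b)
 case (Suc m)
 show ?case
  unfolding wd.simps mmul_def scaledX_def by (intro polybdd_intros Suc) auto
qed (simp add: polybdd_const)

text \<open>\<open>T\<close> is the random weight: estimates hold pathwise with powers of
  \<open>T\<close>, and after integration only the moments \<open>ET q\<close> are left.\<close>

locale controlled_entries = iid_entries +
 fixes n :: nat and K :: real and M :: nat and T :: "arr => real"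
 assumes n: "0 < n"
  and pT: "polybdd ({..<n} \<times> {..<n}) T"
  and ctrl: "\<And>x. controlled n K M x (T x)"
begin

abbreviation Ix :: "(nat \<times> nat) set" where "Ix \<equiv> {..<n} \<times> {..<n}"

definition ET :: "nat => real" where "ET q = (\<integral>x. T x ^ q \<partial>Pr Ix)"

lemma finI: "finite Ix" by simp

lemma T2: "2 <= T x" using controlled_ge[OF ctrl] by blast

lemma T1: "1 <= T x" using T2[of x] by linarith

lemma T0 [simp]: "0 <= T x" using T2[of x] by linarith

lemma ET_mono: "a <= b ==> ET a <= ET b"
 unfolding ET_def by (intro integral_power_mono pT T1) auto

lemma ET_ge1: "1 <= ET q"
proof -
 interpret P: prob_space "Pr Ix" by (rule prob_space_Pr)
 have "ET 0 = 1" by (simp add: ET_def P.prob_space)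
 then show ?thesis using ET_mono[of 0 q] by simp
qed

lemma ET_square: "(ET a)^2 <= ET (2 * a)"
 using square_integral_le[OF finI polybdd_power[OF pT, of a]] by (simp add: ET_def mult.commute flip: power_mult)

lemma norm_integral_le_ET:
 fixes f :: "_ => complex"
 assumes "\<And>x. cmod (f x) <= c * T x ^ q"
 shows "cmod (\<integral>x. f x \<partial>Pr Ix) <= c * ET q"
proof -
 have "cmod (\<integral>x. f x \<partial>Pr Ix) <= (\<integral>x. c * T x ^ q \<partial>Pr Ix)"
  by (intro norm_integral_le finI assms polybdd_intros pT)
 then show ?thesis by (simp add: ET_def)
qed

lemma variance_le:
 assumes "polybdd Ix f" "polybdd Ix g"
  "\<And>x. (\<Sum>e\<in>Ix. (cmod (f x - f (x(e := 0))))^2) <= g x"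
 shows "(\<integral>x. (cmod (f x - integral\<^sup>L (Pr Ix) f))^2 \<partial>Pr Ix) <= integral\<^sup>L (Pr Ix) g"
proof -
 have pd: "polybdd Ix (\<lambda>x. (cmod (f x - f (x(e := 0))))^2)" if "e \<in> Ix" for e
  using that by (intro polybdd_intros assms finI)
 have "(\<integral>x. (cmod (f x - integral\<^sup>L (Pr Ix) f))^2 \<partial>Pr Ix)
   <= (\<Sum>e\<in>Ix. \<integral>x. (cmod (f x - f (x(e := 0))))^2 \<partial>Pr Ix)" by (rule Efron_Stein[OF finI assms(1)])
 also have "... = (\<integral>x. (\<Sum>e\<in>Ix. (cmod (f x - f (x(e := 0))))^2) \<partial>Pr Ix)"
  by (rule Bochner_Integration.integral_sum[symmetric]) (rule integrable_polybdd[OF finI pd])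
 also have "... <= integral\<^sup>L (Pr Ix) g" by (rule integral_mono_polybdd[OF finI polybdd_sum[OF pd] assms(2,3)])
 finally show ?thesis .
qed

lemma second_moment:
 fixes f :: "_ => complex"
 assumes "polybdd Ix f"
 shows "(\<integral>x. (cmod (f x - c))^2 \<partial>Pr Ix)
  = (\<integral>x. (cmod (f x - integral\<^sup>L (Pr Ix) f))^2 \<partial>Pr Ix) + (cmod (integral\<^sup>L (Pr Ix) f - c))^2"
proof -
 interpret P: prob_space "Pr Ix" by (rule prob_space_Pr)
 have i: "integrable (Pr Ix) f" "integrable (Pr Ix) (\<lambda>x. (cmod (f x))^2)" by (intro integrable_polybdd finI assms polybdd_intros)+
 show ?thesis unfolding P.variance_decomposition(2)[OF i, of c]
  P.variance_decomposition(2)[OF i, of "integral\<^sup>L (Pr Ix) f"] by simp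
qed

section \<open>Mean, variance and fourth moment of a word entry\<close>

context
 fixes C :: "nat => cmat"
 assumes C: "\<And>q. form_bound n (C q) K"
begin

lemma wd_variance:
 assumes "m <= M" "a < n" "b < n"
 shows "(\<integral>x. (cmod (wd n C p m x a b - (\<integral>x. wd n C p m x a b \<partial>Pr Ix)))^2 \<partial>Pr Ix) <= ET 12 / real n"
proof -
 have "(\<integral>x. (cmod (wd n C p m x a b - (\<integral>x. wd n C p m x a b \<partial>Pr Ix)))^2 \<partial>Pr Ix)
   <= (\<integral>x. T x ^ 12 / real n \<partial>Pr Ix)"
  by (rule variance_le) (intro polybdd_wd polybdd_intros pT wd_diff_square_sum_le[OF ctrl C] assms)+
 then show ?thesis by (simp add: ET_def)
qed

lemma wd_Suc_expand:
 "wd n C p (Suc m) x a b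
  = (\<Sum>(i, j)\<in>Ix. C p a i / cor (sqrt (real n)) * (x (i, j) * wd n C (Suc p) m x j b))"
proof -
 have "wd n C p (Suc m) x a b = (\<Sum>i<n. C p a i * (\<Sum>j<n. scaledX n x i j * wd n C (Suc p) m x j b))"
  by (simp only: wd_Suc_left mmul_assoc) (simp add: mmul_def)
 also have "... = (\<Sum>i<n. \<Sum>j<n. C p a i / cor (sqrt (real n)) * (x (i, j) * wd n C (Suc p) m x j b))"
  by (simp add: scaledX_def sum_distrib_left mult_ac)
 finally show ?thesis by (simp add: sum.cartesian_product)
qed

text \<open>Splitting off the first factor gives \<open>x (i, j)\<close> times a shorter word, and
  the part of that word without the entry averages to 0. Its increment brings a second factor
  \<open>1 / sqrt n\<close>. The sum over \<open>i\<close> is absorbed by Cauchy-Schwarz, the sum of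
  the profile over \<open>j\<close> costs \<open>sqrt n\<close>, so one factor is left.\<close>

lemma wd_mean:
 assumes m: "m < M" and ab: "a < n" "b < n"
 shows "cmod (\<integral>x. wd n C p (Suc m) x a b \<partial>Pr Ix) <= ET 8 / sqrt (real n)"
proof -
 let ?s = "sqrt (real n)"
 have s: "0 < ?s" using n by simp
 let ?w = "\<lambda>j x. wd n C (Suc p) m x j b"
 have pw: "polybdd Ix (?w j)" for j by (rule polybdd_wd)
 have "(\<integral>x. wd n C p (Suc m) x a b \<partial>Pr Ix)
   = (\<integral>x. (\<Sum>(i, j)\<in>Ix. C p a i / cor ?s * (x (i, j) * ?w j x)) \<partial>Pr Ix)" by (simp only: wd_Suc_expand)
 also have "... = (\<Sum>(i, j)\<in>Ix. (\<integral>x. C p a i / cor ?s * (x (i, j) * ?w j x) \<partial>Pr Ix))"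
  unfolding case_prod_unfold by (rule Bochner_Integration.integral_sum) (intro integrable_polybdd finI polybdd_intros pw, auto)
 also have "... = (\<Sum>(i, j)\<in>Ix. (\<integral>x. C p a i / cor ?s * (x (i, j) * (?w j x - ?w j (x((i, j) := 0)))) \<partial>Pr Ix))"
 proof (rule sum_pair_cong)
  fix i j assume ij: "i < n" "j < n"
  then have e: "(i, j) \<in> Ix" by simp
  have "(\<integral>x. x (i, j) * (?w j x - ?w j (x((i, j) := 0))) \<partial>Pr Ix)
    = (\<integral>x. x (i, j) * ?w j x \<partial>Pr Ix) - (\<integral>x. x (i, j) * ?w j (x((i, j) := 0)) \<partial>Pr Ix)"
   unfolding right_diff_distrib by (rule Bochner_Integration.integral_diff) (intro integrable_polybdd finI polybdd_intros pw e)+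
  then show "(\<integral>x. C p a i / cor ?s * (x (i, j) * ?w j x) \<partial>Pr Ix)
    = (\<integral>x. C p a i / cor ?s * (x (i, j) * (?w j x - ?w j (x((i, j) := 0)))) \<partial>Pr Ix)"
   using integral_coord_times_update[OF finI e pw[of j]] by (simp only: integral_mult_right_zero diff_zero)
 qed
 also have "... = (\<integral>x. (\<Sum>(i, j)\<in>Ix. C p a i / cor ?s * (x (i, j) * (?w j x - ?w j (x((i, j) := 0))))) \<partial>Pr Ix)"
  unfolding case_prod_unfold by (rule Bochner_Integration.integral_sum[symmetric])
    (intro integrable_polybdd finI polybdd_intros pw, auto)
 also have "cmod ... <= 1 / ?s * ET 8"
 proof (rule norm_integral_le_ET)
  fix x
  note c = ctrl[of x] C
  let ?T = "T x" and ?E = "\<lambda>j. env n C (Suc p) m x j b" and ?P = "\<lambda>j i. pre n C (Suc p) m x j i"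
  have mM: "m <= M" using m by simp
  have "cmod (\<Sum>(i, j)\<in>Ix. C p a i / cor ?s * (x (i, j) * (?w j x - ?w j (x((i, j) := 0)))))
    <= (\<Sum>(i, j)\<in>Ix. cmod (C p a i) / ?s * (?T * (?T^2 / ?s * (?P j i * ?E j))))"
  proof (rule norm_sum_pair_le)
   fix i j assume ij: "i < n" "j < n"
   have "cmod (x (i, j) * (?w j x - ?w j (x((i, j) := 0)))) <= ?T * (?T^2 / ?s * (?P j i * ?E j))"
    unfolding norm_mult by (intro mult_mono controlled_coord[OF c(1)] wd_diff_le[OF c mM] ij ab) auto
   then show "cmod (C p a i / cor ?s * (x (i, j) * (?w j x - ?w j (x((i, j) := 0)))))
     <= cmod (C p a i) / ?s * (?T * (?T^2 / ?s * (?P j i * ?E j)))"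
    unfolding norm_mult[of "C p a i / cor ?s"] norm_divide using s by (intro mult_mono) auto
  qed
  also have "... = ?T^3 / real n * (\<Sum>j<n. ?E j * (\<Sum>i<n. cmod (C p a i) * ?P j i))"
   unfolding sum.cartesian_product[symmetric] sum_distrib_left
   by (subst sum.swap) (use s in \<open>simp add: power2_eq_square power3_eq_cube mult_ac flip: real_sqrt_mult\<close>)
  also have "... <= ?T^3 / real n * (\<Sum>j<n. ?E j * (?T * ?T^2))"
  proof (intro mult_left_mono sum_mono)
   fix j assume "j \<in> {..<n}"
   then show "(\<Sum>i<n. cmod (C p a i) * ?P j i) <= ?T * ?T^2"
    using form_bound_row[OF form_bound_mono[OF C controlled_ge(3)[OF c(1)]] ab(1)]
    by (intro sum_mult_le_L2_set pre_L2[OF c mM]) (auto simp: l2norm_eq_L2_set)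
  qed auto
  also have "... = ?T^6 / real n * (\<Sum>j<n. ?E j)" by (simp add: sum_distrib_left sum_distrib_right mult_ac flip: power_add power_Suc)
  also have "... <= ?T^6 / real n * (?s * ?T^2)" by (intro mult_left_mono sum_le_sqrt_L2_set env_L2[OF c mM] ab) auto
  also have "... = 1 / ?s * ?T^8"
   using s by (simp add: field_simps flip: power_add)
  finally show "cmod (\<Sum>(i, j)\<in>Ix. C p a i / cor ?s * (x (i, j) * (?w j x - ?w j (x((i, j) := 0)))))
    <= 1 / ?s * ?T^8" .
 qed
 finally show ?thesis by simp
qed

lemma wd_moment2:
 assumes m: "0 < m" "m <= M" and ab: "a < n" "b < n"
 shows "(\<integral>x. (cmod (wd n C p m x a b))^2 \<partial>Pr Ix) <= 2 * ET 16 / real n"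
proof -
 obtain m' where m': "m = Suc m'" "m' < M" using m by (cases m) auto
 let ?e = "\<integral>x. wd n C p m x a b \<partial>Pr Ix"
 have "(\<integral>x. (cmod (wd n C p m x a b))^2 \<partial>Pr Ix)
   = (\<integral>x. (cmod (wd n C p m x a b - ?e))^2 \<partial>Pr Ix) + (cmod ?e)^2"
  using second_moment[of "\<lambda>x. wd n C p m x a b" 0] polybdd_wd by simp
 also have "... <= ET 12 / real n + (ET 8 / sqrt (real n))^2"
  unfolding m'(1) using m(2) m' by (intro add_mono wd_variance power_mono wd_mean ab) auto
 also have "... <= ET 16 / real n + ET 16 / real n"
  using ET_mono[of 12 16] ET_square[of 8] by (intro add_mono) (auto simp: power_divide divide_right_mono)
 finally show ?thesis by simp
qed

text \<open>Efron-Stein is applied to the square of the entry. The resulting variance bound contains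
  half of the fourth moment itself, which is absorbed on the left, and a term of order
  \<open>1 / n^2\<close>. The constant is 2 * (34 + 4), the 4 coming from the squared second
  moment.\<close>

lemma wd_moment4:
 assumes m: "0 < m" "m <= M" and ab: "a < n" "b < n"
 shows "(\<integral>x. (cmod (wd n C p m x a b))^4 \<partial>Pr Ix) <= 76 * ET 32 / (real n)^2"
proof -
 let ?f = "\<lambda>x. wd n C p m x a b"
 let ?Q = "\<integral>x. (cmod (?f x))^4 \<partial>Pr Ix"
 have pf: "polybdd Ix ?f" by (rule polybdd_wd)
 have n0: "0 < real n" using n by simp
 have var: "(\<integral>x. (cmod ((?f x)^2 - (\<integral>x. (?f x)^2 \<partial>Pr Ix)))^2 \<partial>Pr Ix)
   <= (\<integral>x. 1/2 * (cmod (?f x))^4 + 34 / (real n)^2 * T x ^ 24 \<partial>Pr Ix)"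
 proof (rule variance_le)
  fix x
  let ?D = "\<lambda>e. cmod (?f x - ?f (x(e := 0)))" and ?u = "T x ^ 12 / real n"
  have D: "(\<Sum>e\<in>Ix. (?D e)^2) <= ?u" by (rule wd_diff_square_sum_le[OF ctrl C m(2) ab])
  have u0: "0 <= ?u" by simp
  have De: "(?D e)^2 <= ?u" if "e \<in> Ix" for e
   using member_le_sum[of e Ix "\<lambda>e. (?D e)^2"] that D by auto
  have "(\<Sum>e\<in>Ix. (cmod ((?f x)^2 - (?f (x(e := 0)))^2))^2)
    <= (\<Sum>e\<in>Ix. (?D e)^2 * (8 * (cmod (?f x))^2 + 2 * ?u))"
  proof (rule sum_mono)
   fix e assume e: "e \<in> Ix"
   have "(?f x)^2 - (?f (x(e := 0)))^2 = (?f x - ?f (x(e := 0))) * (?f x + ?f (x(e := 0)))"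
    by (simp only: power2_eq_square) (simp only: square_diff_square_factored mult.commute)
   then have 1: "(cmod ((?f x)^2 - (?f (x(e := 0)))^2))^2 = (?D e)^2 * (cmod (?f x + ?f (x(e := 0))))^2" by (simp only: norm_mult power_mult_distrib)
   have "cmod (?f x + ?f (x(e := 0))) <= 2 * cmod (?f x) + ?D e"
    using norm_triangle_ineq4[of "2 * ?f x" "?f x - ?f (x(e := 0))"] by (simp add: norm_mult)
   then have "(cmod (?f x + ?f (x(e := 0))))^2 <= (2 * cmod (?f x) + ?D e)^2" by (intro power_mono) auto
   also have "... <= 2 * (2 * cmod (?f x))^2 + 2 * (?D e)^2"
    using zero_le_power2[of "2 * cmod (?f x) - ?D e"] by (simp add: power2_eq_square algebra_simps)
   also have "... <= 8 * (cmod (?f x))^2 + 2 * ?u"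
    using De[OF e] by (simp add: power_mult_distrib)
   finally show "(cmod ((?f x)^2 - (?f (x(e := 0)))^2))^2 <= (?D e)^2 * (8 * (cmod (?f x))^2 + 2 * ?u)"
    unfolding 1 by (rule mult_left_mono) simp
  qed
  also have "... = (\<Sum>e\<in>Ix. (?D e)^2) * (8 * (cmod (?f x))^2 + 2 * ?u)" by (simp only: sum_distrib_right)
  also have "... <= ?u * (8 * (cmod (?f x))^2 + 2 * ?u)" by (intro mult_right_mono D) (use u0 in auto)
  \<comment> \<open>Young's inequality, weighted so that the fourth power receives 1/2:
    \<open>8 u c^2 <= c^4 / 2 + 32 u^2\<close>, and 32 + 2 = 34.\<close>
  also have "... <= 1/2 * (cmod (?f x))^4 + 34 * ?u^2"
   using zero_le_power2[of "(cmod (?f x))^2 - 8 * ?u"] by (simp only: power2_diff) (simp add: power2_eq_square power4_eq_xxxx algebra_simps)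
  also have "?u^2 = T x ^ 24 / (real n)^2" by (simp add: power_divide flip: power_mult)
  finally show "(\<Sum>e\<in>Ix. (cmod ((?f x)^2 - (?f (x(e := 0)))^2))^2)
   <= 1/2 * (cmod (?f x))^4 + 34 / (real n)^2 * T x ^ 24" by (simp only: times_divide_eq_left times_divide_eq_right)
 qed (intro polybdd_intros pf pT)+
 also have "... = 1/2 * ?Q + 34 / (real n)^2 * ET 24"
  unfolding ET_def by (subst Bochner_Integration.integral_add) (auto intro!: integrable_polybdd finI polybdd_intros pf pT simp del: power_mult)
 finally have var: "(\<integral>x. (cmod ((?f x)^2 - (\<integral>x. (?f x)^2 \<partial>Pr Ix)))^2 \<partial>Pr Ix)
   <= 1/2 * ?Q + 34 / (real n)^2 * ET 24" .
 have "cmod (\<integral>x. (?f x)^2 \<partial>Pr Ix) <= (\<integral>x. (cmod (?f x))^2 \<partial>Pr Ix)"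
  by (rule norm_integral_le[OF finI]) (auto intro!: polybdd_intros pf simp: norm_power)
 also have "... <= 2 * ET 16 / real n" by (rule wd_moment2[OF m ab])
 finally have "(cmod (\<integral>x. (?f x)^2 \<partial>Pr Ix))^2 <= (2 * ET 16 / real n)^2" by (intro power_mono) auto
 also have "... = 4 / (real n)^2 * (ET 16)^2" by (simp add: power2_eq_square)
 also have "... <= 4 / (real n)^2 * ET 32"
  using ET_square[of 16] by (intro mult_left_mono) auto
 finally have mean: "(cmod (\<integral>x. (?f x)^2 \<partial>Pr Ix))^2 <= 4 / (real n)^2 * ET 32" .
 have "?Q = (\<integral>x. (cmod ((?f x)^2))^2 \<partial>Pr Ix)" by (simp add: norm_power flip: power_mult)
 also have "... = (\<integral>x. (cmod ((?f x)^2 - (\<integral>x. (?f x)^2 \<partial>Pr Ix)))^2 \<partial>Pr Ix) + (cmod (\<integral>x. (?f x)^2 \<partial>Pr Ix))^2"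
  using second_moment[of "\<lambda>x. (?f x)^2" 0] by (simp add: polybdd_intros pf)
 also have "... <= 1/2 * ?Q + 34 / (real n)^2 * ET 32 + 4 / (real n)^2 * ET 32"
 proof -
  have "34 / (real n)^2 * ET 24 <= 34 / (real n)^2 * ET 32" by (intro mult_left_mono ET_mono) auto
  then show ?thesis using var mean by linarith
 qed
 finally show ?thesis by simp
qed

end

end

section \<open>Inner products of matrix words\<close>

text \<open>A switch between covariance (\<open>True\<close>) and pseudo-covariance
  (\<open>False\<close>), so that one computation serves both.\<close>

definition kap :: "bool => complex => complex" where
 "kap \<kappa> z = (if \<kappa> then cnj z else z)"

lemma kap_simps [simp]:
 "cmod (kap \<kappa> z) = cmod z" "kap \<kappa> (kap \<kappa> z) = z" "kap \<kappa> 0 = 0" by (simp_all add: kap_def)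

lemma kap_mult: "kap \<kappa> (z * w) = kap \<kappa> z * kap \<kappa> w"
 and kap_diff: "kap \<kappa> (z - w) = kap \<kappa> z - kap \<kappa> w"
 and kap_sum: "kap \<kappa> (\<Sum>i\<in>A. f i) = (\<Sum>i\<in>A. kap \<kappa> (f i))"
 and kap_divide_real: "kap \<kappa> (z / cor r) = kap \<kappa> z / cor r" by (simp_all add: kap_def)

lemma polybdd_kap: "polybdd S f ==> polybdd S (\<lambda>x. kap \<kappa> (f x))" by (cases \<kappa>) (simp_all add: kap_def polybdd_cnj)

lemma l2norm_kap [simp]: "l2norm n (\<lambda>i. kap \<kappa> (x i)) = l2norm n x" by (simp add: l2norm_def)

lemma form_bound_kap: "form_bound n A c ==> form_bound n (\<lambda>i j. kap \<kappa> (A i j)) c"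
 by (cases \<kappa>) (simp_all add: kap_def form_bound_cnj)

lemma polybdd_env: "polybdd ({..<n} \<times> {..<n}) (\<lambda>x. env n C p m x j b)"
 unfolding env_def by (intro polybdd_intros polybdd_wd)

lemma polybdd_pre: "polybdd ({..<n} \<times> {..<n}) (\<lambda>x. pre n C p m x j b)"
 unfolding pre_def by (intro polybdd_intros polybdd_wd)

lemma wd_first: "wd n (C(p := mmul n A (C p))) p m x = mmul n A (wd n C p m x)" by (induction m) (simp_all add: mmul_assoc)

text \<open>Contraction with a fixed matrix only alters the first letter, so the result is an entry
  of another word and inherits the moment bounds for words.\<close>

lemma contract_left:
 "(\<Sum>l<n. A l i * kap \<kappa> (wd n C p m x l k))
  = kap \<kappa> (wd n (C(p := mmul n (\<lambda>a l. kap \<kappa> (A l a)) (C p))) p m x i k)"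
 unfolding wd_first by (simp add: mmul_def kap_sum kap_mult)

lemma pre_col_L2:
 assumes c: "controlled n K M x T" "\<And>q. form_bound n (C q) K" and m: "m <= M" and i: "i < n"
 shows "L2_set (\<lambda>a. pre n C p m x a i) {..<n} <= T^2"
proof -
 have "L2_set (\<lambda>a. pre n C p m x a i) {..<n} <= (\<Sum>r<m. L2_set (\<lambda>a. cmod (wd n C p r x a i)) {..<n})"
  unfolding pre_def by (rule L2_set_sum_le) simp
 also have "... <= (\<Sum>r<m. T)"
  unfolding l2norm_eq_L2_set[symmetric]
  using m by (intro sum_mono form_bound_col[OF controlled_form_bound[OF c]] i) auto
 also have "... = real m * T" by simp
 also have "... <= T * T" using controlled_ge[OF c(1)] m by (intro mult_right_mono) auto
 finally show ?thesis by (simp add: power2_eq_square)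
qed

lemma env_le:
 assumes "controlled n K M x T" "\<And>q. form_bound n (C q) K" "m <= M" "b < n" "j < n"
 shows "env n C p m x j b <= T^2" by (rule le_L2_set[OF _ _ env_L2[OF assms(1-4)]]) (use assms in auto)

lemma pre_le:
 assumes "controlled n K M x T" "\<And>q. form_bound n (C q) K" "m <= M" "a < n" "i < n"
 shows "pre n C p m x a i <= T^2" by (rule le_L2_set[OF _ _ pre_L2[OF assms(1-4)]]) (use assms in auto)

definition gram :: "nat => bool => (nat => cmat) => nat => nat => nat => (nat => cmat) => nat => nat => nat
  => arr => complex" where
 "gram n \<kappa> C p m b C' p' m' b' x = (\<Sum>l<n. wd n C p m x l b * kap \<kappa> (wd n C' p' m' x l b'))"

lemma polybdd_gram: "polybdd ({..<n} \<times> {..<n}) (gram n \<kappa> C p m b C' p' m' b')"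
proof -
 have "polybdd ({..<n} \<times> {..<n}) (\<lambda>x. gram n \<kappa> C p m b C' p' m' b' x)"
  unfolding gram_def by (intro polybdd_intros polybdd_kap polybdd_wd)
 then show ?thesis .
qed

text \<open>When an inner product of words changes, the prefix in front of the removed entry is
  summed against the other vector \<open>Y\<close>. As a function of \<open>i\<close> this is a
  transposed prefix applied to \<open>Y\<close>, hence bounded in l2.\<close>

definition contr :: "nat => (nat => cmat) => nat => nat => (nat => complex) => arr => nat => real" where
 "contr n C p m Y x i = (\<Sum>r<m. cmod (\<Sum>l<n. wd n C p r x l i * Y l))"

lemma contr_nonneg [simp]: "0 <= contr n C p m Y x i" by (simp add: contr_def sum_nonneg)

lemma contr_L2:
 assumes c: "controlled n K M x T" "\<And>q. form_bound n (C q) K" and m: "m <= M" and Y: "l2norm n Y <= T"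
 shows "L2_set (contr n C p m Y x) {..<n} <= T^3"
proof -
 have T: "0 <= T" using controlled_ge[OF c(1)] by linarith
 have "L2_set (\<lambda>i. contr n C p m Y x i) {..<n}
   <= (\<Sum>r<m. L2_set (\<lambda>i. cmod (\<Sum>l<n. wd n C p r x l i * Y l)) {..<n})"
  unfolding contr_def by (rule L2_set_sum_le) simp
 also have "... <= (\<Sum>r<m. T * T)"
 proof (rule sum_mono)
  fix r assume "r \<in> {..<m}"
  then have "form_bound n (\<lambda>i l. wd n C p r x l i) T"
   using m by (intro form_bound_transpose[OF controlled_form_bound[OF c]]) auto
  then have "l2norm n (mvmul n (\<lambda>i l. wd n C p r x l i) Y) <= T * l2norm n Y" by (rule form_bound_vec)
  also have "... <= T * T" using T by (intro mult_left_mono Y)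
  finally show "L2_set (\<lambda>i. cmod (\<Sum>l<n. wd n C p r x l i * Y l)) {..<n} <= T * T" by (simp add: l2norm_eq_L2_set mvmul_def)
 qed
 also have "... = real m * (T * T)" by simp
 also have "... <= T * (T * T)" using controlled_ge[OF c(1)] m T by (intro mult_right_mono) auto
 finally show ?thesis by (simp add: power3_eq_cube)
qed

lemma sum_wd_diff_mult_le:
 assumes c: "controlled n K M x T" "\<And>q. form_bound n (C q) K" and m: "m <= M"
  and ij: "i < n" "j < n" and b: "b < n"
 shows "cmod (\<Sum>l<n. (wd n C p m x l b - wd n C p m (x((i, j) := 0)) l b) * Y l)
  <= T^2 / sqrt (real n) * (contr n C p m Y x i * env n C p m x j b)"
proof -
 let ?x' = "x((i, j) := 0)" and ?h = "x (i, j) / cor (sqrt (real n))"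
 have T: "2 <= T" "cmod (x (i, j)) <= T" using controlled_ge[OF c(1)] controlled_coord[OF c(1) ij] by auto
 have n0: "0 < sqrt (real n)" using ij by simp
 have eq: "(\<Sum>l<n. (wd n C p m x l b - wd n C p m ?x' l b) * Y l)
   = (\<Sum>r<m. (\<Sum>l<n. wd n C p r x l i * Y l) * ?h * wd n C (Suc (p + r)) (m - Suc r) ?x' j b)"
 proof -
  have rearr: "a * h * w * y = a * y * h * w" for a h w y :: complex by (simp add: mult_ac)
  show ?thesis
   unfolding wd_perturb[OF ij] sum_distrib_right by (subst sum.swap) (intro sum.cong refl rearr)
 qed
 have "cmod (\<Sum>l<n. (wd n C p m x l b - wd n C p m ?x' l b) * Y l)
   <= (\<Sum>r<m. cmod (\<Sum>l<n. wd n C p r x l i * Y l) * (T / sqrt (real n)) * (T * env n C p m x j b))"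
  unfolding eq
 proof (intro order_trans[OF norm_sum] sum_mono)
  fix r assume "r \<in> {..<m}"
  then have r: "r < m" by simp
  have "cmod (wd n C (Suc (p + r)) (m - Suc r) ?x' j b) <= T * env n C (Suc (p + r)) (m - Suc r) x j b"
   by (rule controlled_env[OF c]) (use m r ij b in auto)
  also have "... <= T * env n C p m x j b"
   using T by (intro mult_left_mono env_suffix_le r) auto
  finally have 1: "cmod (wd n C (Suc (p + r)) (m - Suc r) ?x' j b) <= T * env n C p m x j b" .
  have 2: "cmod ?h <= T / sqrt (real n)"
   using T n0 by (simp add: norm_divide divide_right_mono)
  show "cmod ((\<Sum>l<n. wd n C p r x l i * Y l) * ?h * wd n C (Suc (p + r)) (m - Suc r) ?x' j b)
    <= cmod (\<Sum>l<n. wd n C p r x l i * Y l) * (T / sqrt (real n)) * (T * env n C p m x j b)"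
   unfolding norm_mult using T n0 by (intro mult_mono 1 2 order_refl) (auto intro!: mult_nonneg_nonneg)
 qed
 also have "... = T^2 / sqrt (real n) * (contr n C p m Y x i * env n C p m x j b)"
  unfolding contr_def sum_distrib_left sum_distrib_right by (intro sum.cong refl) (simp add: power2_eq_square mult_ac)
 finally show ?thesis .
qed

text \<open>Product rule for differences: a first-order term for each word and a cross term in which
  both change. The cross term already carries \<open>1 / n\<close>, so it may forget
  \<open>i\<close> and the profile of the second word.\<close>

lemma gram_diff_le:
 assumes c: "controlled n K M x T" "\<And>q. form_bound n (C q) K" "\<And>q. form_bound n (C' q) K"
  and m: "m <= M" "m' <= M" and ij: "i < n" "j < n" and b: "b < n" "b' < n"
 shows "cmod (gram n \<kappa> C p m b C' p' m' b' x - gram n \<kappa> C p m b C' p' m' b' (x((i, j) := 0)))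
  <= T^2 / sqrt (real n) * (contr n C p m (\<lambda>l. kap \<kappa> (wd n C' p' m' x l b')) x i * env n C p m x j b)
   + T^2 / sqrt (real n) * (contr n C' p' m' (\<lambda>l. kap \<kappa> (wd n C p m x l b)) x i * env n C' p' m' x j b')
   + T^10 / real n * env n C p m x j b"
proof -
 let ?x' = "x((i, j) := 0)"
 let ?Y = "\<lambda>l. wd n C p m x l b" and ?Yd = "\<lambda>l. wd n C p m x l b - wd n C p m ?x' l b"
 let ?V = "\<lambda>l. wd n C' p' m' x l b'" and ?Vd = "\<lambda>l. wd n C' p' m' x l b' - wd n C' p' m' ?x' l b'"
 have T: "2 <= T" using controlled_ge[OF c(1)] by auto
 have n0: "0 < real n" using ij by simp
 have "gram n \<kappa> C p m b C' p' m' b' x - gram n \<kappa> C p m b C' p' m' b' ?x'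
  = (\<Sum>l<n. ?Yd l * kap \<kappa> (?V l)) + (\<Sum>l<n. ?Y l * kap \<kappa> (?Vd l)) - (\<Sum>l<n. ?Yd l * kap \<kappa> (?Vd l))"
  unfolding gram_def kap_diff by (simp only: algebra_simps sum.distrib sum_subtractf)
 then have "cmod (gram n \<kappa> C p m b C' p' m' b' x - gram n \<kappa> C p m b C' p' m' b' ?x')
  <= cmod (\<Sum>l<n. ?Yd l * kap \<kappa> (?V l)) + cmod (\<Sum>l<n. ?Y l * kap \<kappa> (?Vd l)) + cmod (\<Sum>l<n. ?Yd l * kap \<kappa> (?Vd l))"
  by (simp only:) (intro order_trans[OF norm_triangle_ineq4] add_mono norm_triangle_ineq order_refl)
 also have "... <= T^2 / sqrt (real n) * (contr n C p m (\<lambda>l. kap \<kappa> (?V l)) x i * env n C p m x j b)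
   + T^2 / sqrt (real n) * (contr n C' p' m' (\<lambda>l. kap \<kappa> (?Y l)) x i * env n C' p' m' x j b')
   + T^10 / real n * env n C p m x j b"
 proof (intro add_mono)
  show "cmod (\<Sum>l<n. ?Yd l * kap \<kappa> (?V l))
    <= T^2 / sqrt (real n) * (contr n C p m (\<lambda>l. kap \<kappa> (?V l)) x i * env n C p m x j b)"
   by (rule sum_wd_diff_mult_le[OF c(1,2) m(1) ij b(1)])
  have "(\<Sum>l<n. ?Y l * kap \<kappa> (?Vd l)) = kap \<kappa> (\<Sum>l<n. ?Vd l * kap \<kappa> (?Y l))"
   by (simp only: kap_sum kap_mult kap_simps mult.commute)
  then have "cmod (\<Sum>l<n. ?Y l * kap \<kappa> (?Vd l)) = cmod (\<Sum>l<n. ?Vd l * kap \<kappa> (?Y l))" by (simp only: kap_simps)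
  also have "... <= T^2 / sqrt (real n) * (contr n C' p' m' (\<lambda>l. kap \<kappa> (?Y l)) x i * env n C' p' m' x j b')"
   by (rule sum_wd_diff_mult_le[OF c(1,3) m(2) ij b(2)])
  finally show "cmod (\<Sum>l<n. ?Y l * kap \<kappa> (?Vd l))
    <= T^2 / sqrt (real n) * (contr n C' p' m' (\<lambda>l. kap \<kappa> (?Y l)) x i * env n C' p' m' x j b')" .
  let ?E = "env n C p m x j b" and ?E' = "env n C' p' m' x j b'"
  have "cmod (\<Sum>l<n. ?Yd l * kap \<kappa> (?Vd l))
    <= (\<Sum>l<n. (T^2 / sqrt (real n) * (pre n C p m x l i * ?E)) * (T^2 / sqrt (real n) * (pre n C' p' m' x l i * ?E')))"
   by (intro order_trans[OF norm_sum] sum_mono, unfold norm_mult kap_simps)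
     (intro mult_mono wd_diff_le[OF c(1,2)] wd_diff_le[OF c(1,3)] m ij b, auto)
  also have "... = T^4 / real n * (?E * ?E') * (\<Sum>l<n. pre n C p m x l i * pre n C' p' m' x l i)"
   using n0 unfolding sum_distrib_left by (intro sum.cong refl) (simp add: power2_eq_square power4_eq_xxxx mult_ac flip: real_sqrt_mult)
  also have "... <= T^4 / real n * (?E * T^2) * (T^2 * T^2)"
   using T by (intro mult_mono sum_mult_le_L2_set pre_col_L2[OF c(1,2)] pre_col_L2[OF c(1,3)]
     env_le[OF c(1,3)] m ij b mult_left_mono sum_nonneg mult_nonneg_nonneg) auto
  also have "... = T^10 / real n * ?E" by (simp flip: power_add)
  finally show "cmod (\<Sum>l<n. ?Yd l * kap \<kappa> (?Vd l)) <= T^10 / real n * ?E" .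
 qed
 finally show ?thesis .
qed

lemma sum_square_product': "(\<Sum>(i, j)\<in>{..<n} \<times> {..<n}. (c * g j)^2) = real n * c^2 * (\<Sum>j<n. (g j)^2)" for g :: "nat => real"
 using sum_square_product[of c "\<lambda>_. 1" g n] by (simp add: mult_ac)

lemma gram_diff_square_sum_le:
 assumes c: "controlled n K M x T" "\<And>q. form_bound n (C q) K" "\<And>q. form_bound n (C' q) K"
  and m: "m <= M" "m' <= M" and b: "b < n" "b' < n"
 shows "(\<Sum>e\<in>{..<n} \<times> {..<n}. (cmod (gram n \<kappa> C p m b C' p' m' b' x - gram n \<kappa> C p m b C' p' m' b' (x(e := 0))))^2)
   <= 9 * T^24 / real n"
proof -
 let ?s = "sqrt (real n)"
 let ?Y = "\<lambda>l. kap \<kappa> (wd n C p m x l b)" and ?V = "\<lambda>l. kap \<kappa> (wd n C' p' m' x l b')"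
 let ?A = "\<lambda>i j. T^2 / ?s * (contr n C p m ?V x i * env n C p m x j b)"
 let ?B = "\<lambda>i j. T^2 / ?s * (contr n C' p' m' ?Y x i * env n C' p' m' x j b')"
 let ?D = "\<lambda>j. T^10 / real n * env n C p m x j b"
 have T: "1 <= T" using controlled_ge(1)[OF c(1)] by auto
 have n0: "0 < real n" using b by simp
 have sq: "(u + v + w)^2 <= 3 * u^2 + 3 * v^2 + 3 * w^2" for u v w :: real
  using sum_squares_ge_zero[of "u - v" "u - w"] zero_le_power2[of "v - w"] by (simp add: power2_eq_square algebra_simps)
 have "(\<Sum>e\<in>{..<n} \<times> {..<n}. (cmod (gram n \<kappa> C p m b C' p' m' b' x - gram n \<kappa> C p m b C' p' m' b' (x(e := 0))))^2)
   = (\<Sum>(i, j)\<in>{..<n} \<times> {..<n}. (cmod (gram n \<kappa> C p m b C' p' m' b' x - gram n \<kappa> C p m b C' p' m' b' (x((i, j) := 0))))^2)"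
  by (simp only: case_prod_unfold prod.collapse)
 also have "... <= (\<Sum>(i, j)\<in>{..<n} \<times> {..<n}. 3 * (?A i j)^2 + 3 * (?B i j)^2 + 3 * (?D j)^2)"
  by (intro sum_pair_mono order_trans[OF power_mono[OF gram_diff_le[OF c m _ _ b]] sq]) auto
 also have "... = 3 * (\<Sum>(i, j)\<in>{..<n} \<times> {..<n}. (?A i j)^2) + 3 * (\<Sum>(i, j)\<in>{..<n} \<times> {..<n}. (?B i j)^2)
   + 3 * (\<Sum>(i, j)\<in>{..<n} \<times> {..<n}. (?D j)^2)" by (simp only: case_prod_unfold sum.distrib sum_distrib_left)
 also have "(\<Sum>(i, j)\<in>{..<n} \<times> {..<n}. (?A i j)^2) <= T^24 / real n"
 proof -
  have "l2norm n ?V <= T"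
   unfolding l2norm_kap by (rule form_bound_col[OF controlled_form_bound[OF c(1,3) m(2)] b(2)])
  then have "(T^2 / ?s)^2 * ((\<Sum>i<n. (contr n C p m ?V x i)^2) * (\<Sum>j<n. (env n C p m x j b)^2))
    <= (T^2 / ?s)^2 * ((T^3)^2 * (T^2)^2)"
   by (intro mult_left_mono mult_mono sum_squares_le_L2_set contr_L2[OF c(1,2) m(1)] env_L2[OF c(1,2) m(1)] b sum_nonneg) auto
  also have "... = T^14 / real n" using n0 by (simp add: power_divide flip: power_mult power_add)
  also have "... <= T^24 / real n" using T by (intro divide_right_mono power_increasing) auto
  finally show ?thesis by (simp only: sum_square_product)
 qed
 also have "(\<Sum>(i, j)\<in>{..<n} \<times> {..<n}. (?B i j)^2) <= T^24 / real n"
 proof -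
  have "l2norm n ?Y <= T"
   unfolding l2norm_kap by (rule form_bound_col[OF controlled_form_bound[OF c(1,2) m(1)] b(1)])
  then have "(T^2 / ?s)^2 * ((\<Sum>i<n. (contr n C' p' m' ?Y x i)^2) * (\<Sum>j<n. (env n C' p' m' x j b')^2))
    <= (T^2 / ?s)^2 * ((T^3)^2 * (T^2)^2)"
   by (intro mult_left_mono mult_mono sum_squares_le_L2_set contr_L2[OF c(1,3) m(2)] env_L2[OF c(1,3) m(2)] b sum_nonneg) auto
  also have "... = T^14 / real n" using n0 by (simp add: power_divide flip: power_mult power_add)
  also have "... <= T^24 / real n" using T by (intro divide_right_mono power_increasing) auto
  finally show ?thesis by (simp only: sum_square_product)
 qed
 \<comment> \<open>Independent of \<open>i\<close>, this term is counted \<open>n\<close> times,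
   which its squared prefactor \<open>1 / n^2\<close> affords.\<close>
 also have "(\<Sum>(i, j)\<in>{..<n} \<times> {..<n}. (?D j)^2) <= T^24 / real n"
 proof -
  have "real n * (T^10 / real n)^2 * (\<Sum>j<n. (env n C p m x j b)^2) <= real n * (T^10 / real n)^2 * (T^2)^2"
   by (intro mult_left_mono sum_squares_le_L2_set env_L2[OF c(1,2) m(1)] b) auto
  also have "... = T^24 / real n"
  proof -
   have "real n * (T^10 / real n)^2 * (T^2)^2 = real n * (T^20 * T^4 / (real n * real n))"
    by (simp add: power_divide power2_eq_square[of "real n"] flip: power_mult)
   also have "... = T^20 * T^4 / real n" using n0 by simp
   finally show ?thesis by (simp flip: power_add)
  qed
  finally show ?thesis by (simp only: sum_square_product')
 qed
 finally show ?thesis by simp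
qed

section \<open>One step of the recursion for inner products of words\<close>

context iid_entries
begin

text \<open>The expectation of \<open>z * kap \<kappa> z\<close> for a single entry
  \<open>z\<close>.\<close>

definition cf :: "bool => complex" where "cf \<kappa> = (if \<kappa> then 1 else cor \<rho>)"

lemma cf_le1: "cmod (cf \<kappa>) <= 1"
 using rho by (simp add: cf_def)

lemma integration_by_parts_kap:
 fixes F H :: "('e => complex) => complex" and q1 q2 T :: "('e => complex) => real"
 assumes S: "finite S" "e \<in> S"
  and p: "polybdd S F" "polybdd S H" "polybdd S q1" "polybdd S q2" "polybdd S T"
  and q1: "\<And>x. cmod (F x - F (x(e := 0)) - kap \<kappa> (x e) * H x) <= q1 x"
  and q2: "\<And>x. cmod (H x - H (x(e := 0))) <= q2 x"
  and T: "\<And>x. cmod (x e) <= T x" "\<And>x. 1 <= T x"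
 shows "cmod ((\<integral>x. x e * F x \<partial>Pr S) - cf \<kappa> * (\<integral>x. H x \<partial>Pr S))
  <= (\<integral>x. T x * q1 x + 4 * (T x)^2 * q2 x \<partial>Pr S)"
proof -
 have q20: "0 <= q2 x" for x using q2[of x] norm_ge_zero order_trans by blast
 show ?thesis
 proof (cases \<kappa>)
  case True
  have "cmod ((\<integral>x. x e * F x \<partial>Pr S) - \<rho> * (\<integral>x. (0::complex) \<partial>Pr S) - (\<integral>x. H x \<partial>Pr S))
   <= (\<integral>x. T x * q1 x + 4 * (T x)^2 * q2 x \<partial>Pr S)" by (rule integration_by_parts[OF S p(1) polybdd_const p(2-5) _ _ q2 T])
     (use q1 q20 True in \<open>simp_all add: kap_def\<close>)
  then show ?thesis using True by (simp add: cf_def)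
 next
  case False
  have "cmod ((\<integral>x. x e * F x \<partial>Pr S) - \<rho> * (\<integral>x. H x \<partial>Pr S) - (\<integral>x. (0::complex) \<partial>Pr S))
   <= (\<integral>x. T x * q1 x + 4 * (T x)^2 * q2 x \<partial>Pr S)" by (rule integration_by_parts[OF S p(1,2) polybdd_const p(3-5) _ q2 _ T])
     (use q1 q20 False in \<open>simp_all add: kap_def\<close>)
  then show ?thesis using False by (simp add: cf_def)
 qed
qed

end

text \<open>The given letters are bounded by \<open>K0\<close>, the words to which estimates apply
  have letters bounded by \<open>K\<close>. The gap leaves room for a letter that has absorbed
  another one in a contraction.\<close>

locale gram_entries = controlled_entries +
 fixes K0 :: real
 assumes K0: "1 <= K0" "K0 * K0 <= K"
begin

lemma K0_le_K: "K0 <= K"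
 using K0 mult_left_mono[of 1 K0 K0] by linarith

lemma K_ge1: "1 <= K" using K0_le_K K0 by linarith

lemma form_bound_contracted:
 assumes "form_bound n A K0" "\<And>q. form_bound n (C q) K0"
 shows "form_bound n ((C(p := mmul n (\<lambda>a l. kap \<kappa> (A l a)) (C p))) q) K"
proof (cases "q = p")
 case True
 have "form_bound n (\<lambda>a l. A l a) K0" by (rule form_bound_transpose[OF assms(1)])
 then have "form_bound n (mmul n (\<lambda>a l. kap \<kappa> (A l a)) (C p)) (K0 * K0)" by (intro form_bound_mmul assms form_bound_kap)
 then show ?thesis using True K0(2) by (simp add: form_bound_mono)
next
 case False
 then show ?thesis using form_bound_mono[OF assms(2) K0_le_K] by simp
qed

lemma contracted_moment2:
 assumes "form_bound n A K0" "\<And>q. form_bound n (C q) K0" "0 < m" "m <= M" "i < n" "k < n"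
 shows "(\<integral>x. (cmod (\<Sum>l<n. A l i * kap \<kappa> (wd n C p m x l k)))^2 \<partial>Pr Ix) <= 2 * ET 16 / real n"
 unfolding contract_left kap_simps by (rule wd_moment2[OF form_bound_contracted[OF assms(1,2)] assms(3-6)])

context
 fixes C C' :: "nat => cmat" and b b' :: nat
 assumes C: "\<And>q. form_bound n (C q) K0" and C': "\<And>q. form_bound n (C' q) K0"
  and b: "b < n" and b': "b' < n"
begin

lemma CK: "form_bound n (C q) K" by (rule form_bound_mono[OF C K0_le_K])
lemma CK': "form_bound n (C' q) K" by (rule form_bound_mono[OF C' K0_le_K])

lemma gram_expand:
 "gram n \<kappa> C p (Suc m) b C' p' m' b' x
  = (\<Sum>(i, j)\<in>Ix. 1 / cor (sqrt (real n)) * (x (i, j) *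
    ((\<Sum>l<n. C p l i * kap \<kappa> (wd n C' p' m' x l b')) * wd n C (Suc p) m x j b)))"
proof -
 let ?s = "cor (sqrt (real n))"
 have "gram n \<kappa> C p (Suc m) b C' p' m' b' x
   = (\<Sum>l<n. \<Sum>(i, j)\<in>Ix. C p l i / ?s * (x (i, j) * wd n C (Suc p) m x j b) * kap \<kappa> (wd n C' p' m' x l b'))"
  unfolding gram_def wd_Suc_expand[OF CK] by (simp add: sum_distrib_right case_prod_unfold)
 also have "... = (\<Sum>(i, j)\<in>Ix. \<Sum>l<n. C p l i / ?s * (x (i, j) * wd n C (Suc p) m x j b) * kap \<kappa> (wd n C' p' m' x l b'))"
  unfolding case_prod_unfold by (rule sum.swap)
 also have "... = (\<Sum>(i, j)\<in>Ix. 1 / ?s * (x (i, j) *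
    ((\<Sum>l<n. C p l i * kap \<kappa> (wd n C' p' m' x l b')) * wd n C (Suc p) m x j b)))"
  by (rule sum_pair_cong) (simp add: sum_distrib_left sum_distrib_right mult_ac)
 finally show ?thesis .
qed

definition tau :: "bool => nat => nat => complex" where
 "tau \<kappa> p p' = (\<Sum>i<n. \<Sum>l<n. C p l i * kap \<kappa> (C' p' l i)) / real n"

lemma tau_le: "cmod (tau \<kappa> p p') <= K"
proof -
 have "cmod (\<Sum>i<n. \<Sum>l<n. C p l i * kap \<kappa> (C' p' l i)) <= (\<Sum>i<n. K)"
 proof (rule order_trans[OF norm_sum], rule sum_mono)
  fix i assume i: "i \<in> {..<n}"
  have "cmod (\<Sum>l<n. C p l i * kap \<kappa> (C' p' l i)) <= l2norm n (\<lambda>l. C p l i) * l2norm n (\<lambda>l. kap \<kappa> (C' p' l i))"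
   by (rule cmod_sum_mult_le_l2norm)
  also have "... <= K0 * K0"
   unfolding l2norm_kap using i K0 by (intro mult_mono form_bound_col C C') auto
  finally show "cmod (\<Sum>l<n. C p l i * kap \<kappa> (C' p' l i)) <= K" using K0 by linarith
 qed
 then show ?thesis using n by (simp add: tau_def norm_divide divide_le_eq mult.commute)
qed

text \<open>Integration by parts in the first factor of the first word, whose entry looks for a
  partner among the other factors. The first factor of the second word yields
  \<open>cf \<kappa> * tau \<kappa> p p'\<close> times the inner product of the shortened words; all
  other partners together are of order \<open>1 / sqrt n\<close>. Without a factor in the second
  word no leading term arises.\<close>

lemma gram_mean_step:
 assumes m: "Suc m <= M" "m' <= M"
 shows "cmod ((\<integral>x. gram n \<kappa> C p (Suc m) b C' p' m' b' x \<partial>Pr Ix)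
   - (if m' = 0 then 0 else cf \<kappa> * tau \<kappa> p p' * (\<integral>x. gram n \<kappa> C (Suc p) m b C' (Suc p') (m' - 1) b' x \<partial>Pr Ix)))
  <= (11 + 2 * real M) * ET 16 / sqrt (real n)"
proof -
 define s where "s = sqrt (real n)"
 have s: "0 < s" "s * s = real n" using n by (auto simp: s_def)
 have mM: "m <= M" using m by simp
 define w where "w = (\<lambda>j x. wd n C (Suc p) m x j b)"
 define qf where "qf = (\<lambda>i x. \<Sum>l<n. C p l i * kap \<kappa> (wd n C' p' m' x l b'))"
 define wp where "wp = (\<lambda>j x. if m' = 0 then 0 else kap \<kappa> (wd n C' (Suc p') (m' - 1) x j b'))"
 \<comment> \<open>\<open>Q r\<close> contracts the first letter with the prefix of length
   \<open>r\<close> of the second word. For \<open>r = 0\<close> it is deterministic and its sum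
   over \<open>i\<close> is \<open>n\<close> times \<open>tau\<close>; for \<open>r >= 1\<close> it
   is an entry of a genuine word and small in mean square.\<close>
 define Q where "Q = (\<lambda>r i x. \<Sum>l<n. C p l i * kap \<kappa> (wd n C' p' r x l i))"
 define H where "H = (\<lambda>i j x. 1 / cor s * (Q 0 i x * wp j x * w j x))"
 define E where "E = (\<lambda>j x. env n C (Suc p) m x j b)"
 define E' where "E' = (\<lambda>j x. env n C' p' m' x j b')"
 define P where "P = (\<lambda>j i x. pre n C (Suc p) m x j i)"
 define R where "R = (\<lambda>i x. \<Sum>r\<in>{1..<m'}. cmod (Q r i x))"
 define q1 where "q1 = (\<lambda>i j x. 2 * T x^9 / real n * (E j x * E' j x) + T x^2 / s * (E j x * E' j x) * R i x
   + T x^2 / s * (cmod (qf i x) * P j i x * E j x))"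
 define q2 where "q2 = (\<lambda>(i::nat) j x. 2 * T x^7 / real n * (E j x * E' j x))"
 have pw: "polybdd Ix (w j)" for j unfolding w_def by (rule polybdd_wd)
 have pqf: "polybdd Ix (qf i)" for i unfolding qf_def by (intro polybdd_intros polybdd_kap polybdd_wd)
 have pwp: "polybdd Ix (wp j)" for j
  unfolding wp_def by (cases "m' = 0") (auto intro: polybdd_const polybdd_kap polybdd_wd)
 have pQ: "polybdd Ix (Q r i)" for r i unfolding Q_def by (intro polybdd_intros polybdd_kap polybdd_wd)
 have pH: "polybdd Ix (H i j)" for i j unfolding H_def by (intro polybdd_intros pQ pwp pw)
 have pE: "polybdd Ix (E j)" "polybdd Ix (E' j)" for j unfolding E_def E'_def by (intro polybdd_env)+
 have pP: "polybdd Ix (P j i)" for i j unfolding P_def by (intro polybdd_pre)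
 have pR: "polybdd Ix (R i)" for i unfolding R_def by (intro polybdd_intros pQ)
 have pq1: "polybdd Ix (q1 i j)" for i j unfolding q1_def by (intro polybdd_intros pE pP pR pqf pT)
 have pq2: "polybdd Ix (q2 i j)" for i j unfolding q2_def by (intro polybdd_intros pE pT)
 have E0: "0 <= E j x" "0 <= E' j x" "0 <= P j i x" "0 <= R i x" for i j x by (auto simp: E_def E'_def P_def R_def sum_nonneg)
 have wE: "cmod (w j x) <= E j x" for j x unfolding w_def E_def by (rule wd_le_env)
 have QT: "cmod (Q r i x) <= T x^2" if "i < n" "r <= M" for r i x
 proof -
  have "cmod (Q r i x) <= l2norm n (\<lambda>l. C p l i) * l2norm n (\<lambda>l. kap \<kappa> (wd n C' p' r x l i))"
   unfolding Q_def by (rule cmod_sum_mult_le_l2norm)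
  also have "... <= T x * T x"
   unfolding l2norm_kap using that by (intro mult_mono form_bound_col[OF form_bound_mono[OF CK controlled_ge(3)[OF ctrl]]]
     form_bound_col[OF controlled_form_bound[OF ctrl CK']]) auto
  finally show ?thesis by (simp add: power2_eq_square)
 qed
 have wd_up: "cmod (w j x - w j (x((i, j) := 0))) <= T x^2 / s * (P j i x * E j x)" if "i < n" "j < n" for i j x
  unfolding w_def P_def E_def s_def by (rule wd_diff_le[OF ctrl CK mM that b])
 have P_le: "P j i x <= T x^2" if "i < n" "j < n" for i j x
  unfolding P_def by (rule pre_le[OF ctrl CK mM]) (use that in auto)
 have wd_up': "cmod (w j x - w j (x((i, j) := 0))) <= T x^4 / s * E j x" if "i < n" "j < n" for i j x
 proof -
  have "cmod (w j x - w j (x((i, j) := 0))) <= T x^2 / s * (P j i x * E j x)" by (rule wd_up[OF that])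
  also have "... <= T x^2 / s * (T x^2 * E j x)"
   using s by (intro mult_left_mono mult_right_mono P_le that E0) auto
  also have "... = T x^4 / s * E j x" by (simp flip: power_add)
  finally show ?thesis .
 qed
 have wpE: "cmod (wp j x) <= E' j x" for j x
 proof (cases "m' = 0")
  case False
  then have "cmod (wp j x) <= env n C' (Suc (p' + 0)) (m' - Suc 0) x j b'" by (simp add: wp_def wd_le_env)
  also have "... <= E' j x" unfolding E'_def by (rule env_suffix_le) (use False in simp)
  finally show ?thesis .
 qed (use E0 in \<open>simp add: wp_def\<close>)
 have wp_upE: "cmod (wp j (x((i, j) := 0))) <= T x * E' j x" if "i < n" "j < n" for i j x
 proof (cases "m' = 0")
  case False
  then have "cmod (wp j (x((i, j) := 0))) = cmod (wd n C' (Suc (p' + 0)) (m' - Suc 0) (x((i, j) := 0)) j b')"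
   by (simp only: wp_def if_False kap_simps add_0_right One_nat_def)
  also have "... <= T x * env n C' (Suc (p' + 0)) (m' - Suc 0) x j b'" by (rule controlled_env[OF ctrl CK']) (use m that b' in auto)
  also have "... <= T x * E' j x" unfolding E'_def by (intro mult_left_mono env_suffix_le) (use False in auto)
  finally show ?thesis .
 qed (use E0 in \<open>simp add: wp_def\<close>)
 have wp_up: "cmod (wp j x - wp j (x((i, j) := 0))) <= T x^4 / s * E' j x" if "i < n" "j < n" for i j x
 proof (cases "m' = 0")
  case False
  let ?e = "env n C' (Suc (p' + 0)) (m' - Suc 0) x j b'" and ?pp = "pre n C' (Suc (p' + 0)) (m' - Suc 0) x j i"
  have "cmod (wp j x - wp j (x((i, j) := 0)))
    = cmod (wd n C' (Suc (p' + 0)) (m' - Suc 0) x j b' - wd n C' (Suc (p' + 0)) (m' - Suc 0) (x((i, j) := 0)) j b')"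
   using False by (simp only: wp_def if_False kap_diff[symmetric] kap_simps add_0_right One_nat_def)
  also have "... <= T x^2 / s * (?pp * ?e)"
   unfolding s_def by (rule wd_diff_le[OF ctrl CK']) (use m that b' in auto)
  also have "... <= T x^2 / s * (T x^2 * E' j x)"
   unfolding E'_def using s m False by (intro mult_left_mono mult_mono pre_le[OF ctrl CK'] env_suffix_le that) auto
  also have "... = T x^4 / s * E' j x" by (simp flip: power_add)
  finally show ?thesis .
 qed (use E0 s in \<open>simp add: wp_def\<close>)
 have qf_diff: "qf i x - qf i (x((i, j) := 0))
   = (\<Sum>r<m'. Q r i x * (kap \<kappa> (x (i, j)) / cor s) * kap \<kappa> (wd n C' (Suc (p' + r)) (m' - Suc r) (x((i, j) := 0)) j b'))"
  if "i < n" "j < n" for i j x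
 proof -
  have rearr: "a * (d * e * f) = a * d * e * f" for a d e f :: complex by (simp add: mult_ac)
  have "qf i x - qf i (x((i, j) := 0))
    = (\<Sum>l<n. C p l i * kap \<kappa> (wd n C' p' m' x l b' - wd n C' p' m' (x((i, j) := 0)) l b'))"
   unfolding qf_def by (simp only: sum_subtractf[symmetric] right_diff_distrib[symmetric] kap_diff)
  also have "... = (\<Sum>l<n. \<Sum>r<m'. C p l i * kap \<kappa> (wd n C' p' r x l i) * (kap \<kappa> (x (i, j)) / cor s)
     * kap \<kappa> (wd n C' (Suc (p' + r)) (m' - Suc r) (x((i, j) := 0)) j b'))"
   unfolding wd_perturb[OF that] kap_sum kap_mult kap_divide_real s_def sum_distrib_left rearr ..
  also have "... = (\<Sum>r<m'. \<Sum>l<n. C p l i * kap \<kappa> (wd n C' p' r x l i) * (kap \<kappa> (x (i, j)) / cor s)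
     * kap \<kappa> (wd n C' (Suc (p' + r)) (m' - Suc r) (x((i, j) := 0)) j b'))" by (rule sum.swap)
  finally show ?thesis unfolding Q_def sum_distrib_right .
 qed
 have hb: "cmod (kap \<kappa> (x (i, j)) / cor s) <= T x / s" if "i < n" "j < n" for i j x
  using controlled_coord[OF ctrl[of x] that] s by (simp add: norm_divide divide_right_mono)
 have wr: "cmod (kap \<kappa> (wd n C' (Suc (p' + r)) (m' - Suc r) (x((i, j) := 0)) j b')) <= T x * E' j x"
  if "i < n" "j < n" "r < m'" for i j r x
 proof -
  have "cmod (wd n C' (Suc (p' + r)) (m' - Suc r) (x((i, j) := 0)) j b')
    <= T x * env n C' (Suc (p' + r)) (m' - Suc r) x j b'" by (rule controlled_env[OF ctrl CK']) (use m that b' in auto)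
  also have "... <= T x * E' j x" unfolding E'_def by (intro mult_left_mono env_suffix_le that) auto
  finally show ?thesis by simp
 qed
 have qf_up: "cmod (qf i x - qf i (x((i, j) := 0))) <= T x^5 / s * E' j x" if ij: "i < n" "j < n" for i j x
 proof -
  have "cmod (qf i x - qf i (x((i, j) := 0))) <= (\<Sum>r<m'. T x^2 * (T x / s) * (T x * E' j x))"
   unfolding qf_diff[OF ij]
  proof (intro order_trans[OF norm_sum] sum_mono)
   fix r assume r: "r \<in> {..<m'}"
   show "cmod (Q r i x * (kap \<kappa> (x (i, j)) / cor s) * kap \<kappa> (wd n C' (Suc (p' + r)) (m' - Suc r) (x((i, j) := 0)) j b'))
     <= T x^2 * (T x / s) * (T x * E' j x)"
    unfolding norm_mult[of "_ * _"] norm_mult[of "Q r i x"] using r m s E0 by (intro mult_mono QT hb wr ij) auto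
  qed
  also have "... = real m' * (T x^4 / s * E' j x)" by (simp add: mult_ac flip: power_add power_Suc)
  also have "... <= T x * (T x^4 / s * E' j x)"
   using controlled_ge(2)[OF ctrl[of x]] m s E0 by (intro mult_right_mono) auto
  also have "... = T x^5 / s * E' j x" by (simp add: eval_nat_numeral)
  finally show ?thesis .
 qed
 \<comment> \<open>Partners in the second word. Only the summand \<open>r = 0\<close> enters
   \<open>H\<close>, with its suffix moved to \<open>x\<close> at a cost of order
   \<open>1 / n\<close>; the summands with \<open>r >= 1\<close> are collected in
   \<open>R\<close>.\<close>
 have main: "cmod ((qf i x - qf i (x((i, j) := 0))) * w j x - kap \<kappa> (x (i, j)) * H i j x)
   <= T x^7 / real n * (E j x * E' j x) + T x^2 / s * (E j x * E' j x) * R i x" if ij: "i < n" "j < n" for i j x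
 proof (cases "m' = 0")
  case True
  then show ?thesis unfolding qf_diff[OF ij] using s E0 by (simp add: H_def wp_def)
 next
  case False
  let ?k = "kap \<kappa> (x (i, j)) / cor s"
  let ?W = "\<lambda>r. kap \<kappa> (wd n C' (Suc (p' + r)) (m' - Suc r) (x((i, j) := 0)) j b')"
  have sp: "{..<m'} = insert 0 {1..<m'}" using False by auto
  have W0: "?W 0 = wp j (x((i, j) := 0))" using False by (simp only: wp_def if_False add_0_right One_nat_def)
  have split0: "qf i x - qf i (x((i, j) := 0)) = Q 0 i x * ?k * wp j (x((i, j) := 0)) + (\<Sum>r\<in>{1..<m'}. Q r i x * ?k * ?W r)"
   unfolding qf_diff[OF ij] sp W0[symmetric] by (subst sum.insert) auto
  have "(qf i x - qf i (x((i, j) := 0))) * w j x - kap \<kappa> (x (i, j)) * H i j x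
    = - (Q 0 i x * ?k * (wp j x - wp j (x((i, j) := 0))) * w j x) + (\<Sum>r\<in>{1..<m'}. Q r i x * ?k * ?W r) * w j x"
  proof -
   have alg: "(q0 * (k / z) * v + S) * u - k * (1 / z * (q0 * v' * u)) = - (q0 * (k / z) * (v' - v) * u) + S * u"
    for q0 k z v v' S u :: complex by (simp add: algebra_simps diff_divide_distrib)
   show ?thesis unfolding split0 H_def by (rule alg)
  qed
  then have "cmod ((qf i x - qf i (x((i, j) := 0))) * w j x - kap \<kappa> (x (i, j)) * H i j x)
    <= cmod (Q 0 i x * ?k * (wp j x - wp j (x((i, j) := 0))) * w j x) + cmod ((\<Sum>r\<in>{1..<m'}. Q r i x * ?k * ?W r) * w j x)"
   using norm_triangle_ineq[of "- (Q 0 i x * ?k * (wp j x - wp j (x((i, j) := 0))) * w j x)"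
     "(\<Sum>r\<in>{1..<m'}. Q r i x * ?k * ?W r) * w j x"] by (simp only: norm_minus_cancel)
  also have "... <= T x^2 * (T x / s) * (T x^4 / s * E' j x) * E j x
     + (\<Sum>r\<in>{1..<m'}. cmod (Q r i x) * (T x / s) * (T x * E' j x)) * E j x"
  proof (rule add_mono)
   show "cmod (Q 0 i x * ?k * (wp j x - wp j (x((i, j) := 0))) * w j x) <= T x^2 * (T x / s) * (T x^4 / s * E' j x) * E j x"
    unfolding norm_mult[of "_ * _ * _"] norm_mult[of "Q 0 i x * _"] norm_mult[of "Q 0 i x"]
    using s E0 by (intro mult_mono QT hb wp_up wE ij) auto
   have "cmod (\<Sum>r\<in>{1..<m'}. Q r i x * ?k * ?W r) <= (\<Sum>r\<in>{1..<m'}. cmod (Q r i x) * (T x / s) * (T x * E' j x))"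
   proof (intro order_trans[OF norm_sum] sum_mono)
    fix r assume r: "r \<in> {1..<m'}"
    show "cmod (Q r i x * ?k * ?W r) <= cmod (Q r i x) * (T x / s) * (T x * E' j x)"
     unfolding norm_mult[of "_ * _"] norm_mult[of "Q r i x"]
     using r s E0 by (intro mult_mono order_refl hb wr ij) auto
   qed
   then show "cmod ((\<Sum>r\<in>{1..<m'}. Q r i x * ?k * ?W r) * w j x)
     <= (\<Sum>r\<in>{1..<m'}. cmod (Q r i x) * (T x / s) * (T x * E' j x)) * E j x"
    unfolding norm_mult[of _ "w j x"] using s E0 by (intro mult_mono wE) (auto intro!: sum_nonneg)
  qed
  also have "T x^2 * (T x / s) * (T x^4 / s * E' j x) * E j x = T x^7 / real n * (E j x * E' j x)"
   unfolding s(2)[symmetric] by (simp add: eval_nat_numeral mult_ac)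
  also have "(\<Sum>r\<in>{1..<m'}. cmod (Q r i x) * (T x / s) * (T x * E' j x)) * E j x
    = T x^2 / s * (E j x * E' j x) * R i x"
   unfolding R_def sum_distrib_left sum_distrib_right by (intro sum.cong refl) (simp add: power2_eq_square mult_ac)
  finally show ?thesis .
 qed
 \<comment> \<open>Partners in the rest of the first word. The prefix profile \<open>P\<close> and
   the vector \<open>qf\<close> meet in a sum over \<open>i\<close>, to be bounded by Cauchy-Schwarz
   without loss.\<close>
 have second: "cmod (qf i (x((i, j) := 0)) * (w j x - w j (x((i, j) := 0))))
   <= T x^2 / s * (cmod (qf i x) * P j i x * E j x) + T x^9 / real n * (E j x * E' j x)" if ij: "i < n" "j < n" for i j x
 proof -
  let ?d = "w j x - w j (x((i, j) := 0))" and ?g = "qf i x - qf i (x((i, j) := 0))"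
  have "qf i (x((i, j) := 0)) * ?d = qf i x * ?d - ?g * ?d" by (simp only: left_diff_distrib) simp
  then have "cmod (qf i (x((i, j) := 0)) * ?d) <= cmod (qf i x) * cmod ?d + cmod ?g * cmod ?d"
   by (simp only:) (intro order_trans[OF norm_triangle_ineq4], simp only: norm_mult)
  also have "... <= cmod (qf i x) * (T x^2 / s * (P j i x * E j x)) + (T x^5 / s * E' j x) * (T x^4 / s * E j x)"
   using s E0 by (intro add_mono mult_mono wd_up wd_up' qf_up ij order_refl) auto
  also have "(T x^5 / s * E' j x) * (T x^4 / s * E j x) = T x^9 / real n * (E j x * E' j x)"
   unfolding s(2)[symmetric] by (simp add: mult_ac flip: power_add)
  finally show ?thesis by (simp only: mult_ac times_divide_eq_left times_divide_eq_right)
 qed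
 have Hdiff: "cmod (H i j x - H i j (x((i, j) := 0))) <= q2 i j x" if ij: "i < n" "j < n" for i j x
 proof -
  have Q0: "Q 0 i (x((i, j) := 0)) = Q 0 i x" by (simp add: Q_def)
  have "H i j x - H i j (x((i, j) := 0)) = 1 / cor s * (Q 0 i x *
    ((wp j x - wp j (x((i, j) := 0))) * w j x + wp j (x((i, j) := 0)) * (w j x - w j (x((i, j) := 0)))))"
  proof -
   have alg: "1 / z * (q0 * v * u) - 1 / z * (q0 * v' * u') = 1 / z * (q0 * ((v - v') * u + v' * (u - u')))"
    for z q0 v v' u u' :: complex by (simp add: algebra_simps diff_divide_distrib)
   show ?thesis unfolding H_def Q0 by (rule alg)
  qed
  then have "cmod (H i j x - H i j (x((i, j) := 0))) = 1 / s * (cmod (Q 0 i x) *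
    cmod ((wp j x - wp j (x((i, j) := 0))) * w j x + wp j (x((i, j) := 0)) * (w j x - w j (x((i, j) := 0)))))"
   using s by (simp only: norm_mult norm_divide norm_one norm_of_real abs_of_pos)
  also have "... <= 1 / s * (T x^2 * ((T x^4 / s * E' j x) * E j x + (T x * E' j x) * (T x^4 / s * E j x)))"
  proof -
   have "cmod ((wp j x - wp j (x((i, j) := 0))) * w j x + wp j (x((i, j) := 0)) * (w j x - w j (x((i, j) := 0))))
    <= (T x^4 / s * E' j x) * E j x + (T x * E' j x) * (T x^4 / s * E j x)"
    apply (intro order_trans[OF norm_triangle_ineq] add_mono)
    unfolding norm_mult
     apply (intro mult_mono wp_up wE ij)
      apply (use s E0 in auto)[2]
    apply (intro mult_mono wp_upE wd_up' ij)
     apply (use s E0 in auto)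
    done
   then show ?thesis using s by (intro mult_mono QT ij order_refl) auto
  qed
  also have "... = (T x^6 + T x^7) / real n * (E j x * E' j x)"
   unfolding s(2)[symmetric] using s(1) by (simp add: field_simps eval_nat_numeral)
  also have "... <= q2 i j x"
   unfolding q2_def
  proof (intro mult_right_mono divide_right_mono)
   show "T x^6 + T x^7 <= 2 * T x^7" using power_increasing[of 6 7 "T x"] T1[of x] by simp
  qed (use E0 in auto)
  finally show ?thesis .
 qed
 have Fdiff: "cmod (qf i x * w j x - qf i (x((i, j) := 0)) * w j (x((i, j) := 0)) - kap \<kappa> (x (i, j)) * H i j x) <= q1 i j x"
  if ij: "i < n" "j < n" for i j x
 proof -
  have "qf i x * w j x - qf i (x((i, j) := 0)) * w j (x((i, j) := 0)) - kap \<kappa> (x (i, j)) * H i j x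
   = ((qf i x - qf i (x((i, j) := 0))) * w j x - kap \<kappa> (x (i, j)) * H i j x)
    + qf i (x((i, j) := 0)) * (w j x - w j (x((i, j) := 0)))" by (simp only: right_diff_distrib left_diff_distrib) simp
  then have "cmod (qf i x * w j x - qf i (x((i, j) := 0)) * w j (x((i, j) := 0)) - kap \<kappa> (x (i, j)) * H i j x)
   <= cmod ((qf i x - qf i (x((i, j) := 0))) * w j x - kap \<kappa> (x (i, j)) * H i j x)
    + cmod (qf i (x((i, j) := 0)) * (w j x - w j (x((i, j) := 0))))" by (simp only: norm_triangle_ineq)
  also have "... <= (T x^7 / real n * (E j x * E' j x) + T x^2 / s * (E j x * E' j x) * R i x)
    + (T x^2 / s * (cmod (qf i x) * P j i x * E j x) + T x^9 / real n * (E j x * E' j x))" by (intro add_mono main second ij)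
  also have "... <= q1 i j x"
  proof -
   have "T x^7 / real n * (E j x * E' j x) <= T x^9 / real n * (E j x * E' j x)"
    using T1[of x] E0 by (intro mult_right_mono divide_right_mono power_increasing) auto
   moreover have "2 * a / c * z = a / c * z + a / c * z" for a c z :: real
    by (simp only: times_divide_eq_left add_divide_distrib[symmetric]) (simp only: mult_2 distrib_right)
   ultimately show ?thesis unfolding q1_def by (simp only:)
  qed
  finally show ?thesis .
 qed
 define err where "err = (\<lambda>x. \<Sum>(i, j)\<in>Ix. 1 / s * (T x * q1 i j x + 4 * (T x)^2 * q2 i j x))"
 have perr1: "polybdd Ix (\<lambda>x. T x * q1 i j x + 4 * (T x)^2 * q2 i j x)" for i j by (intro polybdd_intros pq1 pq2 pT)
 have perr: "polybdd Ix err" unfolding err_def case_prod_unfold by (intro polybdd_sum polybdd_mult[OF polybdd_const] perr1)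
 have gE: "(\<integral>x. gram n \<kappa> C p (Suc m) b C' p' m' b' x \<partial>Pr Ix)
   = (\<Sum>(i, j)\<in>Ix. 1 / cor s * (\<integral>x. x (i, j) * (qf i x * w j x) \<partial>Pr Ix))"
 proof -
  have "(\<integral>x. gram n \<kappa> C p (Suc m) b C' p' m' b' x \<partial>Pr Ix)
   = (\<integral>x. (\<Sum>(i, j)\<in>Ix. 1 / cor s * (x (i, j) * (qf i x * w j x))) \<partial>Pr Ix)"
   unfolding gram_expand s_def qf_def w_def ..
  also have "... = (\<Sum>(i, j)\<in>Ix. (\<integral>x. 1 / cor s * (x (i, j) * (qf i x * w j x)) \<partial>Pr Ix))"
   unfolding case_prod_unfold by (rule Bochner_Integration.integral_sum) (intro integrable_polybdd finI polybdd_intros pqf pw, auto)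
  finally show ?thesis by (simp only: integral_mult_right_zero)
 qed
 have HE: "(\<Sum>(i, j)\<in>Ix. 1 / cor s * (cf \<kappa> * (\<integral>x. H i j x \<partial>Pr Ix)))
   = (if m' = 0 then 0 else cf \<kappa> * tau \<kappa> p p' * (\<integral>x. gram n \<kappa> C (Suc p) m b C' (Suc p') (m' - 1) b' x \<partial>Pr Ix))"
 proof -
  have Q0: "Q 0 i x = (\<Sum>l<n. C p l i * kap \<kappa> (C' p' l i))" for i x by (simp add: Q_def)
  have "(\<Sum>(i, j)\<in>Ix. 1 / cor s * (cf \<kappa> * (\<integral>x. H i j x \<partial>Pr Ix)))
    = (\<Sum>(i, j)\<in>Ix. (\<integral>x. 1 / cor s * (cf \<kappa> * H i j x) \<partial>Pr Ix))" by (simp only: integral_mult_right_zero)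
  also have "... = (\<integral>x. (\<Sum>(i, j)\<in>Ix. 1 / cor s * (cf \<kappa> * H i j x)) \<partial>Pr Ix)"
   unfolding case_prod_unfold by (rule Bochner_Integration.integral_sum[symmetric]) (intro integrable_polybdd finI polybdd_intros pH)
  also have "(\<lambda>x. \<Sum>(i, j)\<in>Ix. 1 / cor s * (cf \<kappa> * H i j x))
    = (\<lambda>x. cf \<kappa> * tau \<kappa> p p' * (\<Sum>j<n. wp j x * w j x))"
  proof
   fix x
   have rs: "1 / cor s * (1 / cor s) = 1 / of_nat n"
    using s(2) by (simp flip: of_real_mult)
   have "(\<Sum>(i, j)\<in>Ix. 1 / cor s * (cf \<kappa> * H i j x))
     = (\<Sum>(i, j)\<in>Ix. cf \<kappa> * (1 / cor s * (1 / cor s)) * Q 0 i x * (wp j x * w j x))"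
    unfolding H_def by (rule sum_pair_cong) (simp only: mult_ac)
   also have "... = cf \<kappa> * (1 / of_nat n) * ((\<Sum>i<n. Q 0 i x) * (\<Sum>j<n. wp j x * w j x))"
    unfolding rs sum.cartesian_product[symmetric] by (subst sum_product) (simp only: sum_distrib_left mult.assoc)
   finally show "(\<Sum>(i, j)\<in>Ix. 1 / cor s * (cf \<kappa> * H i j x)) = cf \<kappa> * tau \<kappa> p p' * (\<Sum>j<n. wp j x * w j x)"
    unfolding tau_def Q0 by (simp add: mult_ac)
  qed
  also have "(\<integral>x. cf \<kappa> * tau \<kappa> p p' * (\<Sum>j<n. wp j x * w j x) \<partial>Pr Ix)
    = cf \<kappa> * tau \<kappa> p p' * (\<integral>x. (\<Sum>j<n. wp j x * w j x) \<partial>Pr Ix)" by simp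
  also have "(\<lambda>x. \<Sum>j<n. wp j x * w j x) = (\<lambda>x. if m' = 0 then 0 else gram n \<kappa> C (Suc p) m b C' (Suc p') (m' - 1) b' x)"
   by (auto simp: wp_def w_def gram_def mult.commute)
  finally show ?thesis by (cases "m' = 0") simp_all
 qed
 have "cmod ((\<integral>x. gram n \<kappa> C p (Suc m) b C' p' m' b' x \<partial>Pr Ix)
   - (if m' = 0 then 0 else cf \<kappa> * tau \<kappa> p p' * (\<integral>x. gram n \<kappa> C (Suc p) m b C' (Suc p') (m' - 1) b' x \<partial>Pr Ix)))
   = cmod (\<Sum>(i, j)\<in>Ix. 1 / cor s * ((\<integral>x. x (i, j) * (qf i x * w j x) \<partial>Pr Ix) - cf \<kappa> * (\<integral>x. H i j x \<partial>Pr Ix)))"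
  unfolding gE HE[symmetric] by (simp only: case_prod_unfold sum_subtractf[symmetric] right_diff_distrib[symmetric])
 also have "... <= (\<Sum>(i, j)\<in>Ix. 1 / s * (\<integral>x. T x * q1 i j x + 4 * (T x)^2 * q2 i j x \<partial>Pr Ix))"
 proof (rule norm_sum_pair_le)
  fix i j assume ij: "i < n" "j < n"
  then have e: "(i, j) \<in> Ix" by simp
  have "cmod ((\<integral>x. x (i, j) * (qf i x * w j x) \<partial>Pr Ix) - cf \<kappa> * (\<integral>x. H i j x \<partial>Pr Ix))
    <= (\<integral>x. T x * q1 i j x + 4 * (T x)^2 * q2 i j x \<partial>Pr Ix)"
   by (rule integration_by_parts_kap[OF finI e polybdd_mult[OF pqf pw] pH pq1 pq2 pT Fdiff[OF ij] Hdiff[OF ij]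
      controlled_coord[OF ctrl ij] T1])
  then show "cmod (1 / cor s * ((\<integral>x. x (i, j) * (qf i x * w j x) \<partial>Pr Ix) - cf \<kappa> * (\<integral>x. H i j x \<partial>Pr Ix)))
    <= 1 / s * (\<integral>x. T x * q1 i j x + 4 * (T x)^2 * q2 i j x \<partial>Pr Ix)"
   unfolding norm_mult using s(1) by (simp add: norm_divide divide_right_mono)
 qed
 also have "... = (\<integral>x. err x \<partial>Pr Ix)"
  unfolding err_def case_prod_unfold by (subst Bochner_Integration.integral_sum)
    (auto intro!: integrable_polybdd finI polybdd_mult polybdd_const perr1 simp del: times_divide_eq_left)
 also have "... <= (\<integral>x. 11 / s * T x^14 + 1 / real n * (\<Sum>i<n. T x^7 * R i x) \<partial>Pr Ix)"
 proof (rule integral_mono_polybdd[OF finI perr])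
  show "polybdd Ix (\<lambda>x. 11 / s * T x^14 + 1 / real n * (\<Sum>i<n. T x^7 * R i x))" by (intro polybdd_intros pR pT)
  fix x
  let ?T = "T x"
  have EE: "(\<Sum>j<n. E j x * E' j x) <= ?T^2 * ?T^2"
   unfolding E_def E'_def by (intro sum_mult_le_L2_set env_L2[OF ctrl CK] env_L2[OF ctrl CK'] m mM b b') auto
  have qn: "L2_set (\<lambda>i. cmod (qf i x)) {..<n} <= ?T^2"
  proof -
   have V: "l2norm n (\<lambda>l. kap \<kappa> (wd n C' p' m' x l b')) <= ?T"
    unfolding l2norm_kap by (rule form_bound_col[OF controlled_form_bound[OF ctrl CK' m(2)] b'])
   have "form_bound n (\<lambda>i l. C p l i) ?T" by (rule form_bound_transpose[OF form_bound_mono[OF CK controlled_ge(3)[OF ctrl]]])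
   from form_bound_vec[OF this, of "\<lambda>l. kap \<kappa> (wd n C' p' m' x l b')"]
   have "l2norm n (\<lambda>i. qf i x) <= ?T * l2norm n (\<lambda>l. kap \<kappa> (wd n C' p' m' x l b'))" by (simp only: mvmul_def qf_def)
   also have "... <= ?T * ?T" by (intro mult_left_mono V) auto
   finally show ?thesis by (simp add: l2norm_eq_L2_set power2_eq_square)
  qed
  have "err x = 1 / s * ((2 * ?T^10 + 8 * ?T^9) / real n) * (real n * (\<Sum>j<n. E j x * E' j x))
    + ?T^3 / real n * ((\<Sum>i<n. R i x) * (\<Sum>j<n. E j x * E' j x))
    + ?T^3 / real n * (\<Sum>j<n. E j x * (\<Sum>i<n. cmod (qf i x) * P j i x))"
  proof -
   have "1 / s * (?T * q1 i j x + 4 * ?T^2 * q2 i j x)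
    = 1 / s * ((2 * ?T^10 + 8 * ?T^9) / real n) * (E j x * E' j x)
     + ?T^3 / real n * (R i x * (E j x * E' j x)) + ?T^3 / real n * (E j x * (cmod (qf i x) * P j i x))" for i j
    unfolding q1_def q2_def s(2)[symmetric] using s(1) by (simp add: field_simps eval_nat_numeral)
   then have "err x = (\<Sum>i<n. \<Sum>j<n. 1 / s * ((2 * ?T^10 + 8 * ?T^9) / real n) * (E j x * E' j x))
     + (\<Sum>i<n. \<Sum>j<n. ?T^3 / real n * (R i x * (E j x * E' j x)))
     + (\<Sum>i<n. \<Sum>j<n. ?T^3 / real n * (E j x * (cmod (qf i x) * P j i x)))"
    unfolding err_def by (simp only: sum.cartesian_product[symmetric] sum.distrib)
   moreover have "(\<Sum>i<n. \<Sum>j<n. 1 / s * ((2 * ?T^10 + 8 * ?T^9) / real n) * (E j x * E' j x))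
     = 1 / s * ((2 * ?T^10 + 8 * ?T^9) / real n) * (real n * (\<Sum>j<n. E j x * E' j x))"
    by (subst sum_distrib_left[symmetric]) (simp only: sum_constant card_lessThan, simp only: mult_ac)
   moreover have "(\<Sum>i<n. \<Sum>j<n. ?T^3 / real n * (R i x * (E j x * E' j x)))
     = ?T^3 / real n * ((\<Sum>i<n. R i x) * (\<Sum>j<n. E j x * E' j x))" by (subst sum_product) (simp only: sum_distrib_left)
   moreover have "(\<Sum>i<n. \<Sum>j<n. ?T^3 / real n * (E j x * (cmod (qf i x) * P j i x)))
     = ?T^3 / real n * (\<Sum>j<n. E j x * (\<Sum>i<n. cmod (qf i x) * P j i x))" by (subst sum.swap) (simp only: sum_distrib_left)
   ultimately show ?thesis by simp
  qed
  also have "... <= 1 / s * ((10 * ?T^10) / real n) * (real n * (?T^2 * ?T^2))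
    + ?T^3 / real n * ((\<Sum>i<n. R i x) * (?T^2 * ?T^2))
    + ?T^3 / real n * (\<Sum>j<n. E j x * (?T^2 * ?T^2))"
  proof (intro add_mono mult_mono mult_left_mono EE divide_right_mono sum_mono order_refl)
   show "2 * ?T^10 + 8 * ?T^9 <= 10 * ?T^10" using power_increasing[of 9 10 ?T] T1[of x] by simp
   fix j assume "j \<in> {..<n}"
   then show "(\<Sum>i<n. cmod (qf i x) * P j i x) <= ?T^2 * ?T^2"
    using qn unfolding P_def by (intro sum_mult_le_L2_set pre_L2[OF ctrl CK mM]) auto
  qed (use s E0 in \<open>auto intro!: sum_nonneg mult_nonneg_nonneg\<close>)
  also have "... = 10 / s * ?T^14 + 1 / real n * (\<Sum>i<n. ?T^7 * R i x) + ?T^7 / real n * (\<Sum>j<n. E j x)"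
   using n by (simp add: sum_distrib_left sum_distrib_right sum_divide_distrib mult_ac flip: power_add)
  also have "?T^7 / real n * (\<Sum>j<n. E j x) <= ?T^7 / real n * (s * ?T^2)"
   unfolding s_def E_def by (intro mult_left_mono sum_le_sqrt_L2_set env_L2[OF ctrl CK mM b]) auto
  also have "... = 1 / s * ?T^9" unfolding s(2)[symmetric] using s(1) by (simp flip: power_add)
  also have "... <= 1 / s * ?T^14" using s T1[of x] by (intro mult_left_mono power_increasing) auto
  finally show "err x <= 11 / s * ?T^14 + 1 / real n * (\<Sum>i<n. ?T^7 * R i x)" by (simp add: algebra_simps add_divide_distrib[symmetric])
 qed
 also have "... = 11 / s * ET 14 + 1 / real n * (\<Sum>i<n. \<Sum>r\<in>{1..<m'}. \<integral>x. T x^7 * cmod (Q r i x) \<partial>Pr Ix)"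
 proof -
  have "(\<integral>x. 11 / s * T x^14 + 1 / real n * (\<Sum>i<n. T x^7 * R i x) \<partial>Pr Ix)
    = (\<integral>x. 11 / s * T x^14 \<partial>Pr Ix) + (\<integral>x. 1 / real n * (\<Sum>i<n. T x^7 * R i x) \<partial>Pr Ix)"
   by (intro Bochner_Integration.integral_add integrable_polybdd finI polybdd_intros pR pT)
  also have "(\<integral>x. 1 / real n * (\<Sum>i<n. T x^7 * R i x) \<partial>Pr Ix) = 1 / real n * (\<Sum>i<n. \<integral>x. T x^7 * R i x \<partial>Pr Ix)"
   by (simp only: integral_mult_right_zero)
     (subst Bochner_Integration.integral_sum, auto intro!: integrable_polybdd finI polybdd_mult polybdd_power pR pT)
  also have "(\<lambda>i. \<integral>x. T x^7 * R i x \<partial>Pr Ix) = (\<lambda>i. \<Sum>r\<in>{1..<m'}. \<integral>x. T x^7 * cmod (Q r i x) \<partial>Pr Ix)"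
   unfolding R_def sum_distrib_left by (intro ext Bochner_Integration.integral_sum integrable_polybdd finI polybdd_intros pQ pT)
  finally show ?thesis by (simp add: ET_def)
 qed
 also have "... <= 11 / s * ET 16 + 1 / real n * (\<Sum>i<n. \<Sum>r\<in>{1..<m'}. 2 / s * ET 16)"
 proof (intro add_mono mult_left_mono sum_mono ET_mono)
  fix i r assume ir: "i \<in> {..<n}" "r \<in> {1..<m'}"
  \<comment> \<open>The weight \<open>s\<close> in the inequality of arithmetic and geometric means
    balances the order \<open>1 / n\<close> of the second moment of \<open>Q r i\<close>, so that
    both halves are of order \<open>1 / s\<close>.\<close>
  have pt: "T x^7 * cmod (Q r i x) <= 1/2 / s * T x^14 + s / 2 * (cmod (Q r i x))^2" for x
  proof -
   have amgm: "2 * (s * (u * c)) <= u^2 + s * s * c^2" for u c :: real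
    using zero_le_power2[of "u - s * c"] by (simp add: power2_eq_square algebra_simps)
   have "2 * (s * (T x^7 * cmod (Q r i x))) <= T x^14 + s * s * (cmod (Q r i x))^2"
    using amgm[of "T x^7" "cmod (Q r i x)"] by (simp flip: power_mult)
   then show ?thesis using s(1) by (simp add: field_simps power2_eq_square)
  qed
  have "(\<integral>x. T x^7 * cmod (Q r i x) \<partial>Pr Ix) <= (\<integral>x. 1/2 / s * T x^14 + s / 2 * (cmod (Q r i x))^2 \<partial>Pr Ix)"
   by (intro integral_mono_polybdd[OF finI _ _ pt] polybdd_intros pQ pT)
  also have "... = (\<integral>x. 1/2 / s * T x^14 \<partial>Pr Ix) + (\<integral>x. s / 2 * (cmod (Q r i x))^2 \<partial>Pr Ix)"
   by (intro Bochner_Integration.integral_add integrable_polybdd finI polybdd_intros pQ pT)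
  also have "... = 1/2 / s * ET 14 + s / 2 * (\<integral>x. (cmod (Q r i x))^2 \<partial>Pr Ix)" by (simp only: integral_mult_right_zero ET_def)
  also have "... <= 1/2 / s * ET 16 + s / 2 * (2 * ET 16 / real n)"
   unfolding Q_def using s ir m by (intro add_mono mult_left_mono ET_mono contracted_moment2 C C') auto
  also have "... <= 2 / s * ET 16"
   unfolding s(2)[symmetric] using s(1) ET_ge1[of 16] by (simp add: field_simps)
  finally show "(\<integral>x. T x^7 * cmod (Q r i x) \<partial>Pr Ix) <= 2 / s * ET 16" .
 qed (use s in auto)
 also have "... = 11 / s * ET 16 + real (m' - 1) * (2 / s * ET 16)" using n by simp
 also have "... <= 11 / s * ET 16 + real M * (2 / s * ET 16)"
  using m s ET_ge1[of 16] by (intro add_left_mono mult_right_mono) auto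
 also have "... = (11 + 2 * real M) * ET 16 / s" by (simp add: algebra_simps add_divide_distrib)
 finally show ?thesis unfolding s_def .
qed

end

end

lemma env_shift_le:
 assumes "r <= m"
 shows "env n C (p + r) (m - r) x j b <= env n C p m x j b"
proof (cases r)
 case (Suc r')
 then show ?thesis using env_suffix_le[of r' m n C p x j b] assms by simp
qed simp

lemma pre_mono: "r <= m ==> pre n C p r x a i <= pre n C p m x a i"
 unfolding pre_def by (rule sum_mono2) auto

lemma wd_le_pre: "r < m ==> cmod (wd n C p r x a i) <= pre n C p m x a i"
 unfolding pre_def by (rule member_le_sum[of r _ "\<lambda>r. cmod (wd n C p r x a i)"]) auto

lemma wd_last: "wd n (C(p + m := mmul n (C (p + m)) A)) p m x = mmul n (wd n C p m x) A"
proof (cases m)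
 case (Suc m')
 have "wd n (C(p + m := mmul n (C (p + m)) A)) p m' x = wd n C p m' x" by (rule wd_cong) (use Suc in auto)
 then show ?thesis using Suc by (simp add: mmul_assoc)
qed simp

lemma contract_right:
 "(\<Sum>i<n. A c i * kap \<kappa> (wd n C p m x a i))
  = kap \<kappa> (wd n (C(p + m := mmul n (C (p + m)) (\<lambda>i l. kap \<kappa> (A l i)))) p m x a c)"
 unfolding wd_last by (simp add: mmul_def kap_sum kap_mult mult.commute)

text \<open>When the column index of the removed entry matches the column of the word, the increment
 keeps the row profile of the word.\<close>

lemma wd_diff_col_le:
 assumes c: "controlled n K M x T" "\<And>q. form_bound n (C q) K" and m: "m <= M"
  and ij: "i < n" "j < n"
 shows "cmod (wd n C p m x a i - wd n C p m (x((i, j) := 0)) a i)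
  <= T^2 / sqrt (real n) * pre n C p m x a i"
proof -
 have T: "2 <= T" "cmod (x (i, j)) <= T" using controlled_ge[OF c(1)] controlled_coord[OF c(1) ij] by auto
 have n0: "0 < sqrt (real n)" using ij by simp
 have 2: "cmod (x (i, j) / cor (sqrt (real n))) <= T / sqrt (real n)"
  using T n0 by (simp add: norm_divide divide_right_mono)
 have "cmod (wd n C p m x a i - wd n C p m (x((i, j) := 0)) a i)
   <= (\<Sum>r<m. cmod (wd n C p r x a i) * (T / sqrt (real n)) * T)"
  unfolding wd_perturb[OF ij]
 proof (intro order_trans[OF norm_sum] sum_mono)
  fix r assume "r \<in> {..<m}"
  then have 1: "cmod (wd n C (Suc (p + r)) (m - Suc r) (x((i, j) := 0)) j i) <= T"
   using m by (intro form_bound_entry[OF controlled_form_bound_update[OF c _ ij]] ij) auto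
  show "cmod (wd n C p r x a i * (x (i, j) / cor (sqrt (real n)))
    * wd n C (Suc (p + r)) (m - Suc r) (x((i, j) := 0)) j i)
    <= cmod (wd n C p r x a i) * (T / sqrt (real n)) * T"
   unfolding norm_mult using T n0 by (intro mult_mono 1 2 order_refl) (auto intro!: mult_nonneg_nonneg)
 qed
 also have "... = T^2 / sqrt (real n) * pre n C p m x a i" by (simp add: pre_def power2_eq_square sum_distrib_left sum_distrib_right mult_ac)
 finally show ?thesis .
qed

text \<open>The mean recursion unrolled: each step adds \<open>11 + 2 * M\<close> and multiplies the
  earlier error by at most \<open>K\<close>, the bound on \<open>cf \<kappa> * tau\<close>.\<close>

primrec gerr :: "real => nat => nat => real" where
 "gerr K M 0 = 1"
| "gerr K M (Suc m) = 11 + 2 * real M + K * gerr K M m"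

lemma gerr_ge1: "0 <= K ==> 1 <= gerr K M m" by (induction m) auto

section \<open>Limits and concentration of inner products of words\<close>

context gram_entries
begin

lemma form_bound_contracted_right:
 assumes "form_bound n A K0" "\<And>q. form_bound n (C q) K0"
 shows "form_bound n ((C(p := mmul n (C p) (\<lambda>a l. kap \<kappa> (A l a)))) q) K"
proof (cases "q = p")
 case True
 have "form_bound n (\<lambda>a l. A l a) K0" by (rule form_bound_transpose[OF assms(1)])
 then have "form_bound n (mmul n (C p) (\<lambda>a l. kap \<kappa> (A l a))) (K0 * K0)" by (intro form_bound_mmul assms form_bound_kap)
 then show ?thesis using True K0(2) by (simp add: form_bound_mono)
next
 case False
 then show ?thesis using form_bound_mono[OF assms(2) K0_le_K] by simp
qed

lemma contracted_right_moment2: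
 assumes "form_bound n A K0" "\<And>q. form_bound n (C q) K0" "0 < m" "m <= M" "c < n" "a < n"
 shows "(\<integral>x. (cmod (\<Sum>i<n. A c i * kap \<kappa> (wd n C p m x a i)))^2 \<partial>Pr Ix) <= 2 * ET 16 / real n"
 unfolding contract_right kap_simps by (rule wd_moment2[OF form_bound_contracted_right[OF assms(1,2)] assms(3,4,6,5)])

context
 fixes C C' :: "nat => cmat" and b b' :: nat
 assumes C: "\<And>q. form_bound n (C q) K0" and C': "\<And>q. form_bound n (C' q) K0"
  and b: "b < n" and b': "b' < n"
begin

text \<open>For words of different length some factor stays without a partner, hence the value
  0.\<close>

definition glim :: "bool => nat => nat => nat => nat => complex" where
 "glim \<kappa> p m p' m' = (if m = m' then cf \<kappa> ^ m * (\<Prod>s<m. tau C C' \<kappa> (p + s) (p' + s))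
   * (\<Sum>l<n. C (p + m) l b * kap \<kappa> (C' (p' + m) l b')) else 0)"

text \<open>Induction on the first length with the second one arbitrary. In the base case against a
  longer word the inner product is, after contraction, an entry of a single word, whose mean is
  already known to be small.\<close>

lemma gram_mean:
 assumes "m <= M" "m' <= M"
 shows "cmod ((\<integral>x. gram n \<kappa> C p m b C' p' m' b' x \<partial>Pr Ix) - glim \<kappa> p m p' m')
  <= gerr K M m * ET 16 / sqrt (real n)"
 using assms
proof (induction m arbitrary: p p' m')
 case 0
 interpret P: prob_space "Pr Ix" by (rule prob_space_Pr)
 show ?case
 proof (cases m')
  case 0
  then have "gram n \<kappa> C p 0 b C' p' m' b' x = glim \<kappa> p 0 p' m'" for x by (simp add: gram_def glim_def)
  then show ?thesis using ET_ge1[of 16] P.prob_space by simp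
 next
  case (Suc m'')
  let ?D = "C'(p' := mmul n (\<lambda>a l. kap \<kappa> (C p l a)) (C' p'))"
  have D: "form_bound n (?D q) K" for q by (rule form_bound_contracted[OF C C'])
  have g: "gram n \<kappa> C p 0 b C' p' m' b' x = kap \<kappa> (wd n ?D p' (Suc m'') x b b')" for x
   unfolding gram_def wd.simps(1) contract_left Suc ..
  have "cmod (\<integral>x. gram n \<kappa> C p 0 b C' p' m' b' x \<partial>Pr Ix) = cmod (\<integral>x. wd n ?D p' (Suc m'') x b b' \<partial>Pr Ix)"
   unfolding g by (cases \<kappa>) (simp_all only: kap_def if_True if_False Bochner_Integration.integral_cnj complex_mod_cnj)
  also have "... <= ET 8 / sqrt (real n)" by (rule wd_mean[OF D]) (use Suc 0 b b' in auto)
  also have "... <= ET 16 / sqrt (real n)" by (intro divide_right_mono ET_mono) auto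
  finally show ?thesis using Suc by (simp add: glim_def)
 qed
next
 case (Suc m)
 let ?s = "sqrt (real n)"
 have s: "0 < ?s" using n by simp
 have g1: "1 <= gerr K M m" by (rule gerr_ge1) (use K_ge1 in simp)
 note step = gram_mean_step[where C = C and C' = C', OF C C' b b' Suc.prems, where \<kappa> = \<kappa> and p = p and p' = p']
 show ?case
 proof (cases m')
  case 0
  have "(11 + 2 * real M) * ET 16 / ?s <= gerr K M (Suc m) * ET 16 / ?s"
   using K_ge1 g1 ET_ge1[of 16] by (intro divide_right_mono mult_right_mono) auto
  then show ?thesis using step 0 by (simp add: glim_def)
 next
  case (Suc m'')
  let ?I = "\<integral>x. gram n \<kappa> C (Suc p) m b C' (Suc p') m'' b' x \<partial>Pr Ix"
  let ?g = "glim \<kappa> (Suc p) m (Suc p') m''" and ?ct = "cf \<kappa> * tau C C' \<kappa> p p'"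
  have ih: "cmod (?I - ?g) <= gerr K M m * ET 16 / ?s"
   using Suc Suc.prems by (intro Suc.IH) auto
  have gl: "glim \<kappa> p (Suc m) p' m' = ?ct * ?g"
   unfolding glim_def Suc prod.lessThan_Suc_shift by simp
  have ct: "cmod ?ct <= K"
   using mult_mono[OF cf_le1[of \<kappa>] tau_le[where C = C and C' = C' and \<kappa> = \<kappa> and p = p and p' = p', OF C C' b b']]
   by (simp add: norm_mult)
  have "cmod ((\<integral>x. gram n \<kappa> C p (Suc m) b C' p' m' b' x \<partial>Pr Ix) - ?ct * ?I) <= (11 + 2 * real M) * ET 16 / ?s"
   using step Suc by simp
  moreover have "cmod (?ct * ?I - ?ct * ?g) <= K * (gerr K M m * ET 16 / ?s)"
   unfolding right_diff_distrib[symmetric] norm_mult[of ?ct]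
   using K_ge1 by (intro mult_mono ct ih) auto
  ultimately have "cmod ((\<integral>x. gram n \<kappa> C p (Suc m) b C' p' m' b' x \<partial>Pr Ix) - ?ct * ?g)
   <= (11 + 2 * real M) * ET 16 / ?s + K * (gerr K M m * ET 16 / ?s)"
   using norm_triangle_ineq[of "(\<integral>x. gram n \<kappa> C p (Suc m) b C' p' m' b' x \<partial>Pr Ix) - ?ct * ?I" "?ct * ?I - ?ct * ?g"] by simp
  also have "... = gerr K M (Suc m) * ET 16 / ?s" by (simp add: algebra_simps add_divide_distrib)
  finally show ?thesis unfolding gl .
 qed
qed

lemma gram_L1:
 assumes m: "m <= M" "m' <= M"
 shows "(\<integral>x. cmod (gram n \<kappa> C p m b C' p' m' b' x - glim \<kappa> p m p' m') \<partial>Pr Ix)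
  <= (9 + (gerr K M m)^2) * ET 32 / sqrt (real n)"
proof -
 let ?g = "glim \<kappa> p m p' m'" and ?f = "gram n \<kappa> C p m b C' p' m' b'"
 let ?c = "9 + (gerr K M m)^2"
 have pf: "polybdd Ix ?f" by (rule polybdd_gram)
 have n0: "0 < real n" using n by simp
 have CK: "form_bound n (C q) K" "form_bound n (C' q) K" for q by (rule form_bound_mono[OF _ K0_le_K], rule C C')+
 have "(\<integral>x. (cmod (?f x - integral\<^sup>L (Pr Ix) ?f))^2 \<partial>Pr Ix) <= (\<integral>x. 9 * T x^24 / real n \<partial>Pr Ix)"
  by (rule variance_le[OF pf _ gram_diff_square_sum_le[OF ctrl CK m b b']]) (intro polybdd_intros pT)
 also have "... = 9 * ET 24 / real n" by (simp add: ET_def)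
 also have "... <= 9 * ET 32 / real n" using ET_mono[of 24 32] by (intro divide_right_mono) auto
 finally have v: "(\<integral>x. (cmod (?f x - integral\<^sup>L (Pr Ix) ?f))^2 \<partial>Pr Ix) <= 9 * ET 32 / real n" .
 have "(cmod (integral\<^sup>L (Pr Ix) ?f - ?g))^2 <= (gerr K M m * ET 16 / sqrt (real n))^2" by (intro power_mono gram_mean m) auto
 also have "... = (gerr K M m)^2 * (ET 16)^2 / real n" by (simp add: power_divide power_mult_distrib)
 also have "... <= (gerr K M m)^2 * ET 32 / real n"
  using ET_square[of 16] by (intro divide_right_mono mult_left_mono) auto
 finally have "(\<integral>x. (cmod (?f x - ?g))^2 \<partial>Pr Ix) <= ?c * ET 32 / real n"
  unfolding second_moment[OF pf, of ?g] using v by (simp add: distrib_right add_divide_distrib)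
 then have "(\<integral>x. cmod (?f x - ?g) \<partial>Pr Ix)^2 <= ?c * ET 32 / real n"
  using square_integral_le[OF finI, of "\<lambda>x. cmod (?f x - ?g)"] polybdd_norm[OF polybdd_diff[OF pf polybdd_const]] by fastforce
 also have "... <= (?c * ET 32 / sqrt (real n))^2"
 proof -
  \<comment> \<open>A number at least 1 is bounded by its square; this avoids a square root of the
    constant.\<close>
  have "1 <= ?c * ET 32"
   using mult_mono[of 1 ?c 1 "ET 32"] ET_ge1[of 32] zero_le_power2[of "gerr K M m"] by simp
  then have "?c * ET 32 * 1 <= (?c * ET 32) * (?c * ET 32)" by (intro mult_left_mono) auto
  then show ?thesis by (simp add: power_divide power2_eq_square divide_right_mono)
 qed
 finally show ?thesis
  using ET_ge1[of 32] by (intro power2_le_imp_le[of "\<integral>x. cmod (?f x - ?g) \<partial>Pr Ix"]) auto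
qed

end

end

section \<open>Stein's identity for matrix words\<close>

lemma sum_mult_sum_ge:
 fixes f g :: "'a => real"
 assumes "finite A" "\<And>a. a \<in> A ==> 0 <= f a" "\<And>a. a \<in> A ==> 0 <= g a"
 shows "(\<Sum>a\<in>A. f a * g a) <= (\<Sum>a\<in>A. f a) * (\<Sum>a\<in>A. g a)"
 unfolding sum_distrib_right
proof (rule sum_mono)
 fix a assume a: "a \<in> A"
 show "f a * g a <= f a * sum g A"
  using assms a by (intro mult_left_mono member_le_sum) auto
qed

lemma iexp_diff_le: "cmod (iexp a - iexp b) <= \<bar>a - b\<bar>"
proof -
 have "iexp a - iexp b
   = iexp b * (iexp (a - b) - 1)" by (simp add: right_diff_distrib flip: exp_add)
 then have "cmod (iexp a - iexp b)
   = cmod (iexp (a - b) - 1)" by (simp add: norm_mult)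
 also have "... <= \<bar>a - b\<bar>" using iexp_approx1[of "a - b" 0] by simp
 finally show ?thesis .
qed

text \<open>Expansion around the endpoint \<open>a\<close>. In the application \<open>a\<close> is
  the phase at \<open>x\<close> itself, the point at which the integration by parts takes its
  derivatives.\<close>

lemma iexp_diff_second_order_le:
 "cmod (iexp a - iexp b
   - \<i> * cor (a - b) * iexp a) <= (a - b)^2"
proof -
 let ?d = "b - a"
 have "iexp a - iexp b
   - \<i> * cor (a - b) * iexp a
   = - iexp a * (iexp ?d - (1 + \<i> * cor ?d))" by (simp add: algebra_simps flip: exp_add)
 then have "cmod (iexp a - iexp b
   - \<i> * cor (a - b) * iexp a)
   = cmod (iexp ?d - (1 + \<i> * cor ?d))" by (simp add: norm_mult)
 also have "... <= \<bar>?d\<bar>^2 / 2" using iexp_approx1[of ?d 1] by (simp add: numeral_2_eq_2)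
 also have "... <= (a - b)^2" by (simp add: power2_commute)
 finally show ?thesis .
qed

text \<open>\<open>T\<close> also dominates the coefficients and the total length of the words, so
  sums over words cost no more than powers of \<open>T\<close>.\<close>

locale stein_entries = gram_entries +
 fixes k :: "'t::finite => nat" and Cs :: "'t => nat => cmat" and bt :: "'t => complex"
 assumes Cs: "\<And>t q. form_bound n (Cs t q) K0"
  and k: "\<And>t. 1 <= k t" "\<And>t. k t <= M"
  and kT: "\<And>x. real (\<Sum>t\<in>UNIV. k t) <= T x"
  and bT: "\<And>t x. cmod (bt t) <= T x"
begin

definition Zw :: "'t => arr => complex" where
 "Zw t x = cor (sqrt (real n)) * wd n (Cs t) 0 (k t) x 0 0"

definition Ph :: "arr => real" where
 "Ph x = Re (\<Sum>t\<in>UNIV. cnj (bt t) * Zw t x)"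

definition ep :: "arr => complex" where
 "ep x = iexp (Ph x)"

text \<open>Left and right profiles of all words at once. Changes of the phase in the entry
  \<open>(i, j)\<close> are bounded by a power of \<open>T\<close> times \<open>LL i * RR j\<close>,
  and both profiles have l2 norm at most \<open>T^3\<close>.\<close>

definition LL :: "nat => arr => real" where
 "LL i x = (\<Sum>t\<in>UNIV. pre n (Cs t) 0 (k t) x 0 i)"

definition RR :: "nat => arr => real" where
 "RR j x = (\<Sum>t\<in>UNIV. env n (Cs t) 1 (k t - 1) x j 0)"

text \<open>At \<open>x' = x\<close> this is the derivative in the entry \<open>(i, j)\<close> of
  the weighted sum of words; at \<open>x' = x((i, j) := 0)\<close> it is the exact difference
  quotient.\<close>

definition Dm :: "nat => nat => arr => arr => complex" where
 "Dm i j x x' = (\<Sum>t\<in>UNIV. cnj (bt t) * (\<Sum>r<k t. wd n (Cs t) 0 r x 0 i * wd n (Cs t) (Suc r) (k t - Suc r) x' j 0))"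

abbreviation sn :: real where "sn \<equiv> sqrt (real n)"

lemma sn: "0 < sn" "1 <= sn" "sn * sn = real n" using n by auto

lemma CsK: "form_bound n (Cs t q) K" by (rule form_bound_mono[OF Cs K0_le_K])

lemma LR_nonneg [simp]: "0 <= LL i x" "0 <= RR j x" by (auto simp: LL_def RR_def sum_nonneg)

lemma card_le_T: "real CARD('t) <= T x"
proof -
 have "CARD('t) = (\<Sum>t\<in>(UNIV::'t set). 1)" by simp
 also have "... <= (\<Sum>t\<in>UNIV. k t)" by (rule sum_mono) (rule k)
 finally have "real CARD('t) <= real (\<Sum>t\<in>UNIV. k t)" by (simp only: of_nat_le_iff)
 then show ?thesis using kT[of x] by linarith
qed

lemma k_le_T: "real (k t) <= T x"
proof -
 have "k t <= (\<Sum>t\<in>UNIV. k t)" by (rule member_le_sum) auto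
 then have "real (k t) <= real (\<Sum>t\<in>UNIV. k t)" by (simp only: of_nat_le_iff)
 then show ?thesis using kT[of x] by linarith
qed

lemma LL_L2: "L2_set (\<lambda>i. LL i x) {..<n} <= T x^3"
proof -
 have "L2_set (\<lambda>i. LL i x) {..<n} <= (\<Sum>t\<in>UNIV. L2_set (\<lambda>i. pre n (Cs t) 0 (k t) x 0 i) {..<n})"
  unfolding LL_def by (rule L2_set_sum_le) simp
 also have "... <= (\<Sum>t\<in>(UNIV::'t set). T x^2)" by (intro sum_mono pre_L2[OF ctrl CsK] k n)
 also have "... <= T x * T x^2" using card_le_T[of x] by (simp add: mult_right_mono)
 finally show ?thesis by (simp add: power2_eq_square power3_eq_cube)
qed

lemma RR_L2: "L2_set (\<lambda>j. RR j x) {..<n} <= T x^3"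
proof -
 have km: "k t - 1 <= M" for t using k(2)[of t] by simp
 have "L2_set (\<lambda>j. RR j x) {..<n} <= (\<Sum>t\<in>UNIV. L2_set (\<lambda>j. env n (Cs t) 1 (k t - 1) x j 0) {..<n})"
  unfolding RR_def by (rule L2_set_sum_le) simp
 also have "... <= (\<Sum>t\<in>(UNIV::'t set). T x^2)" by (intro sum_mono env_L2[OF ctrl CsK] km n)
 also have "... <= T x * T x^2" using card_le_T[of x] by (simp add: mult_right_mono)
 finally show ?thesis by (simp add: power2_eq_square power3_eq_cube)
qed

lemma LL_le: "i < n ==> LL i x <= T x^3" by (rule le_L2_set[OF _ _ LL_L2]) auto

lemma env_suffix_k:
 assumes "r < k t" shows "env n (Cs t) (Suc r) (k t - Suc r) x j 0 <= env n (Cs t) 1 (k t - 1) x j 0"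
 using env_shift_le[of r "k t - 1" n "Cs t" 1 x j 0] assms by simp

lemma suffix_le:
 assumes "r < k t" shows "cmod (wd n (Cs t) (Suc r) (k t - Suc r) x j 0) <= env n (Cs t) 1 (k t - 1) x j 0"
 by (rule order_trans[OF wd_le_env env_suffix_k[OF assms]])

lemma suffix_update_le:
 assumes "r < k t" "i < n" "j < n"
 shows "cmod (wd n (Cs t) (Suc r) (k t - Suc r) (x((i, j) := 0)) j 0) <= T x * env n (Cs t) 1 (k t - 1) x j 0"
proof -
 have "cmod (wd n (Cs t) (Suc r) (k t - Suc r) (x((i, j) := 0)) j 0) <= T x * env n (Cs t) (Suc r) (k t - Suc r) x j 0"
  by (rule controlled_env[OF ctrl CsK]) (use assms k(2)[of t] n in auto)
 also have "... <= T x * env n (Cs t) 1 (k t - 1) x j 0" by (intro mult_left_mono env_suffix_k assms) simp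
 finally show ?thesis .
qed

lemma suffix_diff_le:
 assumes "r < k t" "i < n" "j < n"
 shows "cmod (wd n (Cs t) (Suc r) (k t - Suc r) x j 0 - wd n (Cs t) (Suc r) (k t - Suc r) (x((i, j) := 0)) j 0)
  <= T x^4 / sn * env n (Cs t) 1 (k t - 1) x j 0"
proof -
 have kM: "k t - Suc r <= M" using k(2)[of t] by simp
 have "cmod (wd n (Cs t) (Suc r) (k t - Suc r) x j 0 - wd n (Cs t) (Suc r) (k t - Suc r) (x((i, j) := 0)) j 0)
   <= T x^2 / sn * (pre n (Cs t) (Suc r) (k t - Suc r) x j i * env n (Cs t) (Suc r) (k t - Suc r) x j 0)"
  by (rule wd_diff_le[OF ctrl CsK kM assms(2,3) n])
 also have "... <= T x^2 / sn * (T x^2 * env n (Cs t) 1 (k t - 1) x j 0)"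
  by (intro mult_left_mono mult_mono pre_le[OF ctrl CsK kM] env_suffix_k assms) auto
 also have "... = T x^4 / sn * env n (Cs t) 1 (k t - 1) x j 0" by (simp flip: power_add)
 finally show ?thesis .
qed

lemma weighted_sum_le:
 assumes f: "\<And>t r. r < k t ==> cmod (f t r) <= c * (g t r * h t)"
  and g: "\<And>t. (\<Sum>r<k t. g t r) <= G t" "\<And>t. 0 <= G t" and h: "\<And>t. 0 <= h t" and c: "0 <= c"
 shows "cmod (\<Sum>t\<in>UNIV. cnj (bt t) * (\<Sum>r<k t. f t r)) <= T x * c * ((\<Sum>t\<in>UNIV. G t) * (\<Sum>t\<in>UNIV. h t))"
proof -
 have "cmod (\<Sum>t\<in>UNIV. cnj (bt t) * (\<Sum>r<k t. f t r)) <= (\<Sum>t\<in>UNIV. T x * (c * (G t * h t)))"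
 proof (rule order_trans[OF norm_sum], rule sum_mono)
  fix t
  have "cmod (\<Sum>r<k t. f t r) <= (\<Sum>r<k t. c * (g t r * h t))" by (rule order_trans[OF norm_sum], rule sum_mono) (use f in auto)
  also have "... = c * ((\<Sum>r<k t. g t r) * h t)" by (simp add: sum_distrib_left sum_distrib_right)
  also have "... <= c * (G t * h t)" by (intro mult_left_mono mult_right_mono g h c)
  finally show "cmod (cnj (bt t) * (\<Sum>r<k t. f t r)) <= T x * (c * (G t * h t))"
   unfolding norm_mult by (intro mult_mono) (use bT in auto)
 qed
 also have "... = T x * c * (\<Sum>t\<in>UNIV. G t * h t)" by (simp add: sum_distrib_left mult.assoc)
 also have "... <= T x * c * ((\<Sum>t\<in>UNIV. G t) * (\<Sum>t\<in>UNIV. h t))"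
  using c by (intro mult_left_mono sum_mult_sum_ge g h) auto
 finally show ?thesis .
qed

lemma pre_sum: "(\<Sum>r<k t. cmod (wd n (Cs t) 0 r x 0 i)) <= pre n (Cs t) 0 (k t) x 0 i" by (simp add: pre_def)

lemma D_le: "cmod (Dm i j x x) <= T x^2 * (LL i x * RR j x)"
proof -
 have "cmod (Dm i j x x) <= T x * 1 * (LL i x * RR j x)"
  unfolding Dm_def LL_def RR_def
 proof (rule weighted_sum_le[OF _ pre_sum])
  show "cmod (wd n (Cs t) 0 r x 0 i * wd n (Cs t) (Suc r) (k t - Suc r) x j 0)
   <= 1 * (cmod (wd n (Cs t) 0 r x 0 i) * env n (Cs t) 1 (k t - 1) x j 0)" if "r < k t" for t r
   unfolding norm_mult mult_1 by (intro mult_left_mono suffix_le that) auto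
 qed auto
 also have "... <= T x^2 * (LL i x * RR j x)"
  using T1[of x] by (intro mult_right_mono) (auto simp: power2_eq_square intro!: mult_nonneg_nonneg)
 finally show ?thesis .
qed

lemma De_le:
 assumes "i < n" "j < n"
 shows "cmod (Dm i j x (x((i, j) := 0))) <= T x^2 * (LL i x * RR j x)"
proof -
 have "cmod (Dm i j x (x((i, j) := 0))) <= T x * T x * (LL i x * RR j x)"
  unfolding Dm_def LL_def RR_def
 proof (rule weighted_sum_le[OF _ pre_sum])
  show "cmod (wd n (Cs t) 0 r x 0 i * wd n (Cs t) (Suc r) (k t - Suc r) (x((i, j) := 0)) j 0)
   <= T x * (cmod (wd n (Cs t) 0 r x 0 i) * env n (Cs t) 1 (k t - 1) x j 0)" if "r < k t" for t r
   using mult_left_mono[OF suffix_update_le[OF that assms, of x], of "cmod (wd n (Cs t) 0 r x 0 i)"]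
   unfolding norm_mult by (simp only: mult.left_commute norm_ge_zero simp_thms)
 qed auto
 then show ?thesis by (simp add: power2_eq_square)
qed

lemma D_De_le:
 assumes "i < n" "j < n"
 shows "cmod (Dm i j x x - Dm i j x (x((i, j) := 0))) <= T x^5 / sn * (LL i x * RR j x)"
proof -
 have "Dm i j x x - Dm i j x (x((i, j) := 0)) = (\<Sum>t\<in>UNIV. cnj (bt t) * (\<Sum>r<k t. wd n (Cs t) 0 r x 0 i *
   (wd n (Cs t) (Suc r) (k t - Suc r) x j 0 - wd n (Cs t) (Suc r) (k t - Suc r) (x((i, j) := 0)) j 0)))"
  unfolding Dm_def by (simp only: right_diff_distrib sum_subtractf)
 moreover have "cmod ... <= T x * (T x^4 / sn) * (LL i x * RR j x)"
  unfolding LL_def RR_def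
 proof (rule weighted_sum_le[OF _ pre_sum])
  show "cmod (wd n (Cs t) 0 r x 0 i *
    (wd n (Cs t) (Suc r) (k t - Suc r) x j 0 - wd n (Cs t) (Suc r) (k t - Suc r) (x((i, j) := 0)) j 0))
   <= T x^4 / sn * (cmod (wd n (Cs t) 0 r x 0 i) * env n (Cs t) 1 (k t - 1) x j 0)" if "r < k t" for t r
   using mult_left_mono[OF suffix_diff_le[OF that assms, of x], of "cmod (wd n (Cs t) 0 r x 0 i)"]
   unfolding norm_mult by (simp only: mult.left_commute norm_ge_zero simp_thms)
 qed auto
 moreover have "T x * (T x^4 / sn) = T x^5 / sn" by (simp add: eval_nat_numeral)
 ultimately show ?thesis by (simp only:)
qed

text \<open>Here the prefixes change and the suffixes stay. The column-preserving estimate for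
  prefixes is what keeps the profile in \<open>i\<close>.\<close>

lemma De_Dee_le:
 assumes "i < n" "j < n"
 shows "cmod (Dm i j x (x((i, j) := 0)) - Dm i j (x((i, j) := 0)) (x((i, j) := 0))) <= T x^5 / sn * (LL i x * RR j x)"
proof -
 let ?x' = "x((i, j) := 0)"
 have "Dm i j x ?x' - Dm i j ?x' ?x' = (\<Sum>t\<in>UNIV. cnj (bt t) * (\<Sum>r<k t.
   (wd n (Cs t) 0 r x 0 i - wd n (Cs t) 0 r ?x' 0 i) * wd n (Cs t) (Suc r) (k t - Suc r) ?x' j 0))"
  unfolding Dm_def by (simp only: right_diff_distrib left_diff_distrib sum_subtractf)
 moreover have "cmod ... <= T x * (T x^3 / sn) * ((\<Sum>t\<in>UNIV. T x * pre n (Cs t) 0 (k t) x 0 i) * RR j x)"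
  unfolding RR_def
 proof (rule weighted_sum_le)
  fix t
  show "(\<Sum>r<k t. pre n (Cs t) 0 (k t) x 0 i) <= T x * pre n (Cs t) 0 (k t) x 0 i"
   using k_le_T[of t x] by (simp add: mult_right_mono)
  fix r assume r: "r < k t"
  have "cmod (wd n (Cs t) 0 r x 0 i - wd n (Cs t) 0 r ?x' 0 i) <= T x^2 / sn * pre n (Cs t) 0 r x 0 i"
   by (rule wd_diff_col_le[OF ctrl CsK]) (use assms r k(2)[of t] in auto)
  also have "... <= T x^2 / sn * pre n (Cs t) 0 (k t) x 0 i"
   using r by (intro mult_left_mono pre_mono) auto
  finally have "cmod ((wd n (Cs t) 0 r x 0 i - wd n (Cs t) 0 r ?x' 0 i) * wd n (Cs t) (Suc r) (k t - Suc r) ?x' j 0)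
   <= (T x^2 / sn * pre n (Cs t) 0 (k t) x 0 i) * (T x * env n (Cs t) 1 (k t - 1) x j 0)"
   unfolding norm_mult by (intro mult_mono suffix_update_le r assms) (auto intro!: mult_nonneg_nonneg)
  also have "... = T x^3 / sn * (pre n (Cs t) 0 (k t) x 0 i * env n (Cs t) 1 (k t - 1) x j 0)" by (simp add: eval_nat_numeral mult_ac)
  finally show "cmod ((wd n (Cs t) 0 r x 0 i - wd n (Cs t) 0 r ?x' 0 i) * wd n (Cs t) (Suc r) (k t - Suc r) ?x' j 0)
   <= T x^3 / sn * (pre n (Cs t) 0 (k t) x 0 i * env n (Cs t) 1 (k t - 1) x j 0)" .
 qed auto
 moreover have "(\<Sum>t\<in>UNIV. T x * pre n (Cs t) 0 (k t) x 0 i) = T x * LL i x"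
  unfolding LL_def by (simp add: sum_distrib_left)
 moreover have "T x * (T x^3 / sn) * (T x * LL i x * RR j x) = T x^5 / sn * (LL i x * RR j x)" by (simp add: eval_nat_numeral mult_ac)
 ultimately show ?thesis by (simp only:)
qed

lemma D_update_le:
 assumes "i < n" "j < n"
 shows "cmod (Dm i j x x - Dm i j (x((i, j) := 0)) (x((i, j) := 0))) <= T x^6 / sn * (LL i x * RR j x)"
proof -
 let ?x' = "x((i, j) := 0)"
 have "cmod (Dm i j x x - Dm i j ?x' ?x') <= cmod (Dm i j x x - Dm i j x ?x') + cmod (Dm i j x ?x' - Dm i j ?x' ?x')"
  using norm_triangle_ineq[of "Dm i j x x - Dm i j x ?x'" "Dm i j x ?x' - Dm i j ?x' ?x'"] by (simp only: add_diff_eq diff_add_cancel)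
 also have "... <= 2 * (T x^5 / sn * (LL i x * RR j x))"
  using D_De_le[OF assms, of x] De_Dee_le[OF assms, of x] by linarith
 also have "... <= T x * (T x^5 / sn * (LL i x * RR j x))"
  using T2[of x] by (intro mult_right_mono) (auto intro!: mult_nonneg_nonneg)
 also have "... = T x^6 / sn * (LL i x * RR j x)" by (simp add: eval_nat_numeral)
 finally show ?thesis .
qed

lemma Dee_le:
 assumes "i < n" "j < n"
 shows "cmod (Dm i j (x((i, j) := 0)) (x((i, j) := 0))) <= 2 * T x^6 * (LL i x * RR j x)"
proof -
 let ?x' = "x((i, j) := 0)"
 have "cmod (Dm i j ?x' ?x') <= cmod (Dm i j x x) + cmod (Dm i j x x - Dm i j ?x' ?x')"
  using norm_triangle_ineq4[of "Dm i j x x" "Dm i j x x - Dm i j ?x' ?x'"] by simp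
 also have "... <= T x^2 * (LL i x * RR j x) + T x^6 / sn * (LL i x * RR j x)" by (intro add_mono D_le D_update_le assms)
 also have "... <= T x^6 * (LL i x * RR j x) + T x^6 * (LL i x * RR j x)"
 proof (intro add_mono mult_right_mono)
  show "T x^2 <= T x^6" using T1[of x] by (intro power_increasing) auto
  show "T x^6 / sn <= T x^6" using divide_left_mono[of 1 sn "T x^6"] sn by simp
 qed (auto intro!: mult_nonneg_nonneg)
 finally show ?thesis by (simp only: mult_2 distrib_right)
qed

lemma Zw_update:
 assumes "i < n" "j < n"
 shows "(\<Sum>t\<in>UNIV. cnj (bt t) * Zw t x) - (\<Sum>t\<in>UNIV. cnj (bt t) * Zw t (x((i, j) := 0)))
  = x (i, j) * Dm i j x (x((i, j) := 0))"
proof -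
 let ?x' = "x((i, j) := 0)"
 have "Zw t x - Zw t ?x' = x (i, j) * (\<Sum>r<k t. wd n (Cs t) 0 r x 0 i * wd n (Cs t) (Suc r) (k t - Suc r) ?x' j 0)" for t
 proof -
  have rearr: "z * (a * (y / z) * d) = y * (a * d)" if "z \<noteq> 0" for z a y d :: complex
   using that by simp
  have "Zw t x - Zw t ?x' = cor sn * (wd n (Cs t) 0 (k t) x 0 0 - wd n (Cs t) 0 (k t) ?x' 0 0)"
   unfolding Zw_def by (simp only: right_diff_distrib)
  also have "... = (\<Sum>r<k t. x (i, j) * (wd n (Cs t) 0 r x 0 i * wd n (Cs t) (Suc r) (k t - Suc r) ?x' j 0))"
   unfolding wd_perturb[OF assms] sum_distrib_left add_0 by (intro sum.cong refl rearr) (use n in simp)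
  finally show ?thesis by (simp only: sum_distrib_left)
 qed
 then show ?thesis
  unfolding Dm_def sum_subtractf[symmetric] right_diff_distrib[symmetric] by (simp only: sum_distrib_left mult.left_commute)
qed

lemma Ph_update:
 assumes "i < n" "j < n"
 shows "Ph x - Ph (x((i, j) := 0)) = Re (x (i, j) * Dm i j x (x((i, j) := 0)))"
 unfolding Ph_def Zw_update[OF assms, symmetric] by (simp only: minus_complex.sel)

lemma Ph_update_le:
 assumes "i < n" "j < n"
 shows "\<bar>Ph x - Ph (x((i, j) := 0))\<bar> <= T x^3 * (LL i x * RR j x)"
proof -
 have "\<bar>Ph x - Ph (x((i, j) := 0))\<bar> <= cmod (x (i, j)) * cmod (Dm i j x (x((i, j) := 0)))"
  unfolding Ph_update[OF assms] norm_mult[symmetric] by (rule abs_Re_le_cmod)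
 also have "... <= T x * (T x^2 * (LL i x * RR j x))" by (intro mult_mono controlled_coord[OF ctrl] De_le assms) auto
 also have "... = T x^3 * (LL i x * RR j x)" by (simp add: eval_nat_numeral)
 finally show ?thesis .
qed

lemma ep_norm [simp]: "cmod (ep x) = 1" by (simp add: ep_def)

lemma ep_update_le:
 assumes "i < n" "j < n"
 shows "cmod (ep x - ep (x((i, j) := 0))) <= T x^3 * (LL i x * RR j x)"
 unfolding ep_def using iexp_diff_le Ph_update_le[OF assms] order_trans by blast

lemma ep_update_second_le:
 assumes "i < n" "j < n"
 shows "cmod (ep x - ep (x((i, j) := 0)) - \<i> * cor (Re (x (i, j) * Dm i j x x)) * ep x)
  <= T x^6 * (LL i x)^2 * (RR j x)^2 + T x^6 / sn * (LL i x * RR j x)"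
proof -
 let ?x' = "x((i, j) := 0)" and ?e = "x (i, j)"
 have "ep x - ep ?x' - \<i> * cor (Re (?e * Dm i j x x)) * ep x
   = (ep x - ep ?x' - \<i> * cor (Ph x - Ph ?x') * ep x)
    - \<i> * cor (Re (?e * (Dm i j x x - Dm i j x ?x'))) * ep x"
  unfolding Ph_update[OF assms] by (simp only: right_diff_distrib minus_complex.sel of_real_diff left_diff_distrib) simp
 then have "cmod (ep x - ep ?x' - \<i> * cor (Re (?e * Dm i j x x)) * ep x)
  <= cmod (ep x - ep ?x' - \<i> * cor (Ph x - Ph ?x') * ep x)
   + cmod (\<i> * cor (Re (?e * (Dm i j x x - Dm i j x ?x'))) * ep x)" by (simp only: norm_triangle_ineq4)
 also have "cmod (ep x - ep ?x' - \<i> * cor (Ph x - Ph ?x') * ep x) <= (Ph x - Ph ?x')^2"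
  unfolding ep_def by (rule iexp_diff_second_order_le)
 also have "... <= (T x^3 * (LL i x * RR j x))^2"
  using power_mono[OF Ph_update_le[OF assms, of x], of 2] by simp
 also have "... = T x^6 * (LL i x)^2 * (RR j x)^2" by (simp add: power_mult_distrib flip: power_mult)
 also have "cmod (\<i> * cor (Re (?e * (Dm i j x x - Dm i j x ?x'))) * ep x)
   <= cmod ?e * cmod (Dm i j x x - Dm i j x ?x')"
  unfolding norm_mult[symmetric, of ?e] using abs_Re_le_cmod[of "?e * (Dm i j x x - Dm i j x ?x')"]
  by (simp only: norm_mult ep_norm norm_ii norm_of_real mult_1 mult_1_right)
 also have "... <= T x * (T x^5 / sn * (LL i x * RR j x))" by (intro mult_mono controlled_coord[OF ctrl] D_De_le assms) auto
 also have "... = T x^6 / sn * (LL i x * RR j x)" by (simp add: eval_nat_numeral)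
 finally show ?thesis by this simp_all
qed

lemma polybdd_LR: "polybdd Ix (LL i)" "polybdd Ix (RR j)"
proof -
 have "polybdd Ix (\<lambda>x. LL i x)" unfolding LL_def by (intro polybdd_intros polybdd_pre)
 then show "polybdd Ix (LL i)" .
 have "polybdd Ix (\<lambda>x. RR j x)" unfolding RR_def by (intro polybdd_intros polybdd_env)
 then show "polybdd Ix (RR j)" .
qed

lemma polybdd_D: "polybdd Ix (\<lambda>x. Dm i j x x)"
 unfolding Dm_def by (intro polybdd_intros polybdd_wd)

lemma polybdd_Zw: "polybdd Ix (Zw t)"
proof -
 have "polybdd Ix (\<lambda>x. Zw t x)" unfolding Zw_def by (intro polybdd_intros polybdd_wd)
 then show ?thesis .
qed

lemma polybdd_Ph: "polybdd Ix Ph"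
proof -
 have "polybdd Ix (\<lambda>x. Ph x)" unfolding Ph_def by (intro polybdd_intros polybdd_Zw)
 then show ?thesis .
qed

lemma polybdd_ep: "polybdd Ix ep"
proof (rule polybdd_bounded)
 show "ep \<in> borel_measurable (PiM Ix (\<lambda>_. borel))"
  unfolding ep_def using polybdd_measurable[OF polybdd_Ph] by measurable
 show "cmod (ep x) <= 1" for x by simp
qed

end

lemma form_boundD:
 "form_bound n A c ==> cmod (\<Sum>i<n. \<Sum>j<n. a i * A i j * b j) <= c * l2norm n a * l2norm n b"
 unfolding form_bound_def by blast

lemma sum_pair_product:
 fixes f g :: "nat => complex"
 shows "(\<Sum>e\<in>{..<n} \<times> {..<n}. f (fst e) * g (snd e)) = (\<Sum>i<n. f i) * (\<Sum>j<n. g j)"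
 by (simp add: sum_product sum.cartesian_product case_prod_unfold)

section \<open>Expansion in one entry for a word of length at least two\<close>

context stein_entries
begin

context
 fixes t0 :: 't
 assumes k2: "2 <= k t0"
begin

abbreviation C0 :: "nat => cmat" where "C0 \<equiv> Cs t0"
abbreviation m0 :: nat where "m0 \<equiv> k t0 - 1"

definition vv :: "nat => complex" where "vv i = C0 0 0 i"
text \<open>Column 0 of what follows the first factor of the word. It still contains a factor
  because \<open>2 <= k t0\<close>, and this makes its entries small.\<close>

definition yy :: "nat => arr => complex" where "yy j x = wd n C0 1 m0 x j 0"
definition AA :: "nat => nat => arr => real" where "AA j i x = pre n C0 1 m0 x j i"
text \<open>The derivative of \<open>yy j\<close> in the entry \<open>(i, j)\<close>.\<close>

definition BB :: "nat => nat => arr => complex" where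
 "BB i j x = 1 / cor sn * (\<Sum>r<m0. wd n C0 1 r x j i * wd n C0 (Suc (1 + r)) (m0 - Suc r) x j 0)"

lemma m0: "0 < m0" "m0 <= M" "Suc m0 = k t0" using k2 k(2)[of t0] by auto

lemma AA_nonneg [simp]: "0 <= AA j i x" by (simp add: AA_def)

lemma AA_le: "i < n ==> j < n ==> AA j i x <= T x^2"
 unfolding AA_def by (rule pre_le[OF ctrl CsK m0(2)])

lemma AA_L2: "j < n ==> L2_set (\<lambda>i. AA j i x) {..<n} <= T x^2"
 unfolding AA_def by (rule pre_L2[OF ctrl CsK m0(2)])

lemma env_le_RR: "env n C0 1 m0 x j 0 <= RR j x"
 unfolding RR_def by (rule member_le_sum[of t0 UNIV "\<lambda>t. env n (Cs t) 1 (k t - 1) x j 0"]) auto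

lemma pre_le_LL: "pre n C0 0 (k t0) x 0 i <= LL i x"
 unfolding LL_def by (rule member_le_sum[of t0 UNIV "\<lambda>t. pre n (Cs t) 0 (k t) x 0 i"]) auto

lemma yy_le: "cmod (yy j x) <= RR j x"
 unfolding yy_def by (rule order_trans[OF wd_le_env env_le_RR])

lemma vv_le: "cmod (vv i) <= LL i x"
proof -
 have "cmod (wd n C0 0 0 x 0 i) <= pre n C0 0 (k t0) x 0 i" by (rule wd_le_pre) (use k2 in simp)
 then show ?thesis using pre_le_LL[of x i] by (simp add: vv_def)
qed

lemma suffix_eq: "r < m0 ==> wd n C0 (Suc (1 + r)) (m0 - Suc r) x j b = wd n C0 (Suc (Suc r)) (k t0 - Suc (Suc r)) x j b" by simp

lemma suf_le: "r < m0 ==> cmod (wd n C0 (Suc (1 + r)) (m0 - Suc r) x j 0) <= RR j x"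
 unfolding suffix_eq by (rule order_trans[OF suffix_le env_le_RR]) simp

lemma suf_diff_le:
 assumes "r < m0" "i < n" "j < n"
 shows "cmod (wd n C0 (Suc (1 + r)) (m0 - Suc r) x j 0 - wd n C0 (Suc (1 + r)) (m0 - Suc r) (x((i, j) := 0)) j 0)
  <= T x^4 / sn * RR j x"
 unfolding suffix_eq[OF assms(1)] by (rule order_trans[OF suffix_diff_le mult_left_mono[OF env_le_RR]]) (use assms in auto)

lemma yy_update_le:
 assumes "i < n" "j < n"
 shows "cmod (yy j x - yy j (x((i, j) := 0))) <= T x^2 / sn * (AA j i x * RR j x)"
proof -
 have "cmod (yy j x - yy j (x((i, j) := 0))) <= T x^2 / sn * (pre n C0 1 m0 x j i * env n C0 1 m0 x j 0)"
  unfolding yy_def by (rule wd_diff_le[OF ctrl CsK m0(2) assms n])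
 also have "... <= T x^2 / sn * (AA j i x * RR j x)"
  unfolding AA_def by (intro mult_left_mono env_le_RR) auto
 finally show ?thesis .
qed

lemma BB_le: "cmod (BB i j x) <= 1 / sn * (AA j i x * RR j x)"
proof -
 have "cmod (\<Sum>r<m0. wd n C0 1 r x j i * wd n C0 (Suc (1 + r)) (m0 - Suc r) x j 0)
   <= (\<Sum>r<m0. cmod (wd n C0 1 r x j i) * RR j x)"
  by (rule order_trans[OF norm_sum], rule sum_mono, unfold norm_mult, rule mult_left_mono[OF suf_le]) auto
 also have "... = AA j i x * RR j x" by (simp only: AA_def pre_def sum_distrib_right)
 finally show ?thesis unfolding BB_def norm_mult using sn by (simp add: norm_divide divide_right_mono)
qed

lemma yy_second_le:
 assumes "i < n" "j < n"
 shows "cmod (yy j x - yy j (x((i, j) := 0)) - x (i, j) * BB i j x) <= T x^5 / real n * (AA j i x * RR j x)"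
proof -
 let ?x' = "x((i, j) := 0)" and ?h = "x (i, j) / cor sn"
 let ?w = "\<lambda>r x. wd n C0 (Suc (1 + r)) (m0 - Suc r) x j 0"
 have h: "cmod ?h <= T x / sn"
  using controlled_coord[OF ctrl[of x] assms] sn by (simp add: norm_divide divide_right_mono)
 have "yy j x - yy j ?x' - x (i, j) * BB i j x
   = (\<Sum>r<m0. wd n C0 1 r x j i * ?h * ?w r ?x') - (\<Sum>r<m0. wd n C0 1 r x j i * ?h * ?w r x)"
 proof -
  have rearr: "a * (1 / z * (d * e)) = d * (a / z) * e" for a z d e :: complex by simp
  have "x (i, j) * BB i j x = (\<Sum>r<m0. wd n C0 1 r x j i * ?h * ?w r x)"
   unfolding BB_def sum_distrib_left by (intro sum.cong refl rearr)
  then show ?thesis unfolding yy_def wd_perturb[OF assms] by (simp only:)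
 qed
 also have "... = (\<Sum>r<m0. wd n C0 1 r x j i * ?h * (?w r ?x' - ?w r x))" by (simp only: sum_subtractf right_diff_distrib)
 finally have eq: "yy j x - yy j ?x' - x (i, j) * BB i j x = (\<Sum>r<m0. wd n C0 1 r x j i * ?h * (?w r ?x' - ?w r x))" .
 have "cmod (yy j x - yy j ?x' - x (i, j) * BB i j x) <= (\<Sum>r<m0. cmod (wd n C0 1 r x j i) * (T x / sn) * (T x^4 / sn * RR j x))"
  unfolding eq
 proof (rule order_trans[OF norm_sum], rule sum_mono)
  fix r assume "r \<in> {..<m0}"
  then have r: "r < m0" by simp
  have "cmod (?w r ?x' - ?w r x) <= T x^4 / sn * RR j x"
   using suf_diff_le[OF r assms, of x] by (simp only: norm_minus_commute)
  then show "cmod (wd n C0 1 r x j i * ?h * (?w r ?x' - ?w r x)) <= cmod (wd n C0 1 r x j i) * (T x / sn) * (T x^4 / sn * RR j x)"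
   unfolding norm_mult using sn by (intro mult_mono order_refl h) (auto intro!: mult_nonneg_nonneg)
 qed
 also have "... = T x^5 / real n * (AA j i x * RR j x)"
  unfolding AA_def pre_def sum_distrib_left sum_distrib_right
  by (intro sum.cong refl) (use sn in \<open>simp add: eval_nat_numeral flip: real_sqrt_mult\<close>)
 finally show ?thesis .
qed

lemma BB_update_le:
 assumes "i < n" "j < n"
 shows "cmod (BB i j x - BB i j (x((i, j) := 0))) <= T x^9 / real n * (AA j i x * RR j x)"
proof -
 let ?x' = "x((i, j) := 0)"
 let ?w = "\<lambda>r x. wd n C0 (Suc (1 + r)) (m0 - Suc r) x j 0" and ?A = "\<lambda>r x. wd n C0 1 r x j i"
 have dA: "cmod (?A r x - ?A r ?x') <= T x^2 / sn * AA j i x" if "r < m0" for r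
 proof -
  have "cmod (?A r x - ?A r ?x') <= T x^2 / sn * pre n C0 1 r x j i" by (rule wd_diff_col_le[OF ctrl CsK]) (use that m0 assms in auto)
  also have "... <= T x^2 / sn * AA j i x"
   unfolding AA_def using that by (intro mult_left_mono pre_mono) auto
  finally show ?thesis .
 qed
 have TT: "T x^2 / sn <= T x^2" using divide_left_mono[of 1 sn "T x^2"] sn by simp
 have Ae: "cmod (?A r ?x') <= 2 * T x^2 * AA j i x" if r: "r < m0" for r
 proof -
  have "cmod (?A r ?x') <= cmod (?A r x) + cmod (?A r x - ?A r ?x')"
   using norm_triangle_ineq4[of "?A r x" "?A r x - ?A r ?x'"] by simp
  also have "... <= 1 * AA j i x + T x^2 * AA j i x"
   using wd_le_pre[OF r, of n C0 1 x j i] order_trans[OF dA[OF r] mult_right_mono[OF TT]] by (intro add_mono) (auto simp: AA_def)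
  also have "... <= T x^2 * AA j i x + T x^2 * AA j i x"
   using T1[of x] by (intro add_right_mono mult_right_mono) (auto simp: one_le_power)
  finally show ?thesis by simp
 qed
 have "BB i j x - BB i j ?x' = 1 / cor sn * (\<Sum>r<m0. (?A r x - ?A r ?x') * ?w r x + ?A r ?x' * (?w r x - ?w r ?x'))"
 proof -
  have "a * b - c * d = (a - c) * b + c * (b - d)" for a b c d :: complex by (simp add: algebra_simps)
  then show ?thesis unfolding BB_def right_diff_distrib[symmetric] sum_subtractf[symmetric] by (simp only:)
 qed
 then have "cmod (BB i j x - BB i j ?x') = 1 / sn * cmod (\<Sum>r<m0. (?A r x - ?A r ?x') * ?w r x + ?A r ?x' * (?w r x - ?w r ?x'))"
  using sn(1) by (simp only: norm_mult norm_divide norm_one norm_of_real abs_of_pos)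
 also have "... <= 1 / sn * (\<Sum>r<m0. 3 * T x^6 / sn * (AA j i x * RR j x))"
 proof (rule mult_left_mono, rule order_trans[OF norm_sum], rule sum_mono)
  fix r assume "r \<in> {..<m0}"
  then have r: "r < m0" by simp
  have "cmod ((?A r x - ?A r ?x') * ?w r x + ?A r ?x' * (?w r x - ?w r ?x'))
    <= cmod (?A r x - ?A r ?x') * cmod (?w r x) + cmod (?A r ?x') * cmod (?w r x - ?w r ?x')"
   by (rule order_trans[OF norm_triangle_ineq]) (simp only: norm_mult)
  also have "... <= (T x^2 / sn * AA j i x) * RR j x + (2 * T x^2 * AA j i x) * (T x^4 / sn * RR j x)"
   by (intro add_mono mult_mono dA Ae suf_le suf_diff_le r assms) auto
  also have "... = (T x^2 + 2 * T x^6) / sn * (AA j i x * RR j x)" by (simp add: algebra_simps add_divide_distrib flip: power_add)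
  also have "... <= 3 * T x^6 / sn * (AA j i x * RR j x)"
   using power_increasing[of 2 6 "T x"] T1[of x] by (intro mult_right_mono divide_right_mono) auto
  finally show "cmod ((?A r x - ?A r ?x') * ?w r x + ?A r ?x' * (?w r x - ?w r ?x')) <= 3 * T x^6 / sn * (AA j i x * RR j x)" .
 qed (use sn in auto)
 also have "... = real m0 * (3 * T x^6 / real n * (AA j i x * RR j x))"
  using sn by (simp flip: real_sqrt_mult)
 also have "... <= T x * (T x^2 * T x^6 / real n * (AA j i x * RR j x))"
 proof (intro mult_mono divide_right_mono mult_right_mono)
  show "real m0 <= T x" using k_le_T[of t0 x] by simp
  show "3 <= T x^2" using power_mono[OF T2[of x], of 2] by simp
 qed auto
 also have "... = T x^9 / real n * (AA j i x * RR j x)" by (simp add: eval_nat_numeral)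
 finally show ?thesis .
qed

text \<open>In the first summand \<open>|yy j|\<close> is kept, since no factor
  \<open>1 / sqrt n\<close> is available there and its smallness is the only source of decay. In the
  second one it has been replaced by the profile \<open>RR j\<close>. The same holds for
  \<open>q2\<close>.\<close>

definition q1 :: "nat => nat => arr => real" where
 "q1 i j x = T x^6 * (cmod (yy j x) * ((LL i x)^2 * (RR j x)^2)) + 2 * T x^6 / sn * (LL i x * (RR j x)^2)
   + T x^5 / real n * (AA j i x * RR j x)"

definition q2 :: "nat => nat => arr => real" where
 "q2 i j x = T x^5 * (cmod (yy j x) * ((LL i x)^2 * (RR j x)^2)) + 4 * T x^10 / sn * (LL i x * (RR j x)^2)
   + T x^9 / real n * (AA j i x * RR j x)"

text \<open>With \<open>HH\<close>, the derivatives of \<open>yy j * ep\<close> in the entry and in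
  its conjugate. The real part in the phase gives each of them one half, hence
  \<open>\<i> / 2\<close>; the words depend on the unconjugated entry only, so \<open>BB\<close>
  occurs here and not in \<open>HH\<close>.\<close>

definition GG :: "nat => nat => arr => complex" where
 "GG i j x = (\<i> / 2 * yy j x * Dm i j x x + BB i j x) * ep x"

definition HH :: "nat => nat => arr => complex" where
 "HH i j x = \<i> / 2 * yy j x * cnj (Dm i j x x) * ep x"

lemma expansion_le:
 assumes "i < n" "j < n"
 shows "cmod (yy j x * ep x - yy j (x((i, j) := 0)) * ep (x((i, j) := 0)) - x (i, j) * GG i j x - cnj (x (i, j)) * HH i j x) <= q1 i j x"
proof -
 let ?x' = "x((i, j) := 0)" and ?e = "x (i, j)"
 have Re2: "?e * (\<i> / 2 * yy j x * Dm i j x x) + cnj ?e * (\<i> / 2 * yy j x * cnj (Dm i j x x))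
   = yy j x * (\<i> * cor (Re (?e * Dm i j x x)))"
 proof -
  have "?e * Dm i j x x + cnj (?e * Dm i j x x) = 2 * cor (Re (?e * Dm i j x x))"
   using complex_add_cnj[of "?e * Dm i j x x"] by simp
  then have "\<i> / 2 * yy j x * (?e * Dm i j x x + cnj (?e * Dm i j x x)) = \<i> / 2 * yy j x * (2 * cor (Re (?e * Dm i j x x)))" by (simp only:)
  then show ?thesis by (simp add: algebra_simps)
 qed
 have alg: "Y * E - Y' * E' - u * ((a + B) * E) - w * (d * E)
   = Y * (E - E' - R * E) + (Y - Y' - u * B) * E' - u * B * (E - E')"
  if "u * a + w * d = Y * R" for Y Y' E E' u a B w d R :: complex
 proof -
  have "Y * E - Y' * E' - u * ((a + B) * E) - w * (d * E) = Y * E - Y' * E' - (u * a + w * d) * E - u * B * E" by (simp add: algebra_simps)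
  then show ?thesis unfolding that by (simp add: algebra_simps)
 qed
 have "yy j x * ep x - yy j ?x' * ep ?x' - ?e * GG i j x - cnj ?e * HH i j x
   = yy j x * (ep x - ep ?x' - \<i> * cor (Re (?e * Dm i j x x)) * ep x)
    + (yy j x - yy j ?x' - ?e * BB i j x) * ep ?x' - ?e * BB i j x * (ep x - ep ?x')"
  unfolding GG_def HH_def by (rule alg[OF Re2])
 then have "cmod (yy j x * ep x - yy j ?x' * ep ?x' - ?e * GG i j x - cnj ?e * HH i j x)
   <= cmod (yy j x) * cmod (ep x - ep ?x' - \<i> * cor (Re (?e * Dm i j x x)) * ep x)
    + cmod (yy j x - yy j ?x' - ?e * BB i j x) + cmod ?e * cmod (BB i j x) * cmod (ep x - ep ?x')"
  by (simp only:) (intro order_trans[OF norm_triangle_ineq4] add_mono order_trans[OF norm_triangle_ineq],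
    simp_all only: norm_mult ep_norm mult_1_right order_refl)
 also have "... <= (T x^6 * (cmod (yy j x) * ((LL i x)^2 * (RR j x)^2)) + T x^6 / sn * (LL i x * (RR j x)^2))
   + T x^5 / real n * (AA j i x * RR j x) + T x^6 / sn * (LL i x * (RR j x)^2)"
 proof (intro add_mono yy_second_le assms)
  have "cmod (yy j x) * cmod (ep x - ep ?x' - \<i> * cor (Re (?e * Dm i j x x)) * ep x)
   <= cmod (yy j x) * (T x^6 * (LL i x)^2 * (RR j x)^2 + T x^6 / sn * (LL i x * RR j x))" by (intro mult_left_mono ep_update_second_le assms) auto
  also have "... = T x^6 * (cmod (yy j x) * ((LL i x)^2 * (RR j x)^2)) + cmod (yy j x) * (T x^6 / sn * (LL i x * RR j x))" by (simp add: algebra_simps)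
  also have "cmod (yy j x) * (T x^6 / sn * (LL i x * RR j x)) <= RR j x * (T x^6 / sn * (LL i x * RR j x))"
   by (intro mult_right_mono yy_le) (auto intro!: mult_nonneg_nonneg)
  also have "... = T x^6 / sn * (LL i x * (RR j x)^2)" by (simp add: power2_eq_square)
  finally show "cmod (yy j x) * cmod (ep x - ep ?x' - \<i> * cor (Re (?e * Dm i j x x)) * ep x)
    <= T x^6 * (cmod (yy j x) * ((LL i x)^2 * (RR j x)^2)) + T x^6 / sn * (LL i x * (RR j x)^2)" by this simp_all
  have "cmod ?e * cmod (BB i j x) * cmod (ep x - ep ?x') <= T x * (1 / sn * (T x^2 * RR j x)) * (T x^3 * (LL i x * RR j x))"
   using sn by (intro mult_mono controlled_coord[OF ctrl] order_trans[OF BB_le] ep_update_le assms mult_left_mono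
     mult_right_mono AA_le) (auto intro!: mult_nonneg_nonneg)
  also have "... = T x^6 / sn * (LL i x * (RR j x)^2)" by (simp add: eval_nat_numeral)
  finally show "cmod ?e * cmod (BB i j x) * cmod (ep x - ep ?x') <= T x^6 / sn * (LL i x * (RR j x)^2)" .
 qed
 also have "... = q1 i j x" unfolding q1_def by (simp add: algebra_simps)
 finally show ?thesis .
qed

lemma coefficient_update_le:
 assumes "i < n" "j < n"
 shows "cmod (yy j x * Dm i j x x * ep x - yy j (x((i, j) := 0)) * Dm i j (x((i, j) := 0)) (x((i, j) := 0)) * ep (x((i, j) := 0)))
  <= T x^5 * (cmod (yy j x) * ((LL i x)^2 * (RR j x)^2)) + 3 * T x^10 / sn * (LL i x * (RR j x)^2)"
proof -
 let ?x' = "x((i, j) := 0)"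
 let ?D = "Dm i j x x" and ?D' = "Dm i j ?x' ?x'" and ?y = "yy j x" and ?y' = "yy j ?x'"
 have alg: "Y * D * E - Y' * D' * E' = Y * D * (E - E') + Y * (D - D') * E' + (Y - Y') * D' * E'"
  for Y Y' D D' E E' :: complex by (simp add: algebra_simps)
 have "cmod (?y * ?D * ep x - ?y' * ?D' * ep ?x')
   <= cmod ?y * cmod ?D * cmod (ep x - ep ?x') + cmod ?y * cmod (?D - ?D') + cmod (?y - ?y') * cmod ?D'"
  unfolding alg by (intro order_trans[OF norm_triangle_ineq] add_mono, simp_all only: norm_mult ep_norm mult_1_right order_refl)
 also have "... <= cmod ?y * (T x^2 * (LL i x * RR j x)) * (T x^3 * (LL i x * RR j x))
   + RR j x * (T x^6 / sn * (LL i x * RR j x)) + (T x^2 / sn * (T x^2 * RR j x)) * (2 * T x^6 * (LL i x * RR j x))"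
  by (intro add_mono mult_mono D_le yy_le ep_update_le D_update_le Dee_le order_trans[OF yy_update_le] assms
    order_refl mult_left_mono mult_right_mono AA_le) (auto intro!: mult_nonneg_nonneg)
 also have "... = T x^5 * (cmod ?y * ((LL i x)^2 * (RR j x)^2)) + (T x^6 + 2 * T x^10) / sn * (LL i x * (RR j x)^2)"
  by (simp add: eval_nat_numeral algebra_simps add_divide_distrib)
 also have "... <= T x^5 * (cmod ?y * ((LL i x)^2 * (RR j x)^2)) + 3 * T x^10 / sn * (LL i x * (RR j x)^2)"
  using power_increasing[of 6 10 "T x"] T1[of x] by (intro add_left_mono mult_right_mono divide_right_mono) auto
 finally show ?thesis .
qed

lemma q_nonneg: "0 <= T x^5 * (cmod (yy j x) * ((LL i x)^2 * (RR j x)^2))" "0 <= 3 * T x^10 / sn * (LL i x * (RR j x)^2)"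
 by (auto intro!: mult_nonneg_nonneg)

lemma GG_update_le:
 assumes "i < n" "j < n"
 shows "cmod (GG i j x - GG i j (x((i, j) := 0))) <= q2 i j x"
proof -
 let ?x' = "x((i, j) := 0)"
 have alg: "(h * Y * D + B) * E - (h * Y' * D' + B') * E' = h * (Y * D * E - Y' * D' * E') + (B * (E - E') + (B - B') * E')"
  for h Y Y' D D' E E' B B' :: complex by (simp add: algebra_simps)
 have "cmod (GG i j x - GG i j ?x')
   <= 1/2 * cmod (yy j x * Dm i j x x * ep x - yy j ?x' * Dm i j ?x' ?x' * ep ?x')
    + (cmod (BB i j x) * cmod (ep x - ep ?x') + cmod (BB i j x - BB i j ?x'))"
  unfolding GG_def alg
  by (intro order_trans[OF norm_triangle_ineq] add_mono, simp_all only: norm_mult norm_divide norm_ii norm_numeral ep_norm mult_1_right order_refl)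
 also have "... <= (T x^5 * (cmod (yy j x) * ((LL i x)^2 * (RR j x)^2)) + 3 * T x^10 / sn * (LL i x * (RR j x)^2))
   + (T x^10 / sn * (LL i x * (RR j x)^2) + T x^9 / real n * (AA j i x * RR j x))"
 proof (intro add_mono BB_update_le assms)
  show "1/2 * cmod (yy j x * Dm i j x x * ep x - yy j ?x' * Dm i j ?x' ?x' * ep ?x')
    <= T x^5 * (cmod (yy j x) * ((LL i x)^2 * (RR j x)^2)) + 3 * T x^10 / sn * (LL i x * (RR j x)^2)"
   using coefficient_update_le[OF assms, of x] q_nonneg(1)[of x j i] q_nonneg(2)[of x i j] by linarith
  have "cmod (BB i j x) * cmod (ep x - ep ?x') <= (1 / sn * (T x^2 * RR j x)) * (T x^3 * (LL i x * RR j x))"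
   using sn by (intro mult_mono order_trans[OF BB_le] ep_update_le assms mult_left_mono
     mult_right_mono AA_le) (auto intro!: mult_nonneg_nonneg)
  also have "... = T x^5 / sn * (LL i x * (RR j x)^2)" by (simp add: eval_nat_numeral)
  also have "... <= T x^10 / sn * (LL i x * (RR j x)^2)"
   using T1[of x] by (intro mult_right_mono divide_right_mono power_increasing) (auto intro!: mult_nonneg_nonneg)
  finally show "cmod (BB i j x) * cmod (ep x - ep ?x') <= T x^10 / sn * (LL i x * (RR j x)^2)" .
 qed
 also have "... = q2 i j x" unfolding q2_def by (simp add: algebra_simps)
 finally show ?thesis .
qed

lemma HH_update_le:
 assumes "i < n" "j < n"
 shows "cmod (HH i j x - HH i j (x((i, j) := 0))) <= q2 i j x"
proof -
 let ?x' = "x((i, j) := 0)"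
 let ?D = "cnj (Dm i j x x)" and ?D' = "cnj (Dm i j ?x' ?x')" and ?y = "yy j x" and ?y' = "yy j ?x'"
 have cD: "cmod (?D - ?D') = cmod (Dm i j x x - Dm i j ?x' ?x')" by (metis complex_cnj_diff complex_mod_cnj)
 have alg: "h * Y * D * E - h * Y' * D' * E' = h * (Y * D * (E - E') + Y * (D - D') * E' + (Y - Y') * D' * E')"
  for h Y Y' D D' E E' :: complex by (simp add: algebra_simps)
 have "cmod (HH i j x - HH i j ?x')
   <= 1/2 * (cmod ?y * cmod (Dm i j x x) * cmod (ep x - ep ?x') + cmod ?y * cmod (Dm i j x x - Dm i j ?x' ?x') + cmod (?y - ?y') * cmod (Dm i j ?x' ?x'))"
  unfolding HH_def alg norm_mult[of "\<i> / 2"] cD[symmetric] by (intro mult_mono order_trans[OF norm_triangle_ineq] add_mono,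
    simp_all only: norm_mult norm_divide norm_ii norm_numeral ep_norm mult_1_right order_refl complex_mod_cnj) auto
 also have "... <= 1/2 * (cmod ?y * (T x^2 * (LL i x * RR j x)) * (T x^3 * (LL i x * RR j x))
   + RR j x * (T x^6 / sn * (LL i x * RR j x)) + (T x^2 / sn * (T x^2 * RR j x)) * (2 * T x^6 * (LL i x * RR j x)))"
  by (intro add_mono mult_mono D_le yy_le ep_update_le D_update_le Dee_le order_trans[OF yy_update_le] assms
    order_refl mult_left_mono mult_right_mono AA_le) (auto intro!: mult_nonneg_nonneg add_nonneg_nonneg)
 also have "... = 1/2 * (T x^5 * (cmod ?y * ((LL i x)^2 * (RR j x)^2)) + (T x^6 + 2 * T x^10) / sn * (LL i x * (RR j x)^2))"
  by (simp add: eval_nat_numeral algebra_simps add_divide_distrib)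
 also have "... <= 1/2 * (T x^5 * (cmod ?y * ((LL i x)^2 * (RR j x)^2)) + 3 * T x^10 / sn * (LL i x * (RR j x)^2))"
  using power_increasing[of 6 10 "T x"] T1[of x] by (intro mult_left_mono add_left_mono mult_right_mono divide_right_mono) auto
 also have "... <= q2 i j x"
 proof -
  have lin: "1/2 * (a + 3 * z) <= a + 4 * z + w" if "0 <= a" "0 <= z" "0 <= w" for a z w :: real
   using that by simp
  have e: "3 * T x^10 / sn * (LL i x * (RR j x)^2) = 3 * (T x^10 / sn * (LL i x * (RR j x)^2))"
   "4 * T x^10 / sn * (LL i x * (RR j x)^2) = 4 * (T x^10 / sn * (LL i x * (RR j x)^2))" by simp_all
  show ?thesis unfolding q2_def e by (rule lin) (auto intro!: mult_nonneg_nonneg)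
 qed
 finally show ?thesis .
qed

text \<open>After summation the first error is a power of \<open>T\<close> times the maximum of
  \<open>|yy j|\<close>. The maximum is traded for terms with the free level \<open>\<eta>\<close>
  and the sum of fourth powers over \<open>\<eta>^3\<close>, whose expectation is under control;
  \<open>\<eta>\<close> is chosen only when \<open>n\<close> varies.\<close>

lemma error_sum_le:
 assumes eta: "0 < \<eta>"
 shows "(\<Sum>(i, j)\<in>Ix. cmod (vv i) * (T x * q1 i j x + 4 * (T x)^2 * q2 i j x))
  <= 25 * \<eta> * T x^44 + \<eta> + (\<Sum>j<n. (cmod (yy j x))^4) / \<eta>^3 + 23 * T x^24 / sn"
proof -
 let ?T = "T x" and ?L = "\<lambda>i. LL i x" and ?R = "\<lambda>j. RR j x" and ?y = "\<lambda>j. cmod (yy j x)"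
 define W where "W = 25 * \<eta> * ?T^44 + \<eta> + (\<Sum>j<n. (?y j)^4) / \<eta>^3"
 have pw: "?T^a * ?T^b = ?T^(a + b)" for a b by (simp add: power_add)
 have summand: "cmod (vv i) * (?T * q1 i j x + 4 * ?T^2 * q2 i j x)
   <= 5 * ?T^7 * ((?L i)^3 * (?y j * (?R j)^2)) + 18 * ?T^12 / sn * ((?L i)^2 * (?R j)^2) + 5 * ?T^11 / real n * (?R j * (?L i * AA j i x))"
  if "i < n" "j < n" for i j
 proof -
  have "0 <= ?T * q1 i j x + 4 * ?T^2 * q2 i j x"
   unfolding q1_def q2_def by (auto intro!: mult_nonneg_nonneg add_nonneg_nonneg)
  then have "cmod (vv i) * (?T * q1 i j x + 4 * ?T^2 * q2 i j x) <= ?L i * (?T * q1 i j x + 4 * ?T^2 * q2 i j x)" by (intro mult_right_mono vv_le)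
  also have "... = 5 * ?T^7 * ((?L i)^3 * (?y j * (?R j)^2)) + (2 * ?T^7 + 16 * ?T^12) / sn * ((?L i)^2 * (?R j)^2)
    + (?T^6 + 4 * ?T^11) / real n * (?R j * (?L i * AA j i x))"
   unfolding q1_def q2_def by (simp add: eval_nat_numeral algebra_simps add_divide_distrib)
  also have "... <= 5 * ?T^7 * ((?L i)^3 * (?y j * (?R j)^2)) + 18 * ?T^12 / sn * ((?L i)^2 * (?R j)^2)
    + 5 * ?T^11 / real n * (?R j * (?L i * AA j i x))"
   using power_increasing[of 7 12 ?T] power_increasing[of 6 11 ?T] T1[of x]
   by (intro add_mono mult_right_mono divide_right_mono order_refl) (auto intro!: mult_nonneg_nonneg)
  finally show ?thesis .
 qed
 have L2: "(\<Sum>i<n. (?L i)^2) <= ?T^6" using sum_squares_le_L2_set[OF LL_L2[of x]] by (simp flip: power_mult)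
 have R2: "(\<Sum>j<n. (?R j)^2) <= ?T^6" using sum_squares_le_L2_set[OF RR_L2[of x]] by (simp flip: power_mult)
 have L3: "(\<Sum>i<n. (?L i)^3) <= ?T^9"
 proof -
  have "(\<Sum>i<n. (?L i)^3) <= (\<Sum>i<n. ?T^3 * (?L i)^2)"
  proof (rule sum_mono)
   fix i assume "i \<in> {..<n}"
   then have "?L i * (?L i)^2 <= ?T^3 * (?L i)^2" by (intro mult_right_mono LL_le) auto
   moreover have "(?L i)^3 = ?L i * (?L i)^2" by (simp add: eval_nat_numeral)
   ultimately show "(?L i)^3 <= ?T^3 * (?L i)^2" by (simp only:)
  qed
  also have "... = ?T^3 * (\<Sum>i<n. (?L i)^2)" by (simp add: sum_distrib_left)
  also have "... <= ?T^3 * ?T^6" by (intro mult_left_mono L2) auto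
  finally show ?thesis by (simp add: pw)
 qed
 \<comment> \<open>22 = 7 + 9 + 6: the power in front, the bound on the sum of \<open>LL^3\<close>
   and the bound on the sum of \<open>RR^2\<close>.\<close>
 have yW: "5 * ?T^22 * ?y j <= W" if "j < n" for j
 proof -
  \<comment> \<open>Two Young inequalities in a row, \<open>a m <= \<eta> a^2 + m^2 / \<eta>\<close>
    and \<open>m^2 / \<eta> <= \<eta> + m^4 / \<eta>^3\<close>. They turn the first power of
    \<open>|yy j|\<close> into a fourth power.\<close>
  have amgm: "a * m <= \<eta> * a^2 + \<eta> + m^4 / \<eta>^3" if "0 <= m" for a m :: real
  proof -
   have "a * m <= \<eta> * a^2 + m^2 / \<eta>"
   proof -
    have "0 <= (\<eta> * a - m)^2 + \<eta> * \<eta> * a^2 + m^2" by simp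
    then have "2 * (\<eta> * (a * m)) <= 2 * (\<eta> * \<eta> * a^2 + m^2)" by (simp add: power2_eq_square algebra_simps)
    then show ?thesis using eta by (simp add: field_simps power2_eq_square)
   qed
   moreover have "m^2 / \<eta> <= \<eta> + m^4 / \<eta>^3"
   proof -
    have "0 <= (\<eta>^2 - m^2)^2 + \<eta>^2 * \<eta>^2 + m^2 * m^2" by simp
    then have "\<eta>^2 * m^2 <= \<eta>^4 + m^4" by (simp add: power2_eq_square power4_eq_xxxx algebra_simps)
    then have "\<eta>^2 * m^2 / \<eta>^3 <= (\<eta>^4 + m^4) / \<eta>^3" using eta by (intro divide_right_mono) auto
    then show ?thesis using eta by (simp add: add_divide_distrib eval_nat_numeral)
   qed
   ultimately show ?thesis by linarith
  qed
  have "5 * ?T^22 * ?y j <= \<eta> * (5 * ?T^22)^2 + \<eta> + (?y j)^4 / \<eta>^3" by (rule amgm) simp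
  also have "... <= W"
  proof -
   have "(?y j)^4 <= (\<Sum>j<n. (?y j)^4)" using that by (intro member_le_sum) auto
   then have "(?y j)^4 / \<eta>^3 <= (\<Sum>j<n. (?y j)^4) / \<eta>^3" using eta by (intro divide_right_mono) auto
   moreover have "\<eta> * (5 * ?T^22)^2 = 25 * \<eta> * ?T^44" by (simp add: power_mult_distrib flip: power_mult)
   ultimately show ?thesis unfolding W_def by linarith
  qed
  finally show ?thesis .
 qed
 have W0: "0 <= W" unfolding W_def using eta by (auto intro!: add_nonneg_nonneg divide_nonneg_nonneg sum_nonneg)
 have "(\<Sum>(i, j)\<in>Ix. cmod (vv i) * (?T * q1 i j x + 4 * ?T^2 * q2 i j x))
  <= (\<Sum>(i, j)\<in>Ix. 5 * ?T^7 * ((?L i)^3 * (?y j * (?R j)^2)) + 18 * ?T^12 / sn * ((?L i)^2 * (?R j)^2)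
    + 5 * ?T^11 / real n * (?R j * (?L i * AA j i x)))" by (rule sum_pair_mono[OF summand])
 also have "... = 5 * ?T^7 * ((\<Sum>i<n. (?L i)^3) * (\<Sum>j<n. ?y j * (?R j)^2))
   + 18 * ?T^12 / sn * ((\<Sum>i<n. (?L i)^2) * (\<Sum>j<n. (?R j)^2)) + 5 * ?T^11 / real n * (\<Sum>j<n. ?R j * (\<Sum>i<n. ?L i * AA j i x))"
 proof -
  have 3: "(\<Sum>i<n. \<Sum>j<n. 5 * ?T^11 / real n * (?R j * (?L i * AA j i x))) = 5 * ?T^11 / real n * (\<Sum>j<n. ?R j * (\<Sum>i<n. ?L i * AA j i x))"
   by (subst sum.swap) (simp only: sum_distrib_left)
  show ?thesis unfolding sum_product sum.cartesian_product[symmetric] sum.distrib 3 by (simp only: sum_distrib_left)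
 qed
 also have "... <= W + 18 * ?T^12 / sn * (?T^6 * ?T^6) + 5 * ?T^11 / real n * (sn * ?T^3 * (?T^3 * ?T^2))"
 proof (intro add_mono)
  have "5 * ?T^7 * ((\<Sum>i<n. (?L i)^3) * (\<Sum>j<n. ?y j * (?R j)^2)) <= 5 * ?T^7 * (?T^9 * (\<Sum>j<n. ?y j * (?R j)^2))"
   by (intro mult_left_mono mult_right_mono L3) (auto intro!: sum_nonneg)
  also have "... = (\<Sum>j<n. 5 * ?T^16 * ?y j * (?R j)^2)" by (simp add: sum_distrib_left mult.assoc pw flip: power_add)
  also have "... <= (\<Sum>j<n. W / ?T^6 * (?R j)^2)"
  proof (rule sum_mono, rule mult_right_mono)
   fix j assume "j \<in> {..<n}"
   then have "5 * (?T^16 * ?T^6) * ?y j <= W" using yW[of j] by (simp add: pw)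
   moreover have "5 * ?T^16 * ?y j * ?T^6 = 5 * (?T^16 * ?T^6) * ?y j" by (simp only: mult_ac)
   ultimately have "5 * ?T^16 * ?y j * ?T^6 <= W" by (simp only:)
   then show "5 * ?T^16 * ?y j <= W / ?T^6" using T1[of x] by (simp add: pos_le_divide_eq)
  qed auto
  also have "... = W / ?T^6 * (\<Sum>j<n. (?R j)^2)" by (simp add: sum_distrib_left)
  also have "... <= W / ?T^6 * ?T^6" by (intro mult_left_mono R2) (use W0 in auto)
  also have "... = W" using T1[of x] by simp
  finally show "5 * ?T^7 * ((\<Sum>i<n. (?L i)^3) * (\<Sum>j<n. ?y j * (?R j)^2)) <= W" .
  show "18 * ?T^12 / sn * ((\<Sum>i<n. (?L i)^2) * (\<Sum>j<n. (?R j)^2)) <= 18 * ?T^12 / sn * (?T^6 * ?T^6)"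
   by (intro mult_left_mono mult_mono L2 R2) (auto intro!: sum_nonneg)
  have "(\<Sum>j<n. ?R j * (\<Sum>i<n. ?L i * AA j i x)) <= (\<Sum>j<n. ?R j * (?T^3 * ?T^2))"
   by (intro sum_mono mult_left_mono sum_mult_le_L2_set LL_L2 AA_L2) auto
  also have "... = (\<Sum>j<n. ?R j) * (?T^3 * ?T^2)" by (simp add: sum_distrib_right)
  also have "... <= (sn * ?T^3) * (?T^3 * ?T^2)" by (intro mult_right_mono sum_le_sqrt_L2_set RR_L2) auto
  finally show "5 * ?T^11 / real n * (\<Sum>j<n. ?R j * (\<Sum>i<n. ?L i * AA j i x)) <= 5 * ?T^11 / real n * (sn * ?T^3 * (?T^3 * ?T^2))"
   by (intro mult_left_mono) auto
 qed
 also have "... = W + 18 * ?T^24 / sn + 5 * ?T^19 / sn"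
 proof -
  have "5 * ?T^11 / real n * (sn * ?T^3 * (?T^3 * ?T^2)) = 5 * (?T^11 * ?T^3 * ?T^3 * ?T^2) / sn"
  proof -
   have "5 * ?T^11 / real n * (sn * ?T^3 * (?T^3 * ?T^2)) = (sn / real n) * (5 * (?T^11 * ?T^3 * ?T^3 * ?T^2))" by simp
   also have "sn / real n = 1 / sn" using sqrt_divide_self_eq[of "real n"] by (simp add: divide_inverse)
   finally show ?thesis by simp
  qed
  then show ?thesis by (simp add: pw)
 qed
 also have "... <= W + 23 * ?T^24 / sn"
 proof -
  have "5 * ?T^19 / sn <= 5 * ?T^24 / sn"
   using power_increasing[of 19 24 ?T] T1[of x] by (intro divide_right_mono) auto
  then show ?thesis by simp
 qed
 finally show ?thesis unfolding W_def .
qed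

lemma Zw_expand: "Zw t0 x = (\<Sum>(i, j)\<in>Ix. vv i * (x (i, j) * yy j x))"
proof -
 have "Zw t0 x = cor sn * wd n C0 0 (Suc m0) x 0 0"
  unfolding Zw_def m0(3) ..
 also have "... = (\<Sum>(i, j)\<in>Ix. cor sn * (C0 0 0 i / cor sn * (x (i, j) * wd n C0 (Suc 0) m0 x j 0)))"
  unfolding wd_Suc_expand[OF CsK] by (simp only: sum_distrib_left case_prod_unfold)
 also have "... = (\<Sum>(i, j)\<in>Ix. vv i * (x (i, j) * yy j x))" by (rule sum_pair_cong) (use n in \<open>simp add: vv_def yy_def\<close>)
 finally show ?thesis .
qed

lemma polybdd_yy: "polybdd Ix (yy j)"
proof -
 have "polybdd Ix (\<lambda>x. yy j x)" unfolding yy_def by (rule polybdd_wd)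
 then show ?thesis .
qed

lemma polybdd_BB: "polybdd Ix (BB i j)"
proof -
 have "polybdd Ix (\<lambda>x. BB i j x)" unfolding BB_def by (intro polybdd_intros polybdd_wd)
 then show ?thesis .
qed

lemma polybdd_GH: "polybdd Ix (GG i j)" "polybdd Ix (HH i j)"
proof -
 have "polybdd Ix (\<lambda>x. GG i j x)" unfolding GG_def by (intro polybdd_intros polybdd_yy polybdd_D polybdd_BB polybdd_ep)
 then show "polybdd Ix (GG i j)" .
 have "polybdd Ix (\<lambda>x. HH i j x)" unfolding HH_def by (intro polybdd_intros polybdd_yy polybdd_D polybdd_ep)
 then show "polybdd Ix (HH i j)" .
qed

lemma polybdd_q: "polybdd Ix (q1 i j)" "polybdd Ix (q2 i j)"
proof -
 have A: "polybdd Ix (\<lambda>x. AA j i x)" unfolding AA_def by (rule polybdd_pre)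
 have "polybdd Ix (\<lambda>x. q1 i j x)" unfolding q1_def by (intro polybdd_intros polybdd_yy polybdd_LR A pT)
 then show "polybdd Ix (q1 i j)" .
 have "polybdd Ix (\<lambda>x. q2 i j x)" unfolding q2_def by (intro polybdd_intros polybdd_yy polybdd_LR A pT)
 then show "polybdd Ix (q2 i j)" .
qed

text \<open>The fourth moment of each \<open>yy j\<close> is of order \<open>1 / n^2\<close>, so the
  sum over \<open>j\<close> is of order \<open>1 / n\<close>. At least two factors in the word are
  essential here: otherwise \<open>yy\<close> would be deterministic.\<close>

lemma stein_first:
 assumes eta: "0 < \<eta>"
 shows "cmod ((\<integral>x. Zw t0 x * ep x \<partial>Pr Ix) - (\<Sum>(i, j)\<in>Ix. vv i * (\<rho> * (\<integral>x. GG i j x \<partial>Pr Ix) + (\<integral>x. HH i j x \<partial>Pr Ix))))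
  <= 26 * \<eta> * ET 44 + 76 * ET 32 / (real n * \<eta>^3) + 23 * ET 24 / sn"
proof -
 define q where "q = (\<lambda>i j x. T x * q1 i j x + 4 * (T x)^2 * q2 i j x)"
 have pq: "polybdd Ix (q i j)" for i j unfolding q_def by (intro polybdd_intros polybdd_q pT)
 have n0: "0 < real n" using n by simp
 have pye: "polybdd Ix (\<lambda>x. yy j x * ep x)" for j by (intro polybdd_mult polybdd_yy polybdd_ep)
 have "(\<integral>x. Zw t0 x * ep x \<partial>Pr Ix) = (\<integral>x. (\<Sum>(i, j)\<in>Ix. vv i * (x (i, j) * (yy j x * ep x))) \<partial>Pr Ix)"
  unfolding Zw_expand by (simp only: sum_distrib_right case_prod_unfold mult.assoc)
 also have "... = (\<Sum>(i, j)\<in>Ix. (\<integral>x. vv i * (x (i, j) * (yy j x * ep x)) \<partial>Pr Ix))"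
  unfolding case_prod_unfold
  by (rule Bochner_Integration.integral_sum) (intro integrable_polybdd finI polybdd_mult polybdd_const polybdd_coord pye, auto)
 also have "... = (\<Sum>(i, j)\<in>Ix. vv i * (\<integral>x. x (i, j) * (yy j x * ep x) \<partial>Pr Ix))" by (simp only: integral_mult_right_zero)
 finally have "(\<integral>x. Zw t0 x * ep x \<partial>Pr Ix) - (\<Sum>(i, j)\<in>Ix. vv i * (\<rho> * (\<integral>x. GG i j x \<partial>Pr Ix) + (\<integral>x. HH i j x \<partial>Pr Ix)))
   = (\<Sum>(i, j)\<in>Ix. vv i * ((\<integral>x. x (i, j) * (yy j x * ep x) \<partial>Pr Ix) - \<rho> * (\<integral>x. GG i j x \<partial>Pr Ix) - (\<integral>x. HH i j x \<partial>Pr Ix)))"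
  by (simp only: case_prod_unfold sum_subtractf[symmetric] right_diff_distrib[symmetric] diff_diff_eq)
 then have "cmod ((\<integral>x. Zw t0 x * ep x \<partial>Pr Ix) - (\<Sum>(i, j)\<in>Ix. vv i * (\<rho> * (\<integral>x. GG i j x \<partial>Pr Ix) + (\<integral>x. HH i j x \<partial>Pr Ix))))
   = cmod (\<Sum>(i, j)\<in>Ix. vv i * ((\<integral>x. x (i, j) * (yy j x * ep x) \<partial>Pr Ix) - \<rho> * (\<integral>x. GG i j x \<partial>Pr Ix) - (\<integral>x. HH i j x \<partial>Pr Ix)))"
  by (simp only:)
 also have "... <= (\<Sum>(i, j)\<in>Ix. cmod (vv i) * (\<integral>x. q i j x \<partial>Pr Ix))"
 proof (rule norm_sum_pair_le)
  fix i j assume ij: "i < n" "j < n"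
  then have e: "(i, j) \<in> Ix" by simp
  have "cmod ((\<integral>x. x (i, j) * (yy j x * ep x) \<partial>Pr Ix) - \<rho> * (\<integral>x. GG i j x \<partial>Pr Ix) - (\<integral>x. HH i j x \<partial>Pr Ix)) <= (\<integral>x. q i j x \<partial>Pr Ix)"
   unfolding q_def by (rule integration_by_parts[OF finI e pye polybdd_GH polybdd_q pT expansion_le[OF ij] GG_update_le[OF ij]
     HH_update_le[OF ij] controlled_coord[OF ctrl ij] T1])
  then show "cmod (vv i * ((\<integral>x. x (i, j) * (yy j x * ep x) \<partial>Pr Ix) - \<rho> * (\<integral>x. GG i j x \<partial>Pr Ix) - (\<integral>x. HH i j x \<partial>Pr Ix)))
    <= cmod (vv i) * (\<integral>x. q i j x \<partial>Pr Ix)"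
   unfolding norm_mult[of "vv i"] by (intro mult_left_mono) auto
 qed
 also have "... = (\<integral>x. (\<Sum>(i, j)\<in>Ix. cmod (vv i) * q i j x) \<partial>Pr Ix)"
  unfolding case_prod_unfold by (subst Bochner_Integration.integral_sum) (auto intro!: integrable_polybdd finI polybdd_mult polybdd_const pq)
 also have "... <= (\<integral>x. 25 * \<eta> * T x^44 + \<eta> + (\<Sum>j<n. (cmod (yy j x))^4) / \<eta>^3 + 23 * T x^24 / sn \<partial>Pr Ix)"
 proof (rule integral_mono_polybdd[OF finI])
  show "polybdd Ix (\<lambda>x. \<Sum>(i, j)\<in>Ix. cmod (vv i) * q i j x)"
   unfolding case_prod_unfold by (intro polybdd_sum polybdd_mult polybdd_const pq)
  show "polybdd Ix (\<lambda>x. 25 * \<eta> * T x^44 + \<eta> + (\<Sum>j<n. (cmod (yy j x))^4) / \<eta>^3 + 23 * T x^24 / sn)"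
   by (intro polybdd_intros pT polybdd_yy)
  show "(\<Sum>(i, j)\<in>Ix. cmod (vv i) * q i j x) <= 25 * \<eta> * T x^44 + \<eta> + (\<Sum>j<n. (cmod (yy j x))^4) / \<eta>^3 + 23 * T x^24 / sn" for x
   unfolding q_def by (rule error_sum_le[OF eta])
 qed
 also have "... = 25 * \<eta> * ET 44 + \<eta> + (\<Sum>j<n. \<integral>x. (cmod (yy j x))^4 \<partial>Pr Ix) / \<eta>^3 + 23 * ET 24 / sn"
 proof -
  interpret P: prob_space "Pr Ix" by (rule prob_space_Pr)
  have i: "integrable (Pr Ix) (\<lambda>x. 25 * \<eta> * T x^44)" "integrable (Pr Ix) (\<lambda>x. \<eta>)"
   "integrable (Pr Ix) (\<lambda>x. (\<Sum>j<n. (cmod (yy j x))^4) / \<eta>^3)" "integrable (Pr Ix) (\<lambda>x. 23 * T x^24 / sn)"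
   "\<And>j. integrable (Pr Ix) (\<lambda>x. (cmod (yy j x))^4)" by (intro integrable_polybdd finI polybdd_intros pT polybdd_yy)+
  have s: "(\<integral>x. (\<Sum>j<n. (cmod (yy j x))^4) / \<eta>^3 \<partial>Pr Ix) = (\<Sum>j<n. \<integral>x. (cmod (yy j x))^4 \<partial>Pr Ix) / \<eta>^3"
   by (simp add: i(5))
  show ?thesis
   using i by (simp add: Bochner_Integration.integral_add s P.prob_space) (simp add: ET_def)
 qed
 also have "... <= 25 * \<eta> * ET 44 + \<eta> * ET 44 + (real n * (76 * ET 32 / (real n)^2)) / \<eta>^3 + 23 * ET 24 / sn"
 proof (intro add_mono divide_right_mono order_refl)
  show "\<eta> <= \<eta> * ET 44" using eta ET_ge1[of 44] by simp
  have "(\<Sum>j<n. \<integral>x. (cmod (yy j x))^4 \<partial>Pr Ix) <= (\<Sum>j<n. 76 * ET 32 / (real n)^2)"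
   unfolding yy_def by (intro sum_mono wd_moment4[OF CsK m0(1,2)] n) auto
  then show "(\<Sum>j<n. \<integral>x. (cmod (yy j x))^4 \<partial>Pr Ix) <= real n * (76 * ET 32 / (real n)^2)" by simp
 qed (use eta in auto)
 also have "... = 26 * \<eta> * ET 44 + 76 * ET 32 / (real n * \<eta>^3) + 23 * ET 24 / sn"
  using n0 eta by (simp add: power2_eq_square)
 finally show ?thesis .
qed

text \<open>Contribution of the derivative of the phase, one for each type of conjugation;
  \<open>VV\<close> below comes from the derivative of the word itself.\<close>

definition UU :: "bool => arr => complex" where
 "UU \<kappa> x = (\<Sum>(i, j)\<in>Ix. vv i * yy j x * kap \<kappa> (Dm i j x x))"

definition VV :: "arr => complex" where
 "VV x = (\<Sum>(i, j)\<in>Ix. vv i * BB i j x)"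

lemma vv_norm: "l2norm n vv <= T x"
 using form_bound_row[OF form_bound_mono[OF CsK controlled_ge(3)[OF ctrl]] n, of t0 0 x] unfolding vv_def .

text \<open>For each \<open>r\<close> the double sum is a bilinear form of a transposed prefix
  between two bounded vectors. Nothing is lost in \<open>n\<close>, and the factor
  \<open>1 / sqrt n\<close> inside \<open>BB\<close> remains.\<close>

lemma VV_le: "cmod (VV x) <= 1 / sn * T x^4"
proof -
 have "VV x = 1 / cor sn * (\<Sum>r<m0. \<Sum>i<n. \<Sum>j<n. vv i * wd n C0 1 r x j i * wd n C0 (Suc (1 + r)) (m0 - Suc r) x j 0)"
 proof -
  have "VV x = (\<Sum>i<n. \<Sum>j<n. \<Sum>r<m0. 1 / cor sn * (vv i * wd n C0 1 r x j i * wd n C0 (Suc (1 + r)) (m0 - Suc r) x j 0))"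
   unfolding VV_def BB_def sum.cartesian_product[symmetric] sum_distrib_left by (intro sum.cong refl) (simp only: mult_ac)
  also have "... = (\<Sum>r<m0. \<Sum>i<n. \<Sum>j<n. 1 / cor sn * (vv i * wd n C0 1 r x j i * wd n C0 (Suc (1 + r)) (m0 - Suc r) x j 0))"
   by (rule trans[OF sum.cong[OF refl sum.swap] sum.swap])
  finally show ?thesis by (simp only: sum_distrib_left)
 qed
 then have "cmod (VV x) = 1 / sn * cmod (\<Sum>r<m0. \<Sum>i<n. \<Sum>j<n. vv i * wd n C0 1 r x j i * wd n C0 (Suc (1 + r)) (m0 - Suc r) x j 0)"
  using sn(1) by (simp only: norm_mult norm_divide norm_one norm_of_real abs_of_pos)
 also have "... <= 1 / sn * (\<Sum>r<m0. T x^3)"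
 proof (rule mult_left_mono, rule order_trans[OF norm_sum], rule sum_mono)
  fix r assume "r \<in> {..<m0}"
  then have r: "r <= M" "m0 - Suc r <= M" using m0(2) by auto
  have "form_bound n (\<lambda>i j. wd n C0 1 r x j i) (T x)" by (rule form_bound_transpose[OF controlled_form_bound[OF ctrl CsK r(1)]])
  then have "cmod (\<Sum>i<n. \<Sum>j<n. vv i * wd n C0 1 r x j i * wd n C0 (Suc (1 + r)) (m0 - Suc r) x j 0)
    <= T x * l2norm n vv * l2norm n (\<lambda>j. wd n C0 (Suc (1 + r)) (m0 - Suc r) x j 0)" by (rule form_boundD)
  also have "... <= T x * T x * T x" by (intro mult_mono mult_left_mono vv_norm form_bound_col[OF controlled_form_bound[OF ctrl CsK r(2)] n]) auto
  finally show "cmod (\<Sum>i<n. \<Sum>j<n. vv i * wd n C0 1 r x j i * wd n C0 (Suc (1 + r)) (m0 - Suc r) x j 0) <= T x^3"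
   by (simp add: power3_eq_cube)
 qed (use sn in auto)
 also have "... = 1 / sn * (real m0 * T x^3)" by simp
 also have "... <= 1 / sn * (T x * T x^3)"
  using k_le_T[of t0 x] sn by (intro mult_left_mono mult_right_mono) auto
 finally show ?thesis by (simp add: eval_nat_numeral)
qed

lemma polybdd_UV: "polybdd Ix (UU \<kappa>)" "polybdd Ix VV"
proof -
 have "polybdd Ix (\<lambda>x. UU \<kappa> x)" unfolding UU_def case_prod_unfold
  by (intro polybdd_sum polybdd_mult polybdd_const polybdd_yy polybdd_kap polybdd_D)
 then show "polybdd Ix (UU \<kappa>)" .
 have "polybdd Ix (\<lambda>x. VV x)" unfolding VV_def case_prod_unfold by (intro polybdd_sum polybdd_mult polybdd_const polybdd_BB)
 then show "polybdd Ix VV" .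
qed

lemma stein_second:
 "(\<Sum>(i, j)\<in>Ix. vv i * (\<rho> * (\<integral>x. GG i j x \<partial>Pr Ix) + (\<integral>x. HH i j x \<partial>Pr Ix)))
  = (\<integral>x. (\<i> / 2 * (\<rho> * UU False x + UU True x) + \<rho> * VV x) * ep x \<partial>Pr Ix)"
proof -
 have "(\<Sum>(i, j)\<in>Ix. vv i * (\<rho> * (\<integral>x. GG i j x \<partial>Pr Ix) + (\<integral>x. HH i j x \<partial>Pr Ix)))
  = (\<Sum>(i, j)\<in>Ix. (\<integral>x. vv i * (\<rho> * GG i j x + HH i j x) \<partial>Pr Ix))"
 proof (rule sum_pair_cong)
  fix i j
  have "(\<integral>x. \<rho> * GG i j x + HH i j x \<partial>Pr Ix) = \<rho> * (\<integral>x. GG i j x \<partial>Pr Ix) + (\<integral>x. HH i j x \<partial>Pr Ix)"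
   by (subst Bochner_Integration.integral_add) (auto intro!: integrable_polybdd finI polybdd_mult polybdd_const polybdd_GH)
  then show "vv i * (\<rho> * (\<integral>x. GG i j x \<partial>Pr Ix) + (\<integral>x. HH i j x \<partial>Pr Ix)) = (\<integral>x. vv i * (\<rho> * GG i j x + HH i j x) \<partial>Pr Ix)"
   by simp
 qed
 also have "... = (\<integral>x. (\<Sum>(i, j)\<in>Ix. vv i * (\<rho> * GG i j x + HH i j x)) \<partial>Pr Ix)"
  unfolding case_prod_unfold by (rule Bochner_Integration.integral_sum[symmetric])
    (intro integrable_polybdd finI polybdd_mult polybdd_add polybdd_const polybdd_GH)
 also have "... = (\<integral>x. (\<i> / 2 * (\<rho> * UU False x + UU True x) + \<rho> * VV x) * ep x \<partial>Pr Ix)"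
 proof (rule Bochner_Integration.integral_cong[OF refl])
  fix x
  have "(\<Sum>(i, j)\<in>Ix. vv i * (\<rho> * GG i j x + HH i j x))
   = (\<Sum>(i, j)\<in>Ix. \<i> / 2 * \<rho> * ep x * (vv i * yy j x * kap False (Dm i j x x)) + \<i> / 2 * ep x * (vv i * yy j x * kap True (Dm i j x x))
     + \<rho> * ep x * (vv i * BB i j x))"
   unfolding GG_def HH_def kap_def by (rule sum_pair_cong) (simp add: algebra_simps)
  also have "... = \<i> / 2 * \<rho> * ep x * UU False x + \<i> / 2 * ep x * UU True x + \<rho> * ep x * VV x"
   unfolding UU_def VV_def by (simp only: case_prod_unfold sum.distrib sum_distrib_left)
  finally show "(\<Sum>(i, j)\<in>Ix. vv i * (\<rho> * GG i j x + HH i j x)) = (\<i> / 2 * (\<rho> * UU False x + UU True x) + \<rho> * VV x) * ep x"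
   by (simp add: algebra_simps)
 qed
 finally show ?thesis .
qed

text \<open>The sum over all entries factors into a left contraction with \<open>vv\<close> and a
  right inner product with \<open>yy\<close>.\<close>

lemma UU_expand:
 "UU \<kappa> x = (\<Sum>t\<in>UNIV. kap \<kappa> (cnj (bt t)) * (\<Sum>r<k t. (\<Sum>i<n. vv i * kap \<kappa> (wd n (Cs t) 0 r x 0 i))
   * (\<Sum>j<n. yy j x * kap \<kappa> (wd n (Cs t) (Suc r) (k t - Suc r) x j 0))))"
proof -
 let ?l = "\<lambda>t r i. wd n (Cs t) 0 r x 0 i" and ?r = "\<lambda>t r j. wd n (Cs t) (Suc r) (k t - Suc r) x j 0"
 have "UU \<kappa> x = (\<Sum>e\<in>Ix. \<Sum>t\<in>UNIV. \<Sum>r<k t. kap \<kappa> (cnj (bt t)) * ((vv (fst e) * kap \<kappa> (?l t r (fst e))) * (yy (snd e) x * kap \<kappa> (?r t r (snd e)))))"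
  unfolding UU_def Dm_def case_prod_unfold kap_sum kap_mult sum_distrib_left by (intro sum.cong refl) (simp only: mult_ac)
 also have "... = (\<Sum>t\<in>UNIV. \<Sum>r<k t. \<Sum>e\<in>Ix. kap \<kappa> (cnj (bt t)) * ((vv (fst e) * kap \<kappa> (?l t r (fst e))) * (yy (snd e) x * kap \<kappa> (?r t r (snd e)))))"
  by (subst sum.swap, intro sum.cong refl, rule sum.swap)
 also have "... = (\<Sum>t\<in>UNIV. \<Sum>r<k t. kap \<kappa> (cnj (bt t)) * ((\<Sum>i<n. vv i * kap \<kappa> (?l t r i)) * (\<Sum>j<n. yy j x * kap \<kappa> (?r t r j))))"
  by (simp only: sum_distrib_left[symmetric] sum_pair_product[where f = "\<lambda>i. vv i * kap \<kappa> (?l _ _ i)" and g = "\<lambda>j. yy j x * kap \<kappa> (?r _ _ j)"])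
 finally show ?thesis by (simp only: sum_distrib_left)
qed

definition sig :: "bool => 't => complex" where
 "sig \<kappa> t = (\<Sum>i<n. vv i * kap \<kappa> (Cs t 0 0 i)) * glim C0 (Cs t) 0 0 \<kappa> 1 m0 1 (k t - 1)"

text \<open>For \<open>r = 0\<close> the left factor is deterministic and the right one concentrates
  by \<open>gram_L1\<close>. For \<open>r >= 1\<close> the left factor is an entry of a contracted
  word, of order \<open>1 / sqrt n\<close> in mean square, and the right one is bounded by
  \<open>T^2\<close>.\<close>

lemma UU_L1:
 assumes \<beta>: "\<And>t. cmod (bt t) <= \<beta>"
 shows "(\<integral>x. cmod (UU \<kappa> x - (\<Sum>t\<in>UNIV. kap \<kappa> (cnj (bt t)) * sig \<kappa> t)) \<partial>Pr Ix)
  <= real CARD('t) * \<beta> * (K * (9 + (gerr K M m0)^2) + 2 * real M) * ET 32 / sn"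
proof -
 have \<beta>0: "0 <= \<beta>" using \<beta>[of t0] norm_ge_zero order_trans by blast
 define u where "u = (\<lambda>t r x. \<Sum>i<n. vv i * kap \<kappa> (wd n (Cs t) 0 r x 0 i))"
 define z where "z = (\<lambda>t r x. \<Sum>j<n. yy j x * kap \<kappa> (wd n (Cs t) (Suc r) (k t - Suc r) x j 0))"
 define g where "g = (\<lambda>t x. gram n \<kappa> C0 1 m0 0 (Cs t) 1 (k t - 1) 0 x)"
 let ?l = "\<lambda>t. glim C0 (Cs t) 0 0 \<kappa> 1 m0 1 (k t - 1)"
 have z0: "z t 0 x = g t x" for t x unfolding z_def g_def gram_def yy_def by simp
 have u0: "u t 0 x = (\<Sum>i<n. vv i * kap \<kappa> (Cs t 0 0 i))" for t x by (simp add: u_def)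
 have u0_le: "cmod (u t 0 x) <= K" for t x
 proof -
  have "cmod (u t 0 x) <= l2norm n vv * l2norm n (\<lambda>i. kap \<kappa> (Cs t 0 0 i))"
   unfolding u0 by (rule cmod_sum_mult_le_l2norm)
  also have "... <= K0 * K0"
   unfolding l2norm_kap vv_def using K0 by (intro mult_mono form_bound_row[OF Cs n]) auto
  finally show ?thesis using K0 by linarith
 qed
 have z_le: "cmod (z t r x) <= T x^2" if "r < k t" for t r x
 proof -
  have "cmod (z t r x) <= l2norm n (\<lambda>j. yy j x) * l2norm n (\<lambda>j. kap \<kappa> (wd n (Cs t) (Suc r) (k t - Suc r) x j 0))"
   unfolding z_def by (rule cmod_sum_mult_le_l2norm)
  also have "... <= T x * T x"
   unfolding l2norm_kap yy_def using m0(2) k(2)[of t] that by (intro mult_mono form_bound_col[OF controlled_form_bound[OF ctrl CsK] n]) auto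
  finally show ?thesis by (simp add: power2_eq_square)
 qed
 have pu: "polybdd Ix (u t r)" for t r unfolding u_def by (intro polybdd_intros polybdd_kap polybdd_wd)
 have pg: "polybdd Ix (g t)" for t unfolding g_def using polybdd_gram by simp
 have path: "cmod (UU \<kappa> x - (\<Sum>t\<in>UNIV. kap \<kappa> (cnj (bt t)) * sig \<kappa> t))
   <= (\<Sum>t\<in>UNIV. \<beta> * (K * cmod (g t x - ?l t) + (\<Sum>r\<in>{1..<k t}. T x^2 * cmod (u t r x))))" for x
 proof -
  have "UU \<kappa> x - (\<Sum>t\<in>UNIV. kap \<kappa> (cnj (bt t)) * sig \<kappa> t)
    = (\<Sum>t\<in>UNIV. kap \<kappa> (cnj (bt t)) * (u t 0 x * (g t x - ?l t) + (\<Sum>r\<in>{1..<k t}. u t r x * z t r x)))"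
  proof -
   have pt: "(\<Sum>r<k t. u t r x * z t r x) - sig \<kappa> t = u t 0 x * (g t x - ?l t) + (\<Sum>r\<in>{1..<k t}. u t r x * z t r x)" for t
   proof -
    have sp: "{..<k t} = insert 0 {1..<k t}" using k(1)[of t] by auto
    have "(\<Sum>r<k t. u t r x * z t r x) = u t 0 x * z t 0 x + (\<Sum>r\<in>{1..<k t}. u t r x * z t r x)"
     unfolding sp by (subst sum.insert) auto
    then show ?thesis unfolding sig_def z0 u0 by (simp add: algebra_simps)
   qed
   have "UU \<kappa> x = (\<Sum>t\<in>UNIV. kap \<kappa> (cnj (bt t)) * (\<Sum>r<k t. u t r x * z t r x))"
    unfolding UU_expand u_def z_def ..
   then have "UU \<kappa> x - (\<Sum>t\<in>UNIV. kap \<kappa> (cnj (bt t)) * sig \<kappa> t)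
     = (\<Sum>t\<in>UNIV. kap \<kappa> (cnj (bt t)) * ((\<Sum>r<k t. u t r x * z t r x) - sig \<kappa> t))"
    by (simp only: sum_subtractf right_diff_distrib)
   then show ?thesis by (simp only: pt)
  qed
  then have "cmod (UU \<kappa> x - (\<Sum>t\<in>UNIV. kap \<kappa> (cnj (bt t)) * sig \<kappa> t))
    = cmod (\<Sum>t\<in>UNIV. kap \<kappa> (cnj (bt t)) * (u t 0 x * (g t x - ?l t) + (\<Sum>r\<in>{1..<k t}. u t r x * z t r x)))" by simp
  also have "... <= (\<Sum>t\<in>UNIV. \<beta> * (K * cmod (g t x - ?l t) + (\<Sum>r\<in>{1..<k t}. T x^2 * cmod (u t r x))))"
  proof (rule order_trans[OF norm_sum], rule sum_mono)
   fix t
   have "cmod (u t 0 x * (g t x - ?l t) + (\<Sum>r\<in>{1..<k t}. u t r x * z t r x))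
     <= cmod (u t 0 x) * cmod (g t x - ?l t) + (\<Sum>r\<in>{1..<k t}. cmod (z t r x) * cmod (u t r x))"
    by (rule order_trans[OF norm_triangle_ineq], rule add_mono, simp add: norm_mult,
      rule order_trans[OF norm_sum], simp add: norm_mult mult.commute)
   also have "... <= K * cmod (g t x - ?l t) + (\<Sum>r\<in>{1..<k t}. T x^2 * cmod (u t r x))"
    by (intro add_mono mult_right_mono u0_le sum_mono z_le) auto
   finally show "cmod (kap \<kappa> (cnj (bt t)) * (u t 0 x * (g t x - ?l t) + (\<Sum>r\<in>{1..<k t}. u t r x * z t r x)))
     <= \<beta> * (K * cmod (g t x - ?l t) + (\<Sum>r\<in>{1..<k t}. T x^2 * cmod (u t r x)))"
    unfolding norm_mult[of "kap \<kappa> _"] using \<beta>[of t] by (intro mult_mono) (auto simp: \<beta>0)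
  qed
  finally show ?thesis .
 qed
 have Eu: "(\<integral>x. T x^2 * cmod (u t r x) \<partial>Pr Ix) <= 2 * ET 32 / sn" if r: "r \<in> {1..<k t}" for t r
 proof -
  have pt: "T x^2 * cmod (u t r x) <= 1/2 / sn * T x^4 + sn / 2 * (cmod (u t r x))^2" for x
  proof -
   have amgm: "2 * (sn * (a * c)) <= a^2 + sn * sn * c^2" for a c :: real
    using zero_le_power2[of "a - sn * c"] by (simp add: power2_eq_square algebra_simps)
   have "a * c <= 1/2 / sn * a^2 + sn / 2 * c^2" for a c :: real
    using amgm[of a c] sn(1) by (simp add: field_simps power2_eq_square)
   from this[of "T x^2" "cmod (u t r x)"] show ?thesis by (simp flip: power_mult)
  qed
  have "(\<integral>x. T x^2 * cmod (u t r x) \<partial>Pr Ix) <= (\<integral>x. 1/2 / sn * T x^4 + sn / 2 * (cmod (u t r x))^2 \<partial>Pr Ix)"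
   by (intro integral_mono_polybdd[OF finI _ _ pt] polybdd_intros pu pT)
  also have "... = (\<integral>x. 1/2 / sn * T x^4 \<partial>Pr Ix) + (\<integral>x. sn / 2 * (cmod (u t r x))^2 \<partial>Pr Ix)"
   by (intro Bochner_Integration.integral_add integrable_polybdd finI polybdd_intros pu pT)
  also have "... = 1/2 / sn * ET 4 + sn / 2 * (\<integral>x. (cmod (u t r x))^2 \<partial>Pr Ix)" by (simp only: integral_mult_right_zero ET_def)
  also have "... <= 1/2 / sn * ET 32 + sn / 2 * (2 * ET 16 / real n)"
  proof (intro add_mono mult_left_mono ET_mono)
   show "(\<integral>x. (cmod (u t r x))^2 \<partial>Pr Ix) <= 2 * ET 16 / real n"
    unfolding u_def vv_def using r k(2)[of t] by (intro contracted_right_moment2 Cs n) auto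
  qed (use sn in auto)
  also have "sn / 2 * (2 * ET 16 / real n) = ET 16 / sn"
  proof -
   have "sn / real n = 1 / sn" using sqrt_divide_self_eq[of "real n"] by (simp add: divide_inverse)
   moreover have "sn / 2 * (2 * ET 16 / real n) = sn / real n * ET 16" by simp
   ultimately show ?thesis by (simp only: times_divide_eq_left mult_1)
  qed
  also have "1/2 / sn * ET 32 + ET 16 / sn <= 1 / sn * ET 32 + 1 / sn * ET 32"
  proof (intro add_mono mult_right_mono)
   show "1/2 / sn <= 1 / sn" using sn(1) by (intro divide_right_mono) auto
   show "ET 16 / sn <= 1 / sn * ET 32" using sn(1) ET_mono[of 16 32] by (simp add: divide_right_mono)
  qed (use ET_ge1[of 32] in auto)
  finally show ?thesis by simp
 qed
 have "(\<integral>x. cmod (UU \<kappa> x - (\<Sum>t\<in>UNIV. kap \<kappa> (cnj (bt t)) * sig \<kappa> t)) \<partial>Pr Ix)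
  <= (\<integral>x. (\<Sum>t\<in>UNIV. \<beta> * (K * cmod (g t x - ?l t) + (\<Sum>r\<in>{1..<k t}. T x^2 * cmod (u t r x)))) \<partial>Pr Ix)"
  by (intro integral_mono_polybdd[OF finI _ _ path] polybdd_norm polybdd_diff polybdd_UV polybdd_const
    polybdd_sum polybdd_mult polybdd_add polybdd_power pg pu pT)
 also have "... = (\<Sum>t\<in>UNIV. \<beta> * (K * (\<integral>x. cmod (g t x - ?l t) \<partial>Pr Ix) + (\<Sum>r\<in>{1..<k t}. \<integral>x. T x^2 * cmod (u t r x) \<partial>Pr Ix)))"
 proof -
  have i: "integrable (Pr Ix) (\<lambda>x. cmod (g t x - ?l t))" "integrable (Pr Ix) (\<lambda>x. T x^2 * cmod (u t r x))" for t r
   by (intro integrable_polybdd finI polybdd_norm polybdd_diff polybdd_const polybdd_mult polybdd_power pg pu pT)+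
  have "(\<integral>x. (\<Sum>t\<in>UNIV. \<beta> * (K * cmod (g t x - ?l t) + (\<Sum>r\<in>{1..<k t}. T x^2 * cmod (u t r x)))) \<partial>Pr Ix)
   = (\<Sum>t\<in>UNIV. \<integral>x. \<beta> * (K * cmod (g t x - ?l t) + (\<Sum>r\<in>{1..<k t}. T x^2 * cmod (u t r x))) \<partial>Pr Ix)"
   by (rule Bochner_Integration.integral_sum)
     (intro integrable_mult_right Bochner_Integration.integrable_add Bochner_Integration.integrable_sum i)
  also have "... = (\<Sum>t\<in>UNIV. \<beta> * (\<integral>x. K * cmod (g t x - ?l t) + (\<Sum>r\<in>{1..<k t}. T x^2 * cmod (u t r x)) \<partial>Pr Ix))"
   by (simp only: integral_mult_right_zero)
  also have "... = (\<Sum>t\<in>UNIV. \<beta> * ((\<integral>x. K * cmod (g t x - ?l t) \<partial>Pr Ix) + (\<integral>x. (\<Sum>r\<in>{1..<k t}. T x^2 * cmod (u t r x)) \<partial>Pr Ix)))"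
   by (intro sum.cong refl arg_cong[where f = "\<lambda>z. \<beta> * z"] Bochner_Integration.integral_add integrable_mult_right
     Bochner_Integration.integrable_sum i)
  also have "... = (\<Sum>t\<in>UNIV. \<beta> * (K * (\<integral>x. cmod (g t x - ?l t) \<partial>Pr Ix) + (\<Sum>r\<in>{1..<k t}. \<integral>x. T x^2 * cmod (u t r x) \<partial>Pr Ix)))"
   by (simp only: integral_mult_right_zero Bochner_Integration.integral_sum[OF i(2)])
  finally show ?thesis .
 qed
 also have "... <= (\<Sum>t\<in>(UNIV::'t set). \<beta> * (K * ((9 + (gerr K M m0)^2) * ET 32 / sn) + real M * (2 * ET 32 / sn)))"
 proof (intro sum_mono mult_left_mono add_mono \<beta>0)
  fix t
  show "(\<integral>x. cmod (g t x - ?l t) \<partial>Pr Ix) <= (9 + (gerr K M m0)^2) * ET 32 / sn"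
   unfolding g_def using k(2)[of t] by (intro gram_L1 Cs n m0) auto
  have "(\<Sum>r\<in>{1..<k t}. \<integral>x. T x^2 * cmod (u t r x) \<partial>Pr Ix) <= (\<Sum>r\<in>{1..<k t}. 2 * ET 32 / sn)"
   by (rule sum_mono) (rule Eu)
  also have "... = real (k t - 1) * (2 * ET 32 / sn)" by simp
  also have "... <= real M * (2 * ET 32 / sn)"
   using k(2)[of t] ET_ge1[of 32] sn by (intro mult_right_mono) auto
  finally show "(\<Sum>r\<in>{1..<k t}. \<integral>x. T x^2 * cmod (u t r x) \<partial>Pr Ix) <= real M * (2 * ET 32 / sn)" .
 qed (use K_ge1 in auto)
 also have "... = real CARD('t) * \<beta> * (K * (9 + (gerr K M m0)^2) + 2 * real M) * ET 32 / sn" by (simp add: algebra_simps add_divide_distrib)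
 finally show ?thesis .
qed

lemma stein:
 assumes \<beta>: "\<And>t. cmod (bt t) <= \<beta>" and eta: "0 < \<eta>"
 shows "cmod ((\<integral>x. Zw t0 x * ep x \<partial>Pr Ix)
   - \<i> / 2 * (\<Sum>t\<in>UNIV. cnj (bt t) * (\<rho> * sig False t) + bt t * sig True t) * (\<integral>x. ep x \<partial>Pr Ix))
  <= 26 * \<eta> * ET 44 + 76 * ET 32 / (real n * \<eta>^3) + 24 * ET 24 / sn
   + real CARD('t) * \<beta> * (K * (9 + (gerr K M m0)^2) + 2 * real M) * ET 32 / sn"
proof -
 define c where "c = (\<lambda>\<kappa>. \<Sum>t\<in>UNIV. kap \<kappa> (cnj (bt t)) * sig \<kappa> t)"
 let ?B = "real CARD('t) * \<beta> * (K * (9 + (gerr K M m0)^2) + 2 * real M) * ET 32 / sn"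
 have half: "1/2 * z + 1/2 * z = z" for z :: real by simp
 have pU: "polybdd Ix (\<lambda>x. UU \<kappa> x - c \<kappa>)" for \<kappa> by (intro polybdd_diff polybdd_UV polybdd_const)
 have cs: "(\<Sum>t\<in>UNIV. cnj (bt t) * (\<rho> * sig False t) + bt t * sig True t) = \<rho> * c False + c True"
  unfolding c_def kap_def by (simp add: sum.distrib sum_distrib_left algebra_simps)
 have eq: "(\<integral>x. (\<i> / 2 * (\<rho> * UU False x + UU True x) + \<rho> * VV x) * ep x \<partial>Pr Ix)
   - \<i> / 2 * (\<rho> * c False + c True) * (\<integral>x. ep x \<partial>Pr Ix)
   = (\<integral>x. (\<i> / 2 * (\<rho> * UU False x + UU True x) + \<rho> * VV x) * ep x - \<i> / 2 * (\<rho> * c False + c True) * ep x \<partial>Pr Ix)"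
 proof -
  have i: "integrable (Pr Ix) (\<lambda>x. (\<i> / 2 * (\<rho> * UU False x + UU True x) + \<rho> * VV x) * ep x)"
   "integrable (Pr Ix) (\<lambda>x. \<i> / 2 * (\<rho> * c False + c True) * ep x)"
   by (intro integrable_polybdd finI polybdd_mult polybdd_add polybdd_UV polybdd_const polybdd_ep)+
  show ?thesis by (simp only: Bochner_Integration.integral_diff[OF i] integral_mult_right_zero)
 qed
 have "cmod ((\<integral>x. (\<i> / 2 * (\<rho> * UU False x + UU True x) + \<rho> * VV x) * ep x \<partial>Pr Ix)
   - \<i> / 2 * (\<rho> * c False + c True) * (\<integral>x. ep x \<partial>Pr Ix))
  <= (\<integral>x. 1/2 * cmod (UU False x - c False) + 1/2 * cmod (UU True x - c True) + 1 / sn * T x^4 \<partial>Pr Ix)"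
  unfolding eq
 proof (rule norm_integral_le[OF finI])
  show "polybdd Ix (\<lambda>x. 1/2 * cmod (UU False x - c False) + 1/2 * cmod (UU True x - c True) + 1 / sn * T x^4)"
   by (intro polybdd_add polybdd_mult polybdd_const polybdd_norm pU polybdd_power pT)
  fix x
  have "(\<i> / 2 * (\<rho> * UU False x + UU True x) + \<rho> * VV x) * ep x - \<i> / 2 * (\<rho> * c False + c True) * ep x
   = (\<i> / 2 * \<rho> * (UU False x - c False) + \<i> / 2 * (UU True x - c True) + \<rho> * VV x) * ep x" by (simp add: algebra_simps)
  then have "cmod ((\<i> / 2 * (\<rho> * UU False x + UU True x) + \<rho> * VV x) * ep x - \<i> / 2 * (\<rho> * c False + c True) * ep x)
   = cmod (\<i> / 2 * \<rho> * (UU False x - c False) + \<i> / 2 * (UU True x - c True) + \<rho> * VV x)" by (simp add: norm_mult)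
  also have "... <= cmod (\<i> / 2 * \<rho> * (UU False x - c False)) + cmod (\<i> / 2 * (UU True x - c True)) + cmod (\<rho> * VV x)"
   by (intro order_trans[OF norm_triangle_ineq] add_mono norm_triangle_ineq order_refl)
  also have "... <= 1/2 * cmod (UU False x - c False) + 1/2 * cmod (UU True x - c True) + 1 / sn * T x^4"
  proof (intro add_mono)
   have "\<rho> * cmod (UU False x - c False) <= 1 * cmod (UU False x - c False)" using rho by (intro mult_right_mono) auto
   then show "cmod (\<i> / 2 * \<rho> * (UU False x - c False)) <= 1/2 * cmod (UU False x - c False)"
    using rho by (simp add: norm_mult norm_divide)
   show "cmod (\<i> / 2 * (UU True x - c True)) <= 1/2 * cmod (UU True x - c True)" by (simp add: norm_mult norm_divide)
   have "\<rho> * cmod (VV x) <= 1 * cmod (VV x)" using rho by (intro mult_right_mono) auto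
   then show "cmod (\<rho> * VV x) <= 1 / sn * T x^4" using VV_le[of x] rho by (simp add: norm_mult)
  qed
  finally show "cmod ((\<i> / 2 * (\<rho> * UU False x + UU True x) + \<rho> * VV x) * ep x - \<i> / 2 * (\<rho> * c False + c True) * ep x)
    <= 1/2 * cmod (UU False x - c False) + 1/2 * cmod (UU True x - c True) + 1 / sn * T x^4" .
 qed
 also have "... = 1/2 * (\<integral>x. cmod (UU False x - c False) \<partial>Pr Ix) + 1/2 * (\<integral>x. cmod (UU True x - c True) \<partial>Pr Ix) + 1 / sn * ET 4"
 proof -
  have i: "integrable (Pr Ix) (\<lambda>x. cmod (UU \<kappa> x - c \<kappa>))" "integrable (Pr Ix) (\<lambda>x. T x^4)" for \<kappa>
   by (intro integrable_polybdd finI polybdd_norm pU polybdd_power pT)+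
  show ?thesis by (simp add: i ET_def)
 qed
 also have "... <= 1/2 * ?B + 1/2 * ?B + 1 / sn * ET 24"
  using sn unfolding c_def by (intro add_mono mult_left_mono UU_L1[OF \<beta>] ET_mono) auto
 finally have "cmod ((\<integral>x. (\<i> / 2 * (\<rho> * UU False x + UU True x) + \<rho> * VV x) * ep x \<partial>Pr Ix)
   - \<i> / 2 * (\<rho> * c False + c True) * (\<integral>x. ep x \<partial>Pr Ix)) <= 1/2 * ?B + 1/2 * ?B + 1 / sn * ET 24" .
 then have 2: "cmod ((\<integral>x. (\<i> / 2 * (\<rho> * UU False x + UU True x) + \<rho> * VV x) * ep x \<partial>Pr Ix)
   - \<i> / 2 * (\<rho> * c False + c True) * (\<integral>x. ep x \<partial>Pr Ix)) <= ?B + 1 / sn * ET 24"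
  unfolding half .
 show ?thesis
  unfolding cs
  using norm_triangle_ineq[of "(\<integral>x. Zw t0 x * ep x \<partial>Pr Ix) - (\<integral>x. (\<i> / 2 * (\<rho> * UU False x + UU True x) + \<rho> * VV x) * ep x \<partial>Pr Ix)"
    "(\<integral>x. (\<i> / 2 * (\<rho> * UU False x + UU True x) + \<rho> * VV x) * ep x \<partial>Pr Ix) - \<i> / 2 * (\<rho> * c False + c True) * (\<integral>x. ep x \<partial>Pr Ix)"]
   2 stein_first[OF eta, unfolded stein_second] by simp
qed

end

end

section \<open>Operator norm of the matrix\<close>

definition ip :: "nat => cvec => cvec => complex" where
 "ip n u v = (\<Sum>i<n. u i * cnj (v i))"

text \<open>The operator \<open>A A*\<close> on vectors; its powers are function iterates.\<close>

definition XXs :: "nat => cmat => cvec => cvec" where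
 "XXs n A v = mvmul n A (mvmul n (\<lambda>i j. cnj (A j i)) v)"

lemma ip_adjoint: "ip n (mvmul n A u) v = ip n u (mvmul n (\<lambda>i j. cnj (A j i)) v)"
 unfolding ip_def mvmul_def by (simp add: sum_distrib_left sum_distrib_right mult_ac) (rule sum.swap)

lemma ip_XXs: "ip n (XXs n A u) v = ip n (mvmul n (\<lambda>i j. cnj (A j i)) u) (mvmul n (\<lambda>i j. cnj (A j i)) v)"
 unfolding XXs_def by (rule ip_adjoint)

lemma ip_XXs_sym: "ip n (XXs n A u) v = ip n u (XXs n A v)"
 unfolding ip_XXs using ip_adjoint[of n "\<lambda>i j. cnj (A j i)" u "mvmul n (\<lambda>i j. cnj (A j i)) v"] by (simp add: XXs_def)

lemma ip_XXs_pow: "ip n ((XXs n A ^^ q) u) v = ip n u ((XXs n A ^^ q) v)"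
proof (induction q arbitrary: v)
 case (Suc q)
 have "ip n ((XXs n A ^^ Suc q) u) v = ip n ((XXs n A ^^ q) u) (XXs n A v)" by (simp add: ip_XXs_sym)
 also have "... = ip n u ((XXs n A ^^ q) (XXs n A v))" by (rule Suc)
 finally show ?case by (simp add: funpow_swap1)
qed simp

lemma ip_self: "ip n v v = cor ((l2norm n v)^2)"
 using sum_self_cnj[of v n] by (simp add: ip_def mult.commute)

lemma ip_le: "cmod (ip n u v) <= l2norm n u * l2norm n v"
 using cmod_sum_mult_le_l2norm[of u "\<lambda>i. cnj (v i)" n] by (simp add: ip_def)

lemma l2norm_XXs_pow_square:
 "(l2norm n ((XXs n A ^^ q) v))^2 <= l2norm n ((XXs n A ^^ (2 * q)) v) * l2norm n v"
proof -
 have "cor ((l2norm n ((XXs n A ^^ q) v))^2) = ip n v ((XXs n A ^^ (2 * q)) v)"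
  unfolding ip_self[symmetric] ip_XXs_pow by (simp add: funpow_add mult_2)
 then have "(l2norm n ((XXs n A ^^ q) v))^2 = cmod (ip n v ((XXs n A ^^ (2 * q)) v))" by (metis norm_of_real abs_of_nonneg zero_le_power2)
 then show ?thesis using ip_le[of n v "(XXs n A ^^ (2 * q)) v"] by (simp add: mult.commute)
qed

text \<open>Repeated squaring: Cauchy-Schwarz for the self-adjoint operator \<open>A A*\<close>
  doubles the exponent, which is why powers of two appear.\<close>

lemma l2norm_adjoint_power_le:
 "(l2norm n (mvmul n (\<lambda>i j. cnj (A j i)) v)) ^ (2 * 2 ^ r)
  <= l2norm n ((XXs n A ^^ (2 ^ r)) v) * (l2norm n v) ^ (2 * 2 ^ r - 1)"
proof (induction r)
 case 0
 have "cor ((l2norm n (mvmul n (\<lambda>i j. cnj (A j i)) v))^2) = ip n (XXs n A v) v"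
  unfolding ip_XXs ip_self ..
 then have "(l2norm n (mvmul n (\<lambda>i j. cnj (A j i)) v))^2 = cmod (ip n (XXs n A v) v)" by (metis norm_of_real abs_of_nonneg zero_le_power2)
 then show ?case using ip_le[of n "XXs n A v" v] by simp
next
 case (Suc r)
 let ?w = "l2norm n (mvmul n (\<lambda>i j. cnj (A j i)) v)" and ?q = "2 ^ r :: nat"
 have "?w ^ (2 * 2 ^ Suc r) = (?w ^ (2 * 2 ^ r))^2" by (simp flip: power_mult)
 also have "... <= (l2norm n ((XXs n A ^^ ?q) v) * (l2norm n v) ^ (2 * ?q - 1))^2" by (intro power_mono Suc) simp
 also have "... = (l2norm n ((XXs n A ^^ ?q) v))^2 * (l2norm n v) ^ (2 * (2 * ?q - 1))" by (simp add: power_mult_distrib mult.commute flip: power_mult)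
 also have "... <= (l2norm n ((XXs n A ^^ (2 * ?q)) v) * l2norm n v) * (l2norm n v) ^ (2 * (2 * ?q - 1))"
  by (intro mult_right_mono l2norm_XXs_pow_square) simp
 also have "... = l2norm n ((XXs n A ^^ (2 * ?q)) v) * (l2norm n v) ^ (Suc (2 * (2 * ?q - 1)))" by simp
 also have "Suc (2 * (2 * ?q - 1)) = 2 * 2 ^ Suc r - 1"
 proof -
  have "Suc (2 * (2 * z - 1)) = 2 * (2 * z) - 1" if "1 <= z" for z :: nat using that by arith
  from this[of ?q] show ?thesis by simp
 qed
 finally show ?case by simp
qed

text \<open>Each pair \<open>(j, i)\<close> is a double step from the current row through column
  \<open>j\<close> to row \<open>i\<close>. From row \<open>a\<close> it contributes
  \<open>x (a, j) * cnj (x (i, j))\<close>, and the flags in \<open>pedges\<close> mark the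
  conjugates.\<close>

definition paths :: "nat => nat => (nat \<times> nat) list set" where
 "paths n m = {ws. set ws \<subseteq> {..<n} \<times> {..<n} \<and> length ws = m}"

fun pend :: "nat => (nat \<times> nat) list => nat" where
 "pend a [] = a" | "pend a ((j, i) # ws) = pend i ws"

fun pedges :: "nat => (nat \<times> nat) list => ((nat \<times> nat) \<times> bool) list" where
 "pedges a [] = []" | "pedges a ((j, i) # ws) = ((a, j), False) # ((i, j), True) # pedges i ws"

definition wmonom :: "((nat \<times> nat) \<times> bool) list => arr => complex" where
 "wmonom fl x = prod_list (map (\<lambda>p. kap (snd p) (x (fst p))) fl)"

lemma finite_paths: "finite (paths n m)"
 unfolding paths_def by (rule finite_lists_length_eq) simp

lemma paths_Suc: "paths n (Suc m) = (\<lambda>(p, ws). p # ws) ` (({..<n} \<times> {..<n}) \<times> paths n m)"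
 unfolding paths_def by (auto simp: length_Suc_conv image_iff)

lemma sum_paths_Suc:
 "(\<Sum>ws\<in>paths n (Suc m). f ws) = (\<Sum>p\<in>{..<n} \<times> {..<n}. \<Sum>ws\<in>paths n m. f (p # ws))"
proof -
 have "(\<Sum>ws\<in>paths n (Suc m). f ws) = (\<Sum>y\<in>({..<n} \<times> {..<n}) \<times> paths n m. f (fst y # snd y))"
  unfolding paths_Suc by (subst sum.reindex) (auto simp: inj_on_def case_prod_unfold)
 then show ?thesis by (simp add: sum.cartesian_product case_prod_unfold)
qed

lemma XXs_pow_paths:
 "(XXs n (matX x) ^^ m) v a = (\<Sum>ws\<in>paths n m. wmonom (pedges a ws) x * v (pend a ws))"
proof (induction m arbitrary: a)
 case 0
 have "paths n 0 = {[]}" by (auto simp: paths_def)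
 then show ?case by (simp add: wmonom_def)
next
 case (Suc m)
 have "(XXs n (matX x) ^^ Suc m) v a = (\<Sum>j<n. x (a, j) * (\<Sum>i<n. cnj (x (i, j)) * (XXs n (matX x) ^^ m) v i))"
  by (simp add: XXs_def mvmul_def matX_def)
 also have "... = (\<Sum>j<n. \<Sum>i<n. \<Sum>ws\<in>paths n m. wmonom (pedges a ((j, i) # ws)) x * v (pend a ((j, i) # ws)))"
  unfolding Suc sum_distrib_left by (simp add: wmonom_def kap_def mult.assoc)
 also have "... = (\<Sum>p\<in>{..<n} \<times> {..<n}. \<Sum>ws\<in>paths n m. wmonom (pedges a (p # ws)) x * v (pend a (p # ws)))"
  unfolding sum.cartesian_product[of _ "{..<n}" "{..<n}"] by (simp only: case_prod_unfold prod.collapse)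
 finally show ?case by (simp only: sum_paths_Suc)
qed

lemma pend_less: "ws \<in> paths n (Suc m) ==> pend a ws < n"
proof (induction m arbitrary: a ws)
 case 0
 then show ?case by (auto simp: paths_def length_Suc_conv)
next
 case (Suc m)
 then obtain j i ws' where "ws = (j, i) # ws'" "ws' \<in> paths n (Suc m)" by (auto simp: paths_Suc[of n "Suc m"])
 then show ?case using Suc.IH by simp
qed

text \<open>Squared Hilbert-Schmidt norm of the \<open>m\<close>-th power of \<open>A A*\<close>,
  that is, the trace of its \<open>2 * m\<close>-th power. It dominates the squared operator norm of
  the power and expands into pairs of walks with common endpoints.\<close>

definition HSq :: "nat => nat => arr => real" where
 "HSq n m x = (\<Sum>a<n. \<Sum>b<n. (cmod (\<Sum>ws\<in>{ws\<in>paths n m. pend a ws = b}. wmonom (pedges a ws) x))^2)"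

lemma HSq_nonneg [simp]: "0 <= HSq n m x" by (simp add: HSq_def sum_nonneg)

lemma XXs_pow_HSq:
 assumes "0 < m"
 shows "(l2norm n ((XXs n (matX x) ^^ m) v))^2 <= HSq n m x * (l2norm n v)^2"
proof -
 obtain m' where m: "m = Suc m'" using assms by (cases m) auto
 have "(l2norm n ((XXs n (matX x) ^^ m) v))^2 = (\<Sum>a<n. (cmod ((XXs n (matX x) ^^ m) v a))^2)" by (rule l2norm_square)
 also have "... <= (\<Sum>a<n. (\<Sum>b<n. (cmod (\<Sum>ws\<in>{ws\<in>paths n m. pend a ws = b}. wmonom (pedges a ws) x))^2) * (l2norm n v)^2)"
 proof (rule sum_mono)
  fix a
  let ?h = "\<lambda>b. \<Sum>ws\<in>{ws\<in>paths n m. pend a ws = b}. wmonom (pedges a ws) x"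
  have "(XXs n (matX x) ^^ m) v a = (\<Sum>b<n. \<Sum>ws\<in>{ws\<in>paths n m. pend a ws = b}. wmonom (pedges a ws) x * v (pend a ws))"
   unfolding XXs_pow_paths by (rule sum.group[symmetric]) (auto simp: finite_paths m intro: pend_less)
  also have "... = (\<Sum>b<n. ?h b * v b)" by (simp add: sum_distrib_right)
  finally have "cmod ((XXs n (matX x) ^^ m) v a) <= l2norm n ?h * l2norm n v" by (simp add: cmod_sum_mult_le_l2norm)
  then have "(cmod ((XXs n (matX x) ^^ m) v a))^2 <= (l2norm n ?h * l2norm n v)^2" by (intro power_mono) auto
  then show "(cmod ((XXs n (matX x) ^^ m) v a))^2 <= (\<Sum>b<n. (cmod (?h b))^2) * (l2norm n v)^2" by (simp add: power_mult_distrib l2norm_square)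
 qed
 finally show ?thesis by (simp add: HSq_def sum_distrib_right)
qed

lemma form_bound_matX:
 assumes "0 <= c" "HSq n (2 ^ r) x <= c ^ (4 * 2 ^ r)"
 shows "form_bound n (matX x) c"
proof -
 have "form_bound n (\<lambda>i j. cnj (matX x j i)) c"
 proof (rule form_boundI_vec[OF assms(1)])
  fix v
  let ?w = "l2norm n (mvmul n (\<lambda>i j. cnj (matX x j i)) v)" and ?q = "2 ^ r :: nat" and ?v = "l2norm n v"
  have q: "1 <= ?q" by simp
  have "?w ^ (4 * ?q) = (?w ^ (2 * ?q))^2" by (simp flip: power_mult)
  also have "... <= (l2norm n ((XXs n (matX x) ^^ ?q) v) * ?v ^ (2 * ?q - 1))^2" by (intro power_mono l2norm_adjoint_power_le) simp
  also have "... = (l2norm n ((XXs n (matX x) ^^ ?q) v))^2 * ?v ^ (2 * (2 * ?q - 1))" by (simp add: power_mult_distrib mult.commute flip: power_mult)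
  also have "... <= (HSq n ?q x * ?v^2) * ?v ^ (2 * (2 * ?q - 1))" by (intro mult_right_mono XXs_pow_HSq) auto
  also have "... = HSq n ?q x * ?v ^ (2 + 2 * (2 * ?q - 1))" by (simp only: power_add mult.assoc)
  also have "2 + 2 * (2 * ?q - 1) = 4 * ?q"
  proof -
   have "2 + 2 * (2 * z - 1) = 4 * z" if "1 <= z" for z :: nat using that by arith
   from this[OF q] show ?thesis .
  qed
  also have "HSq n ?q x * ?v ^ (4 * ?q) <= c ^ (4 * ?q) * ?v ^ (4 * ?q)" by (intro mult_right_mono assms) simp
  finally have "?w ^ (4 * ?q) <= (c * ?v) ^ (4 * ?q)" by (simp add: power_mult_distrib)
  moreover have "4 * ?q = Suc (4 * ?q - 1)" using q by simp
  ultimately show "?w <= c * ?v"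
   using power_le_imp_le_base[of ?w "4 * ?q - 1" "c * ?v"] assms(1) by simp
 qed
 from form_bound_transpose[OF form_bound_cnj[OF this]] show ?thesis by simp
qed

lemma form_bound_scaledX:
 assumes "form_bound n (matX x) (c * sqrt (real n))" "0 < n"
 shows "form_bound n (scaledX n x) c"
proof (rule form_boundI_vec)
 have s: "0 < sqrt (real n)" using assms by simp
 show "0 <= c" using assms s by (simp add: form_bound_def zero_le_mult_iff)
 fix b
 have "mvmul n (scaledX n x) b = (\<lambda>i. cor (1 / sqrt (real n)) * mvmul n (matX x) b i)"
  by (simp add: mvmul_def scaledX_def matX_def sum_distrib_left)
 then have "l2norm n (mvmul n (scaledX n x) b) = 1 / sqrt (real n) * l2norm n (mvmul n (matX x) b)"
  by (simp add: l2norm_def norm_mult power_mult_distrib sum_distrib_left[symmetric] real_sqrt_mult norm_divide power_divide real_sqrt_divide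
    sum_divide_distrib[symmetric])
 also have "... <= 1 / sqrt (real n) * (c * sqrt (real n) * l2norm n b)" by (intro mult_left_mono form_bound_vec assms) auto
 also have "... = c * l2norm n b" using s by simp
 finally show "l2norm n (mvmul n (scaledX n x) b) <= c * l2norm n b" .
qed

text \<open>Each new vertex of a walk in the bipartite graph of rows and columns comes with a new edge.\<close>

definition walk_inv :: "(nat + nat) set => (nat \<times> nat) set => bool" where
 "walk_inv V E \<longleftrightarrow> finite V \<and> finite E \<and> (\<forall>(i, j)\<in>E. Inl i \<in> V \<and> Inr j \<in> V) \<and> card V <= Suc (card E)"

lemma walk_inv_insert_Inr:
 "walk_inv V E ==> Inl a \<in> V ==> walk_inv (insert (Inr j) V) (insert (a, j) E)"
 unfolding walk_inv_def by (auto simp: card_insert_if)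

lemma walk_inv_insert_Inl:
 "walk_inv V E ==> Inr j \<in> V ==> walk_inv (insert (Inl i) V) (insert (i, j) E)"
 unfolding walk_inv_def by (auto simp: card_insert_if)

definition pverts :: "(nat \<times> nat) list => (nat + nat) list" where
 "pverts ws = concat (map (\<lambda>(j, i). [Inr j, Inl i]) ws)"

lemma walk_inv_path:
 "walk_inv V E ==> Inl a \<in> V ==> walk_inv (V \<union> set (pverts ws)) (E \<union> set (map fst (pedges a ws)))"
proof (induction ws arbitrary: a V E)
 case (Cons p ws)
 obtain j i where p: "p = (j, i)" by force
 have "walk_inv (insert (Inl i) (insert (Inr j) V)) (insert (i, j) (insert (a, j) E))"
  by (intro walk_inv_insert_Inl walk_inv_insert_Inr Cons.prems) auto
 from Cons.IH[OF this, of i] show ?case by (simp add: p pverts_def insert_commute)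
qed (simp add: pverts_def)

lemma length_pedges: "length (pedges a ws) = 2 * length ws" by (induction a ws rule: pedges.induct) auto

lemma length_pverts: "length (pverts ws) = 2 * length ws" by (induction ws) (auto simp: pverts_def)

lemma set_pverts: "ws \<in> paths n m ==> set (pverts ws) \<subseteq> Inl ` {..<n} \<union> Inr ` {..<n}" by (auto simp: paths_def pverts_def)

lemma pverts_inj: "length ws = length ws' ==> pverts ws = pverts ws' ==> ws = ws'"
proof (induction ws ws' rule: list_induct2)
 case (Cons x xs y ys)
 then show ?case by (cases x; cases y) (auto simp: pverts_def)
qed simp

text \<open>Such a list is coded by \<open>r\<close> candidate values and, for every place, the
  position of its value among them. Missing candidates are padded with the head of the list.\<close>

lemma card_few_values:
 assumes U: "finite U" "U \<noteq> {}"
 shows "card {xs. set xs \<subseteq> U \<and> length xs = l \<and> card (set xs) <= r} <= card U ^ r * r ^ l"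
proof -
 let ?A = "{g. set g \<subseteq> U \<and> length g = r}" and ?B = "{h. set h \<subseteq> {..<r} \<and> length h = l}"
 have "{xs. set xs \<subseteq> U \<and> length xs = l \<and> card (set xs) <= r} \<subseteq> (\<lambda>(g, h). map ((!) g) h) ` (?A \<times> ?B)"
 proof
  fix xs assume "xs \<in> {xs. set xs \<subseteq> U \<and> length xs = l \<and> card (set xs) <= r}"
  then have xs: "set xs \<subseteq> U" "length xs = l" "card (set xs) <= r" by auto
  show "xs \<in> (\<lambda>(g, h). map ((!) g) h) ` (?A \<times> ?B)"
  proof (cases "xs = []")
   case True
   obtain u where "u \<in> U" using U by auto
   then show ?thesis using True xs by (intro image_eqI[of _ _ "(replicate r u, [])"]) auto
  next
   case False
   define d where "d = remdups xs"
   define g where "g = d @ replicate (r - length d) (hd xs)"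
   have ld: "length d <= r" using xs(3) by (simp add: d_def length_remdups_card_conv)
   have g: "g \<in> ?A"
    using xs(1) False ld by (auto simp: g_def d_def)
   have "\<forall>y\<in>set xs. \<exists>k<length d. d ! k = y" by (simp add: d_def in_set_conv_nth[symmetric] flip: in_set_conv_nth)
   then obtain ix where ix: "\<And>y. y \<in> set xs ==> ix y < length d \<and> d ! ix y = y" by metis
   have "map ((!) g) (map ix xs) = xs"
    unfolding map_map by (rule map_idI) (simp add: g_def nth_append ix)
   moreover have "map ix xs \<in> ?B" using ix ld xs(2) by (auto dest: order_less_le_trans)
   ultimately show ?thesis using g by (intro image_eqI[of _ _ "(g, map ix xs)"]) auto
  qed
 qed
 then have "card {xs. set xs \<subseteq> U \<and> length xs = l \<and> card (set xs) <= r} <= card (?A \<times> ?B)"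
  by (rule surj_card_le[rotated]) (auto intro!: finite_cartesian_product finite_lists_length_eq U)
 then show ?thesis by (simp add: card_cartesian_product card_lists_length_eq U)
qed

text \<open>Every edge occurs at least twice. Any other monomial has mean 0, because an entry that
  occurs once is centered and independent of the rest.\<close>

definition heavy :: "((nat \<times> nat) \<times> bool) list => bool" where
 "heavy fl \<longleftrightarrow> (\<forall>e\<in>set (map fst fl). 2 <= count_list (map fst fl) e)"

lemma heavy_card:
 assumes "heavy fl" shows "2 * card (set (map fst fl)) <= length fl"
proof -
 have "2 * card (set (map fst fl)) = (\<Sum>e\<in>set (map fst fl). 2)" by simp
 also have "... <= (\<Sum>e\<in>set (map fst fl). count_list (map fst fl) e)"
  using assms unfolding heavy_def by (intro sum_mono) auto
 also have "... = length (map fst fl)" by (rule sum_count_set) auto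
 finally show ?thesis by simp
qed

definition pflip :: "((nat \<times> nat) \<times> bool) list => ((nat \<times> nat) \<times> bool) list" where
 "pflip fl = map (\<lambda>p. (fst p, \<not> snd p)) fl"

definition walk_pair :: "nat => (nat \<times> nat) list => (nat \<times> nat) list => ((nat \<times> nat) \<times> bool) list" where
 "walk_pair a ws ws' = pedges a ws @ pflip (pedges a ws')"

lemma fst_pflip: "map fst (pflip fl) = map fst fl" by (simp add: pflip_def comp_def)

lemma wmonom_append: "wmonom (fl @ fl') x = wmonom fl x * wmonom fl' x" by (simp add: wmonom_def)

lemma wmonom_pflip: "wmonom (pflip fl) x = cnj (wmonom fl x)" by (induction fl) (auto simp: wmonom_def pflip_def kap_def)

text \<open>Two walks with the same start have \<open>4 * m\<close> steps in total. If each edge is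
  used twice, there are at most \<open>2 * m\<close> edges, and since the common start keeps the
  graph connected, at most \<open>2 * m + 1\<close> vertices. Rows and columns are distinct
  vertices, hence \<open>2 * n\<close> choices for each.\<close>

lemma heavy_walks_card:
 assumes n: "0 < n"
 shows "card {(a, ws, ws'). a < n \<and> ws \<in> paths n m \<and> ws' \<in> paths n m \<and> heavy (walk_pair a ws ws')}
   <= (2 * n) ^ (2 * m + 1) * (2 * m + 1) ^ (4 * m + 1)"
proof -
 let ?U = "Inl ` {..<n} \<union> Inr ` {..<n} :: (nat + nat) set"
 let ?S = "{(a, ws, ws'). a < n \<and> ws \<in> paths n m \<and> ws' \<in> paths n m \<and> heavy (walk_pair a ws ws')}"
 let ?L = "{xs. set xs \<subseteq> ?U \<and> length xs = 4 * m + 1 \<and> card (set xs) <= 2 * m + 1}"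
 let ?f = "\<lambda>(a, ws, ws'). Inl a # pverts ws @ pverts ws'"
 have cU: "card ?U = 2 * n" by (subst card_Un_disjoint) (auto simp: card_image)
 have "inj_on ?f ?S"
 proof (rule inj_onI)
  fix y z assume yz: "y \<in> ?S" "z \<in> ?S" "?f y = ?f z"
  obtain a ws ws' where y: "y = (a, ws, ws')" by (cases y)
  obtain a2 ws2 ws2' where z: "z = (a2, ws2, ws2')" by (cases z)
  have *: "ws \<in> paths n m" "ws' \<in> paths n m" "ws2 \<in> paths n m" "ws2' \<in> paths n m"
   "Inl a # pverts ws @ pverts ws' = Inl a2 # pverts ws2 @ pverts ws2'"
   using yz y z by auto
  then have l: "length ws = length ws2" "length ws' = length ws2'" by (auto simp: paths_def)
  then have "length (pverts ws) = length (pverts ws2)" by (simp add: length_pverts)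
  with * have "pverts ws = pverts ws2" "pverts ws' = pverts ws2'" "a = a2" by auto
  then show "y = z" using pverts_inj l y z by blast
 qed
 moreover have "?f ` ?S \<subseteq> ?L"
 proof (rule subsetI)
  fix y assume "y \<in> ?f ` ?S"
  then obtain a ws ws' where y: "y = Inl a # pverts ws @ pverts ws'"
   and *: "a < n" "ws \<in> paths n m" "ws' \<in> paths n m" "heavy (walk_pair a ws ws')" by auto
  let ?E = "set (map fst (pedges a ws)) \<union> set (map fst (pedges a ws'))"
  have "walk_inv {Inl a} {}" by (simp add: walk_inv_def)
  then have "walk_inv ({Inl a} \<union> set (pverts ws)) ({} \<union> set (map fst (pedges a ws)))" by (rule walk_inv_path) simp
  then have "walk_inv ({Inl a} \<union> set (pverts ws) \<union> set (pverts ws')) ({} \<union> set (map fst (pedges a ws)) \<union> set (map fst (pedges a ws')))"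
   by (rule walk_inv_path) simp
  then have "card ({Inl a} \<union> set (pverts ws) \<union> set (pverts ws')) <= Suc (card ?E)" by (simp add: walk_inv_def)
  moreover have "2 * card ?E <= 4 * m"
  proof -
   have "set (map fst (walk_pair a ws ws')) = ?E" by (simp only: walk_pair_def map_append fst_pflip set_append)
   moreover have "length (walk_pair a ws ws') = 4 * m"
    using * by (simp add: walk_pair_def pflip_def length_pedges paths_def)
   ultimately show ?thesis using heavy_card[OF *(4)] by simp
  qed
  ultimately have c: "card (set (Inl a # pverts ws @ pverts ws')) <= 2 * m + 1" by (simp add: Un_assoc)
  have "length (Inl a # pverts ws @ pverts ws') = 4 * m + 1" using * by (simp add: length_pverts paths_def)
  moreover have "set (Inl a # pverts ws @ pverts ws') \<subseteq> ?U"
   using set_pverts[OF *(2)] set_pverts[OF *(3)] *(1) by auto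
  ultimately show "y \<in> ?L" unfolding y using c by blast
 qed
 moreover have "finite ?L" by (rule finite_subset[OF _ finite_lists_length_eq[of ?U "4 * m + 1"]]) auto
 ultimately have "card ?S <= card ?L" by (rule card_inj_on_le)
 also have "... <= card ?U ^ (2 * m + 1) * (2 * m + 1) ^ (4 * m + 1)" by (rule card_few_values) (use n in auto)
 finally show ?thesis unfolding cU .
qed

lemma prod_list_le_sum_power:
 fixes f :: "'a => real"
 assumes "\<And>y. 0 <= f y" "xs \<noteq> []"
 shows "prod_list (map f xs) <= (\<Sum>y\<in>set xs. f y ^ length xs)"
proof -
 define c where "c = Max (f ` set xs)"
 have le: "f y <= c" if "y \<in> set xs" for y unfolding c_def using that by (intro Max_ge) auto
 have c0: "0 <= c" using le[of "hd xs"] assms by (meson hd_in_set order_trans)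
 have "prod_list (map f ys) <= c ^ length ys" if "set ys \<subseteq> set xs" for ys
  using that
 proof (induction ys)
  case (Cons y ys)
  have "0 <= prod_list (map f ys)" by (induction ys) (auto simp: assms)
  then show ?case using Cons le c0 by (auto intro!: mult_mono)
 qed simp
 then have "prod_list (map f xs) <= c ^ length xs" by simp
 also have "c \<in> f ` set xs" unfolding c_def by (rule Max_in) (use assms in auto)
 then obtain y where y: "y \<in> set xs" "c = f y" by auto
 have "c ^ length xs <= (\<Sum>y\<in>set xs. f y ^ length xs)"
  unfolding y(2) using y(1) by (intro member_le_sum) (auto simp: assms)
 finally show ?thesis .
qed

lemma norm_wmonom: "cmod (wmonom fl x) = prod_list (map (\<lambda>p. cmod (x (fst p))) fl)" by (induction fl) (auto simp: wmonom_def norm_mult)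

lemma polybdd_wmonom:
 assumes "finite S" "set (map fst fl) \<subseteq> S" shows "polybdd S (wmonom fl)"
proof -
 have "polybdd S (\<lambda>x. prod_list (map (\<lambda>p. kap (snd p) (x (fst p))) fl))"
  using assms(2) by (induction fl) (auto intro!: polybdd_const polybdd_mult polybdd_kap polybdd_coord assms(1))
 then show ?thesis unfolding wmonom_def .
qed

section \<open>Expected walk sums and construction of the random weight\<close>

context iid_entries
begin

lemma integral_coord_moment:
 assumes "finite S" "e \<in> S" shows "(\<integral>x. cmod (x e) ^ q \<partial>Pr S) = (\<integral>z. cmod z ^ q \<partial>\<mu>)"
proof -
 interpret P: prob_space "Pr S" by (rule prob_space_Pr)
 have "polybdd S (\<lambda>x. cor (cmod (x e) ^ q))" by (intro polybdd_intros assms)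
 from integral_update_decouple[OF assms polybdd_const this, of 1]
 have "(\<integral>x. cor (cmod (x e) ^ q) \<partial>Pr S) = (\<integral>z. cor (cmod z ^ q) \<partial>\<mu>)" by (simp add: P.prob_space)
 then show ?thesis unfolding integral_complex_of_real by simp
qed

text \<open>An entry that occurs once is separated from the other factors by independence, and its
  mean is 0.\<close>

lemma integral_wmonom_light:
 assumes S: "finite S" "set (map fst fl) \<subseteq> S" and "\<not> heavy fl"
 shows "(\<integral>x. wmonom fl x \<partial>Pr S) = 0"
proof -
 obtain e where e: "e \<in> set (map fst fl)" "count_list (map fst fl) e < 2"
  using assms(3) unfolding heavy_def by (meson not_le)
 then obtain p where p: "p \<in> set fl" "fst p = e" by auto
 then obtain l1 l2 where fl: "fl = l1 @ p # l2" by (meson split_list)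
 have "count_list (map fst l1) e = 0" "count_list (map fst l2) e = 0" using e(2) fl p by auto
 then have ne: "e \<notin> set (map fst (l1 @ l2))" by (auto simp: count_list_0_iff)
 have eS: "e \<in> S" using e(1) S(2) by auto
 have same: "wmonom (l1 @ l2) (x(e := 0)) = wmonom (l1 @ l2) x" for x
  unfolding wmonom_def using ne by (intro arg_cong[of _ _ prod_list] map_cong) auto
 have split: "wmonom fl x = kap (snd p) (x e) * wmonom (l1 @ l2) (x(e := 0))" for x
  unfolding same by (simp add: fl wmonom_def p(2))
 have pm: "polybdd S (wmonom (l1 @ l2))" using S fl by (intro polybdd_wmonom) auto
 have "(\<integral>x. wmonom fl x \<partial>Pr S) = (\<integral>z. kap (snd p) z \<partial>\<mu>) * (\<integral>x. wmonom (l1 @ l2) (x(e := 0)) \<partial>Pr S)"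
  unfolding split by (rule integral_update_decouple[OF S(1) eS pm]) (intro polybdd_kap polybdd_coord S(1) eS)
 also have "(\<integral>z. kap (snd p) z \<partial>\<mu>) = 0" by (cases "snd p") (simp_all add: kap_def mean0)
 finally show ?thesis by simp
qed

lemma integral_wmonom_le:
 assumes S: "finite S" "set (map fst fl) \<subseteq> S" and "fl \<noteq> []"
 shows "cmod (\<integral>x. wmonom fl x \<partial>Pr S) <= real (length fl) * (\<integral>z. cmod z ^ length fl \<partial>\<mu>)"
proof -
 let ?l = "length fl"
 have in_S: "fst p \<in> S" if "p \<in> set fl" for p using that S(2) by auto
 have "cmod (\<integral>x. wmonom fl x \<partial>Pr S) <= (\<integral>x. (\<Sum>p\<in>set fl. cmod (x (fst p)) ^ ?l) \<partial>Pr S)"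
 proof (rule norm_integral_le[OF S(1)])
  show "polybdd S (\<lambda>x. \<Sum>p\<in>set fl. cmod (x (fst p)) ^ ?l)" by (intro polybdd_intros S(1) in_S)
  show "cmod (wmonom fl x) <= (\<Sum>p\<in>set fl. cmod (x (fst p)) ^ ?l)" for x
   unfolding norm_wmonom by (rule prod_list_le_sum_power) (use assms in auto)
 qed
 also have "... = (\<Sum>p\<in>set fl. (\<integral>z. cmod z ^ ?l \<partial>\<mu>))" by (subst Bochner_Integration.integral_sum)
    (auto intro!: integrable_polybdd polybdd_intros S(1) in_S simp: integral_coord_moment[OF S(1) in_S])
 also have "... = real (card (set fl)) * (\<integral>z. cmod z ^ ?l \<partial>\<mu>)" by simp
 also have "... <= real ?l * (\<integral>z. cmod z ^ ?l \<partial>\<mu>)"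
  by (intro mult_right_mono) (auto simp: card_length intro!: integral_nonneg_AE)
 finally show ?thesis .
qed

lemma pedges_in:
 "ws \<in> paths n m ==> a < n ==> set (map fst (pedges a ws)) \<subseteq> {..<n} \<times> {..<n}"
proof (induction a ws arbitrary: m rule: pedges.induct)
 case (2 a j i ws)
 then have "ws \<in> paths n (m - 1)" "i < n" "j < n" by (auto simp: paths_def)
 then show ?case using 2 by auto
qed simp

text \<open>Only the power \<open>2 * m + 1\<close> of \<open>n\<close> matters, the remaining
  factor being crude. After division by \<open>n^(2 * m)\<close> one factor \<open>n\<close> is left
  over, which a root of high degree makes harmless.\<close>

lemma HSq_moment:
 assumes n: "0 < n" and m: "0 < m"
 shows "(\<integral>x. HSq n m x \<partial>Pr ({..<n} \<times> {..<n}))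
  <= (2 * real n) ^ (2 * m + 1) * (real (2 * m + 1) ^ (4 * m + 1) * (real (4 * m) * (\<integral>z. cmod z ^ (4 * m) \<partial>\<mu>)))"
proof -
 let ?S = "{..<n} \<times> {..<n}" and ?P = "\<lambda>a b. {ws\<in>paths n m. pend a ws = b}"
 define c where "c = real (4 * m) * (\<integral>z. cmod z ^ (4 * m) \<partial>\<mu>)"
 have c0: "0 <= c" unfolding c_def by (auto intro!: mult_nonneg_nonneg integral_nonneg_AE)
 define ind where "ind = (\<lambda>a ws ws'. if heavy (walk_pair a ws ws') then 1 else 0 :: real)"
 have fS: "finite ?S" by simp
 have len: "length (walk_pair a ws ws') = 4 * m" if "ws \<in> paths n m" "ws' \<in> paths n m" for a ws ws'
  using that by (simp add: walk_pair_def pflip_def length_pedges paths_def)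
 have sub: "set (map fst (walk_pair a ws ws')) \<subseteq> ?S" if "a < n" "ws \<in> paths n m" "ws' \<in> paths n m" for a ws ws'
  unfolding walk_pair_def map_append fst_pflip set_append using pedges_in that by blast
 have fin: "finite (?P a b)" for a b using finite_paths by simp
 have HS: "cor (HSq n m x) = (\<Sum>a<n. \<Sum>b<n. \<Sum>ws\<in>?P a b. \<Sum>ws'\<in>?P a b. wmonom (walk_pair a ws ws') x)" for x
  unfolding HSq_def of_real_sum complex_norm_square cnj_sum sum_product walk_pair_def wmonom_append wmonom_pflip ..
 have pm: "polybdd ?S (wmonom (walk_pair a ws ws'))" if "a < n" "ws \<in> paths n m" "ws' \<in> paths n m" for a ws ws'
  by (rule polybdd_wmonom[OF fS sub[OF that]])
 have int: "integrable (Pr ?S) (wmonom (walk_pair a ws ws'))" if "a < n" "ws \<in> paths n m" "ws' \<in> paths n m" for a ws ws'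
  by (rule integrable_polybdd[OF fS pm[OF that]])
 have bnd: "cmod (\<integral>x. wmonom (walk_pair a ws ws') x \<partial>Pr ?S) <= c * ind a ws ws'"
  if "a < n" "ws \<in> paths n m" "ws' \<in> paths n m" for a ws ws'
 proof (cases "heavy (walk_pair a ws ws')")
  case True
  have "walk_pair a ws ws' \<noteq> []" using len[OF that(2,3), of a] m by auto
  then show ?thesis using integral_wmonom_le[OF fS sub[OF that]] len[OF that(2,3), of a] True by (simp add: c_def ind_def)
 next
  case False
  then show ?thesis using integral_wmonom_light[OF fS sub[OF that]] by (simp add: ind_def)
 qed
 have "cor (\<integral>x. HSq n m x \<partial>Pr ?S) = (\<integral>x. cor (HSq n m x) \<partial>Pr ?S)" by (rule integral_complex_of_real[symmetric])
 also have "... = (\<Sum>a<n. \<Sum>b<n. \<Sum>ws\<in>?P a b. \<Sum>ws'\<in>?P a b. \<integral>x. wmonom (walk_pair a ws ws') x \<partial>Pr ?S)"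
  unfolding HS by (rule trans[OF Bochner_Integration.integral_sum], (intro Bochner_Integration.integrable_sum int; auto), rule sum.cong[OF refl])+
    (rule refl)
 finally have "cmod (cor (\<integral>x. HSq n m x \<partial>Pr ?S))
   = cmod (\<Sum>a<n. \<Sum>b<n. \<Sum>ws\<in>?P a b. \<Sum>ws'\<in>?P a b. \<integral>x. wmonom (walk_pair a ws ws') x \<partial>Pr ?S)" by simp
 also have "... <= (\<Sum>a<n. \<Sum>b<n. \<Sum>ws\<in>?P a b. \<Sum>ws'\<in>?P a b. c * ind a ws ws')" by (intro sum_norm_le bnd) auto
 also have "... <= (\<Sum>a<n. \<Sum>ws\<in>paths n m. \<Sum>ws'\<in>paths n m. c * ind a ws ws')"
 proof (rule sum_mono)
  fix a
  have "(\<Sum>b<n. \<Sum>ws\<in>?P a b. \<Sum>ws'\<in>?P a b. c * ind a ws ws') <= (\<Sum>b<n. \<Sum>ws\<in>?P a b. \<Sum>ws'\<in>paths n m. c * ind a ws ws')"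
   by (intro sum_mono sum_mono2) (auto simp: finite_paths c0 ind_def)
  also have "... = (\<Sum>ws\<in>paths n m. \<Sum>ws'\<in>paths n m. c * ind a ws ws')"
  proof (rule sum.group)
   show "pend a ` paths n m \<subseteq> {..<n}" using pend_less[of _ n "m - 1"] m by auto
  qed (auto simp: finite_paths)
  finally show "(\<Sum>b<n. \<Sum>ws\<in>?P a b. \<Sum>ws'\<in>?P a b. c * ind a ws ws') <= (\<Sum>ws\<in>paths n m. \<Sum>ws'\<in>paths n m. c * ind a ws ws')" .
 qed
 also have "... = c * real (card {(a, ws, ws'). a < n \<and> ws \<in> paths n m \<and> ws' \<in> paths n m \<and> heavy (walk_pair a ws ws')})"
 proof -
  let ?D = "{..<n} \<times> paths n m \<times> paths n m"
  have "(\<Sum>a<n. \<Sum>ws\<in>paths n m. \<Sum>ws'\<in>paths n m. c * ind a ws ws') = (\<Sum>y\<in>?D. c * ind (fst y) (fst (snd y)) (snd (snd y)))"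
   by (simp add: sum.cartesian_product case_prod_unfold)
  also have "... = c * (\<Sum>y\<in>?D. ind (fst y) (fst (snd y)) (snd (snd y)))" by (simp add: sum_distrib_left)
  also have "(\<Sum>y\<in>?D. ind (fst y) (fst (snd y)) (snd (snd y))) = real (card {y\<in>?D. heavy (walk_pair (fst y) (fst (snd y)) (snd (snd y)))})"
   unfolding ind_def by (subst sum.inter_filter[symmetric]) (auto simp: finite_paths)
  also have "{y\<in>?D. heavy (walk_pair (fst y) (fst (snd y)) (snd (snd y)))} = {(a, ws, ws'). a < n \<and> ws \<in> paths n m \<and> ws' \<in> paths n m \<and> heavy (walk_pair a ws ws')}"
   by auto
  finally show ?thesis .
 qed
 also have "... <= c * real ((2 * n) ^ (2 * m + 1) * (2 * m + 1) ^ (4 * m + 1))"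
  by (intro mult_left_mono c0) (simp only: of_nat_le_iff heavy_walks_card[OF n])
 also have "... = (2 * real n) ^ (2 * m + 1) * (real (2 * m + 1) ^ (4 * m + 1) * c)" by (simp only: of_nat_mult of_nat_power of_nat_numeral mult_ac)
 finally show ?thesis unfolding c_def by simp
qed

lemma polybdd_HSq: "polybdd ({..<n} \<times> {..<n}) (HSq n m)"
proof -
 have "polybdd ({..<n} \<times> {..<n}) (\<lambda>x. HSq n m x)"
  unfolding HSq_def
 proof (intro polybdd_sum polybdd_power polybdd_norm)
  fix a b ws assume "a \<in> {..<n}" "ws \<in> {ws\<in>paths n m. pend a ws = b}"
  then show "polybdd ({..<n} \<times> {..<n}) (wmonom (pedges a ws))"
   using pedges_in[of ws n m a] by (intro polybdd_wmonom) auto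
 qed
 then show ?thesis .
qed

text \<open>The weight is \<open>A\<close> plus a root of high degree of the normalised trace and
  the sum of high powers of all entries. Under the root the mean is at most of order
  \<open>n^2\<close>; the degree is chosen so large that the \<open>N\<close>-th moment grows at
  most like \<open>n powr (1 / 16)\<close>.\<close>

lemma matrix_control:
 fixes N :: nat and A :: real
 assumes A: "1 <= A"
 shows "\<exists>c. \<forall>n>0. \<exists>X. polybdd ({..<n} \<times> {..<n}) X \<and> (\<forall>x. A <= X x \<and> form_bound n (scaledX n x) (X x)
   \<and> (\<forall>i<n. \<forall>j<n. cmod (x (i, j)) <= X x))
  \<and> (\<integral>x. X x ^ N \<partial>Pr ({..<n} \<times> {..<n})) <= c * real n powr (1 / 16)"
proof -
 \<comment> \<open>A power of two, as repeated squaring requires, and large enough for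
   \<open>32 * N <= 4 * q\<close>: then \<open>N / Q <= 1/32\<close>, so \<open>n^2\<close> to the
   power \<open>N / Q\<close> is at most \<open>n^(1/16)\<close>.\<close>
 define q where "q = (2::nat) ^ (8 * N)"
 define Q where "Q = 4 * q"
 have q1: "1 <= q" by (simp add: q_def)
 then have Q0: "0 < Q" by (simp add: Q_def)
 have QN: "32 * N <= Q" using less_exp[of "8 * N"] unfolding Q_def q_def by linarith
 define c1 where "c1 = 2 ^ (2 * q + 1) * (real (2 * q + 1) ^ (4 * q + 1) * (real (4 * q) * (\<integral>z. cmod z ^ (4 * q) \<partial>\<mu>)))"
 define mQ where "mQ = (\<integral>z. cmod z ^ Q \<partial>\<mu>)"
 have mQ0: "0 <= mQ" unfolding mQ_def by (auto intro!: integral_nonneg_AE)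
 have c10: "0 <= c1" unfolding c1_def by (auto intro!: mult_nonneg_nonneg integral_nonneg_AE)
 define c where "c = 2 ^ N * (A ^ N + 1 + c1 + mQ)"
 show ?thesis
 proof (rule exI[of _ c], intro allI impI)
  fix n :: nat assume n: "0 < n"
  let ?S = "{..<n} \<times> {..<n}"
  have n1: "1 <= real n" using n by simp
  have fS: "finite ?S" by simp
  define z where "z = (\<lambda>x. HSq n q x / real n ^ (2 * q) + (\<Sum>e\<in>?S. cmod (x e) ^ Q))"
  define y where "y = (\<lambda>x. root Q (z x))"
  define X where "X = (\<lambda>x. A + y x)"
  have z0: "0 <= z x" for x unfolding z_def by (auto intro!: add_nonneg_nonneg sum_nonneg)
  have y0: "0 <= y x" for x unfolding y_def using z0 Q0 by simp
  have yQ: "y x ^ Q = z x" for x unfolding y_def using z0 Q0 by simp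
  have pz: "polybdd ?S z" unfolding z_def by (intro polybdd_intros polybdd_HSq fS)
  have py: "polybdd ?S y"
  proof (rule polybdd_dominated[OF _ polybdd_add[OF polybdd_const[of _ 1] pz]])
   have "continuous_on UNIV (root Q)" by (intro continuous_intros)
   then have "root Q \<in> borel_measurable borel" by (rule borel_measurable_continuous_onI)
   then show "y \<in> borel_measurable (PiM ?S (\<lambda>_. borel))"
    unfolding y_def using polybdd_measurable[OF pz] by measurable
   fix x
   have "y x <= 1 + z x"
   proof (cases "y x <= 1")
    case True then show ?thesis using z0[of x] by linarith
   next
    case False
    then have "y x ^ 1 <= y x ^ Q" using Q0 by (intro power_increasing) auto
    then show ?thesis using yQ[of x] by simp
   qed
   then show "norm (y x) <= norm (1 + z x)" using y0[of x] z0[of x] by simp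
  qed
  have pX: "polybdd ?S X" unfolding X_def by (intro polybdd_intros py)
  have fb: "form_bound n (scaledX n x) (y x)" for x
  proof (rule form_bound_scaledX[OF _ n])
   have "HSq n q x / real n ^ (2 * q) <= y x ^ Q" unfolding yQ z_def by (simp add: sum_nonneg)
   then have "HSq n q x <= y x ^ Q * real n ^ (2 * q)" using n by (simp add: field_simps)
   also have "... = (y x * sqrt (real n)) ^ Q"
   proof -
    have "Q = 2 * (2 * q)" by (simp add: Q_def)
    then have "sqrt (real n) ^ Q = (sqrt (real n) ^ 2) ^ (2 * q)" by (simp only: power_mult)
    then show ?thesis by (simp add: power_mult_distrib)
   qed
   finally show "form_bound n (matX x) (y x * sqrt (real n))"
    unfolding Q_def q_def using y0[of x] by (intro form_bound_matX) auto
  qed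
  have xe: "cmod (x (i, j)) <= y x" if "i < n" "j < n" for i j x
  proof -
   have "cmod (x (i, j)) ^ Q <= (\<Sum>e\<in>?S. cmod (x e) ^ Q)"
    using that by (intro member_le_sum[of "(i, j)"]) auto
   also have "... <= y x ^ Q" unfolding yQ z_def by simp
   finally show ?thesis using Q0 y0[of x] power_mono_iff[of "cmod (x (i, j))" "y x" Q] by simp
  qed
  \<comment> \<open>With \<open>th = N / Q\<close> the left side is the product of the powers
    \<open>th\<close> of \<open>n^2\<close> and of \<open>z / n^2\<close>. As
    \<open>th <= 1\<close>, the second one is at most \<open>1 + z / n^2\<close>, whose mean is
    bounded.\<close>
  have yN: "y x ^ N <= real n powr (1 / 16) * (1 + z x / (real n)^2)" for x
  proof (cases "z x = 0")
   case True
   then have "y x = 0" using Q0 by (simp add: y_def)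
   then have "y x ^ N <= 1" by (cases N) auto
   then show ?thesis using True ge_one_powr_ge_zero[OF n1, of "1/16"] by simp
  next
   case False
   then have zp: "0 < z x" using z0[of x] by linarith
   define w where "w = z x / (real n)^2"
   define th where "th = real N / real Q"
   have th: "0 <= th" "th <= 1" "2 * th <= 1 / 16"
    using QN Q0 by (auto simp: th_def field_simps)
   have wp: "0 < w" using zp n by (simp add: w_def)
   have "y x ^ N = z x powr th"
   proof -
    have "y x = z x powr (1 / real Q)" unfolding y_def using zp Q0 by (simp add: root_powr_inverse)
    then have "y x ^ N = (z x powr (1 / real Q)) powr real N" using zp by (simp add: powr_realpow)
    then show ?thesis by (simp add: powr_powr th_def)
   qed
   also have "... = ((real n)^2) powr th * w powr th"
    using n zp by (simp add: w_def powr_mult[symmetric])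
   also have "((real n)^2) powr th = real n powr (2 * th)"
    using n by (simp add: powr_powr flip: powr_numeral)
   also have "real n powr (2 * th) * w powr th <= real n powr (1 / 16) * (1 + w)"
   proof (intro mult_mono)
    show "real n powr (2 * th) <= real n powr (1 / 16)" using n1 th by (intro powr_mono) auto
    show "w powr th <= 1 + w"
    proof (cases "w <= 1")
     case True
     then have "w powr th <= 1" using wp th by (simp add: powr_le1)
     then show ?thesis using wp by linarith
    next
     case False
     then have "w powr th <= w powr 1" using th by (intro powr_mono) auto
     then show ?thesis using wp by simp
    qed
   qed (use wp in auto)
   finally show ?thesis by (simp add: w_def)
  qed
  have Ez: "(\<integral>x. z x \<partial>Pr ?S) <= (c1 + mQ) * (real n)^2"
  proof -
   have iH: "integrable (Pr ?S) (HSq n q)" by (intro integrable_polybdd fS polybdd_HSq)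
   have ie: "integrable (Pr ?S) (\<lambda>x. cmod (x e) ^ Q)" if "e \<in> ?S" for e
    using that by (intro integrable_polybdd fS polybdd_intros)
   have "(\<integral>x. z x \<partial>Pr ?S) = (\<integral>x. HSq n q x / real n ^ (2 * q) \<partial>Pr ?S) + (\<integral>x. (\<Sum>e\<in>?S. cmod (x e) ^ Q) \<partial>Pr ?S)"
    unfolding z_def using iH ie by (intro Bochner_Integration.integral_add integrable_divide Bochner_Integration.integrable_sum) auto
   also have "(\<integral>x. (\<Sum>e\<in>?S. cmod (x e) ^ Q) \<partial>Pr ?S) = (\<Sum>e\<in>?S. mQ)"
    unfolding mQ_def using ie by (subst Bochner_Integration.integral_sum) (auto simp: integral_coord_moment[OF fS])
   also have "... = mQ * (real n)^2" by (simp add: power2_eq_square)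
   also have "(\<integral>x. HSq n q x / real n ^ (2 * q) \<partial>Pr ?S) = (\<integral>x. HSq n q x \<partial>Pr ?S) / real n ^ (2 * q)" by simp
   also have "... <= ((2 * real n) ^ (2 * q + 1) * (real (2 * q + 1) ^ (4 * q + 1) * (real (4 * q) * (\<integral>z. cmod z ^ (4 * q) \<partial>\<mu>)))) / real n ^ (2 * q)"
    by (intro divide_right_mono HSq_moment n) (use q1 in auto)
   also have "... = c1 * real n"
    unfolding c1_def power_mult_distrib using n by (simp add: power_add)
   also have "... <= c1 * (real n)^2"
    using c10 n1 by (intro mult_left_mono) (auto simp: power2_eq_square)
   finally show ?thesis by (simp add: algebra_simps)
  qed
  have "(\<integral>x. X x ^ N \<partial>Pr ?S) <= (\<integral>x. 2 ^ N * (A ^ N + real n powr (1 / 16) * (1 + z x / (real n)^2)) \<partial>Pr ?S)"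
  proof (rule integral_mono_polybdd[OF fS])
   show "polybdd ?S (\<lambda>x. X x ^ N)" by (intro polybdd_intros pX)
   show "polybdd ?S (\<lambda>x. 2 ^ N * (A ^ N + real n powr (1 / 16) * (1 + z x / (real n)^2)))" by (intro polybdd_intros pz)
   fix x
   have "X x <= 2 * max A (y x)" unfolding X_def by simp
   then have "X x ^ N <= (2 * max A (y x)) ^ N" using A y0[of x] by (intro power_mono) (auto simp: X_def)
   also have "... = 2 ^ N * max A (y x) ^ N" by (rule power_mult_distrib)
   also have "max A (y x) ^ N <= A ^ N + y x ^ N" using A y0[of x] by (auto simp: max_def)
   also have "A ^ N + y x ^ N <= A ^ N + real n powr (1 / 16) * (1 + z x / (real n)^2)" using yN[of x] by simp
   finally show "X x ^ N <= 2 ^ N * (A ^ N + real n powr (1 / 16) * (1 + z x / (real n)^2))" by simp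
  qed
  also have "... = 2 ^ N * (A ^ N + real n powr (1 / 16) * (1 + (\<integral>x. z x \<partial>Pr ?S) / (real n)^2))"
  proof -
   interpret P: prob_space "Pr ?S" by (rule prob_space_Pr)
   have "integrable (Pr ?S) z" by (intro integrable_polybdd fS pz)
   then show ?thesis by (simp add: P.prob_space)
  qed
  also have "... <= 2 ^ N * (A ^ N * real n powr (1 / 16) + real n powr (1 / 16) * (1 + (c1 + mQ)))"
  proof (intro mult_left_mono add_mono)
   have "1 <= real n powr (1 / 16)" using n1 by (simp add: ge_one_powr_ge_zero)
   then show "A ^ N <= A ^ N * real n powr (1 / 16)" using A by simp
   show "(\<integral>x. z x \<partial>Pr ?S) / (real n)^2 <= c1 + mQ" using Ez n by (simp add: divide_le_eq)
  qed auto
  also have "... = c * real n powr (1 / 16)" unfolding c_def by (simp add: algebra_simps)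
  finally have EX: "(\<integral>x. X x ^ N \<partial>Pr ?S) <= c * real n powr (1 / 16)" .
  have "A <= X x \<and> form_bound n (scaledX n x) (X x) \<and> (\<forall>i<n. \<forall>j<n. cmod (x (i, j)) <= X x)" for x
  proof (intro conjI allI impI)
   show "A <= X x" using y0[of x] by (simp add: X_def)
   have yX: "y x <= X x" using A by (simp add: X_def)
   show "form_bound n (scaledX n x) (X x)" by (rule form_bound_mono[OF fb yX])
   show "cmod (x (i, j)) <= X x" if "i < n" "j < n" for i j using xe[OF that, of x] yX by linarith
  qed
  then show "\<exists>X. polybdd ?S X \<and> (\<forall>x. A <= X x \<and> form_bound n (scaledX n x) (X x) \<and> (\<forall>i<n. \<forall>j<n. cmod (x (i, j)) <= X x))
    \<and> (\<integral>x. X x ^ N \<partial>Pr ?S) <= c * real n powr (1 / 16)"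
   using pX EX by blast
 qed
qed

end

section \<open>Smoothing and the Levy-Prokhorov distance\<close>

definition nrm :: "('a::euclidean_space => real) measure" where
 "nrm = PiM Basis (\<lambda>_. std_normal_distribution)"

definition nvec :: "('a::euclidean_space => real) => 'a" where
 "nvec w = (\<Sum>b\<in>Basis. w b *\<^sub>R b)"

text \<open>Unnormalised Gaussian density of width \<open>1 / s\<close> and, at the same time, the
  characteristic function of \<open>s\<close> times a standard Gaussian vector. The smoothing
  argument needs both readings.\<close>

definition gk :: "real => 'a::euclidean_space => real" where
 "gk s z = exp (- (s^2 * (norm z)^2 / 2))"

definition chf :: "'a::euclidean_space measure => 'a => complex" where
 "chf P a = (\<integral>x. iexp (a \<bullet> x) \<partial>P)"

lemma prob_space_std_normal: "prob_space std_normal_distribution" by (rule prob_space_normal_density) simp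

lemma prob_space_nrm: "prob_space nrm"
 unfolding nrm_def by (rule prob_space_PiM) (rule prob_space_std_normal)

lemma nvec_measurable [measurable]: "(nvec :: ('a::euclidean_space => real) => 'a) \<in> borel_measurable nrm"
proof -
 have "(\<lambda>w. w b) \<in> borel_measurable (nrm :: ('a => real) measure)" if "b \<in> Basis" for b :: 'a
  unfolding nrm_def
  using measurable_component_singleton[OF that, of "\<lambda>_. std_normal_distribution"] by (simp add: measurable_cong_sets[OF refl sets_density])
 then show ?thesis
  unfolding nvec_def[abs_def] by (intro borel_measurable_sum borel_measurable_scaleR) auto
qed

lemma norm_square_Basis: "(norm z)^2 = (\<Sum>b\<in>Basis. (z \<bullet> b)^2)" for z :: "'a::euclidean_space"
 unfolding power2_norm_eq_inner by (subst euclidean_inner) (simp add: power2_eq_square)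

lemma gk_eq_char:
 fixes z :: "'a::euclidean_space"
 shows "cor (gk s z) = (\<integral>w. iexp (s * (z \<bullet> nvec w)) \<partial>nrm)"
proof -
 interpret N: prob_space std_normal_distribution by (rule prob_space_std_normal)
 interpret product_sigma_finite "\<lambda>_::'a. std_normal_distribution" by (simp add: product_sigma_finite_def N.sigma_finite_measure_axioms)
 have "iexp (s * (z \<bullet> nvec w)) = (\<Prod>b\<in>Basis. iexp ((s * (z \<bullet> b)) * w b))" for w :: "'a => real"
  by (simp add: nvec_def inner_sum_right sum_distrib_left exp_sum[symmetric] mult_ac)
 then have "(\<integral>w. iexp (s * (z \<bullet> nvec w)) \<partial>nrm)
   = (\<Prod>b\<in>(Basis::'a set). (\<integral>x. iexp ((s * (z \<bullet> b)) * x) \<partial>std_normal_distribution))"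
  unfolding nrm_def by (simp only:) (rule product_integral_prod, auto intro!: N.integrable_const_bound[where B = 1])
 also have "... = (\<Prod>b\<in>(Basis::'a set). cor (exp (- ((s * (z \<bullet> b))^2) / 2)))"
  using char_std_normal_distribution unfolding char_def by (intro prod.cong refl) (metis of_real_mult)
 also have "... = cor (exp (\<Sum>b\<in>(Basis::'a set). - ((s * (z \<bullet> b))^2) / 2))"
  by (simp only: of_real_prod[symmetric] exp_sum finite_Basis)
 also have "(\<Sum>b\<in>(Basis::'a set). - ((s * (z \<bullet> b))^2) / 2) = - (s^2 * (norm z)^2 / 2)"
  unfolding norm_square_Basis by (simp add: sum_negf power_mult_distrib sum_distrib_left sum_divide_distrib)
 finally show ?thesis by (simp add: gk_def)
qed

lemma gk_measurable [measurable]: "gk s \<in> borel_measurable borel"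
 unfolding gk_def[abs_def] by measurable

lemma gk_bounds: "0 < gk s z" "gk s z <= 1" by (auto simp: gk_def)

lemma nn_integral_gauss:
 assumes "0 < s"
 shows "(\<integral>\<^sup>+x. ennreal (exp (- (s^2 * x^2 / 2))) \<partial>lborel) = ennreal (sqrt (2 * pi) / s)"
proof -
 interpret prob_space "density lborel (normal_density 0 (1 / s))" by (rule prob_space_normal_density) (use assms in simp)
 have "exp (- (s^2 * x^2 / 2)) = sqrt (2 * pi) / s * normal_density 0 (1 / s) x" for x
  using assms by (simp add: normal_density_def real_sqrt_mult real_sqrt_divide field_simps power_divide)
 then have "(\<integral>\<^sup>+x. ennreal (exp (- (s^2 * x^2 / 2))) \<partial>lborel)
   = (\<integral>\<^sup>+x. ennreal (sqrt (2 * pi) / s) * ennreal (normal_density 0 (1 / s) x) \<partial>lborel)"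
  using assms by (simp add: ennreal_mult[symmetric])
 also have "... = ennreal (sqrt (2 * pi) / s) * (\<integral>\<^sup>+x. ennreal (normal_density 0 (1 / s) x) \<partial>lborel)"
  by (rule nn_integral_cmult) simp
 also have "(\<integral>\<^sup>+x. ennreal (normal_density 0 (1 / s) x) \<partial>lborel) = 1"
  using emeasure_space_1 by (simp add: emeasure_density)
 finally show ?thesis by simp
qed

lemma nn_integral_gk:
 assumes "0 < s"
 shows "(\<integral>\<^sup>+z. ennreal (gk s z) \<partial>(lborel :: 'a::euclidean_space measure)) = ennreal ((sqrt (2 * pi) / s) ^ DIM('a))"
proof -
 have "gk s z = (\<Prod>b\<in>Basis. exp (- (s^2 * (z \<bullet> b)^2 / 2)))" for z :: 'a
  unfolding gk_def norm_square_Basis by (simp add: exp_sum[symmetric] sum_negf sum_distrib_left sum_divide_distrib)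
 then have "(\<integral>\<^sup>+z. ennreal (gk s z) \<partial>(lborel :: 'a measure)) = (\<integral>\<^sup>+z. (\<Prod>b\<in>Basis. ennreal (exp (- (s^2 * (z \<bullet> b)^2 / 2)))) \<partial>(lborel :: 'a measure))"
  by (simp add: prod_ennreal)
 also have "... = (\<Prod>b\<in>(Basis::'a set). (\<integral>\<^sup>+x. ennreal (exp (- (s^2 * x^2 / 2))) \<partial>lborel))"
  by (rule nn_integral_lborel_prod) auto
 also have "... = ennreal ((sqrt (2 * pi) / s) ^ DIM('a))"
  unfolding nn_integral_gauss[OF assms] using assms by (simp add: ennreal_power)
 finally show ?thesis .
qed

lemma nn_integral_translate:
 fixes f :: "'a::euclidean_space => ennreal"
 assumes "f \<in> borel_measurable borel"
 shows "(\<integral>\<^sup>+y. f (y - x) \<partial>lborel) = (\<integral>\<^sup>+y. f y \<partial>lborel)"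
proof -
 have "(\<integral>\<^sup>+y. f y \<partial>lborel) = (\<integral>\<^sup>+y. f y \<partial>distr lborel borel ((+) (- x)))"
  by (simp add: lborel_distr_plus)
 also have "... = (\<integral>\<^sup>+y. f (- x + y) \<partial>lborel)"
  using assms by (subst nn_integral_distr) auto
 finally show ?thesis by (simp add: add.commute)
qed

text \<open>Half of the exponent is spent on the tail; the other half is integrated as the kernel
  with parameter \<open>s / sqrt 2\<close>, which explains the powers of
  \<open>sqrt 2\<close>.\<close>

lemma nn_integral_gk_tail:
 assumes "0 < s" "0 < d"
 shows "(\<integral>\<^sup>+z. ennreal (gk s z) * indicator {z. d <= norm z} z \<partial>(lborel :: 'a::euclidean_space measure))
  <= ennreal ((sqrt (2 * pi) / s) ^ DIM('a) * (sqrt 2 ^ DIM('a) * exp (- (s^2 * d^2 / 4))))"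
proof -
 have le: "ennreal (gk s z) * indicator {z. d <= norm z} z <= ennreal (exp (- (s^2 * d^2 / 4))) * ennreal (gk (s / sqrt 2) z)" for z :: 'a
 proof (cases "d <= norm z")
  case True
  then have "d^2 <= (norm z)^2" using assms by (intro power_mono) auto
  then have "s^2 * d^2 <= s^2 * (norm z)^2" by (intro mult_left_mono) auto
  then have "gk s z <= exp (- (s^2 * d^2 / 4)) * gk (s / sqrt 2) z"
   unfolding gk_def by (simp add: power_divide flip: exp_add)
  then show ?thesis using True gk_bounds[of s z] gk_bounds[of "s / sqrt 2" z] by (simp add: ennreal_leI flip: ennreal_mult)
 qed simp
 have "(\<integral>\<^sup>+z. ennreal (gk s z) * indicator {z. d <= norm z} z \<partial>(lborel :: 'a measure))
   <= (\<integral>\<^sup>+z. ennreal (exp (- (s^2 * d^2 / 4))) * ennreal (gk (s / sqrt 2) z) \<partial>(lborel :: 'a measure))"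
  by (rule nn_integral_mono) (rule le)
 also have "... = ennreal (exp (- (s^2 * d^2 / 4))) * ennreal ((sqrt (2 * pi) / (s / sqrt 2)) ^ DIM('a))"
  using assms by (subst nn_integral_cmult) (auto simp: nn_integral_gk)
 also have "... = ennreal (exp (- (s^2 * d^2 / 4)) * (sqrt (2 * pi) / (s / sqrt 2)) ^ DIM('a))"
  using assms by (simp add: ennreal_mult)
 also have "(sqrt (2 * pi) / (s / sqrt 2)) ^ DIM('a) = (sqrt (2 * pi) / s) ^ DIM('a) * sqrt 2 ^ DIM('a)"
  unfolding power_mult_distrib[symmetric] by simp
 finally show ?thesis by (simp add: mult_ac)
qed

text \<open>Parseval's identity: the kernel is written as a characteristic function and the
  integrals are exchanged.\<close>

lemma gk_integral_eq_chf:
 fixes P :: "'a::euclidean_space measure"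
 assumes P: "prob_space P" "sets P = sets borel"
 shows "cor (\<integral>x. gk s (y - x) \<partial>P) = (\<integral>w. iexp (s * (y \<bullet> nvec w)) * chf P (- (s *\<^sub>R nvec w)) \<partial>nrm)"
proof -
 interpret P: prob_space P by fact
 interpret N: prob_space "nrm :: ('a => real) measure" by (rule prob_space_nrm)
 interpret PN: pair_prob_space P "nrm :: ('a => real) measure" ..
 have mP [measurable_cong]: "sets P = sets borel" by fact
 have "cor (\<integral>x. gk s (y - x) \<partial>P) = (\<integral>x. cor (gk s (y - x)) \<partial>P)" by (rule integral_complex_of_real[symmetric])
 also have "... = (\<integral>x. (\<integral>w. iexp (s * ((y - x) \<bullet> nvec w)) \<partial>nrm) \<partial>P)" by (simp only: gk_eq_char)
 also have "... = (\<integral>w. (\<integral>x. iexp (s * ((y - x) \<bullet> nvec w)) \<partial>P) \<partial>nrm)"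
 proof (rule PN.Fubini_integral[symmetric])
  have [measurable]: "(\<lambda>p. nvec (snd p)) \<in> borel_measurable (P \<Otimes>\<^sub>M (nrm :: ('a => real) measure))" by measurable
  show "integrable (P \<Otimes>\<^sub>M nrm) (\<lambda>(x, w). iexp (s * ((y - x) \<bullet> nvec w)))"
   by (rule PN.P.integrable_const_bound[where B = 1]) (auto simp: case_prod_unfold)
 qed
 also have "... = (\<integral>w. iexp (s * (y \<bullet> nvec w)) * chf P (- (s *\<^sub>R nvec w)) \<partial>nrm)"
 proof (rule Bochner_Integration.integral_cong[OF refl])
  fix w :: "'a => real"
  have "iexp (s * ((y - x) \<bullet> nvec w))
    = iexp (s * (y \<bullet> nvec w)) * iexp (- (s *\<^sub>R nvec w) \<bullet> x)" for x
   by (simp add: inner_diff_left algebra_simps inner_commute flip: exp_add)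
  then show "(\<integral>x. iexp (s * ((y - x) \<bullet> nvec w)) \<partial>P)
    = iexp (s * (y \<bullet> nvec w)) * chf P (- (s *\<^sub>R nvec w))"
   unfolding chf_def by (simp only: integral_mult_right_zero)
 qed
 finally show ?thesis .
qed

lemma chf_bounded: assumes "prob_space P" shows "cmod (chf P a) <= 1"
proof -
 interpret prob_space P by fact
 show ?thesis unfolding chf_def
  using integral_norm_bound_integral'[of P "\<lambda>_. 1" "\<lambda>x. iexp (a \<bullet> x)"] by (simp add: prob_space)
qed

lemma chf_nvec_measurable:
 fixes P :: "'a::euclidean_space measure"
 assumes P: "prob_space P" "sets P = sets borel"
 shows "(\<lambda>w. chf P (c *\<^sub>R nvec w)) \<in> borel_measurable nrm"
proof -
 interpret P: prob_space P by fact
 have mP [measurable_cong]: "sets P = sets borel" by fact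
 have [measurable]: "(\<lambda>p. nvec (fst p)) \<in> borel_measurable ((nrm :: ('a => real) measure) \<Otimes>\<^sub>M P)" by measurable
 show ?thesis unfolding chf_def by (rule P.borel_measurable_lebesgue_integral) (simp add: case_prod_unfold)
qed

text \<open>Difference of characteristic functions averaged over Gaussian points. It tends to 0
  under mere pointwise convergence, and it bounds the difference of the smoothed densities uniformly
  in the base point.\<close>

definition chd :: "real => 'a::euclidean_space measure => 'a measure => real" where
 "chd s P Q = (\<integral>w. cmod (chf P (- (s *\<^sub>R nvec w)) - chf Q (- (s *\<^sub>R nvec w))) \<partial>nrm)"

lemma chd_commute: "chd s P Q = chd s Q P" by (simp add: chd_def norm_minus_commute)

lemma chd_nonneg: "0 <= chd s P Q" by (simp add: chd_def)

lemma gk_integral_diff_le: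
 fixes P Q :: "'a::euclidean_space measure"
 assumes P: "prob_space P" "sets P = sets borel" and Q: "prob_space Q" "sets Q = sets borel"
 shows "(\<integral>x. gk s (y - x) \<partial>P) <= (\<integral>x. gk s (y - x) \<partial>Q) + chd s P Q"
proof -
 interpret N: prob_space "nrm :: ('a => real) measure" by (rule prob_space_nrm)
 let ?e = "\<lambda>w. iexp (s * (y \<bullet> nvec w))"
 have m: "(\<lambda>w. chf R (- (s *\<^sub>R nvec w))) \<in> borel_measurable nrm" if "prob_space R" "sets R = sets borel" for R :: "'a measure"
  using chf_nvec_measurable[OF that, of "- s"] by simp
 have [measurable]: "(\<lambda>w. chf P (- (s *\<^sub>R nvec w))) \<in> borel_measurable nrm" "(\<lambda>w. chf Q (- (s *\<^sub>R nvec w))) \<in> borel_measurable nrm"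
  by (rule m[OF P], rule m[OF Q])
 have i: "integrable nrm (\<lambda>w. ?e w * chf R (- (s *\<^sub>R nvec w)))" if "prob_space R" "sets R = sets borel" for R :: "'a measure"
 proof (rule N.integrable_const_bound[where B = 1])
  have [measurable]: "(\<lambda>w. chf R (- (s *\<^sub>R nvec w))) \<in> borel_measurable nrm" by (rule m[OF that])
  show "(\<lambda>w. ?e w * chf R (- (s *\<^sub>R nvec w))) \<in> borel_measurable nrm" by measurable
 qed (simp add: norm_mult chf_bounded that)
 have "cor ((\<integral>x. gk s (y - x) \<partial>P) - (\<integral>x. gk s (y - x) \<partial>Q))
   = (\<integral>w. ?e w * chf P (- (s *\<^sub>R nvec w)) - ?e w * chf Q (- (s *\<^sub>R nvec w)) \<partial>nrm)"
  unfolding of_real_diff gk_integral_eq_chf[OF P] gk_integral_eq_chf[OF Q]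
  by (rule Bochner_Integration.integral_diff[symmetric]) (rule i[OF P], rule i[OF Q])
 then have "\<bar>(\<integral>x. gk s (y - x) \<partial>P) - (\<integral>x. gk s (y - x) \<partial>Q)\<bar>
   = cmod (\<integral>w. ?e w * chf P (- (s *\<^sub>R nvec w)) - ?e w * chf Q (- (s *\<^sub>R nvec w)) \<partial>nrm)" by (metis norm_of_real)
 also have "... <= chd s P Q"
  unfolding chd_def
 proof (rule integral_norm_bound_integral')
  have b: "cmod (chf P a - chf Q a) <= 2" for a
   using norm_triangle_ineq4[of "chf P a" "chf Q a"] chf_bounded[OF P(1), of a] chf_bounded[OF Q(1), of a] by linarith
  show "integrable nrm (\<lambda>w. cmod (chf P (- (s *\<^sub>R nvec w)) - chf Q (- (s *\<^sub>R nvec w))))"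
   by (rule N.integrable_const_bound[where B = 2]) (auto simp: b)
 qed (auto simp: norm_mult simp flip: right_diff_distrib)
 finally show ?thesis by linarith
qed

text \<open>Both laws are convolved with the kernel of total mass \<open>c\<close>, and the masses
  on the neighbourhood \<open>U\<close> of the bounded part of \<open>A\<close> are compared. The
  smoothed densities differ by at most \<open>chd s P Q\<close>, integrated over a set of finite
  volume; the kernel mass beyond distance \<open>d\<close> costs \<open>\<eta>\<close> once for each
  law.\<close>

lemma smoothing_inequality:
 fixes P Q :: "'a::euclidean_space measure"
 assumes P: "prob_space P" "sets P = sets borel" and Q: "prob_space Q" "sets Q = sets borel"
  and s: "0 < s" and d: "0 < d" and A: "A \<in> sets borel"
 defines "c \<equiv> (sqrt (2 * pi) / s) ^ DIM('a)" and "\<eta> \<equiv> sqrt 2 ^ DIM('a) * exp (- (s^2 * d^2 / 4))"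
 shows "measure P (A \<inter> ball 0 R) <= measure Q {x. \<exists>y\<in>A. dist x y < 2 * d} + 2 * \<eta>
  + chd s P Q * measure lborel (ball (0::'a) (R + d)) / c"
proof -
 interpret P: prob_space P by fact
 interpret Q: prob_space Q by fact
 have mP [measurable_cong]: "sets P = sets borel" and mQ [measurable_cong]: "sets Q = sets borel" by fact+
 have c0: "0 < c" using s by (simp add: c_def)
 have \<eta>0: "0 <= \<eta>" by (simp add: \<eta>_def)
 define B where "B = A \<inter> ball 0 R"
 define U where "U = (\<Union>x\<in>B. ball x d)"
 define A2 where "A2 = {x. \<exists>y\<in>A. dist x y < 2 * d}"
 have oU: "open U" by (auto simp: U_def)
 then have [measurable]: "U \<in> sets borel" by simp
 have "A2 = (\<Union>y\<in>A. ball y (2 * d))" by (auto simp: A2_def dist_commute)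
 then have "open A2" by auto
 then have [measurable]: "A2 \<in> sets borel" by simp
 have [measurable]: "B \<in> sets borel" using A by (simp add: B_def)
 have UB: "U \<subseteq> ball 0 (R + d)"
 proof
  fix y assume "y \<in> U"
  then obtain x where "x \<in> B" "dist x y < d" by (auto simp: U_def)
  then show "y \<in> ball 0 (R + d)" using dist_triangle[of 0 y x] by (auto simp: B_def)
 qed
 \<comment> \<open>The mass that the kernel centred at \<open>x\<close> gives to \<open>U\<close>:
   nearly all of \<open>c\<close> for \<open>x\<close> in \<open>B\<close> (\<open>low\<close>),
   nearly nothing for \<open>x\<close> outside \<open>A2\<close> (\<open>up\<close>).\<close>
 define G where "G = (\<lambda>x. \<integral>\<^sup>+y. indicator U y * ennreal (gk s (y - x)) \<partial>lborel)"
 have tot: "(\<integral>\<^sup>+y. ennreal (gk s (y - x)) \<partial>lborel) = ennreal c" for x :: 'a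
  using nn_integral_translate[of "\<lambda>z. ennreal (gk s z)" x] nn_integral_gk[OF s, where 'a = 'a] by (simp add: c_def)
 have tail: "(\<integral>\<^sup>+y. ennreal (gk s (y - x)) * indicator {z. d <= norm z} (y - x) \<partial>lborel) <= ennreal (c * \<eta>)" for x :: 'a
 proof -
  have [measurable]: "{z::'a. d <= norm z} \<in> sets borel" by simp
  show ?thesis
   using nn_integral_translate[of "\<lambda>z. ennreal (gk s z) * indicator {z. d <= norm z} z" x]
    nn_integral_gk_tail[OF s d, where 'a = 'a] by (simp add: c_def \<eta>_def)
 qed
 have low: "ennreal c * indicator B x <= G x + ennreal (c * \<eta>)" for x
 proof (cases "x \<in> B")
  case True
  then have sub: "ball x d \<subseteq> U" by (auto simp: U_def)
  have "ennreal c = (\<integral>\<^sup>+y. ennreal (gk s (y - x)) \<partial>lborel)" by (simp add: tot)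
  also have "... <= (\<integral>\<^sup>+y. indicator U y * ennreal (gk s (y - x)) + ennreal (gk s (y - x)) * indicator {z. d <= norm z} (y - x) \<partial>lborel)"
  proof (rule nn_integral_mono)
   fix y
   show "ennreal (gk s (y - x)) <= indicator U y * ennreal (gk s (y - x)) + ennreal (gk s (y - x)) * indicator {z. d <= norm z} (y - x)"
    using sub by (cases "dist x y < d") (auto simp: indicator_def dist_norm norm_minus_commute)
  qed
  also have "... = G x + (\<integral>\<^sup>+y. ennreal (gk s (y - x)) * indicator {z. d <= norm z} (y - x) \<partial>lborel)"
   unfolding G_def by (rule nn_integral_add) auto
  also have "... <= G x + ennreal (c * \<eta>)" by (intro add_left_mono tail)
  finally show ?thesis using True by simp
 qed simp
 have up: "G x <= ennreal c * indicator A2 x + ennreal (c * \<eta>)" for x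
 proof (cases "x \<in> A2")
  case True
  have "G x <= (\<integral>\<^sup>+y. ennreal (gk s (y - x)) \<partial>lborel)" unfolding G_def by (rule nn_integral_mono) (auto simp: indicator_def)
  then show ?thesis using True by (simp add: tot add_increasing2)
 next
  case False
  have "G x <= (\<integral>\<^sup>+y. ennreal (gk s (y - x)) * indicator {z. d <= norm z} (y - x) \<partial>lborel)"
   unfolding G_def
  proof (rule nn_integral_mono)
   fix y
   show "indicator U y * ennreal (gk s (y - x)) <= ennreal (gk s (y - x)) * indicator {z. d <= norm z} (y - x)"
   proof (cases "y \<in> U")
    case True
    then obtain b where b: "b \<in> A" "dist b y < d" by (auto simp: U_def B_def)
    then have "2 * d <= dist x b" using False by (auto simp: A2_def not_less)
    then have "d <= dist x y" using b dist_triangle[of x b y] by (simp add: dist_commute)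
    then show ?thesis using True by (simp add: dist_norm norm_minus_commute)
   qed simp
  qed
  also have "... <= ennreal (c * \<eta>)" by (rule tail)
  finally show ?thesis using False by simp
 qed
 have Gm: "G \<in> borel_measurable borel"
  unfolding G_def by (rule sigma_finite_measure.borel_measurable_nn_integral[OF sigma_finite_lborel]) (simp add: case_prod_unfold, measurable)
 have Gmeas: "G \<in> borel_measurable P" "G \<in> borel_measurable Q"
  using Gm by (auto simp: measurable_cong_sets[OF P(2) refl] measurable_cong_sets[OF Q(2) refl])
 have swap: "(\<integral>\<^sup>+x. G x \<partial>S) = (\<integral>\<^sup>+y. indicator U y * ennreal (\<integral>x. gk s (y - x) \<partial>S) \<partial>lborel)"
  if S: "prob_space S" "sets S = sets borel" for S :: "'a measure"
 proof -
  interpret S: prob_space S by fact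
  interpret L: sigma_finite_measure "lborel :: 'a measure" by (rule sigma_finite_lborel)
  interpret SL: pair_sigma_finite S "lborel :: 'a measure" ..
  have mS [measurable_cong]: "sets S = sets borel" by fact
  have "(\<integral>\<^sup>+x. G x \<partial>S) = (\<integral>\<^sup>+y. (\<integral>\<^sup>+x. indicator U y * ennreal (gk s (y - x)) \<partial>S) \<partial>lborel)"
   unfolding G_def by (rule SL.Fubini'[symmetric]) (simp add: case_prod_unfold, measurable)
  also have "... = (\<integral>\<^sup>+y. indicator U y * ennreal (\<integral>x. gk s (y - x) \<partial>S) \<partial>lborel)"
  proof (rule nn_integral_cong)
   fix y
   have "(\<integral>\<^sup>+x. indicator U y * ennreal (gk s (y - x)) \<partial>S) = indicator U y * (\<integral>\<^sup>+x. ennreal (gk s (y - x)) \<partial>S)"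
    by (rule nn_integral_cmult) simp
   also have "(\<integral>\<^sup>+x. ennreal (gk s (y - x)) \<partial>S) = ennreal (\<integral>x. gk s (y - x) \<partial>S)"
   proof (rule nn_integral_eq_integral)
    show "integrable S (\<lambda>x. gk s (y - x))" by (intro S.integrable_const_bound[where B = 1]) (auto simp: abs_of_pos gk_bounds)
   qed (auto simp: less_imp_le gk_bounds)
   finally show "(\<integral>\<^sup>+x. indicator U y * ennreal (gk s (y - x)) \<partial>S) = indicator U y * ennreal (\<integral>x. gk s (y - x) \<partial>S)" .
  qed
  finally show ?thesis .
 qed
 have gint: "0 <= (\<integral>x. gk s (y - x) \<partial>S)" for y and S :: "'a measure" by (rule integral_nonneg_AE) (auto simp: less_imp_le gk_bounds)
 have "(\<integral>\<^sup>+x. G x \<partial>P) <= (\<integral>\<^sup>+y. indicator U y * ennreal (\<integral>x. gk s (y - x) \<partial>Q) + ennreal (chd s P Q) * indicator U y \<partial>lborel)"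
  unfolding swap[OF P]
 proof (rule nn_integral_mono)
  fix y
  show "indicator U y * ennreal (\<integral>x. gk s (y - x) \<partial>P) <= indicator U y * ennreal (\<integral>x. gk s (y - x) \<partial>Q) + ennreal (chd s P Q) * indicator U y"
   using gk_integral_diff_le[OF P Q, of s y] gint chd_nonneg[of s P Q] by (cases "y \<in> U") (auto simp flip: ennreal_plus intro: ennreal_leI)
 qed
 also have "... = (\<integral>\<^sup>+x. G x \<partial>Q) + ennreal (chd s P Q) * emeasure lborel U"
 proof -
  have m: "(\<lambda>y. \<integral>x. gk s (y - x) \<partial>Q) \<in> borel_measurable lborel"
   by (rule Q.borel_measurable_lebesgue_integral) (simp add: case_prod_unfold, measurable)
  have "(\<integral>\<^sup>+y. indicator U y * ennreal (\<integral>x. gk s (y - x) \<partial>Q) + ennreal (chd s P Q) * indicator U y \<partial>lborel)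
    = (\<integral>\<^sup>+y. indicator U y * ennreal (\<integral>x. gk s (y - x) \<partial>Q) \<partial>lborel) + (\<integral>\<^sup>+y. ennreal (chd s P Q) * indicator U y \<partial>lborel)"
   by (rule nn_integral_add) (use m in measurable)
  also have "(\<integral>\<^sup>+y. ennreal (chd s P Q) * indicator U y \<partial>lborel) = ennreal (chd s P Q) * emeasure lborel U"
   by (simp add: nn_integral_cmult_indicator)
  finally show ?thesis unfolding swap[OF Q] .
 qed
 also have "emeasure lborel U <= ennreal (measure lborel (ball (0::'a) (R + d)))"
 proof -
  have "emeasure lborel U <= emeasure lborel (ball (0::'a) (R + d))" by (rule emeasure_mono[OF UB]) simp
  also have "... = ennreal (measure lborel (ball (0::'a) (R + d)))"
   by (rule emeasure_eq_ennreal_measure) (metis emeasure_lborel_ball_finite infinity_ennreal_def less_irrefl)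
  finally show ?thesis .
 qed
 finally have mid: "(\<integral>\<^sup>+x. G x \<partial>P) <= (\<integral>\<^sup>+x. G x \<partial>Q) + ennreal (chd s P Q) * ennreal (measure lborel (ball (0::'a) (R + d)))"
  by (simp add: mult_left_mono)
 have "ennreal (c * measure P B) = (\<integral>\<^sup>+x. ennreal c * indicator B x \<partial>P)"
  using c0 by (simp add: nn_integral_cmult_indicator P.emeasure_eq_measure ennreal_mult)
 also have "... <= (\<integral>\<^sup>+x. G x + ennreal (c * \<eta>) \<partial>P)" by (rule nn_integral_mono) (rule low)
 also have "... = (\<integral>\<^sup>+x. G x \<partial>P) + ennreal (c * \<eta>)"
  using Gmeas by (subst nn_integral_add) (auto simp: P.emeasure_space_1)
 also have "(\<integral>\<^sup>+x. G x \<partial>P) <= (\<integral>\<^sup>+x. G x \<partial>Q) + ennreal (chd s P Q) * ennreal (measure lborel (ball (0::'a) (R + d)))"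
  by (rule mid)
 also have "(\<integral>\<^sup>+x. G x \<partial>Q) <= (\<integral>\<^sup>+x. ennreal c * indicator A2 x + ennreal (c * \<eta>) \<partial>Q)" by (rule nn_integral_mono) (rule up)
 also have "... = ennreal (c * measure Q A2) + ennreal (c * \<eta>)"
  using c0 by (subst nn_integral_add) (auto simp: Q.prob_space nn_integral_cmult_indicator Q.emeasure_eq_measure ennreal_mult)
 finally have "ennreal (c * measure P B) <= ennreal (c * measure Q A2) + ennreal (c * \<eta>)
   + ennreal (chd s P Q) * ennreal (measure lborel (ball (0::'a) (R + d))) + ennreal (c * \<eta>)" by (simp add: add_mono)
 also have "... = ennreal (c * measure Q A2 + c * \<eta> + chd s P Q * measure lborel (ball (0::'a) (R + d)) + c * \<eta>)"
 proof -
  have nn: "0 <= c * measure Q A2" "0 <= c * \<eta>" "0 <= chd s P Q * measure lborel (ball (0::'a) (R + d))"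
   using c0 \<eta>0 chd_nonneg[of s P Q] by auto
  have "ennreal (chd s P Q) * ennreal (measure lborel (ball (0::'a) (R + d))) = ennreal (chd s P Q * measure lborel (ball (0::'a) (R + d)))"
   by (rule ennreal_mult[symmetric, OF chd_nonneg measure_nonneg])
  then show ?thesis using nn by (simp only: ennreal_plus add_nonneg_nonneg)
 qed
 finally have "c * measure P B <= c * measure Q A2 + c * \<eta> + chd s P Q * measure lborel (ball (0::'a) (R + d)) + c * \<eta>"
  using c0 \<eta>0 chd_nonneg[of s P Q] by (subst (asm) ennreal_le_iff) (auto intro!: add_nonneg_nonneg)
 then have "c * measure P B <= c * (measure Q A2 + 2 * \<eta> + chd s P Q * measure lborel (ball (0::'a) (R + d)) / c)"
  using c0 by (simp add: algebra_simps)
 then show ?thesis using c0 by (simp add: B_def A2_def)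
qed

lemma chd_tendsto_0:
 fixes P Q :: "nat => 'a::euclidean_space measure"
 assumes P: "\<And>n. prob_space (P n)" "\<And>n. sets (P n) = sets borel"
  and Q: "\<And>n. prob_space (Q n)" "\<And>n. sets (Q n) = sets borel"
  and chf: "\<And>a. (\<lambda>n. chf (P n) a - chf (Q n) a) \<longlonglongrightarrow> 0"
 shows "(\<lambda>n. chd s (P n) (Q n)) \<longlonglongrightarrow> 0"
proof -
 interpret N: prob_space "nrm :: ('a => real) measure" by (rule prob_space_nrm)
 have [measurable]: "(\<lambda>w. chf (P n) (- (s *\<^sub>R nvec w))) \<in> borel_measurable nrm"
  "(\<lambda>w. chf (Q n) (- (s *\<^sub>R nvec w))) \<in> borel_measurable nrm" for n
  using chf_nvec_measurable[OF P, of n "- s"] chf_nvec_measurable[OF Q, of n "- s"] by auto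
 have b: "cmod (chf (P n) a - chf (Q n) a) <= 2" for n a
  using norm_triangle_ineq4[of "chf (P n) a" "chf (Q n) a"] chf_bounded[OF P(1), of n a] chf_bounded[OF Q(1), of n a] by linarith
 have "(\<lambda>n. chd s (P n) (Q n)) \<longlonglongrightarrow> (\<integral>w. 0 \<partial>(nrm :: ('a => real) measure))"
  unfolding chd_def
 proof (rule integral_dominated_convergence[where w = "\<lambda>_. 2"])
  show "AE w in nrm. (\<lambda>n. cmod (chf (P n) (- (s *\<^sub>R nvec w)) - chf (Q n) (- (s *\<^sub>R nvec w)))) \<longlonglongrightarrow> 0"
   by (intro AE_I2 tendsto_norm_zero chf)
 qed (auto simp: b)
 then show ?thesis by simp
qed

lemma LP_le:
 assumes "0 < e" "\<And>A. A \<in> sets borel ==> measure P A <= measure Q {x. \<exists>y\<in>A. dist x y < e} + e"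
  "\<And>A. A \<in> sets borel ==> measure Q A <= measure P {x. \<exists>y\<in>A. dist x y < e} + e"
 shows "0 <= LP P Q" "LP P Q <= e"
proof -
 let ?S = "{e. e > 0 \<and> (\<forall>A\<in>sets borel. measure P A <= measure Q {x. \<exists>y\<in>A. dist x y < e} + e \<and>
    measure Q A <= measure P {x. \<exists>y\<in>A. dist x y < e} + e)}"
 have e: "e \<in> ?S" using assms by auto
 have "bdd_below ?S" by (intro bdd_belowI[of _ 0]) auto
 then show "LP P Q <= e" unfolding LP_def using e by (rule cInf_lower[rotated])
 show "0 <= LP P Q" unfolding LP_def using e by (intro cInf_greatest) auto
qed

text \<open>Tightness of \<open>Q n\<close> carries over to \<open>P n\<close>: the smoothing
  inequality with exchanged roles is applied to a large ball.\<close>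

lemma LP_tendsto_0:
 fixes P Q :: "nat => 'a::euclidean_space measure"
 assumes P: "\<And>n. prob_space (P n)" "\<And>n. sets (P n) = sets borel"
  and Q: "\<And>n. prob_space (Q n)" "\<And>n. sets (Q n) = sets borel"
  and chf: "\<And>a. (\<lambda>n. chf (P n) a - chf (Q n) a) \<longlonglongrightarrow> 0"
  and tight: "\<And>e. 0 < e ==> \<exists>R. \<forall>\<^sub>F n in sequentially. measure (Q n) (- ball 0 R) <= e"
 shows "(\<lambda>n. LP (P n) (Q n)) \<longlonglongrightarrow> 0"
proof (rule LIMSEQ_I)
 fix r :: real assume "0 < r"
 define e where "e = r / 2"
 have e: "0 < e" "e < r" using \<open>0 < r\<close> by (auto simp: e_def)
 \<comment> \<open>\<open>2 * d <= e\<close> fits the neighbourhoods into radius \<open>e\<close>,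
   and \<open>2 * d <= 1\<close> lets a ball of radius \<open>R\<close> grow to radius
   \<open>R + 1\<close> at most.\<close>
 define d where "d = min (e / 2) (1/2)"
 have d: "0 < d" "2 * d <= e" "2 * d <= 1" using e by (auto simp: d_def)
 define h where "h = (\<lambda>s. sqrt 2 ^ DIM('a) * exp (- (s^2 * d^2 / 4)))"
 have "(h \<longlongrightarrow> 0) at_top"
  unfolding h_def using d(1) by real_asymp
 then have "\<forall>\<^sub>F s in at_top. h s < e / 16" using e by (intro order_tendstoD) auto
 then have "\<forall>\<^sub>F s in at_top. h s < e / 16 \<and> 0 < s"
  using eventually_gt_at_top[of 0] by eventually_elim simp
 then obtain s where s: "h s < e / 16" "0 < s" by (auto simp: eventually_at_top_linorder)
 obtain R0 where R0: "\<forall>\<^sub>F n in sequentially. measure (Q n) (- ball 0 R0) <= e / 8" using tight[of "e / 8"] e by auto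
 define R where "R = max R0 0"
 define c where "c = (sqrt (2 * pi) / s) ^ DIM('a)"
 define w where "w = measure lborel (ball (0::'a) (R + 1 + d)) / c"
 have c0: "0 < c" using s by (simp add: c_def)
 have "(\<lambda>n. chd s (P n) (Q n) * w) \<longlonglongrightarrow> 0 * w" by (intro tendsto_mult_right chd_tendsto_0 P Q chf)
 then have "\<forall>\<^sub>F n in sequentially. chd s (P n) (Q n) * w < e / 8" using e by (intro order_tendstoD) auto
 with R0 have "\<forall>\<^sub>F n in sequentially. 0 <= LP (P n) (Q n) \<and> LP (P n) (Q n) <= e"
 proof eventually_elim
  fix n assume n: "measure (Q n) (- ball 0 R0) <= e / 8" "chd s (P n) (Q n) * w < e / 8"
  interpret P: prob_space "P n" by (rule P)
  interpret Q: prob_space "Q n" by (rule Q)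
  have mn [measurable_cong]: "sets (P n) = sets borel" "sets (Q n) = sets borel" by (rule P Q)+
  have open_nbh: "open {x. \<exists>y\<in>A. dist x y < q}" for A :: "'a set" and q
  proof -
   have "{x. \<exists>y\<in>A. dist x y < q} = (\<Union>y\<in>A. ball y q)" by (auto simp: dist_commute)
   then show ?thesis by auto
  qed
  have nbh [measurable]: "{x. \<exists>y\<in>A. dist x y < q} \<in> sets borel" for A :: "'a set" and q
   using open_nbh by simp
  have err: "2 * h s + chd s (P n) (Q n) * measure lborel (ball (0::'a) (R' + d)) / c <= e / 4" if "R' <= R + 1" for R'
  proof -
   have "measure lborel (ball (0::'a) (R' + d)) <= measure lborel (ball (0::'a) (R + 1 + d))"
    using that by (intro measure_mono_fmeasurable fmeasurableI) (auto simp: emeasure_lborel_ball_finite[unfolded infinity_ennreal_def])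
   then have "chd s (P n) (Q n) * (measure lborel (ball (0::'a) (R' + d)) / c) <= chd s (P n) (Q n) * w"
    unfolding w_def using c0 by (intro mult_left_mono divide_right_mono chd_nonneg) auto
   then show ?thesis using n(2) s(1) by simp
  qed
  have PQ: "measure (P n) (A \<inter> ball 0 R') <= measure (Q n) {x. \<exists>y\<in>A. dist x y < 2 * d} + e / 4"
   if "A \<in> sets borel" "R' <= R + 1" for A R'
   using smoothing_inequality[OF P(1)[of n] P(2) Q(1)[of n] Q(2) s(2) d(1) that(1), of R'] err[OF that(2)]
   unfolding h_def c_def by linarith
  have QP: "measure (Q n) (A \<inter> ball 0 R') <= measure (P n) {x. \<exists>y\<in>A. dist x y < 2 * d} + e / 4"
   if "A \<in> sets borel" "R' <= R + 1" for A R'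
   using smoothing_inequality[OF Q(1)[of n] Q(2) P(1)[of n] P(2) s(2) d(1) that(1), of R'] err[OF that(2)]
   unfolding h_def c_def chd_commute[of s "Q n"] by linarith
  have split: "measure S A <= measure S (A \<inter> ball 0 R') + measure S (- ball 0 R')"
   if S: "prob_space S" "sets S = sets borel" and A: "A \<in> sets borel" for S :: "'a measure" and A R'
  proof -
   interpret S: prob_space S by fact
   have "measure S A <= measure S ((A \<inter> ball 0 R') \<union> - ball 0 R')"
    using A S by (intro S.finite_measure_mono) auto
   also have "... <= measure S (A \<inter> ball 0 R') + measure S (- ball 0 R')"
    using A S by (intro measure_Un_le) auto
   finally show ?thesis .
  qed
  have QR: "measure (Q n) (- ball 0 R) <= e / 8"
  proof -
   have "measure (Q n) (- ball 0 R) <= measure (Q n) (- ball 0 R0)" by (intro Q.finite_measure_mono) (auto simp: R_def mn)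
   then show ?thesis using n(1) by linarith
  qed
  \<comment> \<open>The ball of radius \<open>R\<close> carries almost all mass of
    \<open>Q n\<close>, so its neighbourhood, inside the ball of radius \<open>R + 1\<close>,
    carries most of the mass of \<open>P n\<close>.\<close>
  have PR: "measure (P n) (- ball 0 (R + 1)) <= e / 2"
  proof -
   have c1: "measure (Q n) (ball 0 R) = 1 - measure (Q n) (- ball 0 R)"
    using Q.prob_compl[of "- ball 0 R"] by (simp add: mn sets_eq_imp_space_eq[OF mn(2)] Compl_eq_Diff_UNIV[symmetric] double_complement)
   have "measure (Q n) (ball 0 R \<inter> ball 0 R) <= measure (P n) {x. \<exists>y\<in>ball 0 R. dist x y < 2 * d} + e / 4" by (rule QP) auto
   also have "measure (P n) {x. \<exists>y\<in>ball 0 R. dist x y < 2 * d} <= measure (P n) (ball 0 (R + 1))"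
   proof (rule P.finite_measure_mono)
    show "{x. \<exists>y\<in>ball 0 R. dist x y < 2 * d} \<subseteq> ball (0::'a) (R + 1)"
    proof clarify
     fix x y :: 'a assume "y \<in> ball 0 R" "dist x y < 2 * d"
     then show "x \<in> ball 0 (R + 1)" using dist_triangle[of 0 x y] d by (auto simp: dist_commute)
    qed
   qed (simp add: mn)
   also have "measure (P n) (ball 0 (R + 1)) = 1 - measure (P n) (- ball 0 (R + 1))"
    using P.prob_compl[of "- ball 0 (R + 1)"] by (simp add: mn sets_eq_imp_space_eq[OF mn(1)] Compl_eq_Diff_UNIV[symmetric] double_complement)
   finally show ?thesis using c1 QR e(1) by simp
  qed
  show "0 <= LP (P n) (Q n) \<and> LP (P n) (Q n) <= e"
  proof (intro conjI LP_le[OF e(1)])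
   fix A :: "'a set" assume A: "A \<in> sets borel"
   have mono: "measure S {x. \<exists>y\<in>A. dist x y < 2 * d} <= measure S {x. \<exists>y\<in>A. dist x y < e}"
    if "prob_space S" "sets S = sets borel" for S :: "'a measure"
   proof -
    interpret S: prob_space S by fact
    show ?thesis
    proof (rule S.finite_measure_mono)
     show "{x. \<exists>y\<in>A. dist x y < 2 * d} \<subseteq> {x. \<exists>y\<in>A. dist x y < e}"
      using d(2) by (smt (verit) Collect_mono)
    qed (simp add: that)
   qed
   have "measure (P n) A <= measure (P n) (A \<inter> ball 0 (R + 1)) + measure (P n) (- ball 0 (R + 1))" by (rule split[OF P A])
   also have "... <= (measure (Q n) {x. \<exists>y\<in>A. dist x y < 2 * d} + e / 4) + e / 2" by (rule add_mono[OF PQ[OF A order_refl] PR])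
   also have "... <= measure (Q n) {x. \<exists>y\<in>A. dist x y < e} + e" using mono[OF Q(1)[of n] Q(2)] e by linarith
   finally show "measure (P n) A <= measure (Q n) {x. \<exists>y\<in>A. dist x y < e} + e" .
   \<comment> \<open>\<open>LP_le\<close> has two conclusions with the same premises, so each bound
     is supplied for both.\<close>
   then show "measure (P n) A <= measure (Q n) {x. \<exists>y\<in>A. dist x y < e} + e" .
   have "measure (Q n) A <= measure (Q n) (A \<inter> ball 0 R) + measure (Q n) (- ball 0 R)" by (rule split[OF Q A])
   also have "... <= (measure (P n) {x. \<exists>y\<in>A. dist x y < 2 * d} + e / 4) + e / 8" by (rule add_mono[OF QP[OF A] QR]) simp
   also have "... <= measure (P n) {x. \<exists>y\<in>A. dist x y < e} + e" using mono[OF P(1)[of n] P(2)] e by linarith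
   finally show "measure (Q n) A <= measure (P n) {x. \<exists>y\<in>A. dist x y < e} + e" .
   then show "measure (Q n) A <= measure (P n) {x. \<exists>y\<in>A. dist x y < e} + e" .
  qed
 qed
 then obtain N where "\<And>n. N <= n ==> 0 <= LP (P n) (Q n) \<and> LP (P n) (Q n) <= e" by (auto simp: eventually_sequentially)
 then show "\<exists>no. \<forall>n\<ge>no. norm (LP (P n) (Q n) - 0) < r" using e by (intro exI[of _ N]) force
qed

section \<open>Decoupling of characteristic functions\<close>

lemma has_vector_derivative_quadratic:
 fixes f :: "real => 'a::real_normed_vector"
 assumes "\<And>t. norm (f t - f s - (t - s) *\<^sub>R f') <= C * (t - s)^2"
 shows "(f has_vector_derivative f') (at s within S)"
 unfolding has_vector_derivative_def
proof (rule has_derivativeI_sandwich[of 1 _ _ _ _ "\<lambda>t. C * \<bar>t - s\<bar>"])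
 show "bounded_linear (\<lambda>x. x *\<^sub>R f')" by (rule bounded_linear_scaleR_left)
 show "norm ((f y - f s) - (y - s) *\<^sub>R f') / norm (y - s) <= C * \<bar>y - s\<bar>" if "y \<noteq> s" for y
  using assms[of y] that by (simp add: divide_le_eq power2_eq_square mult.assoc abs_mult_self_eq)
 have "((\<lambda>t. C * \<bar>t - s\<bar>) \<longlongrightarrow> C * \<bar>s - s\<bar>) (at s within S)" by (intro tendsto_intros)
 then show "((\<lambda>t. C * \<bar>t - s\<bar>) \<longlongrightarrow> 0) (at s within S)" by simp
qed simp

text \<open>The integrating factor \<open>exp (s^2 * R / 4)\<close> turns the approximate equation
  into a function with small derivative. One factor \<open>exp (\<bar>R\<bar> / 4)\<close> bounds
  the integrating factor, a second one its inverse at the end point.\<close>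

lemma gaussian_ode:
 fixes \<phi> \<phi>' :: "real => complex"
 assumes d: "\<And>s. s \<in> {0..1} ==> (\<phi> has_vector_derivative \<phi>' s) (at s within {0..1})"
  and e: "\<And>s. s \<in> {0..1} ==> cmod (\<phi>' s + cor (s / 2 * R) * \<phi> s) <= E" and E: "0 <= E"
 shows "cmod (\<phi> 1 - \<phi> 0 * exp (- cor (R / 4))) <= E * exp (\<bar>R\<bar> / 2)"
proof -
 let ?g = "\<lambda>s. cor (exp (s^2 * R / 4))"
 define \<psi> where "\<psi> = (\<lambda>s. \<phi> s * ?g s)"
 let ?v = "\<lambda>s. \<phi> s * cor (exp (s^2 * R / 4) * (s / 2 * R)) + \<phi>' s * ?g s"
 have dg: "(?g has_vector_derivative cor (exp (s^2 * R / 4) * (s / 2 * R))) (at s within {0..1})" for s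
 proof -
  have "((\<lambda>s. exp (s^2 * R / 4)) has_real_derivative exp (s^2 * R / 4) * (s / 2 * R)) (at s within {0..1})"
   by (auto intro!: derivative_eq_intros)
  then have "((\<lambda>s. exp (s^2 * R / 4)) has_vector_derivative exp (s^2 * R / 4) * (s / 2 * R)) (at s within {0..1})"
   by (simp add: has_real_derivative_iff_has_vector_derivative)
  then show ?thesis by (rule bounded_linear.has_vector_derivative[OF bounded_linear_of_real])
 qed
 have d\<psi>: "(\<psi> has_derivative (\<lambda>h. h *\<^sub>R ?v s)) (at s within {0..1})" if "s \<in> {0..1}" for s
  unfolding \<psi>_def has_vector_derivative_def[symmetric] by (rule has_vector_derivative_mult[OF d[OF that] dg])
 have on: "onorm (\<lambda>h. h *\<^sub>R ?v s) <= E * exp (\<bar>R\<bar> / 4)" if s: "s \<in> {0..1}" for s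
 proof -
  have "?v s = (\<phi>' s + cor (s / 2 * R) * \<phi> s) * ?g s" by (simp add: algebra_simps)
  then have "cmod (?v s) = cmod (\<phi>' s + cor (s / 2 * R) * \<phi> s) * exp (s^2 * R / 4)" by (simp add: norm_mult)
  also have "... <= E * exp (\<bar>R\<bar> / 4)"
  proof (intro mult_mono e s)
   have "s^2 <= 1" using s by (simp add: power_le_one)
   then have "s^2 * \<bar>R\<bar> <= 1 * \<bar>R\<bar>" by (intro mult_right_mono) auto
   moreover have "s^2 * R <= s^2 * \<bar>R\<bar>" by (intro mult_left_mono) auto
   ultimately have "s^2 * R / 4 <= \<bar>R\<bar> / 4" by simp
   then show "exp (s^2 * R / 4) <= exp (\<bar>R\<bar> / 4)" by simp
  qed (use E in auto)
  finally have v: "cmod (?v s) <= E * exp (\<bar>R\<bar> / 4)" .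
  show ?thesis
  proof (rule onorm_le)
   fix h :: real
   have "\<bar>h\<bar> * cmod (?v s) <= \<bar>h\<bar> * (E * exp (\<bar>R\<bar> / 4))" by (intro mult_left_mono v) simp
   then show "norm (h *\<^sub>R ?v s) <= E * exp (\<bar>R\<bar> / 4) * norm h" by (simp add: mult.commute)
  qed
 qed
 have "cmod (\<psi> 1 - \<psi> 0) <= E * exp (\<bar>R\<bar> / 4) * norm (1 - 0 :: real)"
  by (rule differentiable_bound[OF convex_real_interval(5) d\<psi> on]) auto
 then have b: "cmod (\<phi> 1 * cor (exp (R / 4)) - \<phi> 0) <= E * exp (\<bar>R\<bar> / 4)" by (simp add: \<psi>_def)
 have "\<phi> 1 - \<phi> 0 * exp (- cor (R / 4)) = (\<phi> 1 * cor (exp (R / 4)) - \<phi> 0) * cor (exp (- R / 4))"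
  by (simp add: algebra_simps exp_of_real[symmetric] exp_minus)
 then have "cmod (\<phi> 1 - \<phi> 0 * exp (- cor (R / 4))) = cmod (\<phi> 1 * cor (exp (R / 4)) - \<phi> 0) * exp (- R / 4)" by (simp add: norm_mult)
 also have "... <= E * exp (\<bar>R\<bar> / 4) * exp (\<bar>R\<bar> / 4)" by (intro mult_mono b) (use E in auto)
 also have "... = E * exp (\<bar>R\<bar> / 2)" by (simp flip: exp_add)
 finally show ?thesis .
qed

text \<open>Counterparts of \<open>Zw\<close> and its phase outside the locale: there the
  coefficients are fixed, whereas here they move with the scale parameter.\<close>

definition Zv :: "nat => ('t => nat) => ('t => nat => cmat) => 't => arr => complex" where
 "Zv n k Cs t x = cor (sqrt (real n)) * wd n (Cs t) 0 (k t) x 0 0"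

definition phase :: "nat => ('t::finite => nat) => ('t => nat => cmat) => ('t => complex) => arr => real" where
 "phase n k Cs b x = Re (\<Sum>t\<in>UNIV. cnj (b t) * Zv n k Cs t x)"

lemma polybdd_Zv: "polybdd ({..<n} \<times> {..<n}) (Zv n k Cs t)"
proof -
 have "polybdd ({..<n} \<times> {..<n}) (\<lambda>x. Zv n k Cs t x)" unfolding Zv_def by (intro polybdd_intros polybdd_wd)
 then show ?thesis .
qed

lemma polybdd_phase: "polybdd ({..<n} \<times> {..<n}) (phase n k Cs b)"
proof -
 have "polybdd ({..<n} \<times> {..<n}) (\<lambda>x. phase n k Cs b x)" unfolding phase_def by (intro polybdd_intros polybdd_Zv)
 then show ?thesis .
qed

lemma polybdd_iexp:
 assumes "polybdd S f" shows "polybdd S (\<lambda>x. iexp (f x))"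
proof (rule polybdd_bounded[where C = 1])
 show "(\<lambda>x. iexp (f x)) \<in> borel_measurable (PiM S (\<lambda>_. borel))"
  using polybdd_measurable[OF assms] by measurable
qed simp

context gram_entries
begin

definition sg :: "('t => nat) => ('t => nat => cmat) => bool => 't => 't => complex" where
 "sg k Cs \<kappa> t0 t = (\<Sum>i<n. Cs t0 0 0 i * kap \<kappa> (Cs t 0 0 i)) * glim (Cs t0) (Cs t) 0 0 \<kappa> 1 (k t0 - 1) 1 (k t - 1)"

text \<open>The sum over all \<open>m <= M\<close> makes the bound independent of the word to which
  Stein's identity is applied.\<close>

definition stein_error :: "nat => real => real => real" where
 "stein_error c \<beta> \<eta> = 26 * \<eta> * ET 44 + 76 * ET 32 / (real n * \<eta>^3) + 24 * ET 24 / sqrt (real n)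
   + real c * \<beta> * (K * (9 + (\<Sum>m\<le>M. (gerr K M m)^2)) + 2 * real M) * ET 32 / sqrt (real n)"

context
 fixes k :: "'t::finite => nat" and Cs :: "'t => nat => cmat"
 assumes Cs: "\<And>t q. form_bound n (Cs t q) K0"
  and k: "\<And>t. 1 <= k t" "\<And>t. k t <= M"
  and kT: "\<And>x. real (\<Sum>t\<in>UNIV. k t) <= T x"
begin

lemma stein_explicit:
 assumes \<beta>: "\<And>t. cmod (bt t) <= \<beta>" "\<And>x. \<beta> <= T x" and eta: "0 < \<eta>" and t0: "2 <= k t0"
 shows "cmod ((\<integral>x. Zv n k Cs t0 x * iexp (phase n k Cs bt x) \<partial>Pr Ix)
   - \<i> / 2 * (\<Sum>t\<in>UNIV. cnj (bt t) * (\<rho> * sg k Cs False t0 t) + bt t * sg k Cs True t0 t)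
    * (\<integral>x. iexp (phase n k Cs bt x) \<partial>Pr Ix))
  <= stein_error CARD('t) \<beta> \<eta>"
proof -
 interpret S: stein_entries \<mu> \<rho> n K M T K0 k Cs bt by unfold_locales (use Cs k kT \<beta> order_trans in blast)+
 have \<beta>0: "0 <= \<beta>" using \<beta>(1)[of t0] norm_ge_zero order_trans by blast
 have Z: "S.Zw t x = Zv n k Cs t x" for t x unfolding S.Zw_def Zv_def ..
 have e: "S.ep x = iexp (phase n k Cs bt x)" for x
  unfolding S.ep_def S.Ph_def phase_def Z ..
 have sgs: "S.sig t0 \<kappa> t = sg k Cs \<kappa> t0 t" for \<kappa> t
  unfolding S.sig_def[OF t0] sg_def S.vv_def[OF t0] ..
 have "cmod ((\<integral>x. S.Zw t0 x * S.ep x \<partial>Pr Ix)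
   - \<i> / 2 * (\<Sum>t\<in>UNIV. cnj (bt t) * (\<rho> * S.sig t0 False t) + bt t * S.sig t0 True t) * (\<integral>x. S.ep x \<partial>Pr Ix))
  <= 26 * \<eta> * ET 44 + 76 * ET 32 / (real n * \<eta>^3) + 24 * ET 24 / sqrt (real n)
   + real CARD('t) * \<beta> * (K * (9 + (gerr K M (k t0 - 1))^2) + 2 * real M) * ET 32 / sqrt (real n)" by (rule S.stein[OF t0 \<beta>(1) eta])
 also have "... <= stein_error CARD('t) \<beta> \<eta>"
  unfolding stein_error_def
 proof (intro add_left_mono divide_right_mono mult_right_mono mult_left_mono add_right_mono)
  show "(gerr K M (k t0 - 1))^2 <= (\<Sum>m\<le>M. (gerr K M m)^2)"
   using k(2)[of t0] by (intro member_le_sum) auto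
 qed (use K_ge1 \<beta>0 ET_ge1[of 32] in auto)
 finally show ?thesis unfolding Z e sgs .
qed

text \<open>Words of length at least two are multiplied by \<open>s\<close>, words of length one are
  kept. The derivative in \<open>s\<close> is an expectation of the long words against the
  exponential, which Stein's identity evaluates. As words of different length do not interact, the
  coefficient is exactly linear in \<open>s\<close>, and the solution at \<open>s = 1\<close> is the
  product form.\<close>

lemma characteristic_function_decoupling:
 fixes a :: "'t => complex"
 assumes \<beta>: "\<And>t. cmod (a t) <= \<beta>" "\<And>x. \<beta> <= T x" and eta: "0 < \<eta>"
 defines "R \<equiv> Re (\<Sum>t\<in>{t. 2 <= k t}. \<Sum>t'\<in>UNIV. cnj (a t) * (cnj (a t') * (\<rho> * sg k Cs False t t') + a t' * sg k Cs True t t'))"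
 shows "cmod ((\<integral>x. iexp (phase n k Cs a x) \<partial>Pr Ix)
   - (\<integral>x. iexp (phase n k Cs (\<lambda>t. if k t = 1 then a t else 0) x) \<partial>Pr Ix) * exp (- cor (R / 4)))
  <= real CARD('t) * \<beta> * stein_error CARD('t) \<beta> \<eta> * exp (\<bar>R\<bar> / 2)"
proof -
 define U2 where "U2 = {t. 2 <= k t}"
 define S where "S = (\<Sum>t\<in>U2. \<Sum>t'\<in>UNIV. cnj (a t) * (cnj (a t') * (\<rho> * sg k Cs False t t') + a t' * sg k Cs True t t'))"
 have RS: "R = Re S" unfolding R_def S_def U2_def ..
 have \<beta>0: "0 <= \<beta>" using \<beta>(1) norm_ge_zero order_trans by blast
 define err where "err = stein_error CARD('t) \<beta> \<eta>"
 have err0: "0 <= err" unfolding err_def stein_error_def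
  using ET_ge1[of 44] ET_ge1[of 32] ET_ge1[of 24] eta \<beta>0 K_ge1
  by (auto intro!: add_nonneg_nonneg mult_nonneg_nonneg divide_nonneg_nonneg sum_nonneg)
 define bs where "bs = (\<lambda>s t. if k t = 1 then a t else cor s * a t)"
 define \<Phi>1 where "\<Phi>1 = phase n k Cs (\<lambda>t. if k t = 1 then a t else 0)"
 define W where "W = (\<lambda>x. \<Sum>t\<in>U2. cnj (a t) * Zv n k Cs t x)"
 define \<Phi>2 where "\<Phi>2 = (\<lambda>x. Re (W x))"
 have pW: "polybdd Ix W" unfolding W_def by (intro polybdd_intros polybdd_Zv)
 have p1: "polybdd Ix \<Phi>1" unfolding \<Phi>1_def by (rule polybdd_phase)
 have p2: "polybdd Ix \<Phi>2" unfolding \<Phi>2_def by (intro polybdd_intros pW)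
 have ph: "phase n k Cs (bs s) x = \<Phi>1 x + s * \<Phi>2 x" for s x
 proof -
  have "(\<Sum>t\<in>UNIV. cnj (bs s t) * Zv n k Cs t x)
    = (\<Sum>t\<in>UNIV. cnj (if k t = 1 then a t else 0) * Zv n k Cs t x) + (\<Sum>t\<in>UNIV. if t \<in> U2 then cor s * (cnj (a t) * Zv n k Cs t x) else 0)"
   unfolding sum.distrib[symmetric]
  proof (rule sum.cong[OF refl])
   fix t
   show "cnj (bs s t) * Zv n k Cs t x = cnj (if k t = 1 then a t else 0) * Zv n k Cs t x + (if t \<in> U2 then cor s * (cnj (a t) * Zv n k Cs t x) else 0)"
    using k(1)[of t] by (auto simp: bs_def U2_def)
  qed
  also have "(\<Sum>t\<in>UNIV. if t \<in> U2 then cor s * (cnj (a t) * Zv n k Cs t x) else 0) = cor s * W x"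
   unfolding W_def by (simp add: sum.inter_restrict[symmetric] sum_distrib_left)
  finally show ?thesis unfolding phase_def \<Phi>1_def \<Phi>2_def by simp
 qed
 define \<phi> where "\<phi> = (\<lambda>s. \<integral>x. iexp (\<Phi>1 x + s * \<Phi>2 x) \<partial>Pr Ix)"
 define \<phi>' where "\<phi>' = (\<lambda>s. \<integral>x. \<i> * cor (\<Phi>2 x) * iexp (\<Phi>1 x + s * \<Phi>2 x) \<partial>Pr Ix)"
 have pe: "polybdd Ix (\<lambda>x. iexp (\<Phi>1 x + s * \<Phi>2 x))" for s by (intro polybdd_iexp polybdd_intros p1 p2)
 have pe': "polybdd Ix (\<lambda>x. \<i> * cor (\<Phi>2 x) * iexp (\<Phi>1 x + s * \<Phi>2 x))" for s
  by (intro polybdd_mult polybdd_const polybdd_of_real p2 pe)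
 have deriv: "(\<phi> has_vector_derivative \<phi>' s) (at s within {0..1})" for s
 proof (rule has_vector_derivative_quadratic[where C = "\<integral>x. (\<Phi>2 x)^2 \<partial>Pr Ix"])
  fix t
  let ?e = "\<lambda>s x. iexp (\<Phi>1 x + s * \<Phi>2 x)"
  let ?d = "\<lambda>x. ?e t x - ?e s x - cor (t - s) * (\<i> * cor (\<Phi>2 x) * ?e s x)"
  have "\<phi> t - \<phi> s - (t - s) *\<^sub>R \<phi>' s = (\<integral>x. ?d x \<partial>Pr Ix)"
  proof -
   have i: "integrable (Pr Ix) (?e t)" "integrable (Pr Ix) (?e s)"
    "integrable (Pr Ix) (\<lambda>x. cor (t - s) * (\<i> * cor (\<Phi>2 x) * ?e s x))"
    by (intro integrable_polybdd finI pe polybdd_mult[OF polybdd_const] pe')+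
   show ?thesis
    unfolding \<phi>_def \<phi>'_def Bochner_Integration.integral_diff[OF Bochner_Integration.integrable_diff[OF i(1,2)] i(3)]
     Bochner_Integration.integral_diff[OF i(1,2)] integral_mult_right_zero scaleR_conv_of_real ..
  qed
  moreover have "cmod (\<integral>x. ?d x \<partial>Pr Ix) <= (\<integral>x. (t - s)^2 * (\<Phi>2 x)^2 \<partial>Pr Ix)"
  proof (rule norm_integral_le[OF finI])
   show "polybdd Ix (\<lambda>x. (t - s)^2 * (\<Phi>2 x)^2)" by (intro polybdd_intros p2)
   fix x
   have "cmod (?d x) = cmod (?e s x - ?e t x - \<i> * cor ((\<Phi>1 x + s * \<Phi>2 x) - (\<Phi>1 x + t * \<Phi>2 x)) * ?e s x)"
    by (subst norm_minus_cancel[symmetric]) (simp add: algebra_simps)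
   also have "... <= ((\<Phi>1 x + s * \<Phi>2 x) - (\<Phi>1 x + t * \<Phi>2 x))^2" by (rule iexp_diff_second_order_le)
   also have "... = (t - s)^2 * (\<Phi>2 x)^2" by (simp add: power2_eq_square algebra_simps)
   finally show "cmod (?d x) <= (t - s)^2 * (\<Phi>2 x)^2" .
  qed
  ultimately show "norm (\<phi> t - \<phi> s - (t - s) *\<^sub>R \<phi>' s) <= (\<integral>x. (\<Phi>2 x)^2 \<partial>Pr Ix) * (t - s)^2"
   by (simp add: mult.commute)
 qed
 have sg0: "sg k Cs \<kappa> t t' = 0" if "k t \<noteq> k t'" for \<kappa> t t'
 proof -
  have "k t - 1 \<noteq> k t' - 1" using that k(1)[of t] k(1)[of t'] by linarith
  moreover have "glim (Cs t) (Cs t') 0 0 \<kappa> 1 (k t - 1) 1 (k t' - 1) = 0"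
   using calculation by (simp add: glim_def[OF Cs Cs n n])
  ultimately show ?thesis by (simp add: sg_def)
 qed
 \<comment> \<open>The unscaled coefficients of the words of length one are multiplied by 0 here, by
   \<open>sg0\<close>. The sign \<open>c\<close> covers both \<open>bs s\<close> and its
   negative.\<close>
 have lin: "(\<Sum>t'\<in>UNIV. cnj (c * bs s t') * (\<rho> * sg k Cs False t t') + c * bs s t' * sg k Cs True t t')
   = c * cor s * (\<Sum>t'\<in>UNIV. cnj (a t') * (\<rho> * sg k Cs False t t') + a t' * sg k Cs True t t')"
  if "t \<in> U2" "c \<in> {1, -1}" for t s and c :: complex
  unfolding sum_distrib_left
 proof (rule sum.cong[OF refl])
  fix t'
  show "cnj (c * bs s t') * (\<rho> * sg k Cs False t t') + c * bs s t' * sg k Cs True t t'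
    = c * cor s * (cnj (a t') * (\<rho> * sg k Cs False t t') + a t' * sg k Cs True t t')"
  proof (cases "k t = k t'")
   case True
   then have "bs s t' = cor s * a t'" using that by (simp add: bs_def U2_def)
   then show ?thesis using that(2) by (auto simp: algebra_simps)
  qed (simp add: sg0)
 qed
 have Wst: "cmod ((\<integral>x. W x * iexp (phase n k Cs (\<lambda>t. c * bs s t) x) \<partial>Pr Ix)
    - \<i> / 2 * c * cor s * S * (\<integral>x. iexp (phase n k Cs (\<lambda>t. c * bs s t) x) \<partial>Pr Ix))
   <= real CARD('t) * \<beta> * err" if s: "s \<in> {0..1}" and c: "c \<in> {1, -1}" for s and c :: complex
 proof -
  let ?b = "\<lambda>t. c * bs s t" and ?E = "\<lambda>x. iexp (phase n k Cs (\<lambda>t. c * bs s t) x)"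
  let ?I = "\<integral>x. ?E x \<partial>Pr Ix"
  have bb: "cmod (?b t) <= \<beta>" for t
  proof -
   have "cmod (cor s * a t) <= 1 * \<beta>" unfolding norm_mult using s \<beta> by (intro mult_mono) auto
   then show ?thesis using c \<beta>(1)[of t] by (auto simp: bs_def)
  qed
  have pE: "polybdd Ix ?E" by (intro polybdd_iexp polybdd_phase)
  have "(\<integral>x. W x * ?E x \<partial>Pr Ix) = (\<integral>x. (\<Sum>t\<in>U2. cnj (a t) * (Zv n k Cs t x * ?E x)) \<partial>Pr Ix)"
   unfolding W_def by (simp only: sum_distrib_right mult.assoc)
  also have "... = (\<Sum>t\<in>U2. \<integral>x. cnj (a t) * (Zv n k Cs t x * ?E x) \<partial>Pr Ix)"
   by (rule Bochner_Integration.integral_sum) (intro integrable_polybdd finI polybdd_mult polybdd_const polybdd_Zv pE)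
  also have "... = (\<Sum>t\<in>U2. cnj (a t) * (\<integral>x. Zv n k Cs t x * ?E x \<partial>Pr Ix))" by (simp only: integral_mult_right_zero)
  finally have 1: "(\<integral>x. W x * ?E x \<partial>Pr Ix) = (\<Sum>t\<in>U2. cnj (a t) * (\<integral>x. Zv n k Cs t x * ?E x \<partial>Pr Ix))" .
  have 2: "\<i> / 2 * c * cor s * S * ?I
   = (\<Sum>t\<in>U2. cnj (a t) * (\<i> / 2 * (\<Sum>t'\<in>UNIV. cnj (?b t') * (\<rho> * sg k Cs False t t') + ?b t' * sg k Cs True t t') * ?I))"
  proof -
   have "(\<Sum>t\<in>U2. cnj (a t) * (\<i> / 2 * (\<Sum>t'\<in>UNIV. cnj (?b t') * (\<rho> * sg k Cs False t t') + ?b t' * sg k Cs True t t') * ?I))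
    = (\<Sum>t\<in>U2. cnj (a t) * (\<i> / 2 * (c * cor s * (\<Sum>t'\<in>UNIV. cnj (a t') * (\<rho> * sg k Cs False t t') + a t' * sg k Cs True t t')) * ?I))"
    by (intro sum.cong refl) (simp only: lin[OF _ c])
   also have "... = (\<Sum>t\<in>U2. \<i> / 2 * c * cor s * (cnj (a t) * (\<Sum>t'\<in>UNIV. cnj (a t') * (\<rho> * sg k Cs False t t') + a t' * sg k Cs True t t')) * ?I)"
    by (intro sum.cong refl) (simp only: mult_ac)
   also have "... = \<i> / 2 * c * cor s * S * ?I"
    unfolding S_def sum_distrib_left[of "cnj (a _)", symmetric] by (simp only: sum_distrib_left[symmetric] sum_distrib_right[symmetric])
   finally show ?thesis ..
  qed
  have "cmod ((\<integral>x. W x * ?E x \<partial>Pr Ix) - \<i> / 2 * c * cor s * S * ?I)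
   = cmod (\<Sum>t\<in>U2. cnj (a t) * ((\<integral>x. Zv n k Cs t x * ?E x \<partial>Pr Ix)
     - \<i> / 2 * (\<Sum>t'\<in>UNIV. cnj (?b t') * (\<rho> * sg k Cs False t t') + ?b t' * sg k Cs True t t') * ?I))"
   unfolding 1 2 by (simp only: sum_subtractf right_diff_distrib)
  also have "... <= (\<Sum>t\<in>U2. \<beta> * err)"
  proof (rule order_trans[OF norm_sum], rule sum_mono)
   fix t assume "t \<in> U2"
   then have "cmod ((\<integral>x. Zv n k Cs t x * ?E x \<partial>Pr Ix)
     - \<i> / 2 * (\<Sum>t'\<in>UNIV. cnj (?b t') * (\<rho> * sg k Cs False t t') + ?b t' * sg k Cs True t t') * ?I) <= err"
    unfolding err_def by (intro stein_explicit[OF bb \<beta>(2) eta]) (simp add: U2_def)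
   then show "cmod (cnj (a t) * ((\<integral>x. Zv n k Cs t x * ?E x \<partial>Pr Ix)
     - \<i> / 2 * (\<Sum>t'\<in>UNIV. cnj (?b t') * (\<rho> * sg k Cs False t t') + ?b t' * sg k Cs True t t') * ?I)) <= \<beta> * err"
    unfolding norm_mult[of "cnj (a t)"] using \<beta>(1)[of t] \<beta>0 by (intro mult_mono) auto
  qed
  also have "... = real (card U2) * (\<beta> * err)" by simp
  also have "... <= real CARD('t) * (\<beta> * err)"
   using \<beta>0 err0 by (intro mult_right_mono) (auto intro: card_mono)
  finally show ?thesis by (simp only: mult.assoc)
 qed
 have bound: "cmod (\<phi>' s + cor (s / 2 * R) * \<phi> s) <= real CARD('t) * \<beta> * err" if s: "s \<in> {0..1}" for s
 proof -
  let ?e = "\<lambda>x. iexp (\<Phi>1 x + s * \<Phi>2 x)"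
  let ?Wp = "\<integral>x. W x * ?e x \<partial>Pr Ix" and ?Wm = "\<integral>x. W x * cnj (?e x) \<partial>Pr Ix"
  \<comment> \<open>The derivative contains the real part of \<open>W\<close>. Its conjugate half is
    obtained from Stein's identity for the negated coefficients, conjugated as a whole.\<close>
  have phm: "phase n k Cs (\<lambda>t. - 1 * bs s t) x = - phase n k Cs (bs s) x" for x
   unfolding phase_def by (simp add: sum_negf)
  have em: "iexp (phase n k Cs (\<lambda>t. - 1 * bs s t) x) = cnj (?e x)" for x
  proof -
   have "iexp (- r) = cnj (iexp r)" for r by (simp add: exp_cnj)
   then show ?thesis unfolding phm ph .
  qed
  have ep: "iexp (phase n k Cs (\<lambda>t. 1 * bs s t) x) = ?e x" for x
   unfolding mult_1 ph ..
  have P: "cmod (?Wp - \<i> / 2 * cor s * S * \<phi> s) <= real CARD('t) * \<beta> * err"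
   using Wst[OF s, of 1] unfolding ep \<phi>_def by simp
  have Mm: "cmod (?Wm - \<i> / 2 * (- 1) * cor s * S * cnj (\<phi> s)) <= real CARD('t) * \<beta> * err"
   using Wst[OF s, of "- 1"] unfolding em \<phi>_def by (simp add: Bochner_Integration.integral_cnj)
  have Mm': "cmod (cnj (?Wm - \<i> / 2 * (- 1) * cor s * S * cnj (\<phi> s))) <= real CARD('t) * \<beta> * err"
   unfolding complex_mod_cnj by (rule Mm)
  have cm: "cnj ?Wm = (\<integral>x. cnj (W x) * ?e x \<partial>Pr Ix)" by (simp flip: Bochner_Integration.integral_cnj)
  have "\<phi>' s = \<i> / 2 * (?Wp + cnj ?Wm)"
  proof -
   have i: "integrable (Pr Ix) (\<lambda>x. W x * ?e x)" "integrable (Pr Ix) (\<lambda>x. cnj (W x) * ?e x)"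
    by (intro integrable_polybdd finI polybdd_mult polybdd_cnj pW pe)+
   have "\<i> * cor (\<Phi>2 x) * ?e x = \<i> / 2 * (W x * ?e x + cnj (W x) * ?e x)" for x
   proof -
    have "cor (\<Phi>2 x) = (W x + cnj (W x)) / 2" unfolding \<Phi>2_def by (simp add: complex_add_cnj)
    then show ?thesis by (simp only: times_divide_eq_left times_divide_eq_right distrib_left distrib_right mult.assoc add_divide_distrib)
   qed
   then show ?thesis unfolding \<phi>'_def cm Bochner_Integration.integral_add[OF i, symmetric] by (simp only: integral_mult_right_zero)
  qed
  then have "\<phi>' s + cor (s / 2 * R) * \<phi> s
   = \<i> / 2 * ((?Wp - \<i> / 2 * cor s * S * \<phi> s) + cnj (?Wm - \<i> / 2 * (- 1) * cor s * S * cnj (\<phi> s)))"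
  proof -
   have SS: "cor R = (S + cnj S) / 2" unfolding RS by (simp add: complex_add_cnj)
   have R: "cor (s / 2 * R) = cor s / 4 * (S + cnj S)" unfolding of_real_mult SS by simp
   have ii: "\<i> * (\<i> * z) = - z" for z by (simp flip: mult.assoc)
   assume "\<phi>' s = \<i> / 2 * (?Wp + cnj ?Wm)"
   then show ?thesis unfolding R by (simp add: algebra_simps ii)
  qed
  then have "cmod (\<phi>' s + cor (s / 2 * R) * \<phi> s)
   = 1/2 * cmod ((?Wp - \<i> / 2 * cor s * S * \<phi> s) + cnj (?Wm - \<i> / 2 * (- 1) * cor s * S * cnj (\<phi> s)))"
   by (simp only: norm_mult norm_divide norm_ii norm_numeral)
  also have "... <= 1/2 * (real CARD('t) * \<beta> * err + real CARD('t) * \<beta> * err)"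
   by (intro mult_left_mono order_trans[OF norm_triangle_ineq] add_mono P Mm') simp
  also have "... = real CARD('t) * \<beta> * err" by (simp only: field_sum_of_halves mult_1 times_divide_eq_left add_divide_distrib)
  finally show ?thesis .
 qed
 have "cmod (\<phi> 1 - \<phi> 0 * exp (- cor (R / 4))) <= real CARD('t) * \<beta> * err * exp (\<bar>R\<bar> / 2)"
  by (rule gaussian_ode[OF deriv bound]) (use \<beta>0 err0 in auto)
 moreover have "\<phi> 0 = (\<integral>x. iexp (phase n k Cs (\<lambda>t. if k t = 1 then a t else 0) x) \<partial>Pr Ix)"
  by (simp add: \<phi>_def \<Phi>1_def)
 moreover have "\<phi> 1 = (\<integral>x. iexp (phase n k Cs a x) \<partial>Pr Ix)"
 proof -
  have "bs 1 = a" by (auto simp: bs_def)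
  then show ?thesis using ph[of 1] by (simp add: \<phi>_def)
 qed
 ultimately show ?thesis unfolding err_def by simp
qed

end

end

section \<open>Traces as matrix words\<close>

lemma l2norm_scale: "l2norm n (\<lambda>i. c * x i) = cmod c * l2norm n x"
proof -
 have "(\<Sum>i<n. (cmod (c * x i))^2) = (cmod c)^2 * (\<Sum>i<n. (cmod (x i))^2)" by (simp add: norm_mult power_mult_distrib sum_distrib_left)
 then show ?thesis unfolding l2norm_def by (simp add: real_sqrt_mult)
qed

lemma l2norm_zero_iff: "l2norm n x = 0 \<longleftrightarrow> (\<forall>i<n. x i = 0)"
 unfolding l2norm_eq_L2_set by (subst L2_set_eq_0_iff) auto

lemma form_bound_sum_entries: "form_bound n A (\<Sum>i<n. \<Sum>j<n. cmod (A i j))"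
 unfolding form_bound_def
proof (intro conjI allI)
 fix a b
 have "cmod (\<Sum>i<n. \<Sum>j<n. a i * A i j * b j) <= (\<Sum>i<n. \<Sum>j<n. cmod (a i * A i j * b j))"
  by (rule order_trans[OF norm_sum], rule sum_mono, rule norm_sum)
 also have "... <= (\<Sum>i<n. \<Sum>j<n. l2norm n a * cmod (A i j) * l2norm n b)"
  unfolding norm_mult by (intro sum_mono mult_mono cmod_le_l2norm) auto
 also have "... = (\<Sum>i<n. \<Sum>j<n. cmod (A i j)) * l2norm n a * l2norm n b"
  unfolding sum_distrib_right by (simp only: mult_ac)
 finally show "cmod (\<Sum>i<n. \<Sum>j<n. a i * A i j * b j) <= (\<Sum>i<n. \<Sum>j<n. cmod (A i j)) * l2norm n a * l2norm n b" .
qed (simp add: sum_nonneg)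

text \<open>The set in \<open>opnorm\<close> is bounded by the sum of the moduli of all entries, so
  its supremum is a true bound on unit vectors; the rest is scaling.\<close>

lemma form_bound_opnorm: "form_bound n A (opnorm n A)"
proof -
 let ?S = "{l2norm n (mvmul n A x) | x. l2norm n x <= 1}"
 let ?c = "\<Sum>i<n. \<Sum>j<n. cmod (A i j)"
 have c0: "0 <= ?c" by (simp add: sum_nonneg)
 have bdd: "bdd_above ?S"
 proof (rule bdd_aboveI)
  fix r assume "r \<in> ?S"
  then obtain x where x: "r = l2norm n (mvmul n A x)" "l2norm n x <= 1" by blast
  have "r <= ?c * l2norm n x" unfolding x by (rule form_bound_vec[OF form_bound_sum_entries])
  also have "... <= ?c * 1" by (intro mult_left_mono x c0)
  finally show "r <= ?c" by simp
 qed
 have le: "l2norm n (mvmul n A x) <= opnorm n A" if "l2norm n x <= 1" for x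
  unfolding opnorm_def by (rule cSup_upper[OF _ bdd]) (use that in blast)
 show ?thesis
 proof (rule form_boundI_vec)
  have "l2norm n (\<lambda>_. 0) <= 1" by (simp add: l2norm_def)
  from order_trans[OF l2norm_nonneg le[OF this]] show "0 <= opnorm n A" .
  fix b
  show "l2norm n (mvmul n A b) <= opnorm n A * l2norm n b"
  proof (cases "l2norm n b = 0")
   case True
   then have "mvmul n A b = (\<lambda>_. 0)" by (auto simp: l2norm_zero_iff mvmul_def)
   then show ?thesis using True by (simp add: l2norm_def)
  next
   case False
   define r where "r = l2norm n b"
   have r: "0 < r" using False l2norm_nonneg[of n b] unfolding r_def by linarith
   let ?x = "\<lambda>i. cor (1 / r) * b i"
   have "l2norm n ?x = 1" unfolding l2norm_scale using r by (simp add: r_def[symmetric] norm_divide)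
   then have "l2norm n (mvmul n A ?x) <= opnorm n A" by (intro le) simp
   moreover have "mvmul n A ?x = (\<lambda>i. cor (1 / r) * mvmul n A b i)" by (simp add: mvmul_def sum_distrib_left mult_ac)
   ultimately have "cmod (cor (1 / r)) * l2norm n (mvmul n A b) <= opnorm n A" by (simp only: l2norm_scale)
   then show ?thesis using r by (simp add: r_def[symmetric] divide_le_eq norm_divide)
  qed
 qed
qed

text \<open>The operator norm of a rank-one matrix is the product of the norms of its two vectors
  and does not bound them separately. Scaling by \<open>sqrt (q / p)\<close> makes the two norms
  equal without changing the matrix.\<close>

lemma rank_one_balanced:
 assumes fb: "form_bound n A K" and A: "\<And>i l. i < n ==> l < n ==> A i l = u i * cnj (v l)"
 obtains u' v' where "\<And>i l. i < n ==> l < n ==> A i l = u' i * cnj (v' l)" "l2norm n u' <= sqrt K" "l2norm n v' <= sqrt K"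
proof -
 define p q where "p = l2norm n u" and "q = l2norm n v"
 have K0: "0 <= K" using fb by (simp add: form_bound_def)
 show thesis
 proof (cases "p = 0 \<or> q = 0")
  case True
  then have "A i l = 0" if "i < n" "l < n" for i l using that A by (auto simp: p_def q_def l2norm_zero_iff)
  then show thesis using K0 by (intro that[of "\<lambda>_. 0" "\<lambda>_. 0"]) (auto simp: l2norm_def)
 next
  case False
  then have p: "0 < p" and q: "0 < q" using l2norm_nonneg[of n u] l2norm_nonneg[of n v] unfolding p_def q_def by linarith+
  have "l2norm n (mvmul n A v) = l2norm n (\<lambda>i. cor (q^2) * u i)"
  proof -
   have "mvmul n A v i = cor (q^2) * u i" if "i < n" for i
   proof -
    have "mvmul n A v i = (\<Sum>l<n. u i * (cnj (v l) * v l))" unfolding mvmul_def using that A by (simp add: mult.assoc)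
    also have "... = u i * cor (q^2)" unfolding sum_distrib_left[symmetric] sum_self_cnj q_def ..
    finally show ?thesis by (simp add: mult.commute)
   qed
   then show ?thesis unfolding l2norm_def by simp
  qed
  then have "q^2 * p <= K * q" using form_bound_vec[OF fb, of v] unfolding l2norm_scale by (simp add: p_def q_def norm_power)
  then have pq: "p * q <= K" using q by (simp add: power2_eq_square mult_ac)
  define c where "c = sqrt (q / p)"
  have c: "0 < c" using p q by (simp add: c_def)
  have cp: "c * p = sqrt (p * q)"
  proof -
   have "c * p = sqrt (q / p) * sqrt (p * p)" using p by (simp add: c_def)
   also have "... = sqrt (p * q)" unfolding real_sqrt_mult[symmetric] using p by (simp add: mult.commute)
   finally show ?thesis .
  qed
  have cq: "q / c = sqrt (p * q)"
  proof -
   have "c * c = q / p" using p q by (simp add: c_def)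
   then have "c * p * c = q" using p by (simp add: field_simps)
   then show ?thesis unfolding cp[symmetric] using c by (simp add: field_simps)
  qed
  show thesis
  proof (rule that[of "\<lambda>i. cor c * u i" "\<lambda>i. cor (1 / c) * v i"])
   show "A i l = cor c * u i * cnj (cor (1 / c) * v l)" if "i < n" "l < n" for i l
    using A[OF that] c by simp
   show "l2norm n (\<lambda>i. cor c * u i) <= sqrt K"
    unfolding l2norm_scale using c cp pq by (simp add: p_def[symmetric])
   show "l2norm n (\<lambda>i. cor (1 / c) * v i) <= sqrt K"
    unfolding l2norm_scale using c cq pq by (simp add: q_def[symmetric] norm_divide)
  qed
 qed
qed

text \<open>The conjugate of \<open>v\<close> is stored in row 0 of the first letter and
  \<open>u\<close> in column 0 of the last, so that the trace becomes the \<open>(0, 0)\<close>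
  entry of a word in square letters.\<close>

definition bordered :: "nat => cvec => cvec => (nat => cmat) => nat => cmat" where
 "bordered k u v Bs q = (if q = 0 then (\<lambda>i l. if i = 0 then cnj (v l) else 0)
   else if q < k then Bs q else if q = k then (\<lambda>i l. if l = 0 then u i else 0) else (\<lambda>_ _. 0))"

lemma form_bound_first_row:
 assumes "0 < n" shows "form_bound n (\<lambda>i l. if i = 0 then w l else 0) (l2norm n w)"
 unfolding form_bound_def
proof (intro conjI allI)
 fix a b
 have "(\<Sum>i<n. \<Sum>j<n. a i * (if i = 0 then w j else 0) * b j) = (\<Sum>i<n. if i = 0 then a 0 * (\<Sum>j<n. w j * b j) else 0)"
  by (intro sum.cong refl) (auto simp: sum_distrib_left mult.assoc)
 also have "... = a 0 * (\<Sum>j<n. w j * b j)" using assms by simp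
 finally have "cmod (\<Sum>i<n. \<Sum>j<n. a i * (if i = 0 then w j else 0) * b j) = cmod (a 0) * cmod (\<Sum>j<n. w j * b j)"
  by (simp only: norm_mult)
 also have "... <= l2norm n a * (l2norm n w * l2norm n b)" by (intro mult_mono cmod_le_l2norm assms cmod_sum_mult_le_l2norm) auto
 finally show "cmod (\<Sum>i<n. \<Sum>j<n. a i * (if i = 0 then w j else 0) * b j) <= l2norm n w * l2norm n a * l2norm n b" by (simp only: mult_ac)
qed simp

lemma form_bound_bordered:
 assumes n: "0 < n" and uv: "l2norm n u <= K" "l2norm n v <= K" and B: "\<And>q. 0 < q ==> q < k ==> form_bound n (Bs q) K"
 shows "form_bound n (bordered k u v Bs q) K"
proof -
 have K: "0 <= K" using uv(1) l2norm_nonneg order_trans by blast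
 have v: "form_bound n (\<lambda>i l. if i = 0 then cnj (v l) else 0) K" by (rule form_bound_mono[OF form_bound_first_row[OF n]]) (use uv in simp)
 have u: "form_bound n (\<lambda>i l. if l = 0 then u i else 0) K"
  by (rule form_bound_mono[OF form_bound_transpose[OF form_bound_first_row[OF n]]]) (use uv in simp)
 have z: "form_bound n (\<lambda>_ _. 0) K" using K by (simp add: form_bound_def)
 show ?thesis unfolding bordered_def using u v z B by simp
qed

text \<open>The vector \<open>u\<close> is moved cyclically from the front of the trace to its end.
  The powers \<open>n^(-(k-1)/2)\<close> and \<open>sqrt n ^ k\<close> combine to a single
  \<open>sqrt n\<close>.\<close>

lemma Zk_eq_word:
 assumes n: "0 < n" and k: "1 <= k" and B0: "\<And>i l. i < n ==> l < n ==> Bs 0 i l = u i * cnj (v l)"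
 shows "Zk n k Bs x = cor (sqrt (real n)) * wd n (bordered k u v Bs) 0 k x 0 0"
proof -
 define s where "s = cor (sqrt (real n))"
 have s0: "s \<noteq> 0" using n by (simp add: s_def)
 let ?C = "bordered k u v Bs"
 let ?P = "\<lambda>m. mmul n (chain n Bs x m) (Bs m)"
 have sX: "x (p, l) = s * scaledX n x p l" for p l using s0 by (simp add: scaledX_def s_def)
 have PX: "mmul n A (matX x) i l = u i * s ^ Suc m * mmul n (wd n ?C 0 m x) (scaledX n x) 0 l"
  if "\<And>j. j < n ==> A i j = u i * s ^ m * wd n ?C 0 m x 0 j" for i l m A
 proof -
  have "mmul n A (matX x) i l = (\<Sum>p<n. (u i * s ^ m * wd n ?C 0 m x 0 p) * (s * scaledX n x p l))"
   unfolding mmul_def matX_def using that by (intro sum.cong refl) (simp only: sX lessThan_iff)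
  also have "... = u i * s ^ Suc m * mmul n (wd n ?C 0 m x) (scaledX n x) 0 l"
   unfolding mmul_def sum_distrib_left by (intro sum.cong refl) (simp add: mult_ac)
  finally show ?thesis .
 qed
 have ind: "?P m i j = u i * s ^ m * wd n ?C 0 m x 0 j" if "m < k" "i < n" "j < n" for m i j
  using that
 proof (induction m arbitrary: j)
  case 0
  have "?P 0 i j = Bs 0 i j"
   unfolding mmul_def chain.simps idm_def using 0 by (simp add: if_distrib[of "\<lambda>z. z * _"] cong: if_cong)
  then show ?case using B0 0 by (simp add: bordered_def)
 next
  case (Suc m)
  have "?P (Suc m) i j = (\<Sum>l<n. mmul n (?P m) (matX x) i l * Bs (Suc m) l j)" by (simp add: mmul_def)
  also have "... = (\<Sum>l<n. u i * s ^ Suc m * mmul n (wd n ?C 0 m x) (scaledX n x) 0 l * ?C (Suc m) l j)"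
  proof (rule sum.cong[OF refl])
   fix l
   have "mmul n (?P m) (matX x) i l = u i * s ^ Suc m * mmul n (wd n ?C 0 m x) (scaledX n x) 0 l" by (rule PX) (use Suc in simp)
   then show "mmul n (?P m) (matX x) i l * Bs (Suc m) l j
     = u i * s ^ Suc m * mmul n (wd n ?C 0 m x) (scaledX n x) 0 l * ?C (Suc m) l j"
    using Suc.prems by (simp only: bordered_def) simp
  qed
  also have "... = u i * s ^ Suc m * wd n ?C 0 (Suc m) x 0 j" by (simp only: wd.simps mmul_def[of n _ "?C _"] sum_distrib_left mult.assoc add_0)
  finally show ?case .
 qed
 obtain m where m: "k = Suc m" using k by (cases k) auto
 have "trace n (chain n Bs x k) = (\<Sum>i<n. mmul n (?P m) (matX x) i i)" by (simp add: trace_def m)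
 also have "... = (\<Sum>i<n. s ^ k * (mmul n (wd n ?C 0 m x) (scaledX n x) 0 i * ?C k i 0))"
 proof (rule sum.cong[OF refl])
  fix i assume i: "i \<in> {..<n}"
  have "mmul n (?P m) (matX x) i i = u i * s ^ Suc m * mmul n (wd n ?C 0 m x) (scaledX n x) 0 i" by (rule PX) (use ind[of m i] i m in simp)
  moreover have "?C k i 0 = u i" using k by (simp add: bordered_def)
  ultimately show "mmul n (?P m) (matX x) i i = s ^ k * (mmul n (wd n ?C 0 m x) (scaledX n x) 0 i * ?C k i 0)"
   using m by (simp add: mult_ac)
 qed
 also have "... = s ^ k * wd n ?C 0 k x 0 0"
  unfolding sum_distrib_left[symmetric] m by (simp add: mmul_def)
 finally have tr: "trace n (chain n Bs x k) = s ^ k * wd n ?C 0 k x 0 0" .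
 have "cor (real n powr (- (real k - 1) / 2)) * s ^ k = s"
 proof -
  have "sqrt (real n) ^ k = real n powr (real k / 2)"
   using n by (simp add: powr_half_sqrt[symmetric] powr_powr flip: powr_realpow)
  then have "real n powr (- (real k - 1) / 2) * sqrt (real n) ^ k = real n powr (- (real k - 1) / 2 + real k / 2)" by (simp only: powr_add)
  also have "- (real k - 1) / 2 + real k / 2 = 1 / 2" by (simp add: field_simps)
  also have "real n powr (1/2) = sqrt (real n)" using n by (simp add: powr_half_sqrt)
  finally show ?thesis unfolding s_def by (metis of_real_mult of_real_power)
 qed
 then show ?thesis unfolding Zk_def tr s_def[symmetric] by (metis mult.assoc)
qed

text \<open>The rank-one letter has been split between the two ends: \<open>sg\<close> pairs the
  vectors \<open>v\<close> in front, \<open>glim\<close> the vectors \<open>u\<close> at the end,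
  and the product of the two pairings is the factor of index 0. The extra \<open>cf\<close> belongs
  to the first factor \<open>X\<close>.\<close>

lemma (in gram_entries) sg_bordered:
 fixes u v :: "'t => cvec" and Bs :: "'t => nat => cmat" and k :: "'t => nat"
 defines "Cs \<equiv> \<lambda>t. bordered (k t) (u t) (v t) (Bs t)"
 assumes Cs: "\<And>t q. form_bound n (Cs t q) K0" and k: "\<And>t. 1 <= k t"
  and B0: "\<And>t i l. i < n ==> l < n ==> Bs t 0 i l = u t i * cnj (v t l)"
 shows "cf \<kappa> * sg k Cs \<kappa> t t' = (if k t = k t' then cf \<kappa> ^ k t * cor (real n powr (1 - real (k t)))
   * (\<Prod>j<k t. \<Sum>i<n. \<Sum>l<n. Bs t j i l * kap \<kappa> (Bs t' j i l)) else 0)"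
proof (cases "k t = k t'")
 case False
 then have "k t - 1 \<noteq> k t' - 1" using k[of t] k[of t'] by linarith
 then show ?thesis using False by (simp add: sg_def glim_def[OF Cs Cs n n])
next
 case True
 obtain m where m: "k t = Suc m" using k[of t] by (cases "k t") auto
 have m': "k t' = Suc m" using True m by simp
 let ?tr = "\<lambda>j. \<Sum>i<n. \<Sum>l<n. Bs t j i l * kap \<kappa> (Bs t' j i l)"
 have kk: "kap \<kappa> (a * b) = kap \<kappa> a * kap \<kappa> b" for a b by (simp add: kap_def)
 have tau: "tau (Cs t) (Cs t') \<kappa> (1 + s) (1 + s) = ?tr (Suc s) / real n" if "s < m" for s
 proof -
  have "(\<Sum>i<n. \<Sum>l<n. Cs t (1 + s) l i * kap \<kappa> (Cs t' (1 + s) l i)) = (\<Sum>i<n. \<Sum>l<n. Bs t (Suc s) l i * kap \<kappa> (Bs t' (Suc s) l i))"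
   unfolding Cs_def bordered_def m m' using that by simp
  also have "... = ?tr (Suc s)" by (rule sum.swap)
  finally show ?thesis by (simp add: tau_def[OF Cs Cs n n])
 qed
 have 0: "?tr 0 = (\<Sum>i<n. u t i * kap \<kappa> (u t' i)) * (\<Sum>l<n. cnj (v t l) * kap \<kappa> (cnj (v t' l)))"
  unfolding sum_product by (intro sum.cong refl) (simp add: B0 kk mult_ac)
 have pt: "(\<Prod>s<m. tau (Cs t) (Cs t') \<kappa> (1 + s) (1 + s)) = (\<Prod>s<m. ?tr (Suc s)) / real n ^ m"
  by (simp add: tau[simplified] prod_dividef)
 have pw: "real n powr (1 - real (k t)) = 1 / real n ^ m"
  using n by (simp add: m powr_minus powr_realpow divide_inverse)
 have first: "(\<Sum>i<n. Cs t 0 0 i * kap \<kappa> (Cs t' 0 0 i)) = (\<Sum>l<n. cnj (v t l) * kap \<kappa> (cnj (v t' l)))"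
  by (simp add: Cs_def bordered_def)
 have lst: "(\<Sum>l<n. Cs t (1 + m) l 0 * kap \<kappa> (Cs t' (1 + m) l 0)) = (\<Sum>i<n. u t i * kap \<kappa> (u t' i))"
  by (simp add: Cs_def bordered_def m m')
 have gl: "glim (Cs t) (Cs t') 0 0 \<kappa> 1 m 1 m = cf \<kappa> ^ m * ((\<Prod>s<m. ?tr (Suc s)) / real n ^ m) * (\<Sum>i<n. u t i * kap \<kappa> (u t' i))"
  unfolding glim_def[OF Cs Cs n n] lst pt by simp
 have "cf \<kappa> * sg k Cs \<kappa> t t' = cf \<kappa> ^ Suc m * (1 / real n ^ m) * (?tr 0 * (\<Prod>s<m. ?tr (Suc s)))"
  unfolding sg_def first 0 m m' diff_Suc_1 gl by (simp add: mult_ac)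
 moreover have "?tr 0 * (\<Prod>s<m. ?tr (Suc s)) = (\<Prod>j<k t. ?tr j)" unfolding m prod.lessThan_Suc_shift ..
 ultimately have "cf \<kappa> * sg k Cs \<kappa> t t' = cf \<kappa> ^ k t * (1 / real n ^ m) * (\<Prod>j<k t. ?tr j)" by (simp only: m)
 then show ?thesis unfolding pw if_P[OF True] by simp
qed

lemma entrywise_product_le:
 assumes "form_bound n A K" "form_bound n B K"
 shows "cmod (\<Sum>i<n. \<Sum>l<n. A i l * B i l) <= real n * K^2"
proof -
 have K: "0 <= K" using assms(1) by (simp add: form_bound_def)
 have "cmod (\<Sum>i<n. \<Sum>l<n. A i l * B i l) <= (\<Sum>i<n. K * K)"
 proof (rule order_trans[OF norm_sum], rule sum_mono)
  fix i assume i: "i \<in> {..<n}"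
  have "cmod (\<Sum>l<n. A i l * B i l) <= l2norm n (\<lambda>l. A i l) * l2norm n (\<lambda>l. B i l)" by (rule cmod_sum_mult_le_l2norm)
  also have "... <= K * K" using i K by (intro mult_mono form_bound_row assms) auto
  finally show "cmod (\<Sum>l<n. A i l * B i l) <= K * K" .
 qed
 then show ?thesis by (simp add: power2_eq_square)
qed

lemma rank_one_product_le:
 assumes A: "\<And>i l. i < n ==> l < n ==> A i l = u i * v l" and B: "\<And>i l. i < n ==> l < n ==> B i l = u' i * v' l"
  and K: "l2norm n u <= K" "l2norm n v <= K" "l2norm n u' <= K" "l2norm n v' <= K"
 shows "cmod (\<Sum>i<n. \<Sum>l<n. A i l * B i l) <= K^4"
proof -
 have K0: "0 <= K" using K(1) l2norm_nonneg order_trans by blast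
 have "(\<Sum>i<n. \<Sum>l<n. A i l * B i l) = (\<Sum>i<n. u i * u' i) * (\<Sum>l<n. v l * v' l)"
  unfolding sum_product by (intro sum.cong refl) (simp add: A B mult_ac)
 then have "cmod (\<Sum>i<n. \<Sum>l<n. A i l * B i l) <= (l2norm n u * l2norm n u') * (l2norm n v * l2norm n v')"
  by (simp add: norm_mult) (intro mult_mono cmod_sum_mult_le_l2norm; simp)
 also have "... <= (K * K) * (K * K)" using K K0 by (intro mult_mono) auto
 finally show ?thesis by (simp add: power4_eq_xxxx mult.assoc)
qed

text \<open>There are \<open>k - 1\<close> factors of order \<open>n\<close> and one of order 1,
  namely the one of index 0, where the letter has rank one. This matches the normalisation.\<close>

lemma covariance_product_le:
 assumes n: "0 < n" and k: "1 <= k" and K: "1 <= K"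
  and T0: "cmod (tr 0) <= K^4" and T: "\<And>j. 0 < j ==> j < k ==> cmod (tr j) <= real n * K^2"
 shows "real n powr (1 - real k) * cmod (\<Prod>j<k. tr j) <= K ^ (2 * k + 2)"
proof -
 obtain m where m: "k = Suc m" using k by (cases k) auto
 have pw: "real n powr (1 - real k) = 1 / real n ^ m"
  using n by (simp add: m powr_minus powr_realpow divide_inverse)
 have "cmod (\<Prod>j<k. tr j) = cmod (tr 0) * (\<Prod>j<m. cmod (tr (Suc j)))"
  unfolding m prod.lessThan_Suc_shift by (simp add: norm_mult prod_norm)
 also have "... <= K^4 * (\<Prod>j<m. real n * K^2)" by (intro mult_mono T0 prod_mono prod_nonneg conjI T) (use m K in auto)
 also have "... = K^4 * (real n ^ m * K ^ (2 * m))" by (simp add: power_mult_distrib power_mult)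
 finally have "real n powr (1 - real k) * cmod (\<Prod>j<k. tr j) <= 1 / real n ^ m * (K^4 * (real n ^ m * K ^ (2 * m)))"
  unfolding pw by (intro mult_left_mono) auto
 also have "... = K ^ (2 * k + 2)" using n by (simp add: m power_add[symmetric] numeral_eq_Suc)
 finally show ?thesis .
qed

section \<open>Linear forms and tightness\<close>

lemma iexp_expansion:
 fixes y :: real
 shows "cmod (iexp y - 1 - \<i> * cor y) <= y^2 / 2"
  "cmod (iexp y - 1 - \<i> * cor y + cor (y^2) / 2) <= \<bar>y\<bar> ^ 3 / 6"
proof -
 have "(\<Sum>j\<le>1. (\<i> * cor y)^j / fact j) = 1 + \<i> * cor y" by simp
 then show "cmod (iexp y - 1 - \<i> * cor y) <= y^2 / 2"
  using iexp_approx1[of y 1] by (simp add: numeral_2_eq_2 diff_diff_eq)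
 have "(\<Sum>j\<le>2. (\<i> * cor y)^j / fact j) = 1 + \<i> * cor y - cor (y^2) / 2"
  by (simp add: numeral_2_eq_2) (simp add: power2_eq_square algebra_simps)
 then have "iexp y - 1 - \<i> * cor y + cor (y^2) / 2
   = iexp y - (\<Sum>j\<le>2. (\<i> * cor y)^j / fact j)" by (simp only:) simp
 then show "cmod (iexp y - 1 - \<i> * cor y + cor (y^2) / 2) <= \<bar>y\<bar> ^ 3 / 6"
  using iexp_approx1[of y 2] by (simp only:) (simp add: fact_numeral)
qed

section \<open>Characteristic functions of linear forms in the entries\<close>

context iid_entries
begin

definition ech :: "complex => complex" where
 "ech d = (\<integral>z. iexp (Re (d * z)) \<partial>\<mu>)"

lemma meas_mu: "borel_measurable \<mu> = borel_measurable borel" by (rule measurable_cong_sets[OF sets_mu refl])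

lemma integrable_bounded_power:
 fixes f :: "complex => 'b::{banach, second_countable_topology}"
 assumes "f \<in> borel_measurable \<mu>" "\<And>z. norm (f z) <= c * cmod z ^ m" shows "integrable \<mu> f"
 by (rule Bochner_Integration.integrable_bound[OF integrable_mult_right[OF moment[of m], of c]])
  (use assms in \<open>auto intro!: AE_I2 order_trans[OF _ abs_ge_self]\<close>)

lemma integral_Re_mult:
 shows "integrable \<mu> (\<lambda>z. Re (d * z))" "(\<integral>z. Re (d * z) \<partial>\<mu>) = 0"
  "integrable \<mu> (\<lambda>z. (Re (d * z))^2)" "(\<integral>z. (Re (d * z))^2 \<partial>\<mu>) = ((cmod d)^2 + \<rho> * Re (d^2)) / 2"
proof -
 have iz: "integrable \<mu> (\<lambda>z. z)" by (rule integrable_bounded_power[where c = 1 and m = 1]) (simp_all add: meas_mu)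
 have iz2: "integrable \<mu> (\<lambda>z. z^2)" by (rule integrable_bounded_power[where c = 1 and m = 2]) (simp_all add: meas_mu norm_power)
 have ia: "integrable \<mu> (\<lambda>z. (cmod z)^2)" by (rule moment)
 show "integrable \<mu> (\<lambda>z. Re (d * z))" using iz by (intro integrable_Re integrable_mult_right) auto
 have "(\<integral>z. Re (d * z) \<partial>\<mu>) = Re (\<integral>z. d * z \<partial>\<mu>)" by (rule integral_Re) (use iz in auto)
 then show "(\<integral>z. Re (d * z) \<partial>\<mu>) = 0" by (simp add: mean0)
 have e: "(Re w)^2 = ((cmod w)^2 + Re (w^2)) / 2" for w by (simp add: cmod_power2 power2_eq_square[of w]) (simp add: power2_eq_square)
 have eq: "(\<lambda>z. (Re (d * z))^2) = (\<lambda>z. (cmod d)^2 / 2 * (cmod z)^2 + Re (d^2 / 2 * z^2))"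
  unfolding e by (auto simp: norm_mult power_mult_distrib field_simps)
 have i2: "integrable \<mu> (\<lambda>z. Re (d^2 / 2 * z^2))" using iz2 by (intro integrable_Re integrable_mult_right) auto
 show "integrable \<mu> (\<lambda>z. (Re (d * z))^2)" unfolding eq using ia i2 by (intro Bochner_Integration.integrable_add integrable_mult_right) auto
 have "(\<integral>z. (Re (d * z))^2 \<partial>\<mu>) = (cmod d)^2 / 2 * 1 + (\<integral>z. Re (d^2 / 2 * z^2) \<partial>\<mu>)"
  unfolding eq by (subst Bochner_Integration.integral_add) (use ia i2 in \<open>auto simp: var1\<close>)
 also have "(\<integral>z. Re (d^2 / 2 * z^2) \<partial>\<mu>) = Re (\<integral>z. d^2 / 2 * z^2 \<partial>\<mu>)" by (rule integral_Re) (use iz2 in auto)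
 also have "... = \<rho> * Re (d^2) / 2" by (simp add: rho)
 finally show "(\<integral>z. (Re (d * z))^2 \<partial>\<mu>) = ((cmod d)^2 + \<rho> * Re (d^2)) / 2" by (simp add: field_simps)
qed

lemma integral_ii_Re_mult: "(\<integral>z. \<i> * cor (Re (d * z)) \<partial>\<mu>) = 0"
 by (simp only: integral_mult_right_zero integral_complex_of_real integral_Re_mult(2) of_real_0 mult_zero_right)

lemma integral_one: "(\<integral>z. 1 \<partial>\<mu>) = (1::complex)" by simp

lemma quadratic_bounds:
 shows "0 <= ((cmod d)^2 + \<rho> * Re (d^2)) / 4" "((cmod d)^2 + \<rho> * Re (d^2)) / 4 <= (cmod d)^2"
proof -
 have h: "0 <= (x + y) / 4 \<and> (x + y) / 4 <= x" if "\<bar>y\<bar> <= 1 * x" for x y :: real using that by (simp add: abs_le_iff)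
 have "\<bar>Re (d^2)\<bar> <= (cmod d)^2" using abs_Re_le_cmod[of "d^2"] by (simp add: norm_power)
 then have "\<bar>\<rho> * Re (d^2)\<bar> <= 1 * (cmod d)^2" unfolding abs_mult using rho by (intro mult_mono) auto
 from h[OF this] show "0 <= ((cmod d)^2 + \<rho> * Re (d^2)) / 4" "((cmod d)^2 + \<rho> * Re (d^2)) / 4 <= (cmod d)^2" by auto
qed

lemma integrable_iexp_Re: "integrable \<mu> (\<lambda>z. iexp (Re (d * z)))"
proof (rule integrable_const_bound[where B = 1])
 show "(\<lambda>z. iexp (Re (d * z))) \<in> borel_measurable \<mu>" unfolding meas_mu by measurable
qed (auto intro!: AE_I2)

lemma ech_le1: "cmod (ech d) <= 1"
 unfolding ech_def using integral_norm_bound_integral'[of \<mu> "\<lambda>_. 1" "\<lambda>z. iexp (Re (d * z))"] by simp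

lemma ech_minus_1: "cmod (ech d - 1) <= (cmod d)^2"
proof -
 let ?y = "\<lambda>z. Re (d * z)"
 have "ech d - 1 = (\<integral>z. iexp (?y z) - 1 - \<i> * cor (?y z) \<partial>\<mu>)"
 proof -
  have "(\<integral>z. iexp (?y z) - 1 - \<i> * cor (?y z) \<partial>\<mu>)
   = ech d - (\<integral>z. 1 \<partial>\<mu>) - (\<integral>z. \<i> * cor (?y z) \<partial>\<mu>)"
  proof -
   have i: "integrable \<mu> (\<lambda>z. iexp (?y z))" "integrable \<mu> (\<lambda>z. 1::complex)"
    "integrable \<mu> (\<lambda>z. \<i> * cor (?y z))"
    by (intro integrable_iexp_Re integrable_const integrable_mult_right integrable_of_real integral_Re_mult)+
   show ?thesis unfolding ech_def Bochner_Integration.integral_diff[OF Bochner_Integration.integrable_diff[OF i(1,2)] i(3)]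
    Bochner_Integration.integral_diff[OF i(1,2)] ..
  qed
  then show ?thesis by (simp only: integral_ii_Re_mult integral_one diff_zero)
 qed
 also have "cmod ... <= (\<integral>z. (?y z)^2 / 2 \<partial>\<mu>)"
 proof (rule integral_norm_bound_integral'[OF _ AE_I2])
  show "integrable \<mu> (\<lambda>z. (?y z)^2 / 2)" using integral_Re_mult(3)[of d] by simp
  fix z
  show "cmod (iexp (?y z) - 1 - \<i> * cor (?y z)) <= (?y z)^2 / 2" by (rule iexp_expansion)
 qed
 also have "... = ((cmod d)^2 + \<rho> * Re (d^2)) / 4" unfolding integral_divide_zero integral_Re_mult(4) by simp
 also have "... <= (cmod d)^2" by (rule quadratic_bounds)
 finally show ?thesis .
qed

text \<open>With \<open>q\<close> the exponent, both sides are compared with \<open>1 - q\<close>: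
  the characteristic function up to the third moment by Taylor expansion, the exponential up to
  \<open>q^2\<close>, where \<open>q\<close> is at most the squared modulus of
  \<open>d\<close>.\<close>

lemma ech_gaussian:
 "cmod (ech d - exp (- cor (((cmod d)^2 + \<rho> * Re (d^2)) / 4))) <= (\<integral>z. cmod z ^ 3 \<partial>\<mu>) * cmod d ^ 3 + cmod d ^ 4"
proof -
 let ?y = "\<lambda>z. Re (d * z)"
 define q where "q = ((cmod d)^2 + \<rho> * Re (d^2)) / 4"
 have q: "0 <= q" "q <= (cmod d)^2" unfolding q_def by (rule quadratic_bounds)+
 have iy: "integrable \<mu> (\<lambda>z. cor ((?y z)^2))" by (rule integrable_of_real[OF integral_Re_mult(3)])
 have "ech d - (1 - cor q) = (\<integral>z. iexp (?y z) - 1 - \<i> * cor (?y z) + cor ((?y z)^2) / 2 \<partial>\<mu>)"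
 proof -
  have "(\<integral>z. iexp (?y z) - 1 - \<i> * cor (?y z) + cor ((?y z)^2) / 2 \<partial>\<mu>)
   = ech d - (\<integral>z. 1 \<partial>\<mu>) - (\<integral>z. \<i> * cor (?y z) \<partial>\<mu>) + (\<integral>z. cor ((?y z)^2) / 2 \<partial>\<mu>)"
  proof -
   have i: "integrable \<mu> (\<lambda>z. iexp (?y z))" "integrable \<mu> (\<lambda>z. 1::complex)"
    "integrable \<mu> (\<lambda>z. \<i> * cor (?y z))" "integrable \<mu> (\<lambda>z. cor ((?y z)^2) / 2)"
    by (intro integrable_iexp_Re integrable_const integrable_mult_right integrable_divide_zero integrable_of_real integral_Re_mult)+
   show ?thesis unfolding ech_def
    Bochner_Integration.integral_add[OF Bochner_Integration.integrable_diff[OF Bochner_Integration.integrable_diff[OF i(1,2)] i(3)] i(4)]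
    Bochner_Integration.integral_diff[OF Bochner_Integration.integrable_diff[OF i(1,2)] i(3)]
    Bochner_Integration.integral_diff[OF i(1,2)] ..
  qed
  moreover have "(\<integral>z. cor ((?y z)^2) / 2 \<partial>\<mu>) = cor q"
   unfolding integral_divide_zero integral_complex_of_real integral_Re_mult(4) q_def by simp
  ultimately show ?thesis by (simp only: integral_ii_Re_mult integral_one diff_zero diff_diff_eq2 add_diff_eq diff_add_eq)
 qed
 also have "cmod ... <= (\<integral>z. cmod d ^ 3 * cmod z ^ 3 \<partial>\<mu>)"
 proof (rule integral_norm_bound_integral'[OF _ AE_I2])
  show "integrable \<mu> (\<lambda>z. cmod d ^ 3 * cmod z ^ 3)" using moment[of 3] by simp
  fix z
  have "cmod (iexp (?y z) - 1 - \<i> * cor (?y z) + cor ((?y z)^2) / 2) <= \<bar>?y z\<bar> ^ 3 / 6" by (rule iexp_expansion)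
  also have "... <= \<bar>?y z\<bar> ^ 3" by simp
  also have "... <= (cmod (d * z)) ^ 3" by (intro power_mono abs_Re_le_cmod) simp
  finally show "cmod (iexp (?y z) - 1 - \<i> * cor (?y z) + cor ((?y z)^2) / 2) <= cmod d ^ 3 * cmod z ^ 3" by (simp add: norm_mult power_mult_distrib)
 qed
 finally have 1: "cmod (ech d - (1 - cor q)) <= (\<integral>z. cmod z ^ 3 \<partial>\<mu>) * cmod d ^ 3" by (simp add: mult.commute)
 have "\<bar>(1 - q) - exp (- q)\<bar> <= q^2"
 proof -
  have "1 + - q <= exp (- q)" by (rule exp_ge_add_one_self)
  moreover have "exp (- q) <= 1 - q + q^2"
  proof (cases "q <= 1")
   case True
   have "1 + q <= exp q" by (rule exp_ge_add_one_self)
   then have "exp (- q) * (1 + q) <= exp (- q) * exp q" by (intro mult_left_mono) auto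
   then have "exp (- q) * (1 + q) <= 1" by (simp flip: exp_add)
   also have "1 <= (1 - q + q^2) * (1 + q)" using q(1) by (simp add: algebra_simps power2_eq_square)
   finally show ?thesis using q(1) by (simp add: mult_le_cancel_right)
  next
   case False
   then have "q * 1 <= q * q" by (intro mult_left_mono) auto
   moreover have "exp (- q) <= 1" using q by simp
   ultimately show ?thesis unfolding power2_eq_square by linarith
  qed
  ultimately show ?thesis by (simp add: abs_le_iff)
 qed
 moreover have "q^2 <= cmod d ^ 4" using power_mono[OF q(2) q(1), of 2] by simp
 moreover have "(1 - cor q) - exp (- cor q) = cor ((1 - q) - exp (- q))" by (simp flip: exp_of_real)
 ultimately have 2: "cmod ((1 - cor q) - exp (- cor q)) <= cmod d ^ 4" by (metis norm_of_real order_trans)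
 show ?thesis unfolding q_def[symmetric] by (rule norm_diff_triangle_le[OF 1 2])
qed

lemma linear_form_product:
 assumes "finite S"
 shows "(\<integral>x. iexp (Re (\<Sum>e\<in>S. d e * x e)) \<partial>Pr S) = (\<Prod>e\<in>S. ech (d e))"
proof -
 interpret product_sigma_finite "\<lambda>_. \<mu>" by (rule psf)
 have "iexp (Re (\<Sum>e\<in>S. d e * x e)) = (\<Prod>e\<in>S. iexp (Re (d e * x e)))" for x
  unfolding Re_sum of_real_sum sum_distrib_left by (rule exp_sum[OF assms])
 then show ?thesis unfolding ech_def by (simp only:) (rule product_integral_prod[OF assms integrable_iexp_Re])
qed

lemma linear_form_near_1:
 assumes "finite S"
 shows "cmod ((\<integral>x. iexp (Re (\<Sum>e\<in>S. d e * x e)) \<partial>Pr S) - 1) <= (\<Sum>e\<in>S. (cmod (d e))^2)"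
proof -
 have "cmod ((\<Prod>e\<in>S. ech (d e)) - (\<Prod>e\<in>S. 1)) <= (\<Sum>e\<in>S. cmod (ech (d e) - 1))" by (rule norm_prod_diff) (auto simp: ech_le1)
 also have "... <= (\<Sum>e\<in>S. (cmod (d e))^2)" by (intro sum_mono ech_minus_1)
 finally show ?thesis unfolding linear_form_product[OF assms] by simp
qed

text \<open>Lindeberg's replacement: products of numbers of modulus at most 1 differ by at most the
  sum of the differences of their factors. In each cubic error one factor is traded for
  \<open>\<delta>\<close>, in each quartic one two, and the squares are summed.\<close>

lemma linear_form_gaussian:
 assumes "finite S" and \<delta>: "\<And>e. e \<in> S ==> cmod (d e) <= \<delta>"
 shows "cmod ((\<integral>x. iexp (Re (\<Sum>e\<in>S. d e * x e)) \<partial>Pr S)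
   - exp (- cor ((\<Sum>e\<in>S. (cmod (d e))^2 + \<rho> * Re ((d e)^2)) / 4)))
  <= ((\<integral>z. cmod z ^ 3 \<partial>\<mu>) * \<delta> + \<delta>^2) * (\<Sum>e\<in>S. (cmod (d e))^2)"
proof -
 define m3 where "m3 = (\<integral>z. cmod z ^ 3 \<partial>\<mu>)"
 have m3: "0 <= m3" by (simp add: m3_def)
 let ?g = "\<lambda>d. exp (- cor (((cmod d)^2 + \<rho> * Re (d^2)) / 4))"
 have g1: "cmod (?g d) <= 1" for d using quadratic_bounds(1)[of d] by (simp add: norm_exp_eq_Re)
 have "- cor ((\<Sum>e\<in>S. (cmod (d e))^2 + \<rho> * Re ((d e)^2)) / 4) = (\<Sum>e\<in>S. - cor (((cmod (d e))^2 + \<rho> * Re ((d e)^2)) / 4))"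
  by (simp only: sum_negf sum_divide_distrib of_real_sum)
 then have E: "exp (- cor ((\<Sum>e\<in>S. (cmod (d e))^2 + \<rho> * Re ((d e)^2)) / 4)) = (\<Prod>e\<in>S. ?g (d e))"
  by (simp only: exp_sum[OF assms(1)])
 have "cmod ((\<Prod>e\<in>S. ech (d e)) - (\<Prod>e\<in>S. ?g (d e))) <= (\<Sum>e\<in>S. cmod (ech (d e) - ?g (d e)))"
  by (rule norm_prod_diff) (auto simp only: ech_le1 g1)
 also have "(\<Sum>e\<in>S. cmod (ech (d e) - ?g (d e))) <= (\<Sum>e\<in>S. (m3 * \<delta> + \<delta>^2) * (cmod (d e))^2)"
 proof (rule sum_mono)
  fix e assume e: "e \<in> S"
  have "m3 * cmod (d e) ^ 3 = m3 * cmod (d e) * (cmod (d e))^2" by (simp add: power3_eq_cube power2_eq_square)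
  also have "... <= m3 * \<delta> * (cmod (d e))^2" using \<delta>[OF e] m3 by (intro mult_right_mono mult_left_mono) auto
  finally have a: "m3 * cmod (d e) ^ 3 <= m3 * \<delta> * (cmod (d e))^2" .
  have "cmod (d e) ^ 4 = (cmod (d e))^2 * (cmod (d e))^2" by (simp add: power4_eq_xxxx power2_eq_square)
  also have "... <= \<delta>^2 * (cmod (d e))^2" using \<delta>[OF e] by (intro mult_right_mono power_mono) auto
  finally have b: "cmod (d e) ^ 4 <= \<delta>^2 * (cmod (d e))^2" .
  show "cmod (ech (d e) - ?g (d e)) <= (m3 * \<delta> + \<delta>^2) * (cmod (d e))^2"
   using ech_gaussian[of "d e"] a b unfolding m3_def[symmetric] by (simp only: distrib_right)
 qed
 finally show ?thesis unfolding linear_form_product[OF assms(1)] E m3_def[symmetric] sum_distrib_left[symmetric] .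
qed

end

text \<open>Averaging \<open>chf\<close> over Gaussian points of scale \<open>s\<close> yields the
  mean of \<open>gk s\<close>, a function that is at most 1/2 outside the ball of radius
  \<open>2 / s\<close>. For small \<open>s\<close> the average is close to 1 uniformly in
  \<open>n\<close>, so little mass can lie outside that ball.\<close>

lemma tight_of_chf:
 fixes Q :: "nat => 'a::euclidean_space measure"
 assumes Q: "\<And>n. prob_space (Q n)" "\<And>n. sets (Q n) = sets borel"
  and chf: "\<forall>\<^sub>F n in sequentially. \<forall>a. cmod (chf (Q n) a - 1) <= C * (norm a)^2" and e: "0 < e"
 shows "\<exists>R. \<forall>\<^sub>F n in sequentially. measure (Q n) (- ball 0 R) <= e"
proof -
 interpret N: prob_space "nrm :: ('a => real) measure" by (rule prob_space_nrm)
 \<comment> \<open>The cap 2 is the trivial bound for a characteristic function minus 1; it gives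
   dominated convergence without moments of the Gaussian vector.\<close>
 define h where "h = (\<lambda>m. \<integral>w. min 2 (C * (norm (- ((1 / real (Suc m)) *\<^sub>R (nvec w :: 'a))))^2) \<partial>nrm)"
 obtain n0 where n0: "\<And>a. cmod (chf (Q n0) a - 1) <= C * (norm a)^2"
  using eventually_happens[OF chf] by auto
 have C: "0 <= C"
 proof -
  obtain b :: 'a where "b \<in> Basis" using nonempty_Basis by blast
  then show ?thesis using order_trans[OF norm_ge_zero n0[of b]] by simp
 qed
 have "h \<longlonglongrightarrow> (\<integral>w. 0 \<partial>(nrm :: ('a => real) measure))"
  unfolding h_def
 proof (rule integral_dominated_convergence[where w = "\<lambda>_. 2"])
  show "AE w in nrm. (\<lambda>m. min 2 (C * (norm (- ((1 / real (Suc m)) *\<^sub>R (nvec w :: 'a))))^2)) \<longlonglongrightarrow> 0"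
  proof (rule AE_I2)
   fix w :: "'a => real"
   have "(\<lambda>m. (1 / real (Suc m))) \<longlonglongrightarrow> 0" by real_asymp
   then have "(\<lambda>m. C * (norm (- ((1 / real (Suc m)) *\<^sub>R (nvec w :: 'a))))^2) \<longlonglongrightarrow> C * (norm (- (0 *\<^sub>R (nvec w :: 'a))))^2"
    by (intro tendsto_intros)
   then have "(\<lambda>m. min 2 (C * (norm (- ((1 / real (Suc m)) *\<^sub>R (nvec w :: 'a))))^2)) \<longlonglongrightarrow> min 2 (C * (norm (- (0 *\<^sub>R (nvec w :: 'a))))^2)"
    by (intro tendsto_min tendsto_const)
   then show "(\<lambda>m. min 2 (C * (norm (- ((1 / real (Suc m)) *\<^sub>R (nvec w :: 'a))))^2)) \<longlonglongrightarrow> 0" by simp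
  qed
  show "AE w in nrm. norm (min 2 (C * (norm (- ((1 / real (Suc m)) *\<^sub>R (nvec w :: 'a))))^2)) <= 2" for m
   using C by (intro AE_I2) (auto simp: abs_le_iff min_def)
 qed auto
 then have "h \<longlonglongrightarrow> 0" by simp
 then have "\<forall>\<^sub>F m in sequentially. h m < e / 2" using e by (intro order_tendstoD) auto
 then obtain m where m: "h m < e / 2" by (auto simp: eventually_sequentially)
 define s where "s = 1 / real (Suc m)"
 have s: "0 < s" by (simp add: s_def)
 show ?thesis
 proof (intro exI[of _ "2 / s"], rule eventually_mono[OF chf])
  fix n assume c: "\<forall>a. cmod (chf (Q n) a - 1) <= C * (norm a)^2"
  interpret P: prob_space "Q n" by (rule Q)
  have [measurable_cong]: "sets (Q n) = sets borel" by (rule Q)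
  have [measurable]: "(\<lambda>w. chf (Q n) (- (s *\<^sub>R nvec w))) \<in> borel_measurable nrm"
   using chf_nvec_measurable[OF Q, of n "- s"] by auto
  have ic: "integrable nrm (\<lambda>w. chf (Q n) (- (s *\<^sub>R nvec w)))"
   by (rule N.integrable_const_bound[where B = 1]) (auto intro!: AE_I2 chf_bounded Q)
  have "cor (\<integral>x. gk s (0 - x) \<partial>Q n) - 1 = (\<integral>w. chf (Q n) (- (s *\<^sub>R nvec w)) - 1 \<partial>nrm)"
   unfolding gk_integral_eq_chf[OF Q] using ic by (simp add: N.prob_space)
  also have "cmod ... <= h m"
   unfolding h_def s_def[symmetric]
  proof (rule integral_norm_bound_integral'[OF _ AE_I2])
   show "integrable nrm (\<lambda>w. min 2 (C * (norm (- (s *\<^sub>R (nvec w :: 'a))))^2))"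
    by (rule N.integrable_const_bound[where B = 2]) (use C in \<open>auto intro!: AE_I2 simp: min_def abs_le_iff\<close>)
   fix w :: "'a => real"
   have "cmod (chf (Q n) (- (s *\<^sub>R nvec w)) - 1) <= cmod (chf (Q n) (- (s *\<^sub>R nvec w))) + cmod 1" by (rule norm_triangle_ineq4)
   then have "cmod (chf (Q n) (- (s *\<^sub>R nvec w)) - 1) <= 2" using chf_bounded[OF Q(1), of n "- (s *\<^sub>R nvec w)"] by simp
   then show "cmod (chf (Q n) (- (s *\<^sub>R nvec w)) - 1) <= min 2 (C * (norm (- (s *\<^sub>R nvec w)))^2)" using c[rule_format, of "- (s *\<^sub>R nvec w)"] by (rule min.boundedI)
  qed
  finally have "cmod (cor ((\<integral>x. gk s (0 - x) \<partial>Q n) - 1)) <= h m" by simp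
  then have g: "1 - (\<integral>x. gk s (0 - x) \<partial>Q n) <= e / 2" using m unfolding norm_of_real by linarith
  have ig: "integrable (Q n) (\<lambda>x. gk s (0 - x))" by (rule P.integrable_const_bound[where B = 1]) (auto simp: gk_def)
  have im: "- ball 0 (2 / s) \<in> sets (Q n)" by (simp add: Q)
  have "1 / 2 * measure (Q n) (- ball 0 (2 / s)) = (\<integral>x. 1 / 2 * indicator (- ball 0 (2 / s)) x \<partial>Q n)" using im by simp
  also have "... <= (\<integral>x. 1 - gk s (0 - x) \<partial>Q n)"
  proof (rule integral_mono)
   show "integrable (Q n) (\<lambda>x. 1 / 2 * indicator (- ball 0 (2 / s)) x :: real)"
    using im by (intro integrable_mult_right integrable_real_indicator) (auto simp: P.emeasure_eq_measure)
   show "integrable (Q n) (\<lambda>x. 1 - gk s (0 - x))" using ig by simp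
   fix x :: 'a
   show "1 / 2 * indicator (- ball 0 (2 / s)) x <= 1 - gk s (0 - x)"
   proof (cases "x \<in> ball 0 (2 / s)")
    case True
    then show ?thesis using gk_bounds(2)[of s "0 - x"] by simp
   next
    case False
    then have "2 / s <= norm x" by simp
    then have "2 <= s * norm x" using s by (simp add: divide_le_eq mult.commute)
    then have "2^2 <= (s * norm x)^2" by (intro power_mono) auto
    then have "1 <= s^2 * (norm x)^2 / 2" by (simp add: power_mult_distrib)
    then have "gk s (0 - x) <= exp (- 1)" by (simp add: gk_def)
    also have "exp (- 1) <= (1 / 2 :: real)" using exp_ge_add_one_self[of 1] by (simp add: exp_minus field_simps)
    finally show ?thesis using False by simp
   qed
  qed
  also have "... = 1 - (\<integral>x. gk s (0 - x) \<partial>Q n)" using ig by (simp add: P.prob_space)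
  finally show "measure (Q n) (- ball 0 (2 / s)) <= e" using g by linarith
 qed
qed

section \<open>Convergence of characteristic functions and laws\<close>

text \<open>Minus four times the exponent in the characteristic function of the Gaussian law with
  covariance \<open>C\<close> and pseudo-covariance \<open>P\<close>.\<close>

definition qform :: "('t::finite => 't => complex) => ('t => 't => complex) => ('t => complex) => real" where
 "qform C P a = Re (\<Sum>s\<in>UNIV. \<Sum>t\<in>UNIV. cnj (a s) * a t * C s t) + Re (\<Sum>s\<in>UNIV. \<Sum>t\<in>UNIV. cnj (a s) * cnj (a t) * P s t)"

lemma qform_le:
 assumes "\<And>s t. cmod (C s t) <= D" "\<And>s t. cmod (P s t) <= D"
 shows "\<bar>qform C P a\<bar> <= 2 * D * (\<Sum>t\<in>UNIV. cmod (a t))^2"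
proof -
 have b: "\<bar>Re (\<Sum>s\<in>UNIV. \<Sum>t\<in>UNIV. f s t * E s t)\<bar> <= D * (\<Sum>t\<in>UNIV. cmod (a t))^2"
  if f: "\<And>s t. cmod (f s t) = cmod (a s) * cmod (a t)" and E: "\<And>s t. cmod (E s t) <= D" for f E
 proof -
  have "\<bar>Re (\<Sum>s\<in>UNIV. \<Sum>t\<in>UNIV. f s t * E s t)\<bar> <= cmod (\<Sum>s\<in>UNIV. \<Sum>t\<in>UNIV. f s t * E s t)" by (rule abs_Re_le_cmod)
  also have "... <= (\<Sum>s\<in>UNIV. \<Sum>t\<in>UNIV. cmod (a s) * cmod (a t) * D)"
  proof (rule order_trans[OF norm_sum], rule sum_mono, rule order_trans[OF norm_sum], rule sum_mono)
   fix s t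
   show "cmod (f s t * E s t) <= cmod (a s) * cmod (a t) * D" unfolding norm_mult f by (intro mult_left_mono E) simp
  qed
  also have "... = D * (\<Sum>t\<in>UNIV. cmod (a t))^2" by (simp add: power2_eq_square sum_product sum_distrib_left mult_ac)
  finally show ?thesis .
 qed
 have "\<bar>Re (\<Sum>s\<in>UNIV. \<Sum>t\<in>UNIV. cnj (a s) * a t * C s t)\<bar> <= D * (\<Sum>t\<in>UNIV. cmod (a t))^2"
  by (rule b) (use assms in \<open>auto simp: norm_mult\<close>)
 moreover have "\<bar>Re (\<Sum>s\<in>UNIV. \<Sum>t\<in>UNIV. cnj (a s) * cnj (a t) * P s t)\<bar> <= D * (\<Sum>t\<in>UNIV. cmod (a t))^2"
  by (rule b) (use assms in \<open>auto simp: norm_mult\<close>)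
 ultimately show ?thesis unfolding qform_def by linarith
qed

text \<open>Both matrices are block diagonal with respect to the length, so restricting the
  coefficients to some lengths amounts to restricting the outer sum alone.\<close>

lemma qform_restrict:
 fixes k :: "'t::finite => nat"
 assumes "\<And>s t. k s \<noteq> k t ==> C s t = 0" "\<And>s t. k s \<noteq> k t ==> P s t = 0"
 shows "qform C P (\<lambda>t. if D (k t) then a t else 0) = Re (\<Sum>s\<in>{s. D (k s)}. \<Sum>t\<in>UNIV. cnj (a s) * (cnj (a t) * P s t + a t * C s t))"
proof -
 let ?b = "\<lambda>t. if D (k t) then a t else 0"
 have "qform C P ?b = Re (\<Sum>s\<in>UNIV. (\<Sum>t\<in>UNIV. cnj (?b s) * ?b t * C s t + cnj (?b s) * cnj (?b t) * P s t))"
  unfolding qform_def by (simp only: sum.distrib plus_complex.sel)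
 also have "(\<Sum>s\<in>UNIV. (\<Sum>t\<in>UNIV. cnj (?b s) * ?b t * C s t + cnj (?b s) * cnj (?b t) * P s t))
  = (\<Sum>s\<in>UNIV. if s \<in> {s. D (k s)} then (\<Sum>t\<in>UNIV. cnj (a s) * (cnj (a t) * P s t + a t * C s t)) else 0)"
 proof (rule sum.cong[OF refl])
  fix s
  have "cnj (?b s) * ?b t * C s t + cnj (?b s) * cnj (?b t) * P s t = (if D (k s) then cnj (a s) * (cnj (a t) * P s t + a t * C s t) else 0)" for t
   by (cases "k s = k t") (simp_all add: assms algebra_simps)
  then show "(\<Sum>t\<in>UNIV. cnj (?b s) * ?b t * C s t + cnj (?b s) * cnj (?b t) * P s t)
   = (if s \<in> {s. D (k s)} then (\<Sum>t\<in>UNIV. cnj (a s) * (cnj (a t) * P s t + a t * C s t)) else 0)" by simp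
 qed
 also have "... = (\<Sum>s\<in>{s. D (k s)}. \<Sum>t\<in>UNIV. cnj (a s) * (cnj (a t) * P s t + a t * C s t))"
  by (subst sum.inter_restrict[symmetric]) auto
 finally show ?thesis .
qed

lemma qform_split:
 fixes k :: "'t::finite => nat"
 assumes CP: "\<And>s t. k s \<noteq> k t ==> C s t = 0" "\<And>s t. k s \<noteq> k t ==> P s t = 0"
 shows "qform C P a = qform C P (\<lambda>t. if k t = 1 then a t else 0) + qform C P (\<lambda>t. if k t \<noteq> 1 then a t else 0)"
proof -
 let ?g = "\<lambda>s. \<Sum>t\<in>UNIV. cnj (a s) * (cnj (a t) * P s t + a t * C s t)"
 have "qform C P a = Re (sum ?g UNIV)" using qform_restrict[of k C P "\<lambda>_. True" a, OF CP] by simp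
 moreover have "sum ?g UNIV = sum ?g {s. k s = 1} + sum ?g {s. k s \<noteq> 1}" by (subst sum.union_disjoint[symmetric]) (auto intro: sum.cong)
 moreover have "qform C P (\<lambda>t. if k t = 1 then a t else 0) = Re (sum ?g {s. k s = 1})"
  using qform_restrict[of k C P "\<lambda>m. m = 1" a, OF CP] .
 moreover have "qform C P (\<lambda>t. if k t \<noteq> 1 then a t else 0) = Re (sum ?g {s. k s \<noteq> 1})"
  using qform_restrict[of k C P "\<lambda>m. m \<noteq> 1" a, OF CP] .
 ultimately show ?thesis by (simp only: plus_complex.sel)
qed

lemma sum_square_array:
 "(\<Sum>i<n. \<Sum>l<n. F i l) = (\<Sum>e\<in>{..<n} \<times> {..<n::nat}. F (snd e) (fst e))"
 by (subst sum.swap) (simp add: sum.cartesian_product case_prod_unfold)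

lemma Zk_one:
 assumes "0 < n"
 shows "Zk n 1 Bs x = (\<Sum>e\<in>{..<n} \<times> {..<n}. Bs 0 (snd e) (fst e) * x e)"
proof -
 have "Zk n 1 Bs x = (\<Sum>i<n. \<Sum>l<n. mmul n idm (Bs 0) i l * x (l, i))"
  using assms by (simp add: Zk_def trace_def) (simp add: mmul_def[of n "mmul n idm (Bs 0)"] matX_def)
 also have "... = (\<Sum>i<n. \<Sum>l<n. Bs 0 i l * x (l, i))"
  by (intro sum.cong refl) (simp add: mmul_def idm_def if_distrib[of "\<lambda>z. z * _"] cong: if_cong)
 finally show ?thesis unfolding sum_square_array by simp
qed

text \<open>Here the two vectors of the rank-one letter are bounded separately; the general case is
  reduced to this one by balancing.\<close>

locale word_family = iid_entries +
 fixes k :: "'t::finite => nat" and B :: "'t => nat => nat => cmat" and u v :: "'t => nat => cvec" and K0 :: real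
 assumes K0: "1 <= K0" and k_pos: "\<And>t. 1 <= k t"
  and B0: "\<And>t n i l. i < n ==> l < n ==> B t n 0 i l = u t n i * cnj (v t n l)"
  and uv: "\<And>t n. l2norm n (u t n) <= K0" "\<And>t n. l2norm n (v t n) <= K0"
  and B: "\<And>t n q. q < k t ==> form_bound n (B t n q) K0"
begin

definition CC :: "nat => 't => 't => complex" where
 "CC n s t = (if k s = k t then Sig n (k s) (B s n) (B t n) else 0)"

definition PP :: "nat => 't => 't => complex" where
 "PP n s t = (if k s = k t then Sig' \<rho> n (k s) (B s n) (B t n) else 0)"

definition MM :: nat where "MM = (\<Sum>t\<in>UNIV. k t)"

lemma k_le: "k t <= MM" unfolding MM_def by (rule member_le_sum) auto

lemma CC_off: "k s \<noteq> k t ==> CC n s t = 0" and PP_off: "k s \<noteq> k t ==> PP n s t = 0" by (simp_all add: CC_def PP_def)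

lemma covariance_le:
 assumes n: "0 < n" and st: "k s = k t"
 shows "real n powr (1 - real (k s)) * cmod (\<Prod>j<k s. \<Sum>i<n. \<Sum>l<n. B s n j i l * kap \<kappa> (B t n j i l)) <= K0 ^ (2 * MM + 2)"
proof -
 let ?u = "\<lambda>i. kap \<kappa> (u t n i)" and ?v = "\<lambda>l. kap \<kappa> (cnj (v t n l))"
 have nk: "l2norm n (\<lambda>i. kap \<kappa> (x i)) = l2norm n x" for x by (simp add: l2norm_def)
 have km: "kap \<kappa> (x * y) = kap \<kappa> x * kap \<kappa> y" for x y by (simp add: kap_def)
 have fk: "form_bound n (\<lambda>i l. kap \<kappa> (A i l)) K0" if "form_bound n A K0" for A
  using that form_bound_cnj[OF that] by (cases \<kappa>) (simp_all add: kap_def)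
 have "real n powr (1 - real (k s)) * cmod (\<Prod>j<k s. \<Sum>i<n. \<Sum>l<n. B s n j i l * kap \<kappa> (B t n j i l)) <= K0 ^ (2 * k s + 2)"
 proof (rule covariance_product_le[OF n k_pos K0])
  show "cmod (\<Sum>i<n. \<Sum>l<n. B s n 0 i l * kap \<kappa> (B t n 0 i l)) <= K0^4"
   by (rule rank_one_product_le[where u = "u s n" and v = "\<lambda>l. cnj (v s n l)" and u' = ?u and v' = ?v])
    (use B0 uv in \<open>auto simp: nk km\<close>)
  show "cmod (\<Sum>i<n. \<Sum>l<n. B s n j i l * kap \<kappa> (B t n j i l)) <= real n * K0^2" if "j < k s" for j
   by (rule entrywise_product_le) (use B that st fk in auto)
 qed
 also have "... <= K0 ^ (2 * MM + 2)" using k_le[of s] by (intro power_increasing K0) auto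
 finally show ?thesis .
qed

lemma CC_le: "0 < n ==> cmod (CC n s t) <= K0 ^ (2 * MM + 2)"
 using covariance_le[of n s t True] K0 by (auto simp: CC_def Sig_def kap_def norm_mult)

lemma PP_le: assumes "0 < n" shows "cmod (PP n s t) <= K0 ^ (2 * MM + 2)"
proof (cases "k s = k t")
 case True
 let ?p = "\<Prod>j<k s. \<Sum>i<n. \<Sum>l<n. B s n j i l * kap False (B t n j i l)"
 have "cmod (PP n s t) = \<rho> ^ k s * (real n powr (1 - real (k s)) * cmod ?p)"
  using True rho by (simp add: PP_def Sig'_def kap_def norm_mult abs_mult norm_power)
 also have "... <= 1 * K0 ^ (2 * MM + 2)" by (intro mult_mono covariance_le assms True power_le_one rho) auto
 finally show ?thesis by simp
qed (use K0 in \<open>simp add: PP_def\<close>)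

definition Cn :: "nat => 't => nat => cmat" where
 "Cn n t = bordered (k t) (u t n) (v t n) (B t n)"

lemma form_bound_Cn: "0 < n ==> form_bound n (Cn n t q) K0"
 unfolding Cn_def by (rule form_bound_bordered) (use uv B in auto)

lemma Zk_Zv: "0 < n ==> Zk n (k t) (B t n) x = Zv n k (Cn n) t x"
 unfolding Zv_def Cn_def by (rule Zk_eq_word) (use k_pos B0 in auto)

lemma polybdd_Zk: "polybdd ({..<n} \<times> {..<n}) (\<lambda>x. Zk n (k t) (B t n) x)"
proof (cases "n = 0")
 case True
 then have "Zk n (k t) (B t n) x = 0" for x by (simp add: Zk_def trace_def)
 then show ?thesis by (simp only: polybdd_const)
next
 case False
 then show ?thesis using polybdd_Zv[of n k "Cn n" t] by (simp add: Zk_Zv)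
qed

definition Ph :: "nat => ('t => complex) => arr => real" where
 "Ph n a x = Re (\<Sum>t\<in>UNIV. cnj (a t) * Zk n (k t) (B t n) x)"

definition chZ :: "nat => ('t => complex) => complex" where
 "chZ n a = (\<integral>x. iexp (Ph n a x) \<partial>Pr ({..<n} \<times> {..<n}))"

lemma decoupling:
 fixes a :: "'t => complex"
 shows "(\<lambda>n. chZ n a - chZ n (\<lambda>t. if k t = 1 then a t else 0)
   * exp (- cor (qform (CC n) (PP n) (\<lambda>t. if k t \<noteq> 1 then a t else 0) / 4))) \<longlonglongrightarrow> 0"
proof -
 define \<beta> where "\<beta> = (\<Sum>t\<in>UNIV. cmod (a t))"
 have \<beta>: "cmod (a t) <= \<beta>" for t unfolding \<beta>_def by (rule member_le_sum) auto
 have \<beta>0: "0 <= \<beta>" by (simp add: \<beta>_def sum_nonneg)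
 define K where "K = K0 * K0"
 have K1: "1 <= K" using mult_mono[OF K0 K0] K0 by (simp add: K_def)
 \<comment> \<open>\<open>A\<close> collects what the weight has to dominate: 2, the number of
   factors plus one, the letter bound \<open>K\<close> and the coefficient bound.\<close>
 define A where "A = 3 + 2 * real MM + K + \<beta>"
 have A: "1 <= A" "2 <= A" "real MM + 1 <= A" "K <= A" "real MM <= A" "\<beta> <= A" using K1 \<beta>0 by (auto simp: A_def)
 \<comment> \<open>\<open>T\<close> will be the power \<open>4 * MM + 1\<close> of the weight, as in
   \<open>controlledI\<close>, and the error terms involve its moments up to order 44.\<close>
 obtain c where c: "\<And>n. 0 < n ==> \<exists>X. polybdd ({..<n} \<times> {..<n}) X \<and> (\<forall>x. A <= X x \<and> form_bound n (scaledX n x) (X x)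
   \<and> (\<forall>i<n. \<forall>j<n. cmod (x (i, j)) <= X x))
  \<and> (\<integral>x. X x ^ ((4 * MM + 1) * 44) \<partial>Pr ({..<n} \<times> {..<n})) <= c * real n powr (1 / 16)"
  using matrix_control[OF A(1), of "(4 * MM + 1) * 44"] by blast
 define D where "D = real CARD('t) * \<beta> * (K * (9 + (\<Sum>m\<le>MM. (gerr K MM m)^2)) + 2 * real MM)"
 have D: "0 <= D" using \<beta>0 K1 by (auto simp: D_def intro!: mult_nonneg_nonneg add_nonneg_nonneg sum_nonneg)
 \<comment> \<open>The error with \<open>\<eta> = n^(-1/8)\<close> and all moments replaced by
   \<open>c n^(1/16)\<close>. The first term decays like \<open>n^(-1/16)\<close>, the second like
   \<open>n^(-9/16)\<close>, the last two like \<open>n^(-7/16)\<close>.\<close>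
 define f where "f = (\<lambda>n. 26 * real n powr (- (1/8)) * (c * real n powr (1/16)) + 76 * (c * real n powr (1/16)) / (real n * (real n powr (- (1/8)))^3)
   + 24 * (c * real n powr (1/16)) / sqrt (real n) + D * (c * real n powr (1/16)) / sqrt (real n))"
 have f0: "f \<longlonglongrightarrow> 0" unfolding f_def by real_asymp
 define Q where "Q = (\<lambda>n. qform (CC n) (PP n) (\<lambda>t. if k t \<noteq> 1 then a t else 0))"
 define H where "H = 2 * K0 ^ (2 * MM + 2) * \<beta>^2"
 have QH: "\<bar>Q n\<bar> <= H" if "0 < n" for n
 proof -
  have "\<bar>Q n\<bar> <= 2 * K0 ^ (2 * MM + 2) * (\<Sum>t\<in>UNIV. cmod (if k t \<noteq> 1 then a t else 0))^2"
   unfolding Q_def by (rule qform_le) (use CC_le PP_le that in auto)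
  also have "... <= H" unfolding H_def \<beta>_def
   using K0 by (intro mult_left_mono power_mono sum_mono) (auto intro: sum_nonneg)
  finally show ?thesis .
 qed
 have bd: "cmod (chZ n a - chZ n (\<lambda>t. if k t = 1 then a t else 0) * exp (- cor (Q n / 4)))
   <= real CARD('t) * \<beta> * f n * exp (H / 2)" if n: "0 < n" for n
 proof -
  obtain X where pX: "polybdd ({..<n} \<times> {..<n}) X" and XA: "\<And>x. A <= X x" and Xf: "\<And>x. form_bound n (scaledX n x) (X x)"
   and Xe: "\<And>x i j. i < n ==> j < n ==> cmod (x (i, j)) <= X x"
   and Xm: "(\<integral>x. X x ^ ((4 * MM + 1) * 44) \<partial>Pr ({..<n} \<times> {..<n})) <= c * real n powr (1 / 16)"
   using c[OF n] by blast
  define T where "T = (\<lambda>x. X x ^ (4 * MM + 1))"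
  have AT: "A <= T x" for x
  proof -
   have "X x ^ 1 <= X x ^ (4 * MM + 1)" using XA[of x] A(1) by (intro power_increasing) auto
   then show ?thesis using XA[of x] by (simp add: T_def)
  qed
  interpret g: gram_entries \<mu> \<rho> n K MM T K0
  proof unfold_locales
   show "polybdd ({..<n} \<times> {..<n}) T" unfolding T_def by (intro polybdd_power pX)
   show "controlled n K MM x (T x)" for x unfolding T_def by (rule controlledI) (use order_trans[OF _ XA] A Xf Xe in auto)
  qed (use n K0 in \<open>auto simp: K_def\<close>)
  have ET: "g.ET q <= c * real n powr (1/16)" if "q <= 44" for q
  proof -
   have "g.ET q <= g.ET 44" unfolding g.ET_def by (rule integral_power_mono) (use that AT A(1) order_trans g.pT in auto)
   also have "... = (\<integral>x. X x ^ ((4 * MM + 1) * 44) \<partial>Pr ({..<n} \<times> {..<n}))"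
    unfolding g.ET_def unfolding T_def by (simp only: power_mult)
   finally show ?thesis using Xm by linarith
  qed
  have se: "g.stein_error CARD('t) \<beta> (real n powr (- (1/8))) <= f n"
   unfolding g.stein_error_def f_def D_def[symmetric]
   using n D by (intro add_mono mult_left_mono divide_right_mono ET) auto
  have kT: "real (\<Sum>t\<in>UNIV. k t) <= T x" for x using AT[of x] A(5) unfolding MM_def by linarith
  have Cf: "form_bound n (Cn n t q) K0" for t q by (rule form_bound_Cn[OF n])
  define R where "R = Re (\<Sum>t\<in>{t. 2 <= k t}. \<Sum>t'\<in>UNIV. cnj (a t) * (cnj (a t') * (\<rho> * g.sg k (Cn n) False t t') + a t' * g.sg k (Cn n) True t t'))"
  have sgT: "g.sg k (Cn n) True t t' = CC n t t'" for t t'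
   using g.sg_bordered[of k "\<lambda>t. u t n" "\<lambda>t. v t n" "\<lambda>t. B t n" True t t'] form_bound_Cn[OF n] k_pos B0
   by (simp add: Cn_def[abs_def] CC_def Sig_def kap_def cf_def)
  have sgF: "\<rho> * g.sg k (Cn n) False t t' = PP n t t'" for t t'
   using g.sg_bordered[of k "\<lambda>t. u t n" "\<lambda>t. v t n" "\<lambda>t. B t n" False t t'] form_bound_Cn[OF n] k_pos B0
   by (simp add: Cn_def[abs_def] PP_def Sig'_def kap_def cf_def)
  have k2: "{t. 2 <= k t} = {t. k t \<noteq> 1}" using k_pos by (auto simp: le_less Suc_le_eq) (metis One_nat_def less_one not_less_eq numeral_2_eq_2 less_antisym not_one_less_zero)
  have RQ: "R = Q n" unfolding R_def sgT sgF k2 Q_def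
   by (rule qform_restrict[of k, symmetric, where D = "\<lambda>m. m \<noteq> 1"]) (simp_all add: CC_off PP_off)
  have ph: "phase n k (Cn n) b x = Ph n b x" for b x
   unfolding phase_def Ph_def Zk_Zv[OF n] ..
  have "cmod ((\<integral>x. iexp (phase n k (Cn n) a x) \<partial>Pr g.Ix)
   - (\<integral>x. iexp (phase n k (Cn n) (\<lambda>t. if k t = 1 then a t else 0) x) \<partial>Pr g.Ix) * exp (- cor (R / 4)))
   <= real CARD('t) * \<beta> * g.stein_error CARD('t) \<beta> (real n powr (- (1/8))) * exp (\<bar>R\<bar> / 2)"
   unfolding R_def by (rule g.characteristic_function_decoupling[OF Cf k_pos k_le kT \<beta>])
    (use order_trans[OF A(6) AT] n in auto)
  also have "... <= real CARD('t) * \<beta> * f n * exp (H / 2)"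
  proof -
   have "0 <= g.stein_error CARD('t) \<beta> (real n powr (- (1/8)))"
    unfolding g.stein_error_def D_def[symmetric]
    using g.ET_ge1[of 44] g.ET_ge1[of 32] g.ET_ge1[of 24] D by (intro add_nonneg_nonneg mult_nonneg_nonneg divide_nonneg_nonneg) auto
   then show ?thesis using se \<beta>0 QH[OF n] RQ by (intro mult_mono mult_left_mono) auto
  qed
  finally show ?thesis unfolding ph RQ chZ_def .
 qed
 have "(\<lambda>n. chZ n a - chZ n (\<lambda>t. if k t = 1 then a t else 0) * exp (- cor (Q n / 4))) \<longlonglongrightarrow> 0"
 proof (rule Lim_null_comparison)
  show "\<forall>\<^sub>F n in sequentially. cmod (chZ n a - chZ n (\<lambda>t. if k t = 1 then a t else 0) * exp (- cor (Q n / 4)))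
    <= real CARD('t) * \<beta> * f n * exp (H / 2)"
   using eventually_gt_at_top[of 0] by eventually_elim (rule bd)
  have "(\<lambda>n. real CARD('t) * \<beta> * f n * exp (H / 2)) \<longlonglongrightarrow> real CARD('t) * \<beta> * 0 * exp (H / 2)"
   by (intro tendsto_intros f0)
  then show "(\<lambda>n. real CARD('t) * \<beta> * f n * exp (H / 2)) \<longlonglongrightarrow> 0" by simp
 qed
 then show ?thesis unfolding Q_def .
qed

text \<open>Coefficient of the entry \<open>x e\<close> in a phase made of words of length one. The
  indices are swapped because the trace pairs the letter at \<open>(i, l)\<close> with
  \<open>x (l, i)\<close>.\<close>

definition dd :: "nat => ('t => complex) => nat \<times> nat => complex" where
 "dd n b e = (\<Sum>t\<in>UNIV. cnj (b t) * B t n 0 (snd e) (fst e))"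

lemma Ph_linear:
 assumes n: "0 < n" and b: "\<And>t. k t \<noteq> 1 ==> b t = 0"
 shows "Ph n b x = Re (\<Sum>e\<in>{..<n} \<times> {..<n}. dd n b e * x e)"
proof -
 have "(\<Sum>t\<in>UNIV. cnj (b t) * Zk n (k t) (B t n) x) = (\<Sum>t\<in>UNIV. \<Sum>e\<in>{..<n} \<times> {..<n}. cnj (b t) * B t n 0 (snd e) (fst e) * x e)"
 proof (rule sum.cong[OF refl])
  fix t
  show "cnj (b t) * Zk n (k t) (B t n) x = (\<Sum>e\<in>{..<n} \<times> {..<n}. cnj (b t) * B t n 0 (snd e) (fst e) * x e)"
  proof (cases "k t = 1")
   case True
   show ?thesis unfolding True Zk_one[OF n] by (simp only: sum_distrib_left mult.assoc)
  qed (simp add: b)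
 qed
 also have "... = (\<Sum>e\<in>{..<n} \<times> {..<n}. dd n b e * x e)"
  unfolding dd_def sum_distrib_right by (rule sum.swap)
 finally show ?thesis unfolding Ph_def by (rule arg_cong)
qed

lemma dd_square_sum:
 "(\<Sum>e\<in>{..<n} \<times> {..<n}. (cmod (dd n b e))^2) <= real CARD('t) * K0^4 * (\<Sum>t\<in>UNIV. (cmod (b t))^2)"
proof -
 have "(\<Sum>e\<in>{..<n} \<times> {..<n}. (cmod (dd n b e))^2)
   <= (\<Sum>e\<in>{..<n} \<times> {..<n}. real CARD('t) * (\<Sum>t\<in>UNIV. (cmod (b t))^2 * (cmod (B t n 0 (snd e) (fst e)))^2))"
 proof (rule sum_mono)
  fix e
  have "(cmod (dd n b e))^2 <= (\<Sum>t\<in>UNIV. cmod (b t) * cmod (B t n 0 (snd e) (fst e)))^2"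
   unfolding dd_def by (intro power_mono order_trans[OF norm_sum]) (auto simp: norm_mult)
  also have "... <= (\<Sum>t\<in>UNIV. (cmod (b t) * cmod (B t n 0 (snd e) (fst e)))^2) * real CARD('t)" by (rule sum_squared_le_sum_of_squares)
  finally show "(cmod (dd n b e))^2 <= real CARD('t) * (\<Sum>t\<in>UNIV. (cmod (b t))^2 * (cmod (B t n 0 (snd e) (fst e)))^2)"
   by (simp add: power_mult_distrib mult.commute)
 qed
 also have "... = real CARD('t) * (\<Sum>t\<in>UNIV. (cmod (b t))^2 * (\<Sum>e\<in>{..<n} \<times> {..<n}. (cmod (B t n 0 (snd e) (fst e)))^2))"
  unfolding sum_distrib_left by (rule sum.swap)
 also have "... <= real CARD('t) * (\<Sum>t\<in>UNIV. (cmod (b t))^2 * K0^4)"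
 proof (intro mult_left_mono sum_mono)
  fix t
  have "(\<Sum>e\<in>{..<n} \<times> {..<n}. (cmod (B t n 0 (snd e) (fst e)))^2) = (\<Sum>i<n. \<Sum>l<n. (cmod (B t n 0 i l))^2)"
   unfolding sum_square_array ..
  also have "... = (\<Sum>i<n. (cmod (u t n i))^2) * (\<Sum>l<n. (cmod (v t n l))^2)"
   unfolding sum_product by (intro sum.cong refl) (simp add: B0 norm_mult power_mult_distrib)
  also have "... = (l2norm n (u t n))^2 * (l2norm n (v t n))^2" by (simp only: l2norm_square)
  also have "... <= K0^2 * K0^2" by (intro mult_mono power_mono uv) auto
  also have "... = K0^4" by (simp flip: power_add)
  finally show "(\<Sum>e\<in>{..<n} \<times> {..<n}. (cmod (B t n 0 (snd e) (fst e)))^2) <= K0^4" .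
 qed auto
 finally show ?thesis by (simp add: sum_distrib_left mult_ac)
qed

text \<open>For words of length one the second-order exponent of the linear form agrees with the
  Gaussian one exactly, at every positive \<open>n\<close>; only the higher-order terms need a
  limit.\<close>

lemma dd_qform:
 assumes n: "0 < n" and b: "\<And>t. k t \<noteq> 1 ==> b t = 0"
 shows "(\<Sum>e\<in>{..<n} \<times> {..<n}. (cmod (dd n b e))^2 + \<rho> * Re ((dd n b e)^2)) = qform (CC n) (PP n) b"
proof -
 let ?S = "{..<n} \<times> {..<n}" and ?b = "\<lambda>t e. B t n 0 (snd e) (fst e)"
 have prodform: "(\<Sum>e\<in>?S. dd n b e * (\<Sum>t\<in>UNIV. g t * h t e)) = (\<Sum>s\<in>UNIV. \<Sum>t\<in>UNIV. cnj (b s) * g t * (\<Sum>e\<in>?S. ?b s e * h t e))" for g h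
 proof -
  have "(\<Sum>e\<in>?S. dd n b e * (\<Sum>t\<in>UNIV. g t * h t e)) = (\<Sum>e\<in>?S. \<Sum>s\<in>UNIV. \<Sum>t\<in>UNIV. cnj (b s) * g t * (?b s e * h t e))"
   unfolding dd_def sum_product by (simp only: mult_ac)
  also have "... = (\<Sum>s\<in>UNIV. \<Sum>e\<in>?S. \<Sum>t\<in>UNIV. cnj (b s) * g t * (?b s e * h t e))" by (rule sum.swap)
  also have "... = (\<Sum>s\<in>UNIV. \<Sum>t\<in>UNIV. \<Sum>e\<in>?S. cnj (b s) * g t * (?b s e * h t e))" by (intro sum.cong refl sum.swap)
  finally show ?thesis by (simp only: sum_distrib_left)
 qed
 have one: "real n powr (1 - real 1) = 1" using n by simp
 have C1: "CC n s t = (\<Sum>e\<in>?S. ?b s e * cnj (?b t e))" if "k s = 1" "k t = 1" for s t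
  using that one by (simp add: CC_def Sig_def sum_square_array)
 have P1: "PP n s t = \<rho> * (\<Sum>e\<in>?S. ?b s e * ?b t e)" if "k s = 1" "k t = 1" for s t
  using that one by (simp add: PP_def Sig'_def sum_square_array)
 have "(\<Sum>e\<in>?S. cor ((cmod (dd n b e))^2)) = (\<Sum>e\<in>?S. dd n b e * (\<Sum>t\<in>UNIV. b t * cnj (?b t e)))"
  by (intro sum.cong refl) (simp only: complex_norm_square, simp add: dd_def)
 also have "... = (\<Sum>s\<in>UNIV. \<Sum>t\<in>UNIV. cnj (b s) * b t * (\<Sum>e\<in>?S. ?b s e * cnj (?b t e)))" by (rule prodform)
 also have "... = (\<Sum>s\<in>UNIV. \<Sum>t\<in>UNIV. cnj (b s) * b t * CC n s t)"
 proof (intro sum.cong refl)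
  fix s t
  show "cnj (b s) * b t * (\<Sum>e\<in>?S. ?b s e * cnj (?b t e)) = cnj (b s) * b t * CC n s t"
  proof (cases "k s = 1 \<and> k t = 1")
   case True
   then show ?thesis by (simp only: C1)
  next
   case False
   then have "b s = 0 \<or> b t = 0" using b by blast
   then show ?thesis by auto
  qed
 qed
 finally have 1: "(\<Sum>e\<in>?S. (cmod (dd n b e))^2) = Re (\<Sum>s\<in>UNIV. \<Sum>t\<in>UNIV. cnj (b s) * b t * CC n s t)"
  unfolding of_real_sum[symmetric] by (metis Re_complex_of_real)
 have "cor \<rho> * (\<Sum>e\<in>?S. (dd n b e)^2) = cor \<rho> * (\<Sum>e\<in>?S. dd n b e * (\<Sum>t\<in>UNIV. cnj (b t) * ?b t e))"
  by (simp only: power2_eq_square dd_def)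
 also have "... = (\<Sum>s\<in>UNIV. \<Sum>t\<in>UNIV. cor \<rho> * (cnj (b s) * cnj (b t) * (\<Sum>e\<in>?S. ?b s e * ?b t e)))"
  unfolding prodform[of "\<lambda>t. cnj (b t)" ?b] by (simp only: sum_distrib_left[of "cor \<rho>"])
 also have "... = (\<Sum>s\<in>UNIV. \<Sum>t\<in>UNIV. cnj (b s) * cnj (b t) * PP n s t)"
 proof (intro sum.cong refl)
  fix s t
  show "cor \<rho> * (cnj (b s) * cnj (b t) * (\<Sum>e\<in>?S. ?b s e * ?b t e)) = cnj (b s) * cnj (b t) * PP n s t"
  proof (cases "k s = 1 \<and> k t = 1")
   case True
   then show ?thesis by (simp only: P1 mult_ac)
  next
   case False
   then have "b s = 0 \<or> b t = 0" using b by blast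
   then show ?thesis by auto
  qed
 qed
 finally have P2: "cor \<rho> * (\<Sum>e\<in>?S. (dd n b e)^2) = (\<Sum>s\<in>UNIV. \<Sum>t\<in>UNIV. cnj (b s) * cnj (b t) * PP n s t)" .
 have "\<rho> * Re (\<Sum>e\<in>?S. (dd n b e)^2) = Re (cor \<rho> * (\<Sum>e\<in>?S. (dd n b e)^2))"
  by (simp only: times_complex.sel Re_complex_of_real Im_complex_of_real mult_zero_left diff_zero)
 then have "\<rho> * Re (\<Sum>e\<in>?S. (dd n b e)^2) = Re (\<Sum>s\<in>UNIV. \<Sum>t\<in>UNIV. cnj (b s) * cnj (b t) * PP n s t)"
  unfolding P2 .
 then have 2: "(\<Sum>e\<in>?S. \<rho> * Re ((dd n b e)^2)) = Re (\<Sum>s\<in>UNIV. \<Sum>t\<in>UNIV. cnj (b s) * cnj (b t) * PP n s t)"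
  unfolding Re_sum[of _ ?S] sum_distrib_left .
 show ?thesis unfolding sum.distrib 1 2 qform_def ..
qed

lemma chZ_linear_near_1:
 assumes n: "0 < n" and b: "\<And>t. k t \<noteq> 1 ==> b t = 0"
 shows "cmod (chZ n b - 1) <= real CARD('t) * K0^4 * (\<Sum>t\<in>UNIV. (cmod (b t))^2)"
proof -
 have ph: "Ph n b x = Re (\<Sum>e\<in>{..<n} \<times> {..<n}. dd n b e * x e)" for x by (rule Ph_linear[OF n]) (rule b)
 show ?thesis unfolding chZ_def ph by (rule order_trans[OF linear_form_near_1 dd_square_sum]) simp
qed

text \<open>The coefficients \<open>dd\<close> are uniformly of order \<open>\<delta> n\<close>
  while their squares have a bounded sum, which is all that Lindeberg's replacement asks
  for.\<close>

lemma chZ_linear_gaussian: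
 assumes small: "\<delta> \<longlonglongrightarrow> 0" "\<And>t n i l. i < n ==> l < n ==> cmod (B t n 0 i l) <= \<delta> n"
  and b: "\<And>t. k t \<noteq> 1 ==> b t = 0"
 shows "(\<lambda>n. chZ n b - exp (- cor (qform (CC n) (PP n) b / 4))) \<longlonglongrightarrow> 0"
proof (rule Lim_null_comparison)
 define m3 where "m3 = (\<integral>z. cmod z ^ 3 \<partial>\<mu>)"
 define \<beta> where "\<beta> = (\<Sum>t\<in>UNIV. cmod (b t))"
 define L where "L = real CARD('t) * K0^4 * (\<Sum>t\<in>UNIV. (cmod (b t))^2)"
 have \<beta>0: "0 <= \<beta>" by (simp add: \<beta>_def sum_nonneg)
 have m3: "0 <= m3" by (simp add: m3_def)
 have "cmod (chZ n b - exp (- cor (qform (CC n) (PP n) b / 4))) <= (m3 * (\<beta> * \<delta> n) + (\<beta> * \<delta> n)^2) * L" if n: "0 < n" for n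
 proof -
  have \<delta>0: "0 <= \<delta> n" using order_trans[OF norm_ge_zero small(2)[OF n n]] .
  have de: "cmod (dd n b e) <= \<beta> * \<delta> n" if "e \<in> {..<n} \<times> {..<n}" for e
  proof -
   have "cmod (dd n b e) <= (\<Sum>t\<in>UNIV. cmod (b t) * cmod (B t n 0 (snd e) (fst e)))"
    unfolding dd_def by (rule order_trans[OF norm_sum]) (simp add: norm_mult)
   also have "... <= (\<Sum>t\<in>UNIV. cmod (b t) * \<delta> n)" using that by (intro sum_mono mult_left_mono small(2)) auto
   finally show ?thesis by (simp add: \<beta>_def sum_distrib_right)
  qed
  have "cmod (chZ n b - exp (- cor (qform (CC n) (PP n) b / 4)))
   <= (m3 * (\<beta> * \<delta> n) + (\<beta> * \<delta> n)^2) * (\<Sum>e\<in>{..<n} \<times> {..<n}. (cmod (dd n b e))^2)"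
  proof -
   have ph: "Ph n b x = Re (\<Sum>e\<in>{..<n} \<times> {..<n}. dd n b e * x e)" for x by (rule Ph_linear[OF n]) (rule b)
   have dq: "qform (CC n) (PP n) b = (\<Sum>e\<in>{..<n} \<times> {..<n}. (cmod (dd n b e))^2 + \<rho> * Re ((dd n b e)^2))"
    by (rule dd_qform[OF n, symmetric]) (rule b)
   show ?thesis unfolding chZ_def ph dq m3_def by (rule linear_form_gaussian) (use de in auto)
  qed
  also have "... <= (m3 * (\<beta> * \<delta> n) + (\<beta> * \<delta> n)^2) * L" unfolding L_def
   using m3 \<beta>0 \<delta>0 by (intro mult_left_mono dd_square_sum) auto
  finally show ?thesis .
 qed
 then show "\<forall>\<^sub>F n in sequentially. cmod (chZ n b - exp (- cor (qform (CC n) (PP n) b / 4))) <= (m3 * (\<beta> * \<delta> n) + (\<beta> * \<delta> n)^2) * L"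
  using eventually_gt_at_top[of "0::nat"] by (rule eventually_mono[rotated])
 have "(\<lambda>n. (m3 * (\<beta> * \<delta> n) + (\<beta> * \<delta> n)^2) * L) \<longlonglongrightarrow> (m3 * (\<beta> * 0) + (\<beta> * 0)^2) * L"
  by (intro tendsto_intros small)
 then show "(\<lambda>n. (m3 * (\<beta> * \<delta> n) + (\<beta> * \<delta> n)^2) * L) \<longlonglongrightarrow> 0" by simp
qed

end

text \<open>Identifies the pairing in \<open>cgauss_law\<close> with the real inner product, so that
  the results on Euclidean spaces apply to complex vectors.\<close>

lemma inner_complex_vec: "a \<bullet> z = Re (\<Sum>t\<in>UNIV. cnj (a $ t) * z $ t)" for a z :: "complex ^ 't"
 by (simp add: inner_vec_def inner_complex_def)

lemma vec_nth_vec_lambda: "($) (\<chi> t. f t) = f" by (rule ext) simp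

lemma borel_measurable_complex_vec:
 fixes f :: "'t::finite => 'x => complex"
 assumes "\<And>t. f t \<in> borel_measurable M"
 shows "(\<lambda>x. \<chi> t. f t x) \<in> borel_measurable M"
proof (subst borel_measurable_euclidean_space, rule ballI)
 fix b :: "complex ^ 't" assume "b \<in> Basis"
 then obtain t c where b: "b = axis t c" by (auto simp: Basis_vec_def)
 have [measurable]: "f t \<in> borel_measurable M" by (rule assms)
 show "(\<lambda>x. (\<chi> t. f t x) \<bullet> b) \<in> borel_measurable M" unfolding b inner_axis by simp
qed

lemma cmod_exp_minus_1_le:
 assumes "cmod (exp (- cor r)) <= 1" shows "cmod (exp (- cor r) - 1) <= \<bar>r\<bar>"
proof -
 have r: "0 <= r" using assms by (simp add: norm_exp_eq_Re)
 have "exp (- cor r) - 1 = cor (exp (- r) - 1)" by (simp flip: exp_of_real)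
 then have "cmod (exp (- cor r) - 1) = \<bar>exp (- r) - 1\<bar>" by (simp only: norm_of_real)
 also have "... <= \<bar>r\<bar>" using exp_ge_add_one_self[of "- r"] r by simp
 finally show ?thesis .
qed

lemma sum_norm_square_vec: "(\<Sum>t\<in>UNIV. (cmod (a $ t))^2) = (norm a)^2" for a :: "complex ^ 't"
 unfolding norm_vec_def L2_set_def by (simp add: sum_nonneg)

section \<open>The laws to be compared and their characteristic functions\<close>

locale gaussian_family = word_family \<mu> \<rho> k B u v K0
 for \<mu> \<rho> and k :: "'t::finite => nat" and B u v K0 +
 fixes G :: "nat => (complex ^ 't) measure"
 assumes G: "\<And>n. cgauss_law (CC n) (PP n) (G n)"
begin

lemma prob_G: "prob_space (G n)" and sets_G: "sets (G n) = sets borel"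
 using G[of n] by (simp_all add: cgauss_law_def)

lemma chf_G: "chf (G n) a = exp (- cor (qform (CC n) (PP n) (($) a) / 4))"
 using G[of n] unfolding cgauss_law_def chf_def inner_complex_vec qform_def by blast

definition lawZ :: "nat => (complex ^ 't) measure" where
 "lawZ n = distr (Xlaw \<mu> n) borel (\<lambda>x. \<chi> t. Zk n (k t) (B t n) x)"

definition lawW :: "nat => (complex ^ 't) measure" where
 "lawW n = distr (Xlaw \<mu> n \<Otimes>\<^sub>M G n) borel (\<lambda>(x, w). \<chi> t. if k t = 1 then Zk n 1 (B t n) x else w $ t)"

lemma measurable_Zk: "(\<lambda>x. Zk n (k t) (B t n) x) \<in> borel_measurable (Xlaw \<mu> n)"
 unfolding Xlaw_def measurable_Pr by (rule polybdd_measurable[OF polybdd_Zk])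

lemma measurable_lawZ: "(\<lambda>x. \<chi> t. Zk n (k t) (B t n) x) \<in> borel_measurable (Xlaw \<mu> n)"
 by (rule borel_measurable_complex_vec) (rule measurable_Zk)

lemma measurable_lawW:
 "(\<lambda>(x, w). \<chi> t. if k t = 1 then Zk n 1 (B t n) x else w $ t) \<in> borel_measurable (Xlaw \<mu> n \<Otimes>\<^sub>M G n)"
 unfolding case_prod_unfold
proof (rule borel_measurable_complex_vec)
 fix t
 have s: "snd \<in> borel_measurable (Xlaw \<mu> n \<Otimes>\<^sub>M G n)"
  using measurable_snd[of "Xlaw \<mu> n" "G n"] by (simp add: measurable_cong_sets[OF refl sets_G])
 have w: "(\<lambda>p. snd p $ t) \<in> borel_measurable (Xlaw \<mu> n \<Otimes>\<^sub>M G n)"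
  by (rule borel_measurable_continuous_on[OF _ s, where f = "\<lambda>w. w $ t"]) (intro continuous_intros)
 have z: "(\<lambda>p. Zk n (k t) (B t n) (fst p)) \<in> borel_measurable (Xlaw \<mu> n \<Otimes>\<^sub>M G n)"
  by (rule measurable_compose[OF measurable_fst measurable_Zk])
 show "(\<lambda>p. if k t = 1 then Zk n 1 (B t n) (fst p) else snd p $ t) \<in> borel_measurable (Xlaw \<mu> n \<Otimes>\<^sub>M G n)"
  using w z by (cases "k t = 1") simp_all
qed

lemma prob_Xlaw: "prob_space (Xlaw \<mu> n)"
 unfolding Xlaw_def by (rule prob_space_Pr)

lemma prob_lawZ: "prob_space (lawZ n)"
 unfolding lawZ_def by (rule prob_space.prob_space_distr[OF prob_Xlaw measurable_lawZ])

lemma prob_pair: "prob_space (Xlaw \<mu> n \<Otimes>\<^sub>M G n)"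
proof -
 interpret X: prob_space "Xlaw \<mu> n" by (rule prob_Xlaw)
 interpret Y: prob_space "G n" by (rule prob_G)
 interpret pair_prob_space "Xlaw \<mu> n" "G n" ..
 show ?thesis by (rule P.prob_space_axioms)
qed

lemma prob_lawW: "prob_space (lawW n)"
 unfolding lawW_def by (rule prob_space.prob_space_distr[OF prob_pair measurable_lawW])

lemma chf_lawZ: "chf (lawZ n) a = chZ n (($) a)"
proof -
 have "chf (lawZ n) a = (\<integral>x. iexp (a \<bullet> (\<chi> t. Zk n (k t) (B t n) x)) \<partial>Xlaw \<mu> n)"
  unfolding chf_def lawZ_def by (rule integral_distr[OF measurable_lawZ]) measurable
 then show ?thesis unfolding chZ_def Ph_def Xlaw_def inner_complex_vec by simp
qed

text \<open>The phase splits into a part in \<open>x\<close> and a part in \<open>w\<close>, and the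
  product measure makes the expectation factor.\<close>

lemma chf_lawW:
 "chf (lawW n) a = chZ n (\<lambda>t. if k t = 1 then a $ t else 0)
   * exp (- cor (qform (CC n) (PP n) (\<lambda>t. if k t \<noteq> 1 then a $ t else 0) / 4))"
proof -
 interpret X: prob_space "Xlaw \<mu> n" by (rule prob_Xlaw)
 interpret Y: prob_space "G n" by (rule prob_G)
 interpret XY: pair_prob_space "Xlaw \<mu> n" "G n" ..
 define b where "b = (\<lambda>t. if k t = 1 then a $ t else 0)"
 define c :: "complex ^ 't" where "c = (\<chi> t. if k t \<noteq> 1 then a $ t else 0)"
 let ?F = "\<lambda>(x, w). \<chi> t. if k t = 1 then Zk n 1 (B t n) x else w $ t"
 have ip: "a \<bullet> ?F (x, w) = Ph n b x + c \<bullet> w" for x w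
 proof -
  have "(\<Sum>t\<in>UNIV. cnj (a $ t) * (?F (x, w)) $ t) = (\<Sum>t\<in>UNIV. cnj (b t) * Zk n (k t) (B t n) x) + (\<Sum>t\<in>UNIV. cnj (c $ t) * w $ t)"
   unfolding sum.distrib[symmetric] by (intro sum.cong refl) (simp add: b_def c_def)
  then show ?thesis unfolding inner_complex_vec Ph_def by (simp only: plus_complex.sel)
 qed
 have m: "(\<lambda>p. iexp (a \<bullet> ?F p)) \<in> borel_measurable (Xlaw \<mu> n \<Otimes>\<^sub>M G n)"
  by (rule measurable_compose[OF measurable_lawW]) measurable
 have int: "integrable (Xlaw \<mu> n \<Otimes>\<^sub>M G n) (\<lambda>p. iexp (a \<bullet> ?F p))"
  by (rule XY.P.integrable_const_bound[where B = 1, OF _ m]) simp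
 have "chf (lawW n) a = (\<integral>p. iexp (a \<bullet> ?F p) \<partial>(Xlaw \<mu> n \<Otimes>\<^sub>M G n))"
  unfolding chf_def lawW_def by (rule integral_distr[OF measurable_lawW]) measurable
 also have "... = (\<integral>x. (\<integral>w. iexp (a \<bullet> ?F (x, w)) \<partial>G n) \<partial>Xlaw \<mu> n)"
  by (rule XY.integral_fst'[OF int, symmetric])
 also have "... = (\<integral>x. (\<integral>w. iexp (Ph n b x) * iexp (c \<bullet> w) \<partial>G n) \<partial>Xlaw \<mu> n)"
  unfolding ip of_real_add distrib_left exp_add ..
 also have "... = (\<integral>x. iexp (Ph n b x) * chf (G n) c \<partial>Xlaw \<mu> n)"
  unfolding chf_def by (simp only: integral_mult_right_zero)
 also have "... = chZ n b * chf (G n) c" unfolding chZ_def Xlaw_def by (simp only: integral_mult_left_zero)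
 finally show ?thesis unfolding chf_G b_def c_def vec_nth_vec_lambda .
qed

lemma qform_le_norm:
 assumes n: "0 < n" and b: "\<And>t. cmod (b t) <= cmod (a $ t)"
 shows "\<bar>qform (CC n) (PP n) b / 4\<bar> <= K0 ^ (2 * MM + 2) * real CARD('t) * (norm a)^2"
proof -
 have "\<bar>qform (CC n) (PP n) b\<bar> <= 2 * K0 ^ (2 * MM + 2) * (\<Sum>t\<in>UNIV. cmod (b t))^2" by (rule qform_le) (use n CC_le PP_le in auto)
 also have "... <= 2 * K0 ^ (2 * MM + 2) * ((\<Sum>t\<in>UNIV. (cmod (a $ t))^2) * real CARD('t))"
 proof (rule mult_left_mono)
  have "(\<Sum>t\<in>UNIV. cmod (b t))^2 <= (\<Sum>t\<in>UNIV. cmod (a $ t))^2" by (intro power_mono sum_mono b) (simp add: sum_nonneg)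
  also have "... <= (\<Sum>t\<in>UNIV. (cmod (a $ t))^2) * real CARD('t)" by (rule sum_squared_le_sum_of_squares)
  finally show "(\<Sum>t\<in>UNIV. cmod (b t))^2 <= (\<Sum>t\<in>UNIV. (cmod (a $ t))^2) * real CARD('t)" .
 qed (use K0 in simp)
 finally have "\<bar>qform (CC n) (PP n) b\<bar> <= 2 * (K0 ^ (2 * MM + 2) * real CARD('t) * (norm a)^2)"
  unfolding sum_norm_square_vec by (simp add: mult_ac)
 moreover have "0 <= K0 ^ (2 * MM + 2) * real CARD('t) * (norm a)^2" using K0 by simp
 ultimately show ?thesis by simp
qed

lemma gaussian_near_1:
 assumes n: "0 < n" and c: "\<And>t. cmod (c $ t) <= cmod (a $ t)"
 shows "cmod (chf (G n) c - 1) <= K0 ^ (2 * MM + 2) * real CARD('t) * (norm a)^2"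
 using cmod_exp_minus_1_le[of "qform (CC n) (PP n) (($) c) / 4"] chf_bounded[OF prob_G, of n c] qform_le_norm[of n "($) c" a, OF n c]
 unfolding chf_G by linarith

lemma tight_G:
 assumes "0 < e" shows "\<exists>R. \<forall>\<^sub>F n in sequentially. measure (G n) (- ball 0 R) <= e"
proof (rule tight_of_chf[OF prob_G sets_G _ assms])
 show "\<forall>\<^sub>F n in sequentially. \<forall>a. cmod (chf (G n) a - 1) <= K0 ^ (2 * MM + 2) * real CARD('t) * (norm a)^2"
  using eventually_gt_at_top[of 0] by eventually_elim (intro allI gaussian_near_1; simp)
qed

lemma tight_lawW:
 assumes "0 < e" shows "\<exists>R. \<forall>\<^sub>F n in sequentially. measure (lawW n) (- ball 0 R) <= e"
proof (rule tight_of_chf[OF prob_lawW _ _ assms])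
 show "sets (lawW n) = sets borel" for n by (simp add: lawW_def)
 let ?C = "real CARD('t) * K0^4 + K0 ^ (2 * MM + 2) * real CARD('t)"
 have "cmod (chf (lawW n) a - 1) <= ?C * (norm a)^2" if n: "0 < n" for n a
 proof -
  define b where "b = (\<lambda>t. if k t = 1 then a $ t else 0)"
  define c :: "complex ^ 't" where "c = (\<chi> t. if k t \<noteq> 1 then a $ t else 0)"
  have eq: "chf (lawW n) a = chZ n b * chf (G n) c" unfolding chf_lawW chf_G b_def c_def vec_nth_vec_lambda ..
  have "chZ n b * chf (G n) c - 1 = (chZ n b - 1) * chf (G n) c + (chf (G n) c - 1)" by (simp add: algebra_simps)
  then have "cmod (chf (lawW n) a - 1) <= cmod (chZ n b - 1) * cmod (chf (G n) c) + cmod (chf (G n) c - 1)"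
   unfolding eq by (metis norm_triangle_ineq norm_mult)
  also have "... <= real CARD('t) * K0^4 * (norm a)^2 * 1 + K0 ^ (2 * MM + 2) * real CARD('t) * (norm a)^2"
  proof (intro add_mono mult_mono)
   have "cmod (chZ n b - 1) <= real CARD('t) * K0^4 * (\<Sum>t\<in>UNIV. (cmod (b t))^2)" by (rule chZ_linear_near_1[OF n]) (simp add: b_def)
   also have "... <= real CARD('t) * K0^4 * (\<Sum>t\<in>UNIV. (cmod (a $ t))^2)" by (intro mult_left_mono sum_mono power_mono) (auto simp: b_def)
   finally show "cmod (chZ n b - 1) <= real CARD('t) * K0^4 * (norm a)^2" unfolding sum_norm_square_vec .
   show "cmod (chf (G n) c - 1) <= K0 ^ (2 * MM + 2) * real CARD('t) * (norm a)^2" by (rule gaussian_near_1[OF n]) (simp add: c_def)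
  qed (auto intro: chf_bounded prob_G)
  finally show ?thesis by (simp only: distrib_right mult_1_right)
 qed
 then show "\<forall>\<^sub>F n in sequentially. \<forall>a. cmod (chf (lawW n) a - 1) <= ?C * (norm a)^2"
  by (intro eventually_mono[OF eventually_gt_at_top[of 0]] allI)
qed

theorem LP_lawW: "(\<lambda>n. LP (lawZ n) (lawW n)) \<longlonglongrightarrow> 0"
proof (rule LP_tendsto_0[OF prob_lawZ _ prob_lawW _ _ tight_lawW])
 show "(\<lambda>n. chf (lawZ n) a - chf (lawW n) a) \<longlonglongrightarrow> 0" for a
  unfolding chf_lawZ chf_lawW by (rule decoupling)
qed (simp_all add: lawZ_def lawW_def)

text \<open>The comparison passes through \<open>lawW n\<close>. Words of different length are
  uncorrelated, so the characteristic function of \<open>G n\<close> factors in the same way, and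
  only the factor of the words of length one has to be replaced by its Gaussian counterpart.\<close>

theorem LP_gaussian:
 assumes small: "\<delta> \<longlonglongrightarrow> 0" "\<And>t n i l. i < n ==> l < n ==> cmod (B t n 0 i l) <= \<delta> n"
 shows "(\<lambda>n. LP (lawZ n) (G n)) \<longlonglongrightarrow> 0"
proof (rule LP_tendsto_0[OF prob_lawZ _ prob_G sets_G _ tight_G])
 fix a :: "complex ^ 't"
 define b where "b = (\<lambda>t. if k t = 1 then a $ t else 0)"
 define c :: "complex ^ 't" where "c = (\<chi> t. if k t \<noteq> 1 then a $ t else 0)"
 have G_split: "chf (G n) a = exp (- cor (qform (CC n) (PP n) b / 4)) * chf (G n) c" for n
 proof -
  have "qform (CC n) (PP n) (($) a) = qform (CC n) (PP n) b + qform (CC n) (PP n) (($) c)"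
   unfolding b_def c_def vec_nth_vec_lambda by (rule qform_split[of k]) (simp_all add: CC_off PP_off)
  then show ?thesis unfolding chf_G by (simp only: add_divide_distrib of_real_add minus_add_distrib exp_add)
 qed
 have "(\<lambda>n. (chf (lawZ n) a - chf (lawW n) a) + (chZ n b - exp (- cor (qform (CC n) (PP n) b / 4))) * chf (G n) c) \<longlonglongrightarrow> 0 + 0"
 proof (rule tendsto_add)
  show "(\<lambda>n. chf (lawZ n) a - chf (lawW n) a) \<longlonglongrightarrow> 0"
   unfolding chf_lawZ chf_lawW by (rule decoupling)
  show "(\<lambda>n. (chZ n b - exp (- cor (qform (CC n) (PP n) b / 4))) * chf (G n) c) \<longlonglongrightarrow> 0"
  proof (rule Lim_null_comparison)
   have "(\<lambda>n. chZ n b - exp (- cor (qform (CC n) (PP n) b / 4))) \<longlonglongrightarrow> 0"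
    by (rule chZ_linear_gaussian[OF small]) (simp_all add: b_def)
   then show "(\<lambda>n. cmod (chZ n b - exp (- cor (qform (CC n) (PP n) b / 4)))) \<longlonglongrightarrow> 0" by (rule tendsto_norm_zero)
   show "\<forall>\<^sub>F n in sequentially. cmod ((chZ n b - exp (- cor (qform (CC n) (PP n) b / 4))) * chf (G n) c)
     <= cmod (chZ n b - exp (- cor (qform (CC n) (PP n) b / 4)))"
    unfolding norm_mult by (intro always_eventually allI mult_left_le chf_bounded prob_G) simp
  qed
 qed
 moreover have "chf (lawW n) a = chZ n b * chf (G n) c" for n unfolding chf_lawW chf_G b_def c_def vec_nth_vec_lambda ..
 ultimately show "(\<lambda>n. chf (lawZ n) a - chf (G n) a) \<longlonglongrightarrow> 0" unfolding G_split by (simp add: algebra_simps)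
qed (simp_all add: lawZ_def)

end

theorem theorem6p1:
  fixes \<mu> :: "complex measure" and \<rho> :: real
    and k :: "'t::finite \<Rightarrow> nat"
    and B :: "'t \<Rightarrow> nat \<Rightarrow> nat \<Rightarrow> cmat"
    and u v :: "'t \<Rightarrow> nat \<Rightarrow> cvec"
    and G :: "nat \<Rightarrow> (complex^'t) measure"
  assumes prob: "prob_space \<mu>" and sets_mu: "sets \<mu> = sets borel"
    and moments: "\<And>m. m \<ge> 2 \<Longrightarrow> integrable \<mu> (\<lambda>z. cmod z ^ m)"
    and mean0: "(\<integral>z. z \<partial>\<mu>) = 0"
    and var1: "(\<integral>z. (cmod z)^2 \<partial>\<mu>) = 1"
    and rho: "(\<integral>z. z^2 \<partial>\<mu>) = complex_of_real \<rho>" "0 \<le> \<rho>" "\<rho> \<le> 1"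
    and k_pos: "\<And>t. k t \<ge> 1"
    and B0: "\<And>t n i l. i < n \<Longrightarrow> l < n \<Longrightarrow> B t n 0 i l = u t n i * cnj (v t n l)"
    and Bbdd: "\<And>t j. bdd_above (range (\<lambda>n. opnorm n (B t n j)))"
    and Ggauss: "\<And>n. cgauss_law
        (\<lambda>s t. if k s = k t then Sig n (k s) (B s n) (B t n) else 0)
        (\<lambda>s t. if k s = k t then Sig' \<rho> n (k s) (B s n) (B t n) else 0) (G n)"
  shows "(\<lambda>n. LP (distr (Xlaw \<mu> n) borel (\<lambda>x. \<chi> t. Zk n (k t) (B t n) x))
               (distr (Xlaw \<mu> n \<Otimes>\<^sub>M G n) borel
                  (\<lambda>(x, w). \<chi> t. if k t = 1 then Zk n 1 (B t n) x else w $ t)))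
           \<longlonglongrightarrow> 0 \<and>
         ((\<forall>t. (\<lambda>n. supnorm n (u t n)) \<longlonglongrightarrow> 0 \<and> (\<lambda>n. supnorm n (v t n)) \<longlonglongrightarrow> 0) \<longrightarrow>
         (\<lambda>n. LP (distr (Xlaw \<mu> n) borel (\<lambda>x. \<chi> t. Zk n (k t) (B t n) x)) (G n)) \<longlonglongrightarrow> 0)"
proof -
 interpret prob_space \<mu> by (rule prob)
 \<comment> \<open>The moments of order 0 and 1 are dominated by 1 plus the second moment.\<close>
 have mom: "integrable \<mu> (\<lambda>z. cmod z ^ m)" for m
 proof (cases "2 <= m")
  case False
  have meas: "(\<lambda>z. cmod z ^ m) \<in> borel_measurable \<mu>" by (simp add: measurable_cong_sets[OF sets_mu refl])
  have "cmod z ^ m <= 1 + cmod z ^ 2" for z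
  proof (cases "cmod z <= 1")
   case True
   then show ?thesis by (simp add: power_le_one add_increasing2)
  next
   case gt: False
   have "cmod z ^ m <= cmod z ^ 2" using gt False by (intro power_increasing) auto
   then show ?thesis by simp
  qed
  then show ?thesis
   by (intro Bochner_Integration.integrable_bound[OF Bochner_Integration.integrable_add[OF integrable_const moments[of 2]] meas, of 1]) auto
 qed (rule moments)
 interpret iid_entries \<mu> \<rho> by unfold_locales (use sets_mu mom mean0 var1 rho in auto)
 obtain b where b: "\<And>t j n. opnorm n (B t n j) <= b t j"
  using Bbdd unfolding bdd_above_def by (metis rangeI)
 \<comment> \<open>Only letters with \<open>j < k t\<close> occur in the words, so finitely many of
   the bounds are collected.\<close>
 define K where "K = 1 + (\<Sum>t\<in>UNIV. \<Sum>j<k t. \<bar>b t j\<bar>)"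
 have K1: "1 <= K" by (simp add: K_def sum_nonneg)
 have bK: "b t j <= K" if "j < k t" for t j
 proof -
  have "\<bar>b t j\<bar> <= (\<Sum>j<k t. \<bar>b t j\<bar>)" using that by (intro member_le_sum) auto
  also have "... <= (\<Sum>t\<in>UNIV. \<Sum>j<k t. \<bar>b t j\<bar>)" by (rule member_le_sum) (auto intro: sum_nonneg)
  finally show ?thesis by (simp add: K_def)
 qed
 have fb: "form_bound n (B t n q) K" if "q < k t" for t n q by (rule form_bound_mono[OF form_bound_opnorm order_trans[OF b bK[OF that]]])
 \<comment> \<open>The given \<open>u\<close> and \<open>v\<close> may be unbalanced and even
   unbounded in \<open>n\<close>. For each \<open>n\<close> a balanced factorisation of the same
   matrix \<open>B t n 0\<close> takes their place.\<close>
 have "\<exists>w. (\<forall>i<n. \<forall>l<n. B t n 0 i l = fst w i * cnj (snd w l)) \<and> l2norm n (fst w) <= K \<and> l2norm n (snd w) <= K" for t n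
 proof -
  have 0: "0 < k t" using k_pos[of t] by simp
  obtain u' v' where w: "\<And>i l. i < n ==> l < n ==> B t n 0 i l = u' i * cnj (v' l)" "l2norm n u' <= sqrt K" "l2norm n v' <= sqrt K"
   using rank_one_balanced[OF fb[OF 0] B0] by metis
  have "K <= K * K" using mult_left_mono[OF K1, of K] K1 by simp
  then have "sqrt K <= K" using K1 by (simp add: real_le_lsqrt power2_eq_square)
  then show ?thesis using w order_trans by (intro exI[of _ "(u', v')"]) auto
 qed
 then have "\<exists>w. \<forall>t n. (\<forall>i<n. \<forall>l<n. B t n 0 i l = fst (w t n) i * cnj (snd (w t n) l)) \<and> l2norm n (fst (w t n)) <= K \<and> l2norm n (snd (w t n)) <= K"
  by (intro choice allI)
 then obtain w where w: "\<And>t n i l. i < n ==> l < n ==> B t n 0 i l = fst (w t n) i * cnj (snd (w t n) l)"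
  "\<And>t n. l2norm n (fst (w t n)) <= K" "\<And>t n. l2norm n (snd (w t n)) <= K" by blast
 interpret W: word_family \<mu> \<rho> k B "\<lambda>t n. fst (w t n)" "\<lambda>t n. snd (w t n)" K by unfold_locales (use K1 k_pos w fb in auto)
 interpret gaussian_family \<mu> \<rho> k B "\<lambda>t n. fst (w t n)" "\<lambda>t n. snd (w t n)" K G
  by unfold_locales (use Ggauss in \<open>simp add: W.CC_def[abs_def] W.PP_def[abs_def]\<close>)
 have "(\<lambda>n. LP (lawZ n) (G n)) \<longlonglongrightarrow> 0"
  if small: "\<And>t. (\<lambda>n. supnorm n (u t n)) \<longlonglongrightarrow> 0" "\<And>t. (\<lambda>n. supnorm n (v t n)) \<longlonglongrightarrow> 0"
 \<comment> \<open>Smallness is a condition on the entries of \<open>B t n 0\<close>, so it does not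
   depend on the factorisation and is read off the original \<open>u\<close> and
   \<open>v\<close>.\<close>
 proof (rule LP_gaussian)
  have "(\<lambda>n. \<Sum>t\<in>UNIV. supnorm n (u t n) * supnorm n (v t n)) \<longlonglongrightarrow> (\<Sum>t\<in>(UNIV :: 't set). 0 * 0)"
   by (intro tendsto_sum tendsto_mult small)
  then show "(\<lambda>n. \<Sum>t\<in>UNIV. supnorm n (u t n) * supnorm n (v t n)) \<longlonglongrightarrow> 0" by simp
  have sn: "cmod (x i) <= supnorm n x" if "i < n" for n i and x :: cvec
   unfolding supnorm_def using that by (intro Max_ge) auto
  have sn0: "0 <= supnorm n x" for n and x :: cvec unfolding supnorm_def by (intro Max_ge) auto
  fix t n i l assume il: "i < (n::nat)" "l < n"
  have "cmod (B t n 0 i l) <= supnorm n (u t n) * supnorm n (v t n)"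
   unfolding B0[OF il] norm_mult complex_mod_cnj by (intro mult_mono sn il sn0) simp
  also have "... <= (\<Sum>t\<in>UNIV. supnorm n (u t n) * supnorm n (v t n))"
   by (rule member_le_sum[of t UNIV "\<lambda>t. supnorm n (u t n) * supnorm n (v t n)"]) (auto intro: mult_nonneg_nonneg sn0)
  finally show "cmod (B t n 0 i l) <= (\<Sum>t\<in>UNIV. supnorm n (u t n) * supnorm n (v t n))" .
 qed
 then show ?thesis using LP_lawW unfolding lawZ_def lawW_def by blast
qed

end
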